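(* Let $\eta$ be a weight of class $\dagger$ and let $E$ be a TMIB space of class $*-\dagger$ with strong dual $E'$. For $1\le p<\infty$ and $p^{-1}+q^{-1}=1$, the strong dual $(W(E,L^p_\eta))'_b$ (viewed as a subspace of $\mathcal S'^*_\dagger(\mathbb R^n)$ via the continuous dense inclusion $\mathcal S^*_\dagger(\mathbb R^n)\subseteq W(E,L^p_\eta)$) equals $W(E',L^q_{1/\eta})$ with equivalent norms. The strong dual $(W(E,\mathcal C_{\eta,0}))'_b$ equals $W(E',L^1_{1/\eta})$ with equivalent norms. Consequently, $W(E',L^p_{1/\eta})$ is a DTMIB space of class $*-\dagger$ for every $1\le p\le\infty$.
   Context: $\{M_p\}_{p\in\mathbb N}$, $\{A_p\}_{p\in\mathbb N}$ are sequences of positive numbers with $M_0=M_1=A_0=A_1=1$, both satisfying (M.1) $M_p^2\le M_{p-1}M_{p+1}$ ($p\ge1$), (M.2) $M_{p+q}\le c_0H^{p+q}M_pM_q$ for some $c_0,H\ge1$, (M.6) $p!\le c_0L_0^pM_p$ for some $c_0,L_0\ge1$; $\{A_p\}$ moreover satisfies (M.2)$^*$: $2m_p\le m_{pN}$ for $p\ge p_0$, some $p_0,N\in\mathbb Z_+$, $m_j=A_j/A_{j-1}$. $M_\alpha=M_{|\alpha|}$; associated functions $M(\rho)=\sup_p\ln(\rho^p/M_p)$, $A(\rho)=\sup_p\ln(\rho^p/A_p)$. $\mathcal S^{M_p,h}_{A_p,h}(\mathbb R^n)$ ($h>0$) is the Banach space of smooth $\varphi$ with $\sup_\alpha h^{|\alpha|}\|e^{A(h|\cdot|)}\partial^\alpha\varphi\|_{L^\infty}/M_\alpha<\infty$;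 $\mathcal S^*_\dagger(\mathbb R^n)$ denotes the Beurling space (projective limit as $h\to\infty$) or the Roumieu space (inductive limit as $h\to0^+$), $\mathcal S'^*_\dagger$ its strong dual; statements hold in both cases. $T_xf=f(\cdot-x)$, $M_\xi f=e^{2\pi i\xi\cdot}f$. TMIB space of class $*-\dagger$: Banach $E$ with (I) $\mathcal S^*_\dagger\subseteq E\subseteq\mathcal S'^*_\dagger$ continuously and densely; (II) $T_x(E),M_\xi(E)\subseteq E$; (III) there are $\tau,C>0$ (Beurling; Roumieu: for every $\tau$ some $C$) with $\|T_x\|_{\mathcal L(E)}\le Ce^{A(\tau|x|)}$, $\|M_{-\xi}\|_{\mathcal L(E)}\le Ce^{M(\tau|\xi|)}$. DTMIB space of class $*-\dagger$: strong dual of a TMIB space of class $*-\dagger$. For $E$ TMIB or DTMIB, $E_{\operatorname{loc}}=\{f\in\mathcal S'^*_\dagger: f\chi\in E\ \forall\chi\in\mathcal S^*_\dagger\}$. Weight of class $\dagger$: measurable $\eta>0$ with $C,\tau>0$ (Beurling; Roumieu: every $\tau$, some $C$) and $\eta(x+y)\le C\eta(x)e^{A(\tau|y|)}$ (then $1/\eta$ is also one). $L^\infty_{\eta,0}$: $f\in L^\infty_\eta$ such that for every $\varepsilon>0$ some compact $K$ has $\|f\eta\|_{L^\infty(\mathbb R^n\setminus K)}\le\varepsilon$; $\mathcal C_{\eta,0}=L^\infty_{\eta,0}\cap C(\mathbb R^n)$. Fix $\chi\in\mathcal S^*_\dagger\setminus\{0\}$: $W(E,L^p_\eta)$ is the Banach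 space of $f\in E_{\operatorname{loc}}$ with $\|f\|_{p,\chi,\eta}=\|\,\|fT_x\chi\|_E\,\eta(x)\|_{L^p(dx)}<\infty$; $W(E,\mathcal C_{\eta,0})$ is the set of $f\in E_{\operatorname{loc}}$ with $x\mapsto\|fT_x\chi\|_E$ in $\mathcal C_{\eta,0}$, normed by $\|\cdot\|_{\infty,\chi,\eta}$ (independent of $\chi$ up to equivalent norms). For $E$ a TMIB space, $\mathcal S^*_\dagger$ is dense in $W(E,L^p_\eta)$, $p<\infty$, and in $W(E,\mathcal C_{\eta,0})$, so their duals embed into $\mathcal S'^*_\dagger$. *)

theory Defs
  imports "HOL-Analysis.Analysis" "HOL-Probability.Essential_Supremum"
begin

text \<open>Test functions on R^n (n = CARD('n)) and ultradistributions, represented as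
  complex functionals on test functions that vanish outside the test space.\<close>

type_synonym 'n tf = "real^'n \<Rightarrow> complex"
type_synonym 'n ud = "'n tf \<Rightarrow> complex"

datatype GSkind = Beurling | Roumieu

definition assoc :: "(nat \<Rightarrow> real) \<Rightarrow> real \<Rightarrow> real" where
  "assoc M \<rho> = (if \<rho> \<le> 0 then 0 else (SUP p. ln (\<rho> ^ p / M p)))"

definition pd :: "'n::finite \<Rightarrow> 'n tf \<Rightarrow> 'n tf" where
  "pd i f x = vector_derivative (\<lambda>t. f (x + t *\<^sub>R axis i 1)) (at 0)"

fun dpart :: "('n::finite) list \<Rightarrow> 'n tf \<Rightarrow> 'n tf" where
  "dpart [] f = f"
| "dpart (i # is) f = pd i (dpart is f)"

definition smooth_fn :: "('n::finite) tf \<Rightarrow> bool" where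
  "smooth_fn f \<longleftrightarrow> (\<forall>is. continuous_on UNIV (dpart is f) \<and>
      (\<forall>i x. (\<lambda>t. dpart is f (x + t *\<^sub>R axis i 1)) differentiable (at 0)))"

definition GSterm :: "(nat \<Rightarrow> real) \<Rightarrow> (nat \<Rightarrow> real) \<Rightarrow> real \<Rightarrow> ('n::finite) tf
    \<Rightarrow> 'n list \<times> (real^'n) \<Rightarrow> real" where
  "GSterm M A h \<phi> ix = h ^ length (fst ix) * exp (assoc A (h * norm (snd ix)))
      * cmod (dpart (fst ix) \<phi> (snd ix)) / M (length (fst ix))"

definition GSnorm :: "(nat \<Rightarrow> real) \<Rightarrow> (nat \<Rightarrow> real) \<Rightarrow> real \<Rightarrow> ('n::finite) tf \<Rightarrow> real" where
  "GSnorm M A h \<phi> = (SUP ix \<in> UNIV. GSterm M A h \<phi> ix)"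

definition GSh :: "(nat \<Rightarrow> real) \<Rightarrow> (nat \<Rightarrow> real) \<Rightarrow> real \<Rightarrow> ('n::finite) tf set" where
  "GSh M A h = {\<phi>. smooth_fn \<phi> \<and> bdd_above (range (GSterm M A h \<phi>))}"

definition GS :: "GSkind \<Rightarrow> (nat \<Rightarrow> real) \<Rightarrow> (nat \<Rightarrow> real) \<Rightarrow> ('n::finite) tf set" where
  "GS k M A = (case k of Beurling \<Rightarrow> (\<Inter>h\<in>{0<..}. GSh M A h)
                       | Roumieu \<Rightarrow> (\<Union>h\<in>{0<..}. GSh M A h))"

text \<open>Bounded subsets of S^*_dagger (Roumieu: the inductive limit is regular).\<close>
definition GS_bounded :: "GSkind \<Rightarrow> (nat \<Rightarrow> real) \<Rightarrow> (nat \<Rightarrow> real) \<Rightarrow> ('n::finite) tf set \<Rightarrow> bool" where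
  "GS_bounded k M A B \<longleftrightarrow> B \<subseteq> GS k M A \<and>
     (case k of Beurling \<Rightarrow> (\<forall>h>0. bdd_above (GSnorm M A h ` B))
              | Roumieu \<Rightarrow> (\<exists>h>0. B \<subseteq> GSh M A h \<and> bdd_above (GSnorm M A h ` B)))"

definition GS_cont :: "GSkind \<Rightarrow> (nat \<Rightarrow> real) \<Rightarrow> (nat \<Rightarrow> real) \<Rightarrow> (('n::finite) tf \<Rightarrow> real) \<Rightarrow> bool" where
  "GS_cont k M A q \<longleftrightarrow> (case k of
      Beurling \<Rightarrow> (\<exists>h>0. \<exists>C. \<forall>\<phi>\<in>GS k M A. q \<phi> \<le> C * GSnorm M A h \<phi>)
    | Roumieu \<Rightarrow> (\<forall>h>0. \<exists>C. \<forall>\<phi>\<in>GS k M A \<inter> GSh M A h. q \<phi> \<le> C * GSnorm M A h \<phi>))"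

definition UD :: "GSkind \<Rightarrow> (nat \<Rightarrow> real) \<Rightarrow> (nat \<Rightarrow> real) \<Rightarrow> ('n::finite) ud set" where
  "UD k M A = {u. (\<forall>\<phi>\<in>GS k M A. \<forall>\<psi>\<in>GS k M A. u (\<lambda>x. \<phi> x + \<psi> x) = u \<phi> + u \<psi>)
      \<and> (\<forall>c. \<forall>\<phi>\<in>GS k M A. u (\<lambda>x. c * \<phi> x) = c * u \<phi>)
      \<and> (\<forall>\<phi>. \<phi> \<notin> GS k M A \<longrightarrow> u \<phi> = 0)
      \<and> GS_cont k M A (\<lambda>\<phi>. cmod (u \<phi>))}"

definition uzero :: "('n::finite) ud" where "uzero = (\<lambda>\<psi>. 0)"
definition uadd :: "('n::finite) ud \<Rightarrow> 'n ud \<Rightarrow> 'n ud" where "uadd u v = (\<lambda>\<psi>. u \<psi> + v \<psi>)"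
definition udiff :: "('n::finite) ud \<Rightarrow> 'n ud \<Rightarrow> 'n ud" where "udiff u v = (\<lambda>\<psi>. u \<psi> - v \<psi>)"
definition uscale :: "complex \<Rightarrow> ('n::finite) ud \<Rightarrow> 'n ud" where "uscale c u = (\<lambda>\<psi>. c * u \<psi>)"

definition emb :: "GSkind \<Rightarrow> (nat \<Rightarrow> real) \<Rightarrow> (nat \<Rightarrow> real) \<Rightarrow> ('n::finite) tf \<Rightarrow> 'n ud" where
  "emb k M A \<phi> = (\<lambda>\<psi>. if \<psi> \<in> GS k M A then (LINT x|lborel. \<phi> x * \<psi> x) else 0)"

definition umult :: "GSkind \<Rightarrow> (nat \<Rightarrow> real) \<Rightarrow> (nat \<Rightarrow> real) \<Rightarrow> ('n::finite) ud \<Rightarrow> 'n tf \<Rightarrow> 'n ud" where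
  "umult k M A f \<theta> = (\<lambda>\<psi>. if \<psi> \<in> GS k M A then f (\<lambda>x. \<theta> x * \<psi> x) else 0)"

definition utrans :: "GSkind \<Rightarrow> (nat \<Rightarrow> real) \<Rightarrow> (nat \<Rightarrow> real) \<Rightarrow> real^('n::finite) \<Rightarrow> 'n ud \<Rightarrow> 'n ud" where
  "utrans k M A y f = (\<lambda>\<psi>. if \<psi> \<in> GS k M A then f (\<lambda>z. \<psi> (z + y)) else 0)"

definition umod :: "GSkind \<Rightarrow> (nat \<Rightarrow> real) \<Rightarrow> (nat \<Rightarrow> real) \<Rightarrow> real^('n::finite) \<Rightarrow> 'n ud \<Rightarrow> 'n ud" where
  "umod k M A \<xi> f = (\<lambda>\<psi>. if \<psi> \<in> GS k M A
       then f (\<lambda>z. exp (complex_of_real (2 * pi * (\<xi> \<bullet> z)) * \<i>) * \<psi> z) else 0)"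

definition banach_sub :: "('n::finite) ud set \<Rightarrow> ('n ud \<Rightarrow> real) \<Rightarrow> bool" where
  "banach_sub E nE \<longleftrightarrow> uzero \<in> E
     \<and> (\<forall>u\<in>E. \<forall>v\<in>E. uadd u v \<in> E) \<and> (\<forall>c. \<forall>u\<in>E. uscale c u \<in> E)
     \<and> (\<forall>u\<in>E. nE u \<ge> 0 \<and> (nE u = 0 \<longleftrightarrow> u = uzero))
     \<and> (\<forall>c. \<forall>u\<in>E. nE (uscale c u) = cmod c * nE u)
     \<and> (\<forall>u\<in>E. \<forall>v\<in>E. nE (uadd u v) \<le> nE u + nE v)
     \<and> (\<forall>s. (\<forall>m. s m \<in> E) \<longrightarrow> (\<forall>e>0. \<exists>N. \<forall>m\<ge>N. \<forall>n\<ge>N. nE (udiff (s m) (s n)) < e)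
            \<longrightarrow> (\<exists>u\<in>E. (\<lambda>m. nE (udiff (s m) u)) \<longlonglongrightarrow> 0))"

definition cls :: "GSkind \<Rightarrow> (real \<Rightarrow> bool) \<Rightarrow> bool" where
  "cls k P \<longleftrightarrow> (case k of Beurling \<Rightarrow> (\<exists>\<tau>>0. P \<tau>) | Roumieu \<Rightarrow> (\<forall>\<tau>>0. P \<tau>))"

definition TMIB :: "GSkind \<Rightarrow> (nat \<Rightarrow> real) \<Rightarrow> (nat \<Rightarrow> real) \<Rightarrow> ('n::finite) ud set \<Rightarrow> ('n ud \<Rightarrow> real) \<Rightarrow> bool" where
  "TMIB k M A E nE \<longleftrightarrow> banach_sub E nE
     \<and> emb k M A ` GS k M A \<subseteq> E \<and> E \<subseteq> UD k M A
     \<and> GS_cont k M A (\<lambda>\<phi>. nE (emb k M A \<phi>))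
     \<and> (\<forall>u\<in>E. \<forall>e>0. \<exists>\<phi>\<in>GS k M A. nE (udiff u (emb k M A \<phi>)) < e)
     \<and> (\<forall>B. GS_bounded k M A B \<longrightarrow> (\<exists>C. \<forall>u\<in>E. \<forall>\<phi>\<in>B. cmod (u \<phi>) \<le> C * nE u))
     \<and> (\<forall>x. \<forall>u\<in>E. utrans k M A x u \<in> E) \<and> (\<forall>\<xi>. \<forall>u\<in>E. umod k M A \<xi> u \<in> E)
     \<and> cls k (\<lambda>\<tau>. \<exists>C>0. \<forall>u\<in>E. \<forall>x.
          nE (utrans k M A x u) \<le> C * exp (assoc A (\<tau> * norm x)) * nE u
        \<and> nE (umod k M A (- x) u) \<le> C * exp (assoc M (\<tau> * norm x)) * nE u)"

text \<open>Strong dual of a Banach space F containing S^*_dagger densely, realised inside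
  S'^*_dagger via the transpose of the inclusion, with the dual norm.\<close>
definition dual_sp :: "GSkind \<Rightarrow> (nat \<Rightarrow> real) \<Rightarrow> (nat \<Rightarrow> real) \<Rightarrow> ('n::finite) ud set \<Rightarrow> ('n ud \<Rightarrow> real) \<Rightarrow> 'n ud set" where
  "dual_sp k M A F nF = {f \<in> UD k M A. \<exists>C. \<forall>\<phi>\<in>GS k M A. cmod (f \<phi>) \<le> C * nF (emb k M A \<phi>)}"

definition dual_norm :: "GSkind \<Rightarrow> (nat \<Rightarrow> real) \<Rightarrow> (nat \<Rightarrow> real) \<Rightarrow> (('n::finite) ud \<Rightarrow> real) \<Rightarrow> 'n ud \<Rightarrow> real" where
  "dual_norm k M A nF f = (SUP \<phi>\<in>{\<phi>\<in>GS k M A. nF (emb k M A \<phi>) \<le> 1}. cmod (f \<phi>))"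

definition norm_equiv :: "'a set \<Rightarrow> ('a \<Rightarrow> real) \<Rightarrow> ('a \<Rightarrow> real) \<Rightarrow> bool" where
  "norm_equiv F n1 n2 \<longleftrightarrow> (\<exists>C>0. \<forall>f\<in>F. n1 f \<le> C * n2 f \<and> n2 f \<le> C * n1 f)"

definition DTMIB :: "GSkind \<Rightarrow> (nat \<Rightarrow> real) \<Rightarrow> (nat \<Rightarrow> real) \<Rightarrow> ('n::finite) ud set \<Rightarrow> ('n ud \<Rightarrow> real) \<Rightarrow> bool" where
  "DTMIB k M A F nF \<longleftrightarrow> (\<exists>E nE. TMIB k M A E nE \<and> F = dual_sp k M A E nE
        \<and> norm_equiv F nF (dual_norm k M A nE))"

definition weight :: "GSkind \<Rightarrow> (nat \<Rightarrow> real) \<Rightarrow> (real^('n::finite) \<Rightarrow> real) \<Rightarrow> bool" where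
  "weight k A \<eta> \<longleftrightarrow> \<eta> \<in> borel_measurable lborel \<and> (\<forall>x. \<eta> x > 0)
     \<and> cls k (\<lambda>\<tau>. \<exists>C>0. \<forall>x y. \<eta> (x + y) \<le> C * \<eta> x * exp (assoc A (\<tau> * norm y)))"

definition Eloc :: "GSkind \<Rightarrow> (nat \<Rightarrow> real) \<Rightarrow> (nat \<Rightarrow> real) \<Rightarrow> ('n::finite) ud set \<Rightarrow> 'n ud set" where
  "Eloc k M A E = {f \<in> UD k M A. \<forall>\<theta>\<in>GS k M A. umult k M A f \<theta> \<in> E}"

definition amp :: "GSkind \<Rightarrow> (nat \<Rightarrow> real) \<Rightarrow> (nat \<Rightarrow> real) \<Rightarrow> (('n::finite) ud \<Rightarrow> real) \<Rightarrow> 'n tf \<Rightarrow> 'n ud \<Rightarrow> real^'n \<Rightarrow> real" where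
  "amp k M A nE \<theta> f x = nE (umult k M A f (\<lambda>y. \<theta> (y - x)))"

definition W_Lp :: "GSkind \<Rightarrow> (nat \<Rightarrow> real) \<Rightarrow> (nat \<Rightarrow> real) \<Rightarrow> ('n::finite) ud set \<Rightarrow> ('n ud \<Rightarrow> real)
    \<Rightarrow> 'n tf \<Rightarrow> (real^'n \<Rightarrow> real) \<Rightarrow> real \<Rightarrow> 'n ud set" where
  "W_Lp k M A E nE \<theta> \<eta> p = {f \<in> Eloc k M A E. amp k M A nE \<theta> f \<in> borel_measurable lborel
      \<and> (\<integral>\<^sup>+ x. ennreal ((amp k M A nE \<theta> f x * \<eta> x) powr p) \<partial>lborel) < \<infinity>}"

definition W_Lp_norm :: "GSkind \<Rightarrow> (nat \<Rightarrow> real) \<Rightarrow> (nat \<Rightarrow> real) \<Rightarrow> (('n::finite) ud \<Rightarrow> real)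
    \<Rightarrow> 'n tf \<Rightarrow> (real^'n \<Rightarrow> real) \<Rightarrow> real \<Rightarrow> 'n ud \<Rightarrow> real" where
  "W_Lp_norm k M A nE \<theta> \<eta> p f =
     (enn2real (\<integral>\<^sup>+ x. ennreal ((amp k M A nE \<theta> f x * \<eta> x) powr p) \<partial>lborel)) powr (1 / p)"

definition W_Linf :: "GSkind \<Rightarrow> (nat \<Rightarrow> real) \<Rightarrow> (nat \<Rightarrow> real) \<Rightarrow> ('n::finite) ud set \<Rightarrow> ('n ud \<Rightarrow> real)
    \<Rightarrow> 'n tf \<Rightarrow> (real^'n \<Rightarrow> real) \<Rightarrow> 'n ud set" where
  "W_Linf k M A E nE \<theta> \<eta> = {f \<in> Eloc k M A E. amp k M A nE \<theta> f \<in> borel_measurable lborel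
      \<and> esssup lborel (\<lambda>x. ereal (amp k M A nE \<theta> f x * \<eta> x)) < \<infinity>}"

definition W_inf_norm :: "GSkind \<Rightarrow> (nat \<Rightarrow> real) \<Rightarrow> (nat \<Rightarrow> real) \<Rightarrow> (('n::finite) ud \<Rightarrow> real)
    \<Rightarrow> 'n tf \<Rightarrow> (real^'n \<Rightarrow> real) \<Rightarrow> 'n ud \<Rightarrow> real" where
  "W_inf_norm k M A nE \<theta> \<eta> f = real_of_ereal (esssup lborel (\<lambda>x. ereal (amp k M A nE \<theta> f x * \<eta> x)))"

definition W_C0 :: "GSkind \<Rightarrow> (nat \<Rightarrow> real) \<Rightarrow> (nat \<Rightarrow> real) \<Rightarrow> ('n::finite) ud set \<Rightarrow> ('n ud \<Rightarrow> real)
    \<Rightarrow> 'n tf \<Rightarrow> (real^'n \<Rightarrow> real) \<Rightarrow> 'n ud set" where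
  "W_C0 k M A E nE \<theta> \<eta> = {f \<in> W_Linf k M A E nE \<theta> \<eta>. continuous_on UNIV (amp k M A nE \<theta> f)
      \<and> (\<forall>e>0. \<exists>K. compact K \<and> (AE x in lborel. x \<notin> K \<longrightarrow> amp k M A nE \<theta> f x * \<eta> x \<le> e))}"

definition std_seq :: "(nat \<Rightarrow> real) \<Rightarrow> bool" where
  "std_seq M \<longleftrightarrow> (\<forall>p. M p > 0) \<and> M 0 = 1 \<and> M 1 = 1
     \<and> (\<forall>p\<ge>1. (M p)^2 \<le> M (p - 1) * M (p + 1))
     \<and> (\<exists>c0 H. c0 \<ge> 1 \<and> H \<ge> 1 \<and> (\<forall>p q. M (p + q) \<le> c0 * H ^ (p + q) * M p * M q))
     \<and> (\<exists>c0 L0. c0 \<ge> 1 \<and> L0 \<ge> 1 \<and> (\<forall>p. fact p \<le> c0 * L0 ^ p * M p))"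

definition M2star :: "(nat \<Rightarrow> real) \<Rightarrow> bool" where
  "M2star A \<longleftrightarrow> (\<exists>p0 N::nat. p0 > 0 \<and> N > 0 \<and>
     (\<forall>p\<ge>p0. 2 * (A p / A (p - 1)) \<le> A (p * N) / A (p * N - 1)))"

end

theory Submission
  imports Defs "HOL-Probability.Sinc_Integral" "HOL-Probability.Characteristic_Functions"
begin

text \<open>The duality is decided on the test space \<open>S\<close>, where only the restriction \<open>n\<close> of the norm of
  \<open>E\<close> matters. Since \<open>f(\<phi>)\<close> times the integral of \<open>\<bar>\<theta>\<bar>\<^sup>4\<close> is the integral over \<open>x\<close> of \<open>f(\<phi> \<bar>T\<^sub>x \<theta>\<bar>\<^sup>4)\<close>, where
  one factor goes with \<open>f\<close>, one with \<open>\<phi>\<close> and the others act as a multiplier, the inequality of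
  Hoelder bounds \<open>f(\<phi>)\<close> by the product of the two amalgam norms. Conversely, choose at finitely many points \<open>x\<^sub>v\<close> test functions \<open>\<phi>\<^sub>v\<close> in the unit ball of \<open>n\<close> on which \<open>f T\<^sub>x\<^sub>v \<theta>\<close> is
  nearly extremal. Products of two translates of \<open>\<theta>\<close> decay in the distance of the translations, so the
  amalgam norm of a sum of the \<open>a\<^sub>v \<phi>\<^sub>v T\<^sub>x\<^sub>v \<theta>\<close> is controlled by the Lebesgue norm of a sum of translated
  kernels with the coefficients \<open>a\<^sub>v\<close>. Letting the points run through the translates of a lattice and
  averaging yields the bound for the dual amalgam norm of \<open>f\<close>.

  The amalgam norm on \<open>S\<close> is again closable with the moderate growth required of a TMIB space. Hence its
  completion is a TMIB space, whose dual is the same as that of the amalgam space.\<close>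

section \<open>Associated functions and decaying kernels\<close>

text \<open>The analytic obstacle is to carry an integral over translates or modulations through a
  seminorm or an ultradistribution, which is controlled only by the norms of the spaces
  \<open>GSh\<close>. Riemann sums are therefore shown to converge in one such norm, and the
  triangle inequality passes to the limit. For translates of a window this yields the averaging
  formula; for Fourier inversion of a test function it turns the growth bound on modulations into a
  bound on multiplication by test functions, uniform over their translates. The constants record
  losses of the parameter h. By (M.2), e^{2A(r)} is at most c e^{A(Hr)}, so a factor H is paid
  whenever one kernel must absorb a growing weight and still decay. Factors 2 come from the Leibniz
  rule and from splitting A(a + b). The Beurling and Roumieu cases share one argument: continuity
  bounds hold for some (every) parameter, memberships for every (some) one, and hence always for a
  common one.\<close>

definition ea :: "(nat \<Rightarrow> real) \<Rightarrow> real \<Rightarrow> real" where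
  "ea A \<rho> = exp (assoc A \<rho>)"

text \<open>With \<open>A\<close> this is the decay of test functions, with \<open>M\<close> that of
  their Fourier transforms. It is integrable for every h > 0 and serves as the model kernel in later
  integrals and lattice sums.\<close>

definition wt :: "(nat \<Rightarrow> real) \<Rightarrow> real \<Rightarrow> real^('n::finite) \<Rightarrow> real" where
  "wt A h x = 1 / ea A (h * norm x)"

definition M2_bound :: "(nat \<Rightarrow> real) \<Rightarrow> real \<Rightarrow> real \<Rightarrow> bool" where
  "M2_bound A c H \<longleftrightarrow> (\<forall>p q. A (p + q) \<le> c * H ^ (p + q) * A p * A q)"

section \<open>Consequences of (M.1), (M.2) and (M.6) for sequences and associated functions\<close>

lemma std_seq_pos: "std_seq A \<Longrightarrow> A p > 0"
  by (simp add: std_seq_def)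

lemma std_seq_0: "std_seq A \<Longrightarrow> A 0 = 1"
  and std_seq_1: "std_seq A \<Longrightarrow> A 1 = 1" "std_seq A \<Longrightarrow> A (Suc 0) = 1"
  by (simp_all add: std_seq_def)

text \<open>This is (M.1) iterated p times: logarithmic convexity makes the quotients of consecutive
  terms increase.\<close>

lemma std_seq_ratio_mono:
  assumes "std_seq A" shows "A (Suc q) / A q \<le> A (p + Suc q) / A (p + q)"
proof (induction p)
  case (Suc p)
  have "(A (Suc (p + q)))\<^sup>2 \<le> A (p + q) * A (Suc (Suc (p + q)))"
    using assms by (auto simp: std_seq_def dest!: spec[of _ "Suc (p + q)"])
  moreover have "A (p + q) > 0" "A (Suc (p + q)) > 0"
    using assms by (auto simp: std_seq_pos)
  ultimately have "A (Suc (p + q)) / A (p + q) \<le> A (Suc (Suc (p + q))) / A (Suc (p + q))"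
    by (simp add: divide_simps power2_eq_square mult.commute)
  with Suc show ?case by simp
qed simp

text \<open>Passing from q to q + 1 multiplies the left side by \<open>A (Suc q) / A q\<close> and
  the right side by the quotient p places later, which is at least as large. Later this merges the
  derivative orders in the Leibniz rule.\<close>

lemma std_seq_mult_le:
  assumes "std_seq A" shows "A p * A q \<le> A (p + q)"
proof (induction q)
  case 0 then show ?case using assms by (simp add: std_seq_0)
next
  case (Suc q)
  have pos: "A r > 0" for r using assms by (rule std_seq_pos)
  have "A p * A (Suc q) = (A p * A q) * (A (Suc q) / A q)"
    using pos[of q] by simp
  also have "\<dots> \<le> A (p + q) * (A (p + Suc q) / A (p + q))"
    using Suc std_seq_ratio_mono[OF assms, of q p] pos
    by (intro mult_mono) (auto intro: less_imp_le divide_nonneg_nonneg)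
  also have "\<dots> = A (p + Suc q)" using pos[of "p+q"] by simp
  finally show ?case .
qed

text \<open>By (M.6) the quotient is at most c times one term of the exponential series of L \<rho>.
  It serves to make the supremum in \<open>assoc\<close> a supremum of a bounded set.\<close>

lemma std_seq_exp_bound:
  assumes "std_seq A" obtains c L where "c \<ge> 1" "L \<ge> 1" "\<And>p \<rho>. \<rho> \<ge> 0 \<Longrightarrow> \<rho>^p / A p \<le> c * exp (L * \<rho>)"
proof -
  obtain c L where c: "c \<ge> 1" "L \<ge> 1" "\<And>p. fact p \<le> c * L ^ p * A p"
    using assms by (auto simp: std_seq_def)
  have "\<rho>^p / A p \<le> c * exp (L * \<rho>)" if "\<rho> \<ge> 0" for p \<rho>
  proof -
    have "\<rho>^p / A p \<le> c * ((L*\<rho>)^p / fact p)"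
    proof -
      have "fact p * \<rho>^p \<le> (c * L ^ p * A p) * \<rho>^p"
        using c(3)[of p] that by (intro mult_right_mono) auto
      then show ?thesis using std_seq_pos[OF assms, of p] by (simp add: divide_simps power_mult_distrib mult_ac)
    qed
    also have "(L*\<rho>)^p / fact p \<le> exp (L * \<rho>)"
    proof -
      have s: "(\<lambda>n. (L*\<rho>)^n /\<^sub>R fact n) sums exp (L*\<rho>)" by (rule exp_converges)
      have "(\<Sum>n\<in>{p}. (L*\<rho>)^n /\<^sub>R fact n) \<le> (\<Sum>n. (L*\<rho>)^n /\<^sub>R fact n)"
        using s that c by (intro sum_le_suminf) (auto simp: sums_iff)
      then show ?thesis using s by (simp add: sums_iff divide_inverse mult.commute)
    qed
    finally show ?thesis using c by simp
  qed
  with c that show ?thesis by blast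
qed

lemma assoc_bdd:
  assumes "std_seq A" "\<rho> > 0" shows "bdd_above (range (\<lambda>p. ln (\<rho>^p / A p)))"
proof -
  obtain c L where c: "c \<ge> 1" "L \<ge> 1" "\<And>p \<rho>. \<rho> \<ge> 0 \<Longrightarrow> \<rho>^p / A p \<le> c * exp (L * \<rho>)"
    using std_seq_exp_bound[OF assms(1)] by blast
  show ?thesis
    using assms c(1) c(3)[of \<rho>] std_seq_pos[OF assms(1)]
    by (intro bdd_aboveI[of _ "ln (c * exp (L * \<rho>))"]) (auto intro!: ln_mono)
qed

text \<open>Together with \<open>ea_le\<close> this replaces the logarithmic definition by
  e^{A(\<rho>)} = sup_p \<rho>^p / A_p. Both include \<rho> = 0, where \<open>assoc\<close> is 0 by
  convention.\<close>

lemma ea_ge: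
  assumes "std_seq A" "\<rho> \<ge> 0" shows "\<rho>^p / A p \<le> ea A \<rho>"
proof (cases "\<rho> = 0")
  case True then show ?thesis using assms
    by (cases p) (auto simp: ea_def assoc_def std_seq_0)
next
  case False
  then have "\<rho> > 0" using assms by simp
  then have "ln (\<rho>^p / A p) \<le> assoc A \<rho>"
    using assoc_bdd[OF assms(1)] by (auto simp: assoc_def intro!: cSUP_upper)
  then have "exp (ln (\<rho>^p / A p)) \<le> ea A \<rho>" by (simp add: ea_def)
  moreover have "\<rho>^p / A p > 0" using \<open>\<rho> > 0\<close> assms std_seq_pos by auto
  ultimately show ?thesis by (simp del: ln_div)
qed

lemma ea_le:
  assumes "std_seq A" "\<rho> \<ge> 0" "\<And>p. \<rho>^p / A p \<le> K" shows "ea A \<rho> \<le> K"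
proof (cases "\<rho> = 0")
  case True then show ?thesis using assms(3)[of 0] assms(1)
    by (auto simp: ea_def assoc_def std_seq_0)
next
  case False
  then have "\<rho> > 0" using assms by simp
  have K: "K \<ge> 1" using assms(3)[of 0] assms(1) by (simp add: std_seq_0)
  have pos: "\<rho>^p / A p > 0" for p using \<open>\<rho> > 0\<close> assms std_seq_pos by auto
  have "assoc A \<rho> \<le> ln K"
    using \<open>\<rho> > 0\<close> assms(3) pos K
    by (auto simp: assoc_def simp del: ln_div intro!: cSUP_least ln_mono)
  then have "ea A \<rho> \<le> exp (ln K)" by (simp add: ea_def)
  then show ?thesis using K by simp
qed

lemma ea_pos [simp]: "ea A \<rho> > 0" by (simp add: ea_def)

lemma ea_nonneg [simp]: "ea A \<rho> \<ge> 0" by (simp add: ea_def)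

lemma ea_neq0 [simp]: "ea A \<rho> \<noteq> 0" by (simp add: ea_def)

lemma ea_ge1: assumes "std_seq A" shows "ea A \<rho> \<ge> 1"
proof (cases "\<rho> \<ge> 0")
  case True then show ?thesis using ea_ge[OF assms True, of 0] assms by (simp add: std_seq_0)
qed (simp add: ea_def assoc_def)

lemma ea_nonpos: "\<rho> \<le> 0 \<Longrightarrow> ea A \<rho> = 1" by (simp add: ea_def assoc_def)

lemma ea_mono:
  assumes "std_seq A" "\<rho> \<le> \<sigma>" shows "ea A \<rho> \<le> ea A \<sigma>"
proof (cases "\<rho> \<ge> 0")
  case True
  show ?thesis
  proof (rule ea_le[OF assms(1) True])
    fix p
    have "\<rho>^p / A p \<le> \<sigma>^p / A p"
      using True assms std_seq_pos[OF assms(1), of p] by (intro divide_right_mono power_mono) auto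
    also have "\<dots> \<le> ea A \<sigma>" using True assms by (intro ea_ge) auto
    finally show "\<rho>^p / A p \<le> ea A \<sigma>" .
  qed
qed (use assms ea_ge1 in \<open>auto simp: ea_nonpos\<close>)

text \<open>The larger of a and b is at least their mean, so a + b is at most 2a or at most 2b, and
  the remaining factor is at least 1. No signs are required because \<open>ea\<close> equals 1 on
  the nonpositive axis.\<close>

lemma ea_add: 
  assumes "std_seq A" shows "ea A (a + b) \<le> ea A (2 * a) * ea A (2 * b)"
proof -
  have "a + b \<le> 2 * a \<or> a + b \<le> 2 * b" by linarith
  then have "ea A (a + b) \<le> ea A (2 * a) \<or> ea A (a + b) \<le> ea A (2 * b)"
    using ea_mono[OF assms] by blast
  then show ?thesis
  proof
    assume "ea A (a + b) \<le> ea A (2 * a)"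
    also have "\<dots> * 1 \<le> ea A (2 * a) * ea A (2 * b)"
      by (rule mult_left_mono) (simp_all add: ea_ge1[OF assms])
    finally show ?thesis by simp
  next
    assume "ea A (a + b) \<le> ea A (2 * b)"
    also have "1 * \<dots> \<le> ea A (2 * a) * ea A (2 * b)"
      by (rule mult_right_mono) (simp_all add: ea_ge1[OF assms])
    finally show ?thesis by simp
  qed
qed

text \<open>(M.2) bounds the product of the terms of index p and q by c times the term of index p +
  q at H \<rho>. The suprema over q and over p are then taken one after the other.\<close>

lemma ea_sq:
  assumes "std_seq A" "M2_bound A c H" "H \<ge> 1" "c \<ge> 1" "\<rho> \<ge> 0"
  shows "(ea A \<rho>)\<^sup>2 \<le> c * ea A (H * \<rho>)"
proof -
  have pos: "A r > 0" for r using assms(1) by (rule std_seq_pos)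
  have *: "(\<rho>^p / A p) * (\<rho>^q / A q) \<le> c * ea A (H * \<rho>)" for p q
  proof -
    have "(\<rho>^p / A p) * (\<rho>^q / A q) = \<rho>^(p+q) / (A p * A q)" by (simp add: power_add)
    also have "\<dots> \<le> \<rho>^(p+q) / (A (p+q) / (c * H^(p+q)))"
      using assms pos by (intro divide_left_mono)
        (auto simp: M2_bound_def field_simps intro!: mult_pos_pos)
    also have "\<dots> = c * ((H * \<rho>)^(p+q) / A (p+q))" by (simp add: power_mult_distrib)
    also have "\<dots> \<le> c * ea A (H * \<rho>)" using assms by (intro mult_left_mono ea_ge) auto
    finally show ?thesis .
  qed
  have *: "(\<rho>^p / A p) * ea A \<rho> \<le> c * ea A (H * \<rho>)" for p
  proof (cases "\<rho>^p / A p = 0")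
    case True
    show ?thesis unfolding True using assms by simp
  next
    case False
    then have p: "\<rho>^p / A p > 0" using divide_nonneg_pos[OF zero_le_power[OF assms(5), of p] pos[of p]] by (rule_tac le_neq_trans) (simp_all only: not_sym)
    have "ea A \<rho> \<le> c * ea A (H * \<rho>) / (\<rho>^p / A p)"
      using * by (intro ea_le assms(1,5)) (simp only: pos_le_divide_eq[OF p] mult.commute)
    then show ?thesis unfolding pos_le_divide_eq[OF p] by (simp only: mult.commute)
  qed
  have "ea A \<rho> \<le> c * ea A (H * \<rho>) / ea A \<rho>"
    using * by (intro ea_le assms) (simp only: pos_le_divide_eq[OF ea_pos])
  then have "ea A \<rho> * ea A \<rho> \<le> c * ea A (H * \<rho>)" by (simp only: pos_le_divide_eq[OF ea_pos])
  then show ?thesis by (simp add: power2_eq_square)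
qed

lemma ea_measurable [measurable]:
  assumes "std_seq A" shows "ea A \<in> borel_measurable borel"
  by (rule borel_measurable_mono) (simp add: mono_def ea_mono[OF assms])

lemma wt_pos [simp]: "wt A h x > 0" and wt_nonneg [simp]: "wt A h x \<ge> 0" by (simp_all add: wt_def)

lemma wt_minus [simp]: "wt A h (- x) = wt A h x" by (simp add: wt_def)

lemma wt_minus_commute: "wt A h (x - y) = wt A h (y - x)"
  by (simp add: wt_def norm_minus_commute)

lemma wt_le_1: "std_seq A \<Longrightarrow> wt A h x \<le> 1" using ea_ge1[of A] by (simp add: wt_def)

lemma wt_measurable [measurable]:
  "std_seq A \<Longrightarrow> wt A h \<in> borel_measurable borel"
  unfolding wt_def using ea_measurable[of A] by measurable

lemma wt_antimono: "std_seq A \<Longrightarrow> h \<le> h' \<Longrightarrow> wt A h' x \<le> wt A h x"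
  unfolding wt_def by (intro divide_left_mono ea_mono mult_right_mono) auto

lemma wt_sq:
  assumes "std_seq A" "M2_bound A c H" "H \<ge> 1" "c \<ge> 1" "h \<ge> 0"
  shows "wt A (H * h) x \<le> c * (wt A h x)\<^sup>2"
proof -
  have "(ea A (h * norm x))\<^sup>2 \<le> c * ea A (H * h * norm x)"
    using ea_sq[OF assms(1-4), of "h * norm x"] assms(5) by (simp add: mult.assoc)
  then show ?thesis by (simp add: wt_def field_simps)
qed

lemma wt_prod:
  assumes "std_seq A" "h \<ge> 0" shows "wt A (2 * h) x * wt A (2 * h) y \<le> wt A h (x + y)"
proof -
  have "ea A (h * norm (x + y)) \<le> ea A (h * norm x + h * norm y)"
    using assms norm_triangle_ineq[of x y] by (intro ea_mono) (auto simp: mult_left_mono simp flip: distrib_left)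
  also have "\<dots> \<le> ea A (2 * (h * norm x)) * ea A (2 * (h * norm y))" by (rule ea_add[OF assms(1)])
  finally show ?thesis by (simp add: wt_def mult.assoc frac_le)
qed

lemma wt_shift:
  assumes "std_seq A" "h \<ge> 0" 
  shows "wt A (2 * h) (x + s) \<le> ea A (2 * h * norm s) * wt A h x"
  using wt_prod[OF assms, of "x + s" "- s"] by (simp add: wt_def field_simps)

text \<open>Lebesgue measure is the image of a product measure indexed by \<open>Basis\<close>,
  whereas the functions are indexed by coordinates; the bijection \<open>ax\<close> translates
  between the two.\<close>

lemma integrable_lborel_prod:
  fixes f :: "'n::finite \<Rightarrow> real \<Rightarrow> 'b::{real_normed_field,banach,second_countable_topology}"
  assumes "\<And>i. integrable lborel (f i)"
  shows "integrable lborel (\<lambda>x::real^'n. \<Prod>i\<in>UNIV. f i (x $ i))"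
    and "(LINT x|lborel. (\<Prod>i\<in>UNIV. f i ((x::real^'n) $ i))) = (\<Prod>i\<in>UNIV. integral\<^sup>L lborel (f i))"
proof -
  interpret product_sigma_finite "\<lambda>b::real^'n. lborel :: real measure" by standard
  define ax where "ax = (\<lambda>i::'n. axis i (1::real))"
  have inj: "inj ax" by (auto simp: ax_def inj_def axis_eq_axis)
  have Bas: "(Basis :: (real^'n) set) = range ax" by (auto simp: Basis_vec_def ax_def)
  define F where "F = (\<lambda>b. f (inv ax b))"
  have F: "integrable lborel (F b)" for b using assms by (simp add: F_def)
  let ?L = "\<lambda>g::real^'n \<Rightarrow> real. \<Sum>b\<in>Basis. g b *\<^sub>R b"
  have coord: "?L g $ i = g (ax i)" for g i
  proof -
    have "?L g $ i = ?L g \<bullet> ax i" by (simp add: ax_def inner_axis)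
    also have "\<dots> = g (ax i)"
      using Bas by (subst inner_sum_left_Basis) auto
    finally show ?thesis .
  qed
  have eq: "(\<Prod>i\<in>UNIV. f i (?L g $ i)) = (\<Prod>b\<in>Basis. F b (g b))" for g
  proof -
    have "(\<Prod>b\<in>Basis. F b (g b)) = (\<Prod>i\<in>UNIV. f i (g (ax i)))"
      unfolding Bas by (subst prod.reindex[OF inj]) (simp add: F_def inv_f_f[OF inj])
    moreover have "(\<Prod>i\<in>UNIV. f i (?L g $ i)) = (\<Prod>i\<in>UNIV. f i (g (ax i)))"
      by (intro prod.cong refl arg_cong[of _ _ "f _"] coord)
    ultimately show ?thesis by (rule trans[OF _ sym, rotated])
  qed
  have meas[measurable]: "f i \<in> borel_measurable borel" for i using assms[of i] by auto
  have m1: "?L \<in> (\<Pi>\<^sub>M b\<in>Basis. lborel) \<rightarrow>\<^sub>M borel" by measurable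
  have m2: "(\<lambda>x::real^'n. \<Prod>i\<in>UNIV. f i (x $ i)) \<in> borel_measurable borel" by measurable
  have I: "integrable (\<Pi>\<^sub>M b\<in>Basis. lborel) (\<lambda>g. \<Prod>b\<in>Basis. F b (g b))"
    by (rule product_integrable_prod) (auto intro: F)
  show "integrable lborel (\<lambda>x::real^'n. \<Prod>i\<in>UNIV. f i (x $ i))"
    by (subst lborel_eq) (simp only: integrable_distr_eq[OF m1 m2] eq I)
  have "(LINT x|lborel. (\<Prod>i\<in>UNIV. f i ((x::real^'n) $ i))) = 
        (LINT g|(\<Pi>\<^sub>M b\<in>Basis. lborel). (\<Prod>b\<in>Basis. F b (g b)))"
    by (subst lborel_eq) (simp only: integral_distr[OF m1 m2] eq)
  also have "\<dots> = (\<Prod>b\<in>Basis. integral\<^sup>L lborel (F b))"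
    by (rule product_integral_prod) (auto intro: F)
  also have "\<dots> = (\<Prod>i\<in>UNIV. integral\<^sup>L lborel (f i))"
    by (simp only: Bas prod.reindex[OF inj] comp_def F_def inv_f_f[OF inj])
  finally show "(LINT x|lborel. (\<Prod>i\<in>UNIV. f i ((x::real^'n) $ i))) = (\<Prod>i\<in>UNIV. integral\<^sup>L lborel (f i))" .
qed

text \<open>With N the dimension, the term of index 2N in e^{A(h|x|)} dominates, up to a constant
  and for large x, the product of the factors 1 + x_i^2, whose reciprocal is integrable coordinate
  by coordinate.\<close>

lemma wt_integrable:
  assumes "std_seq A" "h > 0"
  shows "integrable lborel (wt A h :: real^('n::finite) \<Rightarrow> real)"
proof -
  define N where "N = CARD('n)"
  define C where "C = 2^N * (1 + A (2*N) / h^(2*N))"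
  have A: "A (2*N) > 0" using assms std_seq_pos by blast
  have int1: "integrable lborel (\<lambda>x::real. inverse (1 + x\<^sup>2))"
    using integrable_inverse_1_plus_square by (simp add: set_integrable_def)
  have b: "wt A h x \<le> C * (\<Prod>i\<in>UNIV. inverse (1 + (x$i)\<^sup>2))" for x :: "real^'n"
  proof -
    have "(\<Prod>i\<in>UNIV. 1 + (x$i)\<^sup>2) \<le> (\<Prod>i\<in>(UNIV::'n set). 1 + (norm x)\<^sup>2)"
      by (intro prod_mono) (auto simp: component_le_norm_cart power2_le_iff_abs_le)
    also have "\<dots> = (1 + (norm x)\<^sup>2)^N" by (simp add: N_def)
    also have "\<dots> \<le> 2^N * (1 + (norm x)^(2*N))"
    proof (cases "norm x \<le> 1")
      case True
      then have "(1 + (norm x)\<^sup>2)^N \<le> 2^N" by (intro power_mono) (auto simp: power_le_one)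
      also have "\<dots> \<le> 2^N * (1 + (norm x)^(2*N))" by (simp add: mult_left_mono)
      finally show ?thesis .
    next
      case False
      then have "1 \<le> (norm x)\<^sup>2" by simp
      then have "(1 + (norm x)\<^sup>2)^N \<le> (2 * (norm x)\<^sup>2)^N" by (intro power_mono) auto
      also have "\<dots> \<le> 2^N * (1 + (norm x)^(2*N))" by (simp add: power_mult_distrib power_mult)
      finally show ?thesis .
    qed
    also have "(norm x)^(2*N) \<le> A (2*N) / h^(2*N) * ea A (h * norm x)"
    proof -
      have "(h * norm x)^(2*N) / A (2*N) \<le> ea A (h * norm x)" using assms by (intro ea_ge) auto
      then show ?thesis using A assms by (simp add: field_simps power_mult_distrib)
    qed
    also have "1 + A (2*N) / h^(2*N) * ea A (h * norm x) \<le> (1 + A (2*N) / h^(2*N)) * ea A (h * norm x)"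
      using ea_ge1[OF assms(1)] by (simp add: distrib_right)
    finally have *: "(\<Prod>i\<in>UNIV. 1 + (x$i)\<^sup>2) \<le> C * ea A (h * norm x)"
      by (simp add: C_def mult.assoc mult_left_mono)
    have p: "(\<Prod>i\<in>UNIV. 1 + (x$i)\<^sup>2) > 0" by (intro prod_pos) (auto simp: add_pos_nonneg)
    have "(\<Prod>i\<in>UNIV. inverse (1 + (x$i)\<^sup>2)) = 1 / (\<Prod>i\<in>UNIV. 1 + (x$i)\<^sup>2)"
      using prod_inversef[of "\<lambda>i. 1 + (x$i)\<^sup>2" UNIV] unfolding inverse_eq_divide comp_def .
    then show ?thesis using * p by (simp add: wt_def field_simps)
  qed
  show ?thesis
  proof (rule Bochner_Integration.integrable_bound)
    show "integrable lborel (\<lambda>x::real^'n. C * (\<Prod>i\<in>UNIV. inverse (1 + (x$i)\<^sup>2)))"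
      using integrable_lborel_prod(1)[of "\<lambda>i::'n. \<lambda>x. inverse (1 + x\<^sup>2)"] int1 by simp
    show "AE x in lborel. norm (wt A h x) \<le> norm (C * (\<Prod>i\<in>UNIV. inverse (1 + ((x::real^'n)$i)\<^sup>2)))"
      using b by (intro always_eventually allI) (metis abs_ge_self abs_of_nonneg order_trans real_norm_def wt_nonneg)
  qed (use assms in simp)
qed

text \<open>Level H h provides two factors of the kernel at level h. One absorbs |x|, since the term
  of index 1 with A_1 = 1 gives h|x| \<le> e^{A(h|x|)}; the other remains.\<close>

lemma norm_wt_le:
  assumes "std_seq A" "M2_bound A c H" "H \<ge> 1" "c \<ge> 1" "h > 0"
  shows "norm x * wt A (H * h) x \<le> c / h * wt A h x"
proof -
  have "h * norm x \<le> ea A (h * norm x)"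
    using ea_ge[OF assms(1), of "h * norm x" 1] assms by (simp add: std_seq_1)
  then have *: "norm x * wt A h x \<le> 1 / h" using assms by (simp add: wt_def field_simps)
  have "norm x * wt A (H * h) x \<le> norm x * (c * (wt A h x)\<^sup>2)"
    using wt_sq[OF assms(1-4), of h x] assms by (intro mult_left_mono) auto
  also have "\<dots> = c * wt A h x * (norm x * wt A h x)" by (simp add: power2_eq_square)
  also have "\<dots> \<le> c * wt A h x * (1 / h)" using * assms by (intro mult_left_mono) auto
  finally show ?thesis by simp
qed

section \<open>Test functions and iterated partial derivatives\<close>

text \<open>The quantifier dual to \<open>cls\<close>: the test space is defined by it, while weights, norms and
  continuous functionals obey bounds of the form \<open>cls\<close>.\<close>

definition dcl :: "GSkind \<Rightarrow> (real \<Rightarrow> bool) \<Rightarrow> bool" where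
  "dcl k P \<longleftrightarrow> (case k of Beurling \<Rightarrow> (\<forall>\<tau>>0. P \<tau>) | Roumieu \<Rightarrow> (\<exists>\<tau>>0. P \<tau>))"

text \<open>For either kind one of the two quantifiers is universal and the other existential. This
  is how a continuity bound meets the test functions to which it is applied.\<close>

lemma cls_meet: "cls k P \<Longrightarrow> dcl k R \<Longrightarrow> \<exists>h>0. P h \<and> R h"
  by (cases k) (auto simp: cls_def dcl_def)

text \<open>In the Beurling case the two witnesses are replaced by their maximum, hence the upward
  monotonicity of both bounds.\<close>

lemma cls_conj:
  assumes "cls k P" "cls k Q"
    and "\<And>h h'. 0 < h \<Longrightarrow> h \<le> h' \<Longrightarrow> P h \<Longrightarrow> P h'" "\<And>h h'. 0 < h \<Longrightarrow> h \<le> h' \<Longrightarrow> Q h \<Longrightarrow> Q h'"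
  shows "cls k (\<lambda>h. P h \<and> Q h)"
proof (cases k)
  case Beurling
  with assms obtain a b where "a > 0" "b > 0" "P a" "Q b" by (auto simp: cls_def)
  then have "P (max a b)" "Q (max a b)" "max a b > 0" using assms(3)[of a "max a b"] assms(4)[of b "max a b"] by auto
  then show ?thesis using Beurling by (auto simp: cls_def intro!: exI[of _ "max a b"])
next
  case Roumieu then show ?thesis using assms by (auto simp: cls_def)
qed

lemma dcl_conj:
  assumes "dcl k P" "dcl k Q"
    and "\<And>h h'. 0 < h \<Longrightarrow> h \<le> h' \<Longrightarrow> P h' \<Longrightarrow> P h" "\<And>h h'. 0 < h \<Longrightarrow> h \<le> h' \<Longrightarrow> Q h' \<Longrightarrow> Q h"
  shows "dcl k (\<lambda>h. P h \<and> Q h)"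
proof (cases k)
  case Roumieu
  with assms obtain a b where "a > 0" "b > 0" "P a" "Q b" by (auto simp: dcl_def)
  then have "P (min a b)" "Q (min a b)" "min a b > 0" using assms(3)[of "min a b" a] assms(4)[of "min a b" b] by auto
  then show ?thesis using Roumieu by (auto simp: dcl_def intro!: exI[of _ "min a b"])
next
  case Beurling then show ?thesis using assms by (auto simp: dcl_def)
qed

lemma cls_scale: assumes "cls k P" "a > 0" shows "cls k (\<lambda>h. P (a * h))"
proof (cases k)
  case Beurling
  with assms obtain h where "h > 0" "P h" by (auto simp: cls_def)
  then have "h / a > 0 \<and> P (a * (h / a))" using assms by simp
  then show ?thesis using Beurling by (auto simp: cls_def simp del: times_divide_eq_right)
next
  case Roumieu then show ?thesis using assms by (auto simp: cls_def)
qed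

lemma dcl_scale: assumes "dcl k P" "a > 0" shows "dcl k (\<lambda>h. P (a * h))"
proof (cases k)
  case Roumieu
  with assms obtain h where "h > 0" "P h" by (auto simp: dcl_def)
  then have "h / a > 0 \<and> P (a * (h / a))" using assms by simp
  then show ?thesis using Roumieu by (auto simp: dcl_def simp del: times_divide_eq_right)
next
  case Beurling then show ?thesis using assms by (auto simp: dcl_def)
qed

lemma cls_mono: "cls k P \<Longrightarrow> (\<And>h. h > 0 \<Longrightarrow> P h \<Longrightarrow> Q h) \<Longrightarrow> cls k Q"
  by (cases k) (auto simp: cls_def)

lemma dcl_mono: "dcl k P \<Longrightarrow> (\<And>h. h > 0 \<Longrightarrow> P h \<Longrightarrow> Q h) \<Longrightarrow> dcl k Q"
  by (cases k) (auto simp: dcl_def)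

text \<open>Derives one \<open>cls\<close> bound from another when the argument also needs some
  fixed function, typically the window, at the same level, and changes the level by a factor
  a.\<close>

lemma cls_trans:
  assumes "cls k P" "dcl k R" "a > 0"
    and step: "\<And>h. h > 0 \<Longrightarrow> P h \<Longrightarrow> R h \<Longrightarrow> Q (a * h)"
    and R: "\<And>h h'. 0 < h \<Longrightarrow> h \<le> h' \<Longrightarrow> R h' \<Longrightarrow> R h" and Q: "\<And>h h'. 0 < h \<Longrightarrow> h \<le> h' \<Longrightarrow> Q h \<Longrightarrow> Q h'"
  shows "cls k Q"
proof (cases k)
  case Beurling
  with assms obtain h where h: "h > 0" "P h" by (auto simp: cls_def)
  moreover have "R h" using Beurling assms h by (auto simp: dcl_def)
  ultimately have "Q (a * h)" "a * h > 0" using step assms(3) by auto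
  then show ?thesis using Beurling by (auto simp: cls_def)
next
  case Roumieu
  with assms obtain h1 where h1: "h1 > 0" "R h1" by (auto simp: dcl_def)
  have "Q h" if h: "h > 0" for h
  proof -
    \<comment> \<open>Small enough for R to hold at h0 and for a * h0 not to exceed the target h;
      afterwards Q is carried upwards to h.\<close>
    define h0 where "h0 = min (h / a) h1"
    have h0: "h0 > 0" "h0 \<le> h1" "a * h0 \<le> h" using h h1 assms(3) by (auto simp: h0_def min_def field_simps)
    have "P h0" using assms(1) Roumieu h0 by (auto simp: cls_def)
    then have "Q (a * h0)" using step R h0 h1 by blast
    then show ?thesis using Q[of "a * h0" h] h0 assms(3) by simp
  qed
  then show ?thesis using Roumieu by (auto simp: cls_def)
qed

lemma GS_iff: "\<phi> \<in> GS k M A \<longleftrightarrow> dcl k (\<lambda>h. \<phi> \<in> GSh M A h)"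
  by (cases k) (auto simp: GS_def dcl_def)

text \<open>Intersecting with \<open>GSh M A h\<close> changes nothing in the Beurling case and is
  the definition in the Roumieu case, so one formula covers both.\<close>

lemma GS_cont_iff:
  fixes q :: "('n::finite) tf \<Rightarrow> real"
  shows "GS_cont k M A q \<longleftrightarrow> cls k (\<lambda>h. \<exists>C. \<forall>\<phi>\<in>GS k M A \<inter> GSh M A h. q \<phi> \<le> C * GSnorm M A h \<phi>)"
proof (cases k)
  case Beurling
  then have "GS k M A \<inter> GSh M A h = (GS k M A :: 'n tf set)" if "h > 0" for h using that by (auto simp: GS_def)
  then show ?thesis using Beurling by (simp add: GS_cont_def cls_def) (intro ex_cong1 conj_cong refl; simp)
qed (auto simp: GS_cont_def cls_def)

lemma GS_GSh: "\<phi> \<in> GS k M A \<Longrightarrow> \<exists>h>0. \<phi> \<in> GSh M A h"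
  by (cases k) (auto simp: GS_def intro: exI[of _ 1])

section \<open>Calculus with iterated derivatives along the coordinate axes\<close>

lemma smooth_hvd:
  assumes "smooth_fn f"
  shows "((\<lambda>t. dpart js f (x + t *\<^sub>R axis i 1)) has_vector_derivative dpart (i # js) f x) (at 0)"
  using assms unfolding smooth_fn_def
  by (auto simp: pd_def vector_derivative_works[symmetric])

lemma smooth_hvd_at:
  assumes "smooth_fn f"
  shows "((\<lambda>t. dpart js f (x + t *\<^sub>R axis i 1)) has_vector_derivative dpart (i # js) f (x + s *\<^sub>R axis i 1)) (at s within S)"
proof -
  have "((\<lambda>t. dpart js f ((x + s *\<^sub>R axis i 1) + t *\<^sub>R axis i 1)) has_vector_derivative dpart (i # js) f (x + s *\<^sub>R axis i 1)) (at (s - s))"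
    using smooth_hvd[OF assms] by simp
  moreover have "((\<lambda>t. t - s) has_vector_derivative 1) (at s)"
    by (auto intro!: derivative_eq_intros)
  ultimately have "((\<lambda>t. dpart js f ((x + s *\<^sub>R axis i 1) + t *\<^sub>R axis i 1)) \<circ> (\<lambda>t. t - s) has_vector_derivative 1 *\<^sub>R dpart (i # js) f (x + s *\<^sub>R axis i 1)) (at s)"
    by (intro vector_diff_chain_at) auto
  then show ?thesis
    by (simp add: comp_def algebra_simps has_vector_derivative_at_within)
qed

lemma smooth_cont: "smooth_fn f \<Longrightarrow> continuous_on S (dpart js f)"
  unfolding smooth_fn_def using continuous_on_subset by blast

text \<open>The derivatives for all lists are guessed at once as a family F. Closure of F under one
  more axis derivative then identifies every \<open>dpart\<close> by induction, and smoothness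
  follows.\<close>

lemma smoothI:
  assumes "F [] = f" "\<And>js. continuous_on UNIV (F js)"
    and "\<And>js i x. ((\<lambda>t. F js (x + t *\<^sub>R axis i 1)) has_vector_derivative F (i # js) x) (at 0)"
  shows "smooth_fn f" "dpart js f = F js"
proof -
  have *: "dpart js f = F js" for js
  proof (induction js)
    case (Cons i js)
    show ?case using assms(3)[of js _ i] by (auto simp: Cons pd_def vector_derivative_at)
  qed (simp add: assms)
  show "dpart js f = F js" by (rule *)
  show "smooth_fn f" unfolding smooth_fn_def * using assms(2,3) differentiableI_vector by blast
qed

lemma
  assumes "smooth_fn f" "smooth_fn g"
  shows smooth_add: "smooth_fn (\<lambda>x. f x + g x)"
    and dpart_add: "dpart js (\<lambda>x. f x + g x) = (\<lambda>x. dpart js f x + dpart js g x)"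
  by (rule smoothI[where F = "\<lambda>js x. dpart js f x + dpart js g x"];
      auto intro!: continuous_intros smooth_cont assms has_vector_derivative_add smooth_hvd[OF assms(1), simplified] smooth_hvd[OF assms(2), simplified])+

lemma
  assumes "smooth_fn f"
  shows smooth_scale: "smooth_fn (\<lambda>x. c * f x)"
    and dpart_scale: "dpart js (\<lambda>x. c * f x) = (\<lambda>x. c * dpart js f x)"
  by (rule smoothI[where F = "\<lambda>js x. c * dpart js f x"];
      auto intro!: continuous_intros smooth_cont assms smooth_hvd[OF assms(1), simplified]
      has_vector_derivative_mult_right)+

lemma
  assumes "smooth_fn f"
  shows smooth_trans: "smooth_fn (\<lambda>x. f (x + a))"
    and dpart_trans: "dpart js (\<lambda>x. f (x + a)) = (\<lambda>x. dpart js f (x + a))"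
proof -
  have c: "continuous_on UNIV (\<lambda>x. dpart js f (x + a))" for js
    by (rule continuous_on_compose2[OF smooth_cont[OF assms, of UNIV js]]) (auto intro!: continuous_intros)
  have d: "((\<lambda>t. dpart js f (x + t *\<^sub>R axis i 1 + a)) has_vector_derivative dpart (i # js) f (x + a)) (at 0)" for js i x
    using smooth_hvd[OF assms, of js "x + a" i] by (simp add: algebra_simps)
  show "smooth_fn (\<lambda>x. f (x + a))" "dpart js (\<lambda>x. f (x + a)) = (\<lambda>x. dpart js f (x + a))"
    using smoothI[where F = "\<lambda>js x. dpart js f (x + a)" and f = "\<lambda>x. f (x + a)", OF _ c d] by auto
qed

lemma
  assumes "smooth_fn f"
  shows smooth_cnj: "smooth_fn (\<lambda>x. cnj (f x))"
    and dpart_cnj: "dpart js (\<lambda>x. cnj (f x)) = (\<lambda>x. cnj (dpart js f x))"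
  by (rule smoothI[where F = "\<lambda>js x. cnj (dpart js f x)"];
      auto intro!: continuous_intros smooth_cont assms smooth_hvd[OF assms(1), simplified]
      bounded_linear.has_vector_derivative[OF bounded_linear_cnj])+

lemma dpart_append: "dpart js (dpart is f) = dpart (js @ is) f"
  by (induction js) auto

lemma smooth_dpart: "smooth_fn f \<Longrightarrow> smooth_fn (dpart is f)"
  unfolding smooth_fn_def dpart_append by blast

text \<open>The Leibniz rule for ordered lists: each derivative is assigned to the first or to the
  second factor. The 2^l assignments replace binomial coefficients of multiindices.\<close>

fun splits :: "'n list \<Rightarrow> ('n list \<times> 'n list) list" where
  "splits [] = [([], [])]"
| "splits (i # is) = map (\<lambda>p. (i # fst p, snd p)) (splits is) @ map (\<lambda>p. (fst p, i # snd p)) (splits is)"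

lemma length_splits: "length (splits js) = 2 ^ length js"
  by (induction js) auto

lemma splits_length: "p \<in> set (splits js) \<Longrightarrow> length (fst p) + length (snd p) = length js"
  by (induction js arbitrary: p) auto

lemma has_vector_derivative_sum_list:
  assumes "\<And>p. p \<in> set ps \<Longrightarrow> (f p has_vector_derivative f' p) F"
  shows "((\<lambda>t. \<Sum>p\<leftarrow>ps. f p t) has_vector_derivative (\<Sum>p\<leftarrow>ps. f' p)) F"
  using assms by (induction ps) (auto intro!: has_vector_derivative_add)

lemma continuous_on_sum_list:
  fixes f :: "'a \<Rightarrow> 'b::topological_space \<Rightarrow> 'c::real_normed_vector"
  assumes "\<And>p. p \<in> set ps \<Longrightarrow> continuous_on S (f p)"
  shows "continuous_on S (\<lambda>t. \<Sum>p\<leftarrow>ps. f p t)"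
  using assms by (induction ps) (auto intro!: continuous_on_add)

lemma
  assumes "smooth_fn f" "smooth_fn g"
  shows smooth_mult: "smooth_fn (\<lambda>x. f x * g x)"
    and dpart_mult: "dpart js (\<lambda>x. f x * g x) = (\<lambda>x. \<Sum>p\<leftarrow>splits js. dpart (fst p) f x * dpart (snd p) g x)"
proof -
  let ?F = "\<lambda>js x. \<Sum>p\<leftarrow>splits js. dpart (fst p) f x * dpart (snd p) g x"
  have c: "continuous_on UNIV (?F js)" for js
    by (intro continuous_on_sum_list continuous_intros smooth_cont assms)
  have d: "((\<lambda>t. ?F js (x + t *\<^sub>R axis i 1)) has_vector_derivative ?F (i # js) x) (at 0)" for js i x
  proof -
    have "((\<lambda>t. ?F js (x + t *\<^sub>R axis i 1)) has_vector_derivative 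
       (\<Sum>p\<leftarrow>splits js. dpart (fst p) f x * dpart (i # snd p) g x + dpart (i # fst p) f x * dpart (snd p) g x)) (at 0)"
    proof (rule has_vector_derivative_sum_list)
      fix p
      have "((\<lambda>t. dpart (fst p) f (x + t *\<^sub>R axis i 1) * dpart (snd p) g (x + t *\<^sub>R axis i 1)) has_vector_derivative
             (dpart (fst p) f (x + 0 *\<^sub>R axis i 1) * dpart (i # snd p) g x + dpart (i # fst p) f x * dpart (snd p) g (x + 0 *\<^sub>R axis i 1))) (at 0)"
        by (intro has_vector_derivative_mult smooth_hvd assms)
      then show "((\<lambda>t. dpart (fst p) f (x + t *\<^sub>R axis i 1) * dpart (snd p) g (x + t *\<^sub>R axis i 1)) has_vector_derivative
             (dpart (fst p) f x * dpart (i # snd p) g x + dpart (i # fst p) f x * dpart (snd p) g x)) (at 0)"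
        by simp
    qed
    then show ?thesis by (simp add: sum_list_addf comp_def add.commute)
  qed
  show "smooth_fn (\<lambda>x. f x * g x)" "dpart js (\<lambda>x. f x * g x) = (\<lambda>x. \<Sum>p\<leftarrow>splits js. dpart (fst p) f x * dpart (snd p) g x)"
    using smoothI[where F = ?F and f = "\<lambda>x. f x * g x", OF _ c d] by auto
qed

section \<open>Characters and the mean value estimate\<close>

definition chr :: "real^('n::finite) \<Rightarrow> 'n tf" where
  "chr \<xi> x = exp (complex_of_real (2 * pi * (\<xi> \<bullet> x)) * \<i>)"

text \<open>The eigenvalue of \<open>dpart js\<close> on the character \<open>chr \<xi>\<close>,
  that is, the symbol of this differential operator.\<close>

definition chsym :: "real^('n::finite) \<Rightarrow> 'n list \<Rightarrow> complex" where
  "chsym \<xi> js = (\<Prod>i\<leftarrow>js. complex_of_real (2 * pi * \<xi> $ i) * \<i>)"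

lemma chsym_simps [simp]: "chsym \<xi> [] = 1" "chsym \<xi> (i # js) = complex_of_real (2 * pi * \<xi> $ i) * \<i> * chsym \<xi> js"
  by (simp_all add: chsym_def)

lemma chr_add: "chr (\<xi> + \<zeta>) x = chr \<xi> x * chr \<zeta> x"
  by (simp add: chr_def inner_add_left distrib_left distrib_right exp_add)

lemma chr_add_right: "chr \<xi> (x + y) = chr \<xi> x * chr \<xi> y"
  by (simp add: chr_def inner_add_right distrib_left distrib_right exp_add)

lemma chr_minus_right: "chr \<xi> (- x) = chr (- \<xi>) x"
  by (simp add: chr_def)

lemma chr_0 [simp]: "chr 0 x = 1" "chr \<xi> 0 = 1" by (simp_all add: chr_def)

lemma norm_chr [simp]: "cmod (chr \<xi> x) = 1" by (simp add: chr_def)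

lemma smooth_chr: "smooth_fn (chr \<xi>)"
  and dpart_chr: "dpart js (chr \<xi>) = (\<lambda>x. chsym \<xi> js * chr \<xi> x)"
proof -
  have c: "continuous_on UNIV (\<lambda>x. chsym \<xi> js * chr \<xi> x)" for js
    unfolding chr_def by (intro continuous_intros)
  have d: "((\<lambda>t. chsym \<xi> js * chr \<xi> (x + t *\<^sub>R axis i 1)) has_vector_derivative chsym \<xi> (i # js) * chr \<xi> x) (at 0)" for js i x
  proof -
    have "((\<lambda>t. chsym \<xi> js * (chr \<xi> x * exp (of_real t * (complex_of_real (2 * pi * \<xi> $ i) * \<i>)))) has_vector_derivative
       chsym \<xi> js * (chr \<xi> x * (complex_of_real (2 * pi * \<xi> $ i) * \<i>))) (at 0)"
      by (intro has_vector_derivative_mult_right has_vector_derivative_real_field) (auto intro!: derivative_eq_intros)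
    then show ?thesis by (simp add: chr_add_right) (simp add: chr_def inner_axis mult_ac)
  qed
  show "smooth_fn (chr \<xi>)" "dpart js (chr \<xi>) = (\<lambda>x. chsym \<xi> js * chr \<xi> x)"
    using smoothI[where F = "\<lambda>js x. chsym \<xi> js * chr \<xi> x" and f = "chr \<xi>", OF _ c d] by auto
qed

lemma norm_chsym_le: "cmod (chsym \<xi> js) \<le> (2 * pi * norm \<xi>) ^ length js"
proof (induction js)
  case (Cons i js)
  have "cmod (chsym \<xi> (i # js)) = (2 * pi * \<bar>\<xi> $ i\<bar>) * cmod (chsym \<xi> js)"
    by (simp add: norm_mult abs_mult)
  also have "\<dots> \<le> (2 * pi * norm \<xi>) * (2 * pi * norm \<xi>) ^ length js"
    using Cons by (intro mult_mono) (auto simp: component_le_norm_cart)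
  finally show ?case by simp
qed simp

lemma smooth_mvt1:
  fixes f :: "('n::finite) tf"
  assumes "smooth_fn f" 
    and "\<And>t. \<bar>t\<bar> \<le> \<bar>a\<bar> \<Longrightarrow> t * a \<ge> 0 \<Longrightarrow> cmod (dpart (i # js) f (x + t *\<^sub>R axis i 1)) \<le> B"
  shows "cmod (dpart js f (x + a *\<^sub>R axis i 1) - dpart js f x) \<le> B * \<bar>a\<bar>"
proof -
  have "norm (dpart js f (x + a *\<^sub>R axis i 1) - dpart js f (x + 0 *\<^sub>R axis i 1)) \<le> B * norm (a - 0)"
  proof (rule differentiable_bound[of "closed_segment 0 a" "\<lambda>t. dpart js f (x + t *\<^sub>R axis i 1)" "\<lambda>t s. s *\<^sub>R dpart (i # js) f (x + t *\<^sub>R axis i 1)"])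
    fix t assume "t \<in> closed_segment 0 a"
    then have t: "\<bar>t\<bar> \<le> \<bar>a\<bar> \<and> t * a \<ge> 0"
      by (auto simp: closed_segment_eq_real_ivl split: if_splits intro: mult_nonpos_nonpos)
    show "((\<lambda>t. dpart js f (x + t *\<^sub>R axis i 1)) has_derivative (\<lambda>s. s *\<^sub>R dpart (i # js) f (x + t *\<^sub>R axis i 1))) (at t within closed_segment 0 a)"
      using smooth_hvd_at[OF assms(1)] unfolding has_vector_derivative_def .
    show "onorm (\<lambda>s. s *\<^sub>R dpart (i # js) f (x + t *\<^sub>R axis i 1)) \<le> B"
      using assms(2)[of t] t by (intro onorm_le) (simp add: mult.commute[of B] mult_left_mono del: dpart.simps)
  qed auto
  then show ?thesis by simp
qed

text \<open>The coordinates of x are replaced by those of y one at a time, so that axis derivatives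
  suffice. Every intermediate point differs from x in each coordinate by at most as much as y does,
  so it stays in the ball where the bound is assumed.\<close>

lemma smooth_mvt:
  fixes f :: "('n::finite) tf"
  assumes "smooth_fn f" 
    and "\<And>p i. norm (p - x) \<le> norm (y - x) \<Longrightarrow> cmod (dpart (i # js) f p) \<le> B"
  shows "cmod (dpart js f y - dpart js f x) \<le> real CARD('n) * B * norm (y - x)"
proof -
  define mix where "mix = (\<lambda>I::'n set. (\<chi> j. if j \<in> I then y $ j else x $ j) :: real^'n)"
  have B: "B \<ge> 0" using assms(2)[of x] norm_ge_zero order_trans by (metis diff_self norm_zero norm_ge_zero)
  have "cmod (dpart js f (mix I) - dpart js f x) \<le> real (card I) * B * norm (y - x)" if "finite I" for I
    using that
  proof (induction I)
    case empty
    have "mix {} = x" by (simp add: mix_def vec_eq_iff)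
    then show ?case by simp
  next
    case (insert i I)
    have eq: "mix (insert i I) = mix I + (y $ i - x $ i) *\<^sub>R axis i 1"
      using insert by (auto simp: mix_def vec_eq_iff axis_def)
    have "cmod (dpart js f (mix I + (y $ i - x $ i) *\<^sub>R axis i 1) - dpart js f (mix I)) \<le> B * \<bar>y $ i - x $ i\<bar>"
    proof (rule smooth_mvt1[OF assms(1)])
      fix t assume t: "\<bar>t\<bar> \<le> \<bar>y $ i - x $ i\<bar>"
      have "norm (mix I + t *\<^sub>R axis i 1 - x) \<le> norm (y - x)"
        using t insert by (intro norm_le_componentwise_cart) (auto simp: mix_def axis_def)
      then show "cmod (dpart (i # js) f (mix I + t *\<^sub>R axis i 1)) \<le> B" by (rule assms(2))
    qed
    also have "\<dots> \<le> B * norm (y - x)"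
      using component_le_norm_cart[of "y - x" i] B by (intro mult_left_mono) auto
    finally have "cmod (dpart js f (mix (insert i I)) - dpart js f x) \<le> B * norm (y - x) + real (card I) * B * norm (y - x)"
      unfolding eq using insert.IH norm_triangle_ineq[of "dpart js f (mix I + (y $ i - x $ i) *\<^sub>R axis i 1) - dpart js f (mix I)" "dpart js f (mix I) - dpart js f x"] by simp
    then show ?case using insert by (simp add: algebra_simps)
  qed
  from this[of UNIV] show ?thesis by (simp add: mix_def)
qed

section \<open>Operations on the Gelfand--Shilov classes\<close>

text \<open>The weight w is separate from the level h so that functions without decay fit as well:
  characters with w = 1 and differences of characters with w = 1 + |x|.\<close>

definition dbd :: "(nat \<Rightarrow> real) \<Rightarrow> ('n::finite) tf \<Rightarrow> real \<Rightarrow> real \<Rightarrow> (real^'n \<Rightarrow> real) \<Rightarrow> bool" where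
  "dbd M f C h w \<longleftrightarrow> smooth_fn f \<and> (\<forall>js x. cmod (dpart js f x) \<le> C * (M (length js) / h ^ length js) * w x)"

lemma cmod_chr_diff_le: "cmod (chr s x - 1) \<le> 2 * pi * norm s * norm x"
proof -
  have "cmod (exp (\<i> * complex_of_real (2 * pi * (s \<bullet> x))) - 1) \<le> \<bar>2 * pi * (s \<bullet> x)\<bar>"
    using iexp_approx1[of "2 * pi * (s \<bullet> x)" 0] by simp
  also have "\<dots> \<le> 2 * pi * (norm s * norm x)"
    using Cauchy_Schwarz_ineq2[of s x] by (simp add: abs_mult)
  finally show ?thesis by (simp add: chr_def mult_ac)
qed

text \<open>One pair of constants serves (M.2) for both sequences; in the main theorem it is the
  maximum of the individual ones.\<close>

locale gs =
  fixes M A :: "nat \<Rightarrow> real" and c H :: real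
  assumes sM: "std_seq M" and sA: "std_seq A"
    and M2M: "M2_bound M c H" and M2A: "M2_bound A c H"
    and c1: "c \<ge> 1" and H1: "H \<ge> 1"
begin

lemma Mpos [simp]: "M p > 0" "M p \<ge> 0" "M p \<noteq> 0" using std_seq_pos[OF sM, of p] by auto

lemma GSterm_le_iff:
  assumes "h > 0"
  shows "GSterm M A h \<phi> (js, x) \<le> C \<longleftrightarrow> cmod (dpart js \<phi> x) \<le> C * (M (length js) / h ^ length js) * wt A h x"
  using assms by (simp add: GSterm_def wt_def ea_def field_simps)

lemma GSh_iff: assumes "h > 0" shows "\<phi> \<in> GSh M A h \<longleftrightarrow> (\<exists>C. dbd M \<phi> C h (wt A h))"
  unfolding GSh_def bdd_above_def dbd_def by (auto simp: GSterm_le_iff[OF assms])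

lemma GSh_smooth: "\<phi> \<in> GSh M A h \<Longrightarrow> smooth_fn \<phi>" by (simp add: GSh_def)

lemma dbd_GSnorm: assumes "h > 0" "\<phi> \<in> GSh M A h" shows "dbd M \<phi> (GSnorm M A h \<phi>) h (wt A h)"
proof -
  have "GSterm M A h \<phi> ix \<le> GSnorm M A h \<phi>" for ix
    using assms unfolding GSnorm_def GSh_def by (intro cSUP_upper) auto
  then show ?thesis using assms(2) unfolding dbd_def GSterm_le_iff[OF assms(1), symmetric] by (auto simp: GSh_def)
qed

lemma GSnorm_le: assumes "h > 0" "dbd M \<phi> C h (wt A h)" shows "GSnorm M A h \<phi> \<le> C"
  unfolding GSnorm_def using assms by (intro cSUP_least) (auto simp: dbd_def GSterm_le_iff)

lemma GSterm_nonneg: "h > 0 \<Longrightarrow> GSterm M A h \<phi> ix \<ge> 0"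
  by (simp add: GSterm_def)

lemma GSnorm_nonneg: assumes "h > 0" "\<phi> \<in> GSh M A h" shows "GSnorm M A h \<phi> \<ge> 0"
proof -
  have "GSterm M A h \<phi> ([], 0) \<le> GSnorm M A h \<phi>"
    using assms unfolding GSnorm_def GSh_def by (intro cSUP_upper) auto
  then show ?thesis using GSterm_nonneg[OF assms(1)] order_trans by blast
qed

lemma dbdD: "dbd M f C h w \<Longrightarrow> cmod (dpart js f x) \<le> C * (M (length js) / h ^ length js) * w x"
  by (simp add: dbd_def)

lemma dbd_smooth: "dbd M f C h w \<Longrightarrow> smooth_fn f" by (simp add: dbd_def)

lemma dbd_mono:
  assumes "dbd M f C h w" "\<And>x. C * w x \<le> C' * w' x" "0 < h'" "h' \<le> h" "C \<ge> 0" "\<And>x. w x \<ge> 0"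
  shows "dbd M f C' h' w'"
  unfolding dbd_def
proof (intro conjI allI)
  fix js :: "'a list" and x
  have "cmod (dpart js f x) \<le> C * (M (length js) / h ^ length js) * w x" using assms(1) by (rule dbdD)
  also have "\<dots> = (C * w x) * (M (length js) / h ^ length js)" by simp
  also have "\<dots> \<le> (C' * w' x) * (M (length js) / h' ^ length js)"
  proof (rule mult_mono)
    show "0 \<le> C' * w' x" using assms(2)[of x] assms(5,6) by (meson mult_nonneg_nonneg order_trans)
  qed (use assms in \<open>auto intro!: divide_left_mono power_mono\<close>)
  finally show "cmod (dpart js f x) \<le> C' * (M (length js) / h' ^ length js) * w' x" by (simp add: mult_ac)
qed (use assms(1) in \<open>rule dbd_smooth\<close>)

lemma dbd_add:
  assumes "dbd M f C h w" "dbd M g C' h w" shows "dbd M (\<lambda>x. f x + g x) (C + C') h w"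
  unfolding dbd_def
proof (intro conjI allI)
  show "smooth_fn (\<lambda>x. f x + g x)" using assms by (intro smooth_add dbd_smooth)
  fix js :: "'a list" and x
  show "cmod (dpart js (\<lambda>x. f x + g x) x) \<le> (C + C') * (M (length js) / h ^ length js) * w x"
    using norm_triangle_mono[OF dbdD[OF assms(1), of js x] dbdD[OF assms(2), of js x]]
    unfolding dpart_add[OF dbd_smooth[OF assms(1)] dbd_smooth[OF assms(2)]] distrib_right .
qed

lemma dbd_scale:
  assumes "dbd M f C h w" shows "dbd M (\<lambda>x. a * f x) (cmod a * C) h w"
  unfolding dbd_def
proof (intro conjI allI)
  show "smooth_fn (\<lambda>x. a * f x)" using assms by (intro smooth_scale dbd_smooth)
  fix js :: "'a list" and x
  show "cmod (dpart js (\<lambda>x. a * f x) x) \<le> (cmod a * C) * (M (length js) / h ^ length js) * w x"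
    using mult_left_mono[OF dbdD[OF assms(1), of js x], of "cmod a"]
    unfolding dpart_scale[OF dbd_smooth[OF assms(1)]] by (simp add: norm_mult mult_ac)
qed

lemma dbd_cnj:
  assumes "dbd M f C h w" shows "dbd M (\<lambda>x. cnj (f x)) C h w"
  using assms unfolding dbd_def by (simp add: smooth_cnj dpart_cnj)

lemma dbd_trans:
  assumes "dbd M f C h w" shows "dbd M (\<lambda>x. f (x + a)) C h (\<lambda>x. w (x + a))"
  using assms unfolding dbd_def by (simp add: smooth_trans dpart_trans)

text \<open>There are 2^l Leibniz terms of order l, and halving the level from 2h to h supplies
  exactly this factor. The orders of the two factors merge by
  \<open>std_seq_mult_le\<close>.\<close>

lemma dbd_mult:
  assumes f: "dbd M f C (2 * h) w" and g: "dbd M g C' (2 * h) w'" and h: "h > 0"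
    and nn: "C \<ge> 0" "C' \<ge> 0" "\<And>x. w x \<ge> 0" "\<And>x. w' x \<ge> 0"
  shows "dbd M (\<lambda>x. f x * g x) (C * C') h (\<lambda>x. w x * w' x)"
  unfolding dbd_def
proof (intro conjI allI)
  show "smooth_fn (\<lambda>x. f x * g x)" using f g by (intro smooth_mult dbd_smooth)
  fix js :: "'a list" and x
  let ?l = "length js"
  let ?B = "C * C' * (M ?l / (2 * h) ^ ?l) * (w x * w' x)"
  have B: "cmod (dpart (fst p) f x * dpart (snd p) g x) \<le> ?B" if p: "p \<in> set (splits js)" for p
  proof -
    let ?a = "length (fst p)" and ?b = "length (snd p)"
    have "cmod (dpart (fst p) f x * dpart (snd p) g x) \<le> (C * (M ?a / (2 * h) ^ ?a) * w x) * (C' * (M ?b / (2 * h) ^ ?b) * w' x)"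
      unfolding norm_mult using nn h by (intro mult_mono dbdD[OF f] dbdD[OF g]) (auto intro!: mult_nonneg_nonneg)
    also have "\<dots> = C * C' * (M ?a * M ?b / (2 * h) ^ ?l) * (w x * w' x)"
      unfolding splits_length[OF p, symmetric] power_add by simp
    also have "\<dots> \<le> ?B"
      unfolding splits_length[OF p, symmetric] using std_seq_mult_le[OF sM, of ?a ?b] nn h
      by (intro mult_left_mono mult_right_mono divide_right_mono) auto
    finally show ?thesis .
  qed
  have "cmod (dpart js (\<lambda>x. f x * g x) x) = cmod (\<Sum>p\<leftarrow>splits js. dpart (fst p) f x * dpart (snd p) g x)"
    by (simp add: dpart_mult[OF dbd_smooth[OF f] dbd_smooth[OF g]])
  also have "\<dots> \<le> (\<Sum>p\<leftarrow>splits js. ?B)"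
  proof -
    have "cmod (\<Sum>p\<leftarrow>ps. dpart (fst p) f x * dpart (snd p) g x) \<le> (\<Sum>p\<leftarrow>ps. ?B)" if "set ps \<subseteq> set (splits js)" for ps
      using that
    proof (induction ps)
      case (Cons p ps)
      then show ?case using norm_triangle_mono[OF B[of p], of "\<Sum>p\<leftarrow>ps. dpart (fst p) f x * dpart (snd p) g x"] by simp
    qed simp
    then show ?thesis by blast
  qed
  also have "\<dots> = 2 ^ ?l * ?B" by (simp add: sum_list_triv length_splits)
  also have "\<dots> = C * C' * (M ?l / h ^ ?l) * (w x * w' x)" by (simp add: power_mult_distrib)
  finally show "cmod (dpart js (\<lambda>x. f x * g x) x) \<le> C * C' * (M ?l / h ^ ?l) * (w x * w' x)" .
qed

lemma GSh_mono:
  assumes "0 < h" "h \<le> h'" "\<phi> \<in> GSh M A h'"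
  shows "\<phi> \<in> GSh M A h" "GSnorm M A h \<phi> \<le> GSnorm M A h' \<phi>"
proof -
  have "dbd M \<phi> (GSnorm M A h' \<phi>) h (wt A h)"
    using assms by (intro dbd_mono[OF dbd_GSnorm, of h' \<phi>] mult_left_mono wt_antimono sA GSnorm_nonneg) auto
  then show "\<phi> \<in> GSh M A h" "GSnorm M A h \<phi> \<le> GSnorm M A h' \<phi>"
    using assms GSh_iff GSnorm_le by auto
qed

lemma GSh_I: assumes "h > 0" "dbd M \<phi> C h (wt A h)" shows "\<phi> \<in> GSh M A h \<and> GSnorm M A h \<phi> \<le> C"
  using assms GSh_iff GSnorm_le by blast

lemma GSh_add: assumes "h > 0" "\<phi> \<in> GSh M A h" "\<psi> \<in> GSh M A h"
  shows "(\<lambda>x. \<phi> x + \<psi> x) \<in> GSh M A h \<and> GSnorm M A h (\<lambda>x. \<phi> x + \<psi> x) \<le> GSnorm M A h \<phi> + GSnorm M A h \<psi>"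
  using assms by (intro GSh_I dbd_add dbd_GSnorm)

lemma GSh_scale: assumes "h > 0" "\<phi> \<in> GSh M A h"
  shows "(\<lambda>x. a * \<phi> x) \<in> GSh M A h \<and> GSnorm M A h (\<lambda>x. a * \<phi> x) \<le> cmod a * GSnorm M A h \<phi>"
  using assms by (intro GSh_I dbd_scale dbd_GSnorm)

lemma GSh_cnj: assumes "h > 0" "\<phi> \<in> GSh M A h"
  shows "(\<lambda>x. cnj (\<phi> x)) \<in> GSh M A h \<and> GSnorm M A h (\<lambda>x. cnj (\<phi> x)) \<le> GSnorm M A h \<phi>"
  using assms by (intro GSh_I dbd_cnj dbd_GSnorm)

lemma GSh_trans: assumes "h > 0" "\<phi> \<in> GSh M A (2 * h)"
  shows "(\<lambda>x. \<phi> (x + a)) \<in> GSh M A h \<and> GSnorm M A h (\<lambda>x. \<phi> (x + a)) \<le> ea A (2 * h * norm a) * GSnorm M A (2 * h) \<phi>"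
proof (intro GSh_I)
  show "dbd M (\<lambda>x. \<phi> (x + a)) (ea A (2 * h * norm a) * GSnorm M A (2 * h) \<phi>) h (wt A h)"
  proof (rule dbd_mono[OF dbd_trans[OF dbd_GSnorm, of "2 * h" \<phi>]])
    fix x
    have "wt A (2 * h) (x + a) \<le> ea A (2 * h * norm a) * wt A h x"
      using assms by (intro wt_shift sA) auto
    then show "GSnorm M A (2 * h) \<phi> * wt A (2 * h) (x + a) \<le> ea A (2 * h * norm a) * GSnorm M A (2 * h) \<phi> * wt A h x"
      using assms GSnorm_nonneg[of "2 * h" \<phi>] by (metis mult.assoc mult.commute mult_left_mono mult_pos_pos zero_less_numeral)
  qed (use assms GSnorm_nonneg[of "2 * h" \<phi>] in auto)
qed (use assms in auto)

text \<open>Decay in the translation x: by \<open>wt_sq\<close> the kernel of \<psi> contains two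
  factors at level 2h. One is kept for the decay in y, the other combines with the kernel at y - x
  into \<open>wt A h x\<close>, since y and y - x cannot both be small when x is large.\<close>

lemma GSh_mult_trans:
  assumes h: "h > 0" and \<psi>: "\<psi> \<in> GSh M A (2 * H * h)" and \<kappa>: "\<kappa> \<in> GSh M A (2 * H * h)"
  shows "(\<lambda>y. \<psi> y * \<kappa> (y - x)) \<in> GSh M A h \<and>
    GSnorm M A h (\<lambda>y. \<psi> y * \<kappa> (y - x)) \<le> c * GSnorm M A (2 * H * h) \<psi> * GSnorm M A (2 * H * h) \<kappa> * wt A h x"
proof (intro GSh_I)
  let ?k = "2 * H * h"
  let ?a = "GSnorm M A ?k \<psi>" and ?b = "GSnorm M A ?k \<kappa>"
  have k: "?k > 0" "2 * h \<le> ?k" using h H1 by auto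
  have nn: "?a \<ge> 0" "?b \<ge> 0" using GSnorm_nonneg[OF k(1)] \<psi> \<kappa> by auto
  have d1: "dbd M \<psi> ?a (2 * h) (wt A ?k)"
    by (rule dbd_mono[OF dbd_GSnorm[OF k(1) \<psi>]]) (use h k nn in auto)
  have d2: "dbd M (\<lambda>y. \<kappa> (y - x)) ?b (2 * h) (\<lambda>y. wt A ?k (y - x))"
    by (rule dbd_mono[OF dbd_trans[OF dbd_GSnorm[OF k(1) \<kappa>], of "- x", simplified]]) (use h k nn in auto)
  show "dbd M (\<lambda>y. \<psi> y * \<kappa> (y - x)) (c * ?a * ?b * wt A h x) h (wt A h)"
  proof (rule dbd_mono[OF dbd_mult[OF d1 d2 h]])
    fix y
    have "wt A ?k y * wt A ?k (y - x) \<le> (c * (wt A (2 * h) y)\<^sup>2) * wt A (2 * h) (x - y)"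
      using wt_sq[OF sA M2A H1 c1, of "2 * h" y] h k c1
      by (intro mult_mono) (auto simp: mult_ac wt_minus_commute[of _ _ x y] intro!: wt_antimono sA)
    also have "\<dots> = c * wt A (2 * h) y * (wt A (2 * h) y * wt A (2 * h) (x - y))" by (simp add: power2_eq_square)
    also have "\<dots> \<le> c * wt A h y * wt A h x"
      using wt_prod[OF sA, of h y "x - y"] c1 h by (intro mult_mono) (auto intro!: wt_antimono sA mult_mono)
    finally have "?a * ?b * (wt A ?k y * wt A ?k (y - x)) \<le> ?a * ?b * (c * wt A h y * wt A h x)"
      using nn by (intro mult_left_mono) auto
    then show "?a * ?b * (wt A ?k y * wt A ?k (y - x)) \<le> c * ?a * ?b * wt A h x * wt A h y" by (simp add: mult_ac)
  qed (use nn h in auto)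
qed (use h in auto)

lemma dbd_chr: assumes "h > 0" shows "dbd M (chr \<xi>) (ea M (2 * pi * h * norm \<xi>)) h (\<lambda>_. 1)"
  unfolding dbd_def
proof (intro conjI allI)
  fix js :: "'a list" and x
  have "cmod (dpart js (chr \<xi>) x) \<le> (2 * pi * norm \<xi>) ^ length js"
    by (simp add: dpart_chr norm_mult norm_chsym_le)
  also have "\<dots> = (2 * pi * h * norm \<xi>) ^ length js / M (length js) * (M (length js) / h ^ length js)"
    using assms by (simp add: power_mult_distrib)
  also have "\<dots> \<le> ea M (2 * pi * h * norm \<xi>) * (M (length js) / h ^ length js)"
    using assms by (intro mult_right_mono ea_ge sM) auto
  finally show "cmod (dpart js (chr \<xi>) x) \<le> ea M (2 * pi * h * norm \<xi>) * (M (length js) / h ^ length js) * 1" by simp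
qed (rule smooth_chr)

lemma GSh_chr:
  assumes h: "h > 0" and \<phi>: "\<phi> \<in> GSh M A (2 * h)"
  shows "(\<lambda>x. chr \<xi> x * \<phi> x) \<in> GSh M A h \<and>
    GSnorm M A h (\<lambda>x. chr \<xi> x * \<phi> x) \<le> ea M (4 * pi * h * norm \<xi>) * GSnorm M A (2 * h) \<phi>"
proof (intro GSh_I)
  have h2: "2 * h > 0" using h by simp
  have nn: "GSnorm M A (2 * h) \<phi> \<ge> 0" using GSnorm_nonneg[OF h2 \<phi>] .
  have eq: "2 * pi * (2 * h) * norm \<xi> = 4 * pi * h * norm \<xi>" by simp
  show "dbd M (\<lambda>x. chr \<xi> x * \<phi> x) (ea M (4 * pi * h * norm \<xi>) * GSnorm M A (2 * h) \<phi>) h (wt A h)"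
    by (rule dbd_mono[OF dbd_mult[OF dbd_chr[OF h2, unfolded eq] dbd_GSnorm[OF h2 \<phi>] h]])
      (use h nn in \<open>auto simp: mult.assoc intro!: mult_left_mono wt_antimono sA\<close>)
qed (use h in auto)

text \<open>The value is of size |s| |x|, while derivatives of order l are of size |s|^l \<le> |s|.
  The growing weight 1 + |x| is later paid for by \<open>norm_wt_le\<close>.\<close>

lemma dbd_chr_diff:
  assumes h: "h > 0" and s: "norm s \<le> 1"
  shows "dbd M (\<lambda>x. chr s x - 1) (2 * pi * ea M (2 * pi * h) * norm s) h (\<lambda>x. 1 + norm x)"
proof -
  \<comment> \<open>The constant 1 is written as the character at 0, so that the formulas for
    characters apply; \<open>chsym 0\<close> vanishes on nonempty lists.\<close>
  have sm: "smooth_fn (\<lambda>x. chr s x + (- 1) * chr 0 x)" by (intro smooth_add smooth_scale smooth_chr)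
  have dp: "dpart js (\<lambda>x. chr s x + (- 1) * chr 0 x) x = chsym s js * chr s x - chsym 0 js" for js x
    unfolding dpart_add[OF smooth_chr smooth_scale[OF smooth_chr]] dpart_scale[OF smooth_chr] dpart_chr by simp
  have z: "chsym (0::real^'a) (i # js) = 0" for i js by simp
  let ?K = "2 * pi * ea M (2 * pi * h) * norm s"
  have K: "2 * pi * norm s \<le> ?K" using ea_ge1[OF sM, of "2 * pi * h"] by (simp add: mult_left_mono mult_right_mono)
  have "cmod (dpart js (\<lambda>x. chr s x + (- 1) * chr 0 x) x) \<le> ?K * (M (length js) / h ^ length js) * (1 + norm x)" for js x
  proof (cases js)
    case Nil
    have "cmod (chr s x - 1) \<le> (2 * pi * norm s) * norm x" by (rule cmod_chr_diff_le)
    also have "\<dots> \<le> ?K * (1 + norm x)" using K by (rule mult_mono) auto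
    finally show ?thesis using Nil sM by (simp add: std_seq_0)
  next
    case (Cons i js')
    let ?l = "length js"
    have "cmod (dpart js (\<lambda>x. chr s x + (- 1) * chr 0 x) x) \<le> (2 * pi * norm s) ^ ?l"
      unfolding dp using norm_chsym_le[of s js] by (simp add: Cons norm_mult)
    also have "\<dots> = (2 * pi) ^ ?l * norm s ^ ?l" by (simp add: power_mult_distrib)
    also have "norm s ^ ?l \<le> norm s" using s Cons by (simp add: mult_left_le power_le_one)
    also have "(2 * pi) ^ ?l * norm s = ((2 * pi * h) ^ ?l / M ?l) * (M ?l / h ^ ?l) * norm s"
      using h by (simp add: power_mult_distrib)
    also have "\<dots> \<le> ea M (2 * pi * h) * (M ?l / h ^ ?l) * norm s"
      using h by (intro mult_right_mono ea_ge sM) auto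
    also have "\<dots> \<le> (2 * pi) * (ea M (2 * pi * h) * (M ?l / h ^ ?l) * norm s) * (1 + norm x)"
    proof -
      have "1 * 1 \<le> (2 * pi) * (1 + norm x)" using pi_gt3 by (intro mult_mono) auto
      moreover have "0 \<le> ea M (2 * pi * h) * (M ?l / h ^ ?l) * norm s" using h by simp
      ultimately show ?thesis using mult_right_mono[of "1 * 1" "(2 * pi) * (1 + norm x)" "ea M (2 * pi * h) * (M ?l / h ^ ?l) * norm s"]
        by (simp only: mult_1 mult_ac)
    qed
    finally show ?thesis by (simp add: mult_ac)
  qed
  then show ?thesis unfolding dbd_def using sm by simp
qed

lemma GSh_chr_diff:
  assumes h: "h > 0" and s: "norm s \<le> 1" and \<phi>: "\<phi> \<in> GSh M A (2 * H * h)"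
  shows "(\<lambda>x. (chr s x - 1) * \<phi> x) \<in> GSh M A h \<and>
    GSnorm M A h (\<lambda>x. (chr s x - 1) * \<phi> x) \<le> (2 * pi * ea M (4 * pi * h) * (1 + c / h)) * GSnorm M A (2 * H * h) \<phi> * norm s"
proof (intro GSh_I)
  let ?k = "2 * H * h"
  have k: "?k > 0" "2 * h \<le> ?k" "h \<le> H * h" "H * h \<le> ?k" using h H1 by auto
  have nn: "GSnorm M A ?k \<phi> \<ge> 0" using GSnorm_nonneg[OF k(1) \<phi>] .
  have d1: "dbd M \<phi> (GSnorm M A ?k \<phi>) (2 * h) (wt A ?k)"
    by (rule dbd_mono[OF dbd_GSnorm[OF k(1) \<phi>]]) (use h k nn in auto)
  have h2: "2 * h > 0" using h by simp
  let ?E = "2 * pi * ea M (2 * pi * (2 * h)) * norm s"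
  show "dbd M (\<lambda>x. (chr s x - 1) * \<phi> x) (2 * pi * ea M (4 * pi * h) * (1 + c / h) * GSnorm M A ?k \<phi> * norm s) h (wt A h)"
  proof (rule dbd_mono[OF dbd_mult[OF dbd_chr_diff[OF h2 s] d1 h]])
    fix x
    have "(1 + norm x) * wt A ?k x = wt A ?k x + norm x * wt A ?k x" by (simp add: distrib_right)
    also have "\<dots> \<le> wt A h x + norm x * wt A (H * h) x"
      using h k by (intro add_mono mult_left_mono wt_antimono sA) auto
    also have "\<dots> \<le> wt A h x + c / h * wt A h x" using norm_wt_le[OF sA M2A H1 c1 h, of x] by simp
    finally have "(1 + norm x) * wt A ?k x \<le> (1 + c / h) * wt A h x" by (simp add: distrib_right)
    then have "(?E * GSnorm M A ?k \<phi>) * ((1 + norm x) * wt A ?k x) \<le> (?E * GSnorm M A ?k \<phi>) * ((1 + c / h) * wt A h x)"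
      using nn by (intro mult_left_mono) auto
    then show "?E * GSnorm M A ?k \<phi> * ((1 + norm x) * wt A ?k x) \<le> 2 * pi * ea M (4 * pi * h) * (1 + c / h) * GSnorm M A ?k \<phi> * norm s * wt A h x"
      by (simp add: mult_ac)
  qed (use nn h in auto)
qed (use h in auto)

lemma M_Suc_le: "M (Suc l) \<le> c * H ^ Suc l * M l"
  using M2M[unfolded M2_bound_def, rule_format, of l 1] sM by (simp add: std_seq_1)

text \<open>By (M.2) with q = 1, one further derivative costs the factor H in the level and c / h in
  the constant. The first form differentiates \<open>dpart js \<phi>\<close>, the second is
  \<open>dpart js\<close> of a partial derivative of \<phi>.\<close>

lemma dbd_dpart1:
  assumes "dbd M \<phi> C (H * h) w" "h > 0" "C \<ge> 0" "\<And>x. w x \<ge> 0"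
  shows "cmod (dpart (i # js) \<phi> x) \<le> C * (c / h) * (M (length js) / h ^ length js) * w x"
    and "cmod (dpart (js @ [i]) \<phi> x) \<le> C * (c / h) * (M (length js) / h ^ length js) * w x"
proof -
  let ?l = "length js"
  have "M (Suc ?l) / (H * h) ^ Suc ?l \<le> c * H ^ Suc ?l * M ?l / (H * h) ^ Suc ?l"
    using assms H1 by (intro divide_right_mono M_Suc_le) auto
  also have "\<dots> = c / h * (M ?l / h ^ ?l)" using H1 by (simp add: power_mult_distrib)
  finally have "C * (M (Suc ?l) / (H * h) ^ Suc ?l) * w x \<le> C * (c / h * (M ?l / h ^ ?l)) * w x"
    using assms by (intro mult_right_mono mult_left_mono) auto
  then have *: "C * (M (Suc ?l) / (H * h) ^ Suc ?l) * w x \<le> C * (c / h) * (M ?l / h ^ ?l) * w x" by (simp only: mult.assoc)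
  show "cmod (dpart (i # js) \<phi> x) \<le> C * (c / h) * (M ?l / h ^ ?l) * w x"
    using dbdD[OF assms(1), of "i # js" x] * by (simp del: dpart.simps)
  show "cmod (dpart (js @ [i]) \<phi> x) \<le> C * (c / h) * (M ?l / h ^ ?l) * w x"
    using dbdD[OF assms(1), of "js @ [i]" x] * by (simp del: dpart.simps)
qed

lemma GSh_pd:
  assumes "h > 0" "\<phi> \<in> GSh M A h" shows "pd i \<phi> \<in> GSh M A (h / H)"
proof -
  let ?h = "h / H"
  have h: "?h > 0" "H * ?h = h" "?h \<le> h" using assms H1 by (auto simp: field_simps)
  have d: "dbd M \<phi> (GSnorm M A h \<phi>) (H * ?h) (wt A h)" using dbd_GSnorm[OF assms] unfolding h(2) .
  have nn: "GSnorm M A h \<phi> \<ge> 0" using GSnorm_nonneg assms by auto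
  have "cmod (dpart js (pd i \<phi>) x) \<le> (GSnorm M A h \<phi> * (c / ?h)) * (M (length js) / ?h ^ length js) * wt A ?h x" for js x
  proof -
    have "cmod (dpart (js @ [i]) \<phi> x) \<le> (GSnorm M A h \<phi> * (c / ?h)) * (M (length js) / ?h ^ length js) * wt A h x"
      by (rule dbd_dpart1(2)[OF d h(1) nn]) auto
    also have "\<dots> \<le> (GSnorm M A h \<phi> * (c / ?h)) * (M (length js) / ?h ^ length js) * wt A ?h x"
      using h nn c1 assms H1 by (intro mult_left_mono wt_antimono sA mult_nonneg_nonneg) auto
    finally show ?thesis by (simp add: dpart_append[symmetric])
  qed
  moreover have "smooth_fn (pd i \<phi>)" using smooth_dpart[OF GSh_smooth[OF assms(2)], of "[i]"] by simp
  ultimately show ?thesis using h GSh_iff[OF h(1), of "pd i \<phi>"] unfolding dbd_def by blast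
qed

lemma GSh_dpart: 
  assumes "h > 0" "\<phi> \<in> GSh M A h" shows "\<exists>h'>0. dpart js \<phi> \<in> GSh M A h'"
proof (induction js)
  case (Cons i js)
  then obtain h' where "h' > 0" "dpart js \<phi> \<in> GSh M A h'" by blast
  then have "pd i (dpart js \<phi>) \<in> GSh M A (h' / H)" "h' / H > 0" using GSh_pd H1 by auto
  then show ?case by auto
qed (use assms in auto)

text \<open>The mean value estimate reaches points within distance 1 of x. There
  \<open>wt_shift\<close> compares the kernel with its value at x, at the price of
  e^{A(2h)}.\<close>

lemma GSh_trans_diff:
  fixes \<phi> :: "('n::finite) tf"
  assumes h: "h > 0" and s: "norm s \<le> 1" and \<phi>: "\<phi> \<in> GSh M A (2 * H * h)"
  shows "(\<lambda>x. \<phi> x - \<phi> (x - s)) \<in> GSh M A h \<and>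
    GSnorm M A h (\<lambda>x. \<phi> x - \<phi> (x - s)) \<le> (real CARD('n) * (c / (2 * h)) * ea A (2 * h)) * GSnorm M A (2 * H * h) \<phi> * norm s"
proof (intro GSh_I)
  let ?k = "2 * H * h"
  let ?G = "GSnorm M A ?k \<phi>"
  have k: "?k > 0" "2 * h \<le> ?k" using h H1 by auto
  have nn: "?G \<ge> 0" using GSnorm_nonneg[OF k(1) \<phi>] .
  have d1: "dbd M \<phi> ?G (H * (2 * h)) (wt A (2 * h))"
    by (rule dbd_mono[OF dbd_GSnorm[OF k(1) \<phi>]]) (use h k nn in \<open>auto intro!: mult_left_mono wt_antimono sA\<close>)
  have sm: "smooth_fn \<phi>" using \<phi> GSh_smooth by blast
  have sm2: "smooth_fn (\<lambda>x. \<phi> (x - s))" using smooth_trans[OF sm, of "- s"] by simp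
  have dp: "dpart js (\<lambda>x. \<phi> x + (- 1) * \<phi> (x - s)) x = dpart js \<phi> x - dpart js \<phi> (x - s)" for js x
    using dpart_trans[OF sm, of js "- s"]
    unfolding dpart_add[OF sm smooth_scale[OF sm2]] dpart_scale[OF sm2] by simp
  have sm3: "smooth_fn (\<lambda>x. \<phi> x + (- 1) * \<phi> (x - s))" by (intro smooth_add smooth_scale sm sm2)
  have "cmod (dpart js \<phi> x - dpart js \<phi> (x - s)) \<le> 
     (real CARD('n) * (c / (2 * h)) * ea A (2 * h)) * ?G * norm s * (M (length js) / h ^ length js) * wt A h x" for js x
  proof -
    let ?B = "?G * (c / (2 * h)) * (M (length js) / h ^ length js) * (ea A (2 * h) * wt A h x)"
    have "cmod (dpart js \<phi> (x - s) - dpart js \<phi> x) \<le> real CARD('n) * ?B * norm (x - s - x)"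
    proof (rule smooth_mvt[OF sm])
      fix p i assume p: "norm (p - x) \<le> norm (x - s - x)"
      have "cmod (dpart (i # js) \<phi> p) \<le> ?G * (c / (2 * h)) * (M (length js) / (2 * h) ^ length js) * wt A (2 * h) p"
        using h by (intro dbd_dpart1(1)[OF d1] nn) auto
      also have "\<dots> \<le> ?B"
      proof (intro mult_mono)
        have "wt A (2 * h) (x + (p - x)) \<le> ea A (2 * h * norm (p - x)) * wt A h x"
          using h by (intro wt_shift sA) auto
        also have "\<dots> \<le> ea A (2 * h) * wt A h x"
          using p s h by (intro mult_right_mono ea_mono sA) (auto simp: mult_left_le)
        finally show "wt A (2 * h) p \<le> ea A (2 * h) * wt A h x" by simp
      qed (use nn h c1 in \<open>auto intro!: divide_left_mono power_mono\<close>)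
      finally show "cmod (dpart (i # js) \<phi> p) \<le> ?B" .
    qed
    then show ?thesis by (simp add: norm_minus_commute mult_ac)
  qed
  then show "dbd M (\<lambda>x. \<phi> x - \<phi> (x - s)) ((real CARD('n) * (c / (2 * h)) * ea A (2 * h)) * ?G * norm s) h (wt A h)"
    using sm3 unfolding dbd_def dp[symmetric] by simp
qed (use h in auto)

end

section \<open>Quadrature and Fourier inversion\<close>

definition cellpt :: "real \<Rightarrow> int^'n \<Rightarrow> real^('n::finite)" where
  "cellpt \<delta> v = (\<chi> i. \<delta> * of_int (v $ i))"

definition cellof :: "real \<Rightarrow> real^('n::finite) \<Rightarrow> int^'n" where
  "cellof \<delta> x = (\<chi> i. \<lfloor>x $ i / \<delta>\<rfloor>)"

lemma cellof_dist:
  fixes x :: "real^('n::finite)"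
  assumes "\<delta> > 0" shows "norm (x - cellpt \<delta> (cellof \<delta> x)) \<le> real CARD('n) * \<delta>"
proof -
  have "norm (x - cellpt \<delta> (cellof \<delta> x)) \<le> (\<Sum>i\<in>UNIV. \<bar>(x - cellpt \<delta> (cellof \<delta> x)) $ i\<bar>)"
    by (rule norm_le_l1_cart)
  also have "\<dots> \<le> (\<Sum>i\<in>(UNIV::'n set). \<delta>)"
  proof (rule sum_mono)
    fix i
    have "of_int \<lfloor>x $ i / \<delta>\<rfloor> \<le> x $ i / \<delta>" "x $ i / \<delta> \<le> of_int \<lfloor>x $ i / \<delta>\<rfloor> + 1" by linarith+
    then have "of_int \<lfloor>x $ i / \<delta>\<rfloor> * \<delta> \<le> x $ i" "x $ i \<le> (of_int \<lfloor>x $ i / \<delta>\<rfloor> + 1) * \<delta>"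
      using assms by (simp_all only: pos_le_divide_eq pos_divide_le_eq)
    then show "\<bar>(x - cellpt \<delta> (cellof \<delta> x)) $ i\<bar> \<le> \<delta>"
      by (simp add: cellpt_def cellof_def abs_le_iff algebra_simps)
  qed
  finally show ?thesis by simp
qed

lemma cellof_sets [measurable]: "{x::real^'n::finite. cellof \<delta> x = v} \<in> sets borel"
proof -
  have "{x::real^'n. cellof \<delta> x = v} = (\<Inter>i\<in>UNIV. {x. \<lfloor>x $ i / \<delta>\<rfloor> = v $ i})"
    by (auto simp: cellof_def vec_eq_iff)
  also have "\<dots> \<in> sets borel"
  proof (rule sets.finite_INT)
    fix i show "{x::real^'n. \<lfloor>x $ i / \<delta>\<rfloor> = v $ i} \<in> sets borel"
      by measurable
  qed auto
  finally show ?thesis .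
qed

lemma loclip_continuous:
  fixes G :: "'a::real_normed_vector \<Rightarrow> 'b::real_normed_vector"
  assumes "\<And>x y. norm (x - y) \<le> 1 \<Longrightarrow> norm (G x - G y) \<le> K x * norm (x - y)"
  shows "continuous_on UNIV G"
  unfolding continuous_on_eq_continuous_at[OF open_UNIV] 
proof
  fix x
  have "((\<lambda>y. G x - G y) \<longlongrightarrow> 0) (at x)"
  proof (rule Lim_null_comparison)
    show "\<forall>\<^sub>F y in at x. norm (G x - G y) \<le> K x * norm (x - y)"
      using assms[of x] by (auto simp: eventually_at dist_norm norm_minus_commute[of x] norm_minus_commute[of "G x"] intro!: exI[of _ 1])
    show "((\<lambda>y. K x * norm (x - y)) \<longlongrightarrow> 0) (at x)"
      by (rule tendsto_eq_intros | simp)+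
  qed
  then have "((\<lambda>y. G x - (G x - G y)) \<longlongrightarrow> G x - 0) (at x)" by (intro tendsto_intros)
  then show "isCont G x" by (simp add: isCont_def)
qed

text \<open>The nodes and weights are fixed before the integrand: they work for every G whose size
  and local Lipschitz constant are dominated by L K. This uniformity later controls all derivatives
  at all points by one Riemann sum.\<close>

definition riemann_approx ::
  "(real^('n::finite) \<Rightarrow> real) \<Rightarrow> real \<Rightarrow> nat \<Rightarrow> (nat \<Rightarrow> real^'n) \<Rightarrow> (nat \<Rightarrow> real) \<Rightarrow> bool" where
  "riemann_approx K e N pt cw \<longleftrightarrow> (\<forall>(G::real^'n \<Rightarrow> complex) L. L \<ge> 0 \<longrightarrow> (\<forall>x. cmod (G x) \<le> L * K x) \<longrightarrow>
     (\<forall>x y. norm (x - y) \<le> 1 \<longrightarrow> cmod (G x - G y) \<le> L * K x * norm (x - y)) \<longrightarrow>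
     integrable lborel G \<and> cmod ((\<Sum>j<N. complex_of_real (cw j) * G (pt j)) - (LINT x|lborel. G x)) \<le> L * e)"

lemma riemann_approxD:
  fixes G :: "real^('n::finite) \<Rightarrow> complex"
  assumes "riemann_approx K e N pt cw" "L \<ge> 0" "\<And>x. cmod (G x) \<le> L * K x"
    "\<And>x y. norm (x - y) \<le> 1 \<Longrightarrow> cmod (G x - G y) \<le> L * K x * norm (x - y)"
  shows "integrable lborel G \<and> cmod ((\<Sum>j<N. complex_of_real (cw j) * G (pt j)) - (LINT x|lborel. G x)) \<le> L * e"
  using assms unfolding riemann_approx_def by blast

text \<open>On finitely many cells the Lipschitz bound gives an error proportional to the cell size
  times the integral of K; on the discarded cells the error is at most a tail of that
  integral.\<close>

lemma quadrature:
  fixes K :: "real^('n::finite) \<Rightarrow> real"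
  assumes K: "integrable lborel K" "\<And>x. K x \<ge> 0" and e: "e > 0"
  obtains N :: nat and pt :: "nat \<Rightarrow> real^'n" and cw :: "nat \<Rightarrow> real" where "\<And>j. cw j \<ge> 0"
    "riemann_approx K e N pt cw"
proof -
  define I where "I = (LINT x|lborel. K x)"
  define n where "n = real CARD('n)"
  have I: "I \<ge> 0" unfolding I_def using K by simp
  have n: "n \<ge> 1" by (simp add: n_def)
  \<comment> \<open>The first bound keeps a cell within the distance 1 on which the Lipschitz
    estimate holds; the second makes the error on the cells at most e / 2. I + 1 stands for I to
    avoid a division by zero.\<close>
  define \<delta> where "\<delta> = min (1 / n) (e / (2 * n * (I + 1)))"
  have \<delta>: "\<delta> > 0" "n * \<delta> \<le> 1" proof -
    show "\<delta> > 0" using n I e by (simp add: \<delta>_def)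
    have "n * \<delta> \<le> n * (1 / n)" using n by (intro mult_left_mono) (auto simp: \<delta>_def)
    then show "n * \<delta> \<le> 1" using n by simp
  qed
  have \<delta>2: "n * \<delta> * I \<le> e / 2"
  proof -
    have "\<delta> \<le> e / (2 * n * (I + 1))" by (simp add: \<delta>_def)
    then have "n * \<delta> * I \<le> n * (e / (2 * n * (I + 1))) * I" using n I by (intro mult_right_mono mult_left_mono) auto
    also have "\<dots> = e / 2 * (I / (I + 1))" using n I by (simp add: divide_simps)
    also have "\<dots> \<le> e / 2 * 1" using I e by (intro mult_left_mono) auto
    finally show ?thesis by simp
  qed
  define idx where "idx = (\<lambda>x::real^'n. to_nat (cellof \<delta> x))"
  define pt where "pt = (\<lambda>j. cellpt \<delta> (from_nat j :: int^'n))"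
  define C where "C = (\<lambda>j. {x. idx x = j})"
  have pt: "norm (x - pt (idx x)) \<le> n * \<delta>" for x
    unfolding pt_def idx_def n_def using cellof_dist[OF \<delta>(1), of x] by simp
  have Cm[measurable]: "C j \<in> sets borel" for j
  proof -
    have "C j = (\<Union>v\<in>{v. to_nat v = j}. {x. cellof \<delta> x = v})" by (auto simp: C_def idx_def)
    also have "\<dots> \<in> sets borel"
      by (rule sets.countable_UN'') auto
    finally show ?thesis .
  qed
  have Cf: "emeasure lborel (C j) < \<infinity>" for j
  proof -
    have "C j \<subseteq> cball (pt j) (n * \<delta>)" using pt by (auto simp: C_def dist_norm norm_minus_commute)
    then have "bounded (C j)" using bounded_cball bounded_subset by blast
    then show ?thesis by (rule emeasure_bounded_finite)
  qed
  \<comment> \<open>The mass of K outside the first N cells, which tends to 0 by dominated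
    convergence.\<close>
  define T where "T = (\<lambda>N x. K x * indicator (\<Union>j\<in>{N..}. C j) x)"
  have Tm: "T N \<in> borel_measurable lborel" for N unfolding T_def using K(1) by measurable
  have Ti: "integrable lborel (T N)" for N
    by (rule Bochner_Integration.integrable_bound[OF K(1) Tm]) (auto simp: T_def indicator_def)
  have "(\<lambda>N. LINT x|lborel. T N x) \<longlonglongrightarrow> (LINT x::real^'n|lborel. (0::real))"
  proof (rule integral_dominated_convergence[where w = K])
    show "AE x in lborel. (\<lambda>N. T N x) \<longlonglongrightarrow> 0"
    proof (rule AE_I2)
      fix x
      have "\<forall>\<^sub>F N in sequentially. T N x = 0"
        using eventually_gt_at_top[of "idx x"] by eventually_elim (auto simp: T_def C_def)
      then show "(\<lambda>N. T N x) \<longlonglongrightarrow> 0" by (rule tendsto_eventually)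
    qed
  qed (use K Tm in \<open>auto simp: T_def indicator_def\<close>)
  then have "\<forall>\<^sub>F N in sequentially. (LINT x|lborel. T N x) < e / 2"
    using e by (intro order_tendstoD(2)) auto
  then obtain N where N: "(LINT x|lborel. T N x) < e / 2" by (auto simp: eventually_sequentially)
  have main: "integrable lborel G \<and> cmod ((\<Sum>j<N. complex_of_real (measure lborel (C j)) * G (pt j)) - (LINT x|lborel. G x)) \<le> L * e"
    if L: "L \<ge> 0" and b: "\<And>x. cmod (G x) \<le> L * K x" 
      and lip: "\<And>x y. norm (x - y) \<le> 1 \<Longrightarrow> cmod (G x - G y) \<le> L * K x * norm (x - y)" for G :: "real^'n \<Rightarrow> complex" and L
  proof -
    have [measurable]: "G \<in> borel_measurable borel"
      using loclip_continuous[of G, OF lip] by (rule borel_measurable_continuous_onI)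
    have Gi: "integrable lborel G"
    proof (rule Bochner_Integration.integrable_bound)
      show "integrable lborel (\<lambda>x. L * K x)" using K by simp
      show "AE x in lborel. norm (G x) \<le> norm (L * K x)" using b L K by (auto simp: abs_of_nonneg)
    qed simp
    define S where "S = (\<lambda>x. \<Sum>j<N. indicator (C j) x *\<^sub>R G (pt j))"
    have Si: "integrable lborel S" unfolding S_def
      by (intro Bochner_Integration.integrable_sum integrable_scaleR_left integrable_real_indicator Cf) simp
    have SI: "(LINT x|lborel. S x) = (\<Sum>j<N. complex_of_real (measure lborel (C j)) * G (pt j))"
      unfolding S_def using Cf
      by (subst Bochner_Integration.integral_sum) (auto simp: scaleR_conv_of_real intro!: integrable_scaleR_left integrable_real_indicator)
    have Sx: "S x = (if idx x < N then G (pt (idx x)) else 0)" for x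
    proof -
      have "S x = (\<Sum>j<N. if j = idx x then G (pt (idx x)) else 0)"
        unfolding S_def by (rule sum.cong) (auto simp: C_def indicator_def)
      then show ?thesis by simp
    qed
    have pw: "cmod (S x - G x) \<le> L * (n * \<delta>) * K x + L * T N x" for x
    proof (cases "idx x < N")
      case True
      have "cmod (G x - G (pt (idx x))) \<le> L * K x * norm (x - pt (idx x))" using pt[of x] \<delta> by (intro lip) simp
      also have "\<dots> \<le> L * K x * (n * \<delta>)" using pt L K by (intro mult_left_mono) auto
      finally have "cmod (S x - G x) \<le> L * (n * \<delta>) * K x" using True by (simp add: Sx norm_minus_commute mult_ac)
      moreover have "L * T N x \<ge> 0" using L K by (simp add: T_def)
      ultimately show ?thesis by linarith
    next
      case False
      have "T N x = K x" using False by (auto simp: T_def C_def indicator_def)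
      moreover have "L * (n * \<delta>) * K x \<ge> 0" using L K n \<delta> by simp
      ultimately show ?thesis using b[of x] False by (simp add: Sx)
    qed
    have "cmod ((LINT x|lborel. S x) - (LINT x|lborel. G x)) = cmod (LINT x|lborel. S x - G x)"
      using Si Gi by simp
    also have "\<dots> \<le> (LINT x|lborel. L * (n * \<delta>) * K x + L * T N x)"
      using Si Gi K Ti by (intro Bochner_Integration.integral_norm_bound_integral pw) auto
    also have "\<dots> = L * (n * \<delta> * I) + L * (LINT x|lborel. T N x)"
      using K Ti by (simp add: I_def)
    also have "\<dots> \<le> L * (e / 2) + L * (e / 2)"
      using \<delta>2 N L by (intro add_mono mult_left_mono) auto
    finally show ?thesis using Gi SI by simp
  qed
  have "riemann_approx K e N pt (\<lambda>j. measure lborel (C j))"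
    unfolding riemann_approx_def using main by blast
  then show ?thesis using that[of "\<lambda>j. measure lborel (C j)" N pt] by simp
qed

lemma lborel_integral_affine:
  fixes f :: "real^('n::finite) \<Rightarrow> complex"
  assumes [measurable]: "f \<in> borel_measurable borel" and c: "c \<noteq> 0"
  shows "(LINT x|lborel. f x) = complex_of_real (\<bar>c\<bar> ^ CARD('n)) * (LINT x|lborel. f (t + c *\<^sub>R x))"
proof -
  have "(LINT x|lborel. f x) = (LINT x|density (distr lborel borel (\<lambda>x. t + c *\<^sub>R x)) (\<lambda>_. \<bar>c\<bar>^DIM(real^'n)). f x)"
    using lborel_affine[OF c, of t] by simp
  also have "\<dots> = (LINT x|distr lborel borel (\<lambda>x. t + c *\<^sub>R x). \<bar>c\<bar>^DIM(real^'n) *\<^sub>R f x)"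
    by (subst integral_density) auto
  also have "\<dots> = (LINT x|lborel. \<bar>c\<bar>^DIM(real^'n) *\<^sub>R f (t + c *\<^sub>R x))"
    by (subst integral_distr) auto
  also have "\<dots> = complex_of_real (\<bar>c\<bar> ^ CARD('n)) * (LINT x|lborel. f (t + c *\<^sub>R x))"
    by (simp add: scaleR_conv_of_real)
  finally show ?thesis .
qed

lemma lborel_integrable_shift:
  fixes f :: "real^('n::finite) \<Rightarrow> 'b::{banach,second_countable_topology}"
  shows "integrable lborel (\<lambda>x. f (t + x)) \<longleftrightarrow> integrable lborel f"
    and "(LINT x|lborel. f (t + x)) = (LINT x|lborel. f x)"
proof -
  have i: "integrable lborel (\<lambda>x. g (t + x))" if "integrable lborel g" for t and g :: "real^'n \<Rightarrow> 'b"
  proof -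
    have "integrable (distr lborel borel ((+) t)) g" using that by (simp add: lborel_distr_plus)
    then show ?thesis using that by (subst (asm) integrable_distr_eq) auto
  qed
  show eq: "integrable lborel (\<lambda>x. f (t + x)) \<longleftrightarrow> integrable lborel f"
    using i[of f t] i[of "\<lambda>x. f (t + x)" "- t"] by auto
  show "(LINT x|lborel. f (t + x)) = (LINT x|lborel. f x)"
  proof (cases "integrable lborel f")
    case True
    then have "(LINT x|distr lborel borel ((+) t). f x) = (LINT x|lborel. f (t + x))"
      by (subst integral_distr) auto
    then show ?thesis by (simp add: lborel_distr_plus)
  qed (use eq in \<open>simp add: not_integrable_integral_eq\<close>)
qed

section \<open>Gaussians and Fourier inversion\<close>

definition gauss :: "real^('n::finite) \<Rightarrow> real" where
  "gauss x = (\<Prod>i\<in>UNIV. std_normal_density (x $ i))"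

lemma std_normal_iexp:
  "integrable lborel (\<lambda>x. std_normal_density x *\<^sub>R exp (\<i> * complex_of_real (t * x)))"
  "(LINT x|lborel. std_normal_density x *\<^sub>R exp (\<i> * complex_of_real (t * x))) = complex_of_real (exp (- t\<^sup>2 / 2))"
proof -
  show "integrable lborel (\<lambda>x. std_normal_density x *\<^sub>R exp (\<i> * complex_of_real (t * x)))"
    by (rule Bochner_Integration.integrable_bound[OF integrable_normal_density[of 1 0]]) auto
  have "char std_normal_distribution t = (LINT x|lborel. std_normal_density x *\<^sub>R exp (\<i> * complex_of_real (t * x)))"
    unfolding char_def by (subst integral_density) auto
  then show "(LINT x|lborel. std_normal_density x *\<^sub>R exp (\<i> * complex_of_real (t * x))) = complex_of_real (exp (- t\<^sup>2 / 2))"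
    by (simp add: char_std_normal_distribution)
qed

lemma gauss_iexp:
  fixes z :: "real^('n::finite)"
  shows "integrable lborel (\<lambda>x::real^'n. complex_of_real (gauss x) * exp (\<i> * complex_of_real (z \<bullet> x)))"
    and "(LINT x|lborel. complex_of_real (gauss (x::real^'n)) * exp (\<i> * complex_of_real (z \<bullet> x))) = complex_of_real (exp (- (norm z)\<^sup>2 / 2))"
proof -
  have eq: "(\<Prod>i\<in>UNIV. std_normal_density (x $ i) *\<^sub>R exp (\<i> * complex_of_real (z $ i * x $ i))) =
     complex_of_real (gauss x) * exp (\<i> * complex_of_real (z \<bullet> x))" for x :: "real^'n"
    by (simp add: gauss_def scaleR_conv_of_real prod.distrib inner_vec_def sum_distrib_left exp_sum)
  note P = integrable_lborel_prod[of "\<lambda>i::'n. \<lambda>x. std_normal_density x *\<^sub>R exp (\<i> * complex_of_real (z $ i * x))", OF std_normal_iexp(1)]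
  show "integrable lborel (\<lambda>x::real^'n. complex_of_real (gauss x) * exp (\<i> * complex_of_real (z \<bullet> x)))"
    using P(1) unfolding eq .
  have "(LINT x|lborel. complex_of_real (gauss (x::real^'n)) * exp (\<i> * complex_of_real (z \<bullet> x))) = (\<Prod>i\<in>UNIV. complex_of_real (exp (- (z $ i)\<^sup>2 / 2)))"
    using P(2) unfolding eq std_normal_iexp(2) .
  also have "\<dots> = complex_of_real (exp (\<Sum>i\<in>UNIV. - (z $ i)\<^sup>2 / 2))"
    by (simp add: exp_sum)
  also have "(\<Sum>i\<in>UNIV. - (z $ i)\<^sup>2 / 2) = - (norm z)\<^sup>2 / 2"
    by (simp add: norm_vec_def L2_set_def sum_nonneg sum_divide_distrib[symmetric] sum_negf)
  finally show "(LINT x|lborel. complex_of_real (gauss (x::real^'n)) * exp (\<i> * complex_of_real (z \<bullet> x))) = complex_of_real (exp (- (norm z)\<^sup>2 / 2))" .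
qed

lemma gauss_nonneg [simp]: "gauss x \<ge> 0" by (simp add: gauss_def prod_nonneg)

lemma gauss_measurable [measurable]: "gauss \<in> borel_measurable borel"
  unfolding gauss_def by measurable

lemma gauss_integrable: "integrable lborel (gauss :: real^('n::finite) \<Rightarrow> real)"
  and gauss_integral: "(LINT x|lborel. gauss (x::real^('n::finite))) = 1"
proof -
  have i: "integrable lborel (\<lambda>x::real^'n. complex_of_real (gauss x))" using gauss_iexp(1)[of 0] by simp
  then show "integrable lborel (gauss :: real^('n::finite) \<Rightarrow> real)" by (simp add: complex_of_real_integrable_eq)
  have "(LINT x|lborel. complex_of_real (gauss (x::real^'n))) = 1" using gauss_iexp(2)[of 0] by simp
  then show "(LINT x|lborel. gauss (x::real^('n::finite))) = 1" by simp
qed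

lemma gauss_exp: "gauss (x::real^('n::finite)) = exp (- (norm x)\<^sup>2 / 2) / sqrt (2 * pi) ^ CARD('n)"
proof -
  have "gauss x = (\<Prod>i\<in>(UNIV::'n set). 1 / sqrt (2 * pi)) * (\<Prod>i\<in>UNIV. exp (- (x $ i)\<^sup>2 / 2))"
    unfolding prod.distrib[symmetric] by (simp add: gauss_def std_normal_density_def)
  also have "(\<Prod>i\<in>UNIV. exp (- (x $ i)\<^sup>2 / 2)) = exp (\<Sum>i\<in>UNIV. - (x $ i)\<^sup>2 / 2)" by (simp add: exp_sum)
  also have "(\<Sum>i\<in>UNIV. - (x $ i)\<^sup>2 / 2) = - (norm x)\<^sup>2 / 2"
    by (simp add: norm_vec_def L2_set_def sum_nonneg sum_divide_distrib[symmetric] sum_negf)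
  finally show ?thesis by (simp add: power_divide)
qed

definition ft :: "('n::finite) tf \<Rightarrow> 'n tf" where
  "ft f \<xi> = (LINT x|lborel. chr (- \<xi>) x * f x)"

lemma chr_measurable [measurable]: "chr \<xi> \<in> borel_measurable borel"
  unfolding chr_def by (intro borel_measurable_continuous_onI continuous_intros)

lemma chr_commute: "chr \<xi> x = chr x \<xi>" by (simp add: chr_def inner_commute)

lemma integrable_chr_mult: "integrable lborel f \<Longrightarrow> integrable lborel (\<lambda>x. chr \<xi> x * f x)"
  by (rule Bochner_Integration.integrable_bound[of lborel f]) (auto simp: norm_mult)

lemma gauss_fourier:
  fixes z :: "real^('n::finite)"
  assumes a: "a > 0"
  shows "(LINT \<xi>|lborel. complex_of_real (exp (- (norm (a *\<^sub>R \<xi>))\<^sup>2 / 2)) * chr \<xi> z) = 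
    complex_of_real ((2 * pi / a) ^ CARD('n) * gauss ((2 * pi / a) *\<^sub>R (z::real^'n)))"
proof -
  let ?n = "CARD('n)"
  let ?r = "sqrt (2 * pi) ^ ?n"
  have r: "?r * ?r = (2 * pi) ^ ?n" unfolding power_mult_distrib[symmetric] by simp
  have r0: "?r > 0" by simp
  define f where "f = (\<lambda>\<xi>::real^'n. complex_of_real (exp (- (norm (a *\<^sub>R \<xi>))\<^sup>2 / 2)) * chr \<xi> z)"
  have fm[measurable]: "f \<in> borel_measurable borel" unfolding f_def chr_commute[of _ z] by measurable
  have fe: "f (0 + (1/a) *\<^sub>R x) = complex_of_real ?r * (complex_of_real (gauss x) * exp (\<i> * complex_of_real (((2 * pi / a) *\<^sub>R z) \<bullet> x)))" for x
  proof -
    have 1: "exp (- (norm (a *\<^sub>R (0 + (1/a) *\<^sub>R x)))\<^sup>2 / 2) = ?r * gauss x" using a r0 by (simp add: gauss_exp)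
    have 2: "chr (0 + (1/a) *\<^sub>R x) z = exp (\<i> * complex_of_real (((2 * pi / a) *\<^sub>R z) \<bullet> x))"
      by (simp add: chr_def inner_commute mult_ac)
    show ?thesis unfolding f_def 1 2 by simp
  qed
  have "(LINT \<xi>|lborel. f \<xi>) = complex_of_real (\<bar>1/a\<bar> ^ ?n) * (LINT \<xi>|lborel. f (0 + (1/a) *\<^sub>R \<xi>))"
    using a by (intro lborel_integral_affine) auto
  also have "\<dots> = complex_of_real ((1/a) ^ ?n * ?r * exp (- (norm ((2 * pi / a) *\<^sub>R z))\<^sup>2 / 2))"
    unfolding fe integral_mult_right_zero gauss_iexp(2) using a by (simp del: exp_of_real of_real_exp)
  also have "exp (- (norm ((2 * pi / a) *\<^sub>R z))\<^sup>2 / 2) = ?r * gauss ((2 * pi / a) *\<^sub>R z)"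
    using r0 by (simp add: gauss_exp)
  also have "(1/a) ^ ?n * ?r * (?r * gauss ((2 * pi / a) *\<^sub>R z)) = (1/a) ^ ?n * (?r * ?r) * gauss ((2 * pi / a) *\<^sub>R z)"
    by (simp only: mult.assoc)
  also have "(1/a) ^ ?n * (?r * ?r) = (2 * pi / a) ^ ?n"
    unfolding r by (simp add: power_divide)
  finally show ?thesis unfolding f_def .
qed

lemma ft_measurable [measurable]:
  assumes [measurable]: "g \<in> borel_measurable borel"
  shows "ft g \<in> borel_measurable borel"
proof -
  have "(\<lambda>p. chr (- fst p) (snd p) * g (snd p)) \<in> borel_measurable (borel \<Otimes>\<^sub>M (borel :: (real^'a) measure))"
    unfolding chr_def by measurable
  then have "(\<lambda>\<xi>. LINT x|lborel. chr (- \<xi>) x * g x) \<in> borel_measurable borel"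
    by (intro lborel.borel_measurable_lebesgue_integral) (simp add: split_beta cong: measurable_cong_sets)
  then show ?thesis unfolding ft_def[abs_def] .
qed

text \<open>Gaussian summation: the inversion integral is damped by \<gamma>, and by Fubini the
  damped integral is an average of g around y against a shrinking Gaussian. Dominated convergence
  removes the damping on one side and uses boundedness and continuity of g on the other.\<close>

theorem fourier_inversion:
  fixes g :: "('n::finite) tf"
  assumes g: "continuous_on UNIV g" "\<And>x. cmod (g x) \<le> B" "integrable lborel g" and fg: "integrable lborel (ft g)"
  shows "g y = (LINT \<xi>|lborel. ft g \<xi> * chr \<xi> y)"
proof -
  have gm[measurable]: "g \<in> borel_measurable borel" using g(1) by (rule borel_measurable_continuous_onI)
  define \<gamma> where "\<gamma> = (\<lambda>m \<xi>::real^'n. exp (- (norm ((1 / real (Suc m)) *\<^sub>R \<xi>))\<^sup>2 / 2))"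
  have \<gamma>m[measurable]: "\<gamma> m \<in> borel_measurable borel" for m unfolding \<gamma>_def by measurable
  have \<gamma>1: "0 \<le> \<gamma> m \<xi>" "\<gamma> m \<xi> \<le> 1" for m \<xi> by (simp_all add: \<gamma>_def)
  have \<gamma>i: "integrable lborel (\<gamma> m)" for m
  proof -
    let ?a = "1 / real (Suc m)"
    have "integrable lborel (\<lambda>\<xi>::real^'n. gauss (0 + ?a *\<^sub>R \<xi>))"
    proof -
      have "integrable (density (distr lborel borel (\<lambda>x::real^'n. 0 + ?a *\<^sub>R x)) (\<lambda>_. \<bar>?a\<bar>^DIM(real^'n))) gauss"
        using gauss_integrable lborel_affine[of ?a "0::real^'n"] by simp
      then have "integrable (distr lborel borel (\<lambda>x::real^'n. 0 + ?a *\<^sub>R x)) (\<lambda>x. \<bar>?a\<bar>^DIM(real^'n) *\<^sub>R gauss x)"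
        by (subst (asm) integrable_density) auto
      then have "integrable (distr lborel borel (\<lambda>x::real^'n. 0 + ?a *\<^sub>R x)) gauss" by simp
      then show ?thesis by (subst (asm) integrable_distr_eq) auto
    qed
    then have "integrable lborel (\<lambda>\<xi>::real^'n. sqrt (2 * pi) ^ CARD('n) * gauss (0 + ?a *\<^sub>R \<xi>))" by simp
    then show ?thesis by (simp add: gauss_exp \<gamma>_def)
  qed
  have lim1: "(\<lambda>m. LINT \<xi>|lborel. complex_of_real (\<gamma> m \<xi>) * (ft g \<xi> * chr \<xi> y)) \<longlonglongrightarrow> (LINT \<xi>|lborel. ft g \<xi> * chr \<xi> y)"
  proof (rule integral_dominated_convergence[where w = "\<lambda>\<xi>. cmod (ft g \<xi>)"])
    show "AE \<xi> in lborel. (\<lambda>m. complex_of_real (\<gamma> m \<xi>) * (ft g \<xi> * chr \<xi> y)) \<longlonglongrightarrow> ft g \<xi> * chr \<xi> y"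
    proof (rule AE_I2)
      fix \<xi>
      have "(\<lambda>m. \<gamma> m \<xi>) \<longlonglongrightarrow> exp (- (norm ((0::real) *\<^sub>R \<xi>))\<^sup>2 / 2)"
        unfolding \<gamma>_def by (intro tendsto_intros lim_const_over_n LIMSEQ_Suc[OF lim_1_over_n]) auto
      then have "(\<lambda>m. complex_of_real (\<gamma> m \<xi>) * (ft g \<xi> * chr \<xi> y)) \<longlonglongrightarrow> complex_of_real 1 * (ft g \<xi> * chr \<xi> y)"
        by (intro tendsto_intros) simp
      then show "(\<lambda>m. complex_of_real (\<gamma> m \<xi>) * (ft g \<xi> * chr \<xi> y)) \<longlonglongrightarrow> ft g \<xi> * chr \<xi> y" by simp
    qed
    show "AE \<xi> in lborel. norm (complex_of_real (\<gamma> m \<xi>) * (ft g \<xi> * chr \<xi> y)) \<le> cmod (ft g \<xi>)" for m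
      using \<gamma>1 by (auto simp: norm_mult mult_left_le_one_le)
  qed (use fg in \<open>auto simp: chr_commute[of _ y]\<close>)
  have eq: "(LINT \<xi>|lborel. complex_of_real (\<gamma> m \<xi>) * (ft g \<xi> * chr \<xi> y)) = 
     (LINT u|lborel. g (y - (1 / (2 * pi * real (Suc m))) *\<^sub>R u) * complex_of_real (gauss u))" for m
  proof -
    let ?a = "1 / real (Suc m)"
    let ?F = "\<lambda>x \<xi>. complex_of_real (\<gamma> m \<xi>) * (chr \<xi> (y - x) * g x)"
    have Fm: "case_prod ?F \<in> borel_measurable (lborel \<Otimes>\<^sub>M lborel)"
      unfolding chr_def split_beta' by measurable
    have int: "integrable (lborel \<Otimes>\<^sub>M lborel) (case_prod ?F)"
    proof (rule lborel_pair.Fubini_integrable[OF Fm])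
      have "(LINT \<xi>|lborel. norm (?F x \<xi>)) = (LINT \<xi>|lborel. \<gamma> m \<xi>) * cmod (g x)" for x
        using \<gamma>1 by (simp add: norm_mult)
      then show "integrable lborel (\<lambda>x. LINT \<xi>|lborel. norm (case_prod ?F (x, \<xi>)))" using g(3) by simp
      show "AE x in lborel. integrable lborel (\<lambda>\<xi>. case_prod ?F (x, \<xi>))"
      proof (rule AE_I2)
        fix x
        have "integrable lborel (\<lambda>\<xi>. complex_of_real (\<gamma> m \<xi>) * g x)" using \<gamma>i by simp
        from integrable_chr_mult[OF this, of "y - x"] show "integrable lborel (\<lambda>\<xi>. case_prod ?F (x, \<xi>))"
          by (simp add: chr_commute[of "y - x"] mult_ac)
      qed
    qed
    have "(LINT \<xi>|lborel. complex_of_real (\<gamma> m \<xi>) * (ft g \<xi> * chr \<xi> y)) = (LINT \<xi>|lborel. LINT x|lborel. ?F x \<xi>)"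
    proof (rule Bochner_Integration.integral_cong[OF refl])
      fix \<xi>
      have "(LINT x|lborel. ?F x \<xi>) = (LINT x|lborel. complex_of_real (\<gamma> m \<xi>) * chr \<xi> y * (chr (- \<xi>) x * g x))"
        by (simp add: chr_add_right[of \<xi> y "- _", simplified] chr_minus_right mult_ac)
      also have "\<dots> = complex_of_real (\<gamma> m \<xi>) * chr \<xi> y * ft g \<xi>"
        unfolding ft_def by simp
      finally show "complex_of_real (\<gamma> m \<xi>) * (ft g \<xi> * chr \<xi> y) = (LINT x|lborel. ?F x \<xi>)" by (simp add: mult_ac)
    qed
    also have "\<dots> = (LINT x|lborel. LINT \<xi>|lborel. ?F x \<xi>)" by (rule lborel_pair.Fubini_integral[OF int])
    also have "\<dots> = (LINT x|lborel. complex_of_real ((2 * pi / ?a) ^ CARD('n) * gauss ((2 * pi / ?a) *\<^sub>R (y - x))) * g x)"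
    proof (rule Bochner_Integration.integral_cong[OF refl])
      fix x
      have "(LINT \<xi>|lborel. ?F x \<xi>) = (LINT \<xi>|lborel. (complex_of_real (\<gamma> m \<xi>) * chr \<xi> (y - x)) * g x)"
        by (simp add: mult_ac)
      also have "\<dots> = (LINT \<xi>|lborel. complex_of_real (\<gamma> m \<xi>) * chr \<xi> (y - x)) * g x" by simp
      also have "(LINT \<xi>|lborel. complex_of_real (\<gamma> m \<xi>) * chr \<xi> (y - x)) = complex_of_real ((2 * pi / ?a) ^ CARD('n) * gauss ((2 * pi / ?a) *\<^sub>R (y - x)))"
        unfolding \<gamma>_def by (rule gauss_fourier) simp
      finally show "(LINT \<xi>|lborel. ?F x \<xi>) = complex_of_real ((2 * pi / ?a) ^ CARD('n) * gauss ((2 * pi / ?a) *\<^sub>R (y - x))) * g x" .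
    qed
    \<comment> \<open>Substituting x = y - (a / (2 pi)) u with a = 1 / (m + 1) turns the rescaled
      kernel into \<open>gauss u\<close>; the Jacobian cancels its normalisation.\<close>
    also have "\<dots> = complex_of_real (\<bar>- (?a / (2 * pi))\<bar> ^ CARD('n)) * (LINT u|lborel. 
        complex_of_real ((2 * pi / ?a) ^ CARD('n) * gauss ((2 * pi / ?a) *\<^sub>R (y - (y + (- (?a / (2 * pi))) *\<^sub>R u)))) * g (y + (- (?a / (2 * pi))) *\<^sub>R u))"
      by (rule lborel_integral_affine) auto
    also have "\<dots> = complex_of_real (\<bar>- (?a / (2 * pi))\<bar> ^ CARD('n)) * (LINT u|lborel. 
        complex_of_real ((2 * pi / ?a) ^ CARD('n)) * (g (y - (1 / (2 * pi * real (Suc m))) *\<^sub>R u) * complex_of_real (gauss u)))"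
      by (simp add: mult_ac)
    also have "\<dots> = complex_of_real (\<bar>- (?a / (2 * pi))\<bar> ^ CARD('n) * (2 * pi / ?a) ^ CARD('n)) * (LINT u|lborel. 
        (g (y - (1 / (2 * pi * real (Suc m))) *\<^sub>R u) * complex_of_real (gauss u)))"
      by simp
    also have "\<bar>- (?a / (2 * pi))\<bar> ^ CARD('n) * (2 * pi / ?a) ^ CARD('n) = 1"
      unfolding power_mult_distrib[symmetric] by simp
    finally show ?thesis by simp
  qed
  have lim2: "(\<lambda>m. LINT u|lborel. g (y - (1 / (2 * pi * real (Suc m))) *\<^sub>R u) * complex_of_real (gauss u)) \<longlonglongrightarrow> (LINT u|lborel. g y * complex_of_real (gauss (u::real^'n)))"
  proof (rule integral_dominated_convergence[where w = "\<lambda>u. B * gauss u"])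
    show "AE u in lborel. (\<lambda>m. g (y - (1 / (2 * pi * real (Suc m))) *\<^sub>R u) * complex_of_real (gauss u)) \<longlonglongrightarrow> g y * complex_of_real (gauss u)"
    proof (rule AE_I2)
      fix u
      have "(\<lambda>m. y - (1 / (2 * pi * real (Suc m))) *\<^sub>R u) \<longlonglongrightarrow> y - (1 / (2 * pi) * 0) *\<^sub>R u"
      proof (intro tendsto_intros)
        have "(\<lambda>m. 1 / (2 * pi) * (1 / real (Suc m))) \<longlonglongrightarrow> 1 / (2 * pi) * 0"
          by (intro tendsto_intros LIMSEQ_Suc[OF lim_1_over_n])
        then show "(\<lambda>m. 1 / (2 * pi * real (Suc m))) \<longlonglongrightarrow> 1 / (2 * pi) * 0" by simp
      qed
      moreover have "isCont g y" using g(1) by (simp add: continuous_on_eq_continuous_at)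
      ultimately have "(\<lambda>m. g (y - (1 / (2 * pi * real (Suc m))) *\<^sub>R u)) \<longlonglongrightarrow> g y"
        by (intro isCont_tendsto_compose[of y g]) auto
      then show "(\<lambda>m. g (y - (1 / (2 * pi * real (Suc m))) *\<^sub>R u) * complex_of_real (gauss u)) \<longlonglongrightarrow> g y * complex_of_real (gauss u)"
        by (intro tendsto_intros)
    qed
    show "AE u in lborel. norm (g (y - (1 / (2 * pi * real (Suc m))) *\<^sub>R u) * complex_of_real (gauss u)) \<le> B * gauss u" for m
      using g(2) by (auto simp: norm_mult intro!: mult_right_mono)
  qed (use gauss_integrable in auto)
  have "(LINT u|lborel. g y * complex_of_real (gauss (u::real^'n))) = g y"
    using gauss_integrable gauss_integral[where 'n = 'n] by simp
  then show ?thesis using LIMSEQ_unique[OF lim1[unfolded eq] lim2] by simp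
qed

section \<open>Superpositions of translates and modulations\<close>

context gs begin

lemma GSh_bound: "h > 0 \<Longrightarrow> \<phi> \<in> GSh M A h \<Longrightarrow> cmod (\<phi> x) \<le> GSnorm M A h \<phi> * wt A h x"
  using dbdD[OF dbd_GSnorm, of h \<phi> "[]" x] sM by (simp add: std_seq_0)

lemma GSh_continuous: "\<phi> \<in> GSh M A h \<Longrightarrow> continuous_on T \<phi>"
  using smooth_cont[OF GSh_smooth, of \<phi> h T "[]"] by simp

lemma GSh_measurable: "\<phi> \<in> GSh M A h \<Longrightarrow> \<phi> \<in> borel_measurable borel"
  by (intro borel_measurable_continuous_onI GSh_continuous)

lemma GSh_integrable:
  fixes \<phi> :: "('n::finite) tf"
  assumes "h > 0" "\<phi> \<in> GSh M A h" shows "integrable lborel \<phi>"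
proof (rule Bochner_Integration.integrable_bound)
  show "integrable lborel (\<lambda>x::real^'n. GSnorm M A h \<phi> * wt A h x)" by (intro integrable_mult_right wt_integrable[OF sA assms(1)])
  show "AE x in lborel. norm (\<phi> x) \<le> norm (GSnorm M A h \<phi> * wt A h x)"
    using GSh_bound[OF assms] GSnorm_nonneg[OF assms] by (auto simp: abs_mult)
qed (use GSh_measurable[OF assms(2)] in simp)

text \<open>Difference quotients have integral 0 by translation invariance. They converge pointwise
  to the derivative and, by \<open>GSh_trans_diff\<close>, are dominated by a multiple of an
  integrable kernel.\<close>

lemma integral_pd_zero:
  fixes \<phi> :: "('n::finite) tf"
  assumes "h > 0" "\<phi> \<in> GSh M A h"
  shows "(LINT x|lborel. pd i \<phi> x) = 0"
proof -
  define h' where "h' = h / (2 * H)"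
  have h': "h' > 0" "2 * H * h' = h" using assms H1 by (auto simp: h'_def)
  define e where "e = (axis i 1 :: real^'n)"
  define C where "C = (real CARD('n) * (c / (2 * h')) * ea A (2 * h')) * GSnorm M A h \<phi>"
  have ne: "norm e = 1" by (simp add: e_def)
  have sm: "smooth_fn \<phi>" using assms GSh_smooth by blast
  define s where "s = (\<lambda>m::nat. 1 / real (Suc m))"
  have s: "s m > 0" "s m \<le> 1" for m by (auto simp: s_def)
  let ?D = "\<lambda>m x. (1 / s m) *\<^sub>R (\<phi> (s m *\<^sub>R e + x) - \<phi> x)"
  have i\<phi>: "integrable lborel \<phi>" by (rule GSh_integrable[OF assms])
  have D0: "(LINT x|lborel. ?D m x) = 0" for m
    using i\<phi> lborel_integrable_shift[of \<phi> "s m *\<^sub>R e"] by simp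
  have bd: "norm (?D m x) \<le> C * wt A h' x" for m x
  proof -
    let ?s = "- (s m *\<^sub>R e)"
    have "norm ?s \<le> 1" using s[of m] ne by simp
    from GSh_trans_diff[OF h'(1) this] assms(2) h'(2)
    have g: "(\<lambda>x. \<phi> x - \<phi> (x - ?s)) \<in> GSh M A h'" "GSnorm M A h' (\<lambda>x. \<phi> x - \<phi> (x - ?s)) \<le> C * norm ?s"
      unfolding C_def by auto
    have "cmod (\<phi> x - \<phi> (x - ?s)) \<le> GSnorm M A h' (\<lambda>x. \<phi> x - \<phi> (x - ?s)) * wt A h' x"
      by (rule GSh_bound[OF h'(1) g(1)])
    also have "\<dots> \<le> C * norm ?s * wt A h' x" using g(2) by (intro mult_right_mono) auto
    finally have "cmod (\<phi> (s m *\<^sub>R e + x) - \<phi> x) \<le> C * s m * wt A h' x"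
      using s[of m] ne by (simp add: norm_minus_commute add.commute)
    then show ?thesis unfolding norm_scaleR using s[of m] by (simp add: pos_divide_le_eq mult_ac)
  qed
  have lim: "(\<lambda>m. ?D m x) \<longlonglongrightarrow> pd i \<phi> x" for x
  proof -
    have "((\<lambda>t. \<phi> (x + t *\<^sub>R axis i 1)) has_vector_derivative pd i \<phi> x) (at 0)"
      using smooth_hvd[OF sm, of "[]" x i] by simp
    then have "((\<lambda>t. \<phi> (x + t *\<^sub>R axis i 1)) has_derivative (\<lambda>t. t *\<^sub>R pd i \<phi> x)) (at 0)"
      by (simp add: has_vector_derivative_def)
    then have "(\<lambda>t. norm (\<phi> (x + t *\<^sub>R e) - \<phi> x - t *\<^sub>R pd i \<phi> x) / norm t) \<midarrow>0\<rightarrow> 0"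
      by (simp add: has_derivative_at e_def)
    moreover have "filterlim s (at 0) sequentially"
      unfolding s_def filterlim_at using LIMSEQ_Suc[OF lim_1_over_n] by auto
    ultimately have "(\<lambda>m. norm (\<phi> (x + s m *\<^sub>R e) - \<phi> x - s m *\<^sub>R pd i \<phi> x) / norm (s m)) \<longlonglongrightarrow> 0"
      by (rule filterlim_compose)
    moreover have "norm (\<phi> (x + s m *\<^sub>R e) - \<phi> x - s m *\<^sub>R pd i \<phi> x) / norm (s m) = norm (?D m x - pd i \<phi> x)" for m
    proof -
      have "?D m x - pd i \<phi> x = (1 / s m) *\<^sub>R (\<phi> (x + s m *\<^sub>R e) - \<phi> x - s m *\<^sub>R pd i \<phi> x)"
        using s[of m] by (simp add: algebra_simps)
      then show ?thesis using s[of m] by simp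
    qed
    ultimately have "(\<lambda>m. ?D m x - pd i \<phi> x) \<longlonglongrightarrow> 0" using tendsto_norm_zero_iff by fastforce
    then show ?thesis using LIM_zero_iff by blast
  qed
  have pdm: "pd i \<phi> \<in> borel_measurable borel"
    using smooth_cont[OF sm, of UNIV "[i]"] by (intro borel_measurable_continuous_onI) simp
  have "(\<lambda>m. LINT x|lborel. ?D m x) \<longlonglongrightarrow> (LINT x|lborel. pd i \<phi> x)"
    by (rule integral_dominated_convergence[where w = "\<lambda>x. C * wt A h' x"])
      (use bd lim pdm i\<phi> in \<open>auto intro!: borel_measurable_scaleR borel_measurable_diff integrable_mult_right wt_integrable[OF sA h'(1)]\<close>,
       use GSh_measurable[OF assms(2)] in measurable)
  then show ?thesis unfolding D0 by (simp add: LIMSEQ_const_iff)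
qed

lemma GSh_chr': "h > 0 \<Longrightarrow> \<phi> \<in> GSh M A h \<Longrightarrow> (\<lambda>x. chr \<xi> x * \<phi> x) \<in> GSh M A (h / 2)"
  using GSh_chr[of "h / 2" \<phi> \<xi>] by simp

text \<open>Integration by parts: \<open>integral_pd_zero\<close> is applied to the product of
  \<phi> with a character.\<close>

lemma ft_pd:
  assumes "h > 0" "\<phi> \<in> GSh M A h"
  shows "ft (pd i \<phi>) \<xi> = complex_of_real (2 * pi * \<xi> $ i) * \<i> * ft \<phi> \<xi>"
proof -
  have sm: "smooth_fn \<phi>" using assms GSh_smooth by blast
  have g: "(\<lambda>x. chr (- \<xi>) x * \<phi> x) \<in> GSh M A (h / 2)" using GSh_chr' assms by blast
  have eq: "pd i (\<lambda>x. chr (- \<xi>) x * \<phi> x) = (\<lambda>x. chr (- \<xi>) x * pd i \<phi> x - complex_of_real (2 * pi * \<xi> $ i) * \<i> * (chr (- \<xi>) x * \<phi> x))"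
    using dpart_mult[OF smooth_chr sm, of "[i]"] dpart_chr[of "[i]" "- \<xi>"] by (simp add: fun_eq_iff mult_ac)
  have i2: "integrable lborel (pd i \<phi>)"
    by (rule GSh_integrable[OF _ GSh_pd[OF assms]]) (use assms H1 in auto)
  have "0 = (LINT x|lborel. pd i (\<lambda>x. chr (- \<xi>) x * \<phi> x) x)" 
    using integral_pd_zero[OF _ g, of i] assms by simp
  also have "\<dots> = ft (pd i \<phi>) \<xi> - complex_of_real (2 * pi * \<xi> $ i) * \<i> * ft \<phi> \<xi>"
    unfolding eq ft_def using GSh_integrable[OF assms] i2
    by (subst Bochner_Integration.integral_diff) (auto intro!: integrable_chr_mult simp del: of_real_mult)
  finally show ?thesis by simp
qed

lemma ft_dpart:
  assumes "h > 0" "\<phi> \<in> GSh M A h"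
  shows "ft (dpart js \<phi>) \<xi> = chsym \<xi> js * ft \<phi> \<xi>"
proof (induction js)
  case (Cons i js)
  obtain h' where "h' > 0" "dpart js \<phi> \<in> GSh M A h'" using GSh_dpart[OF assms] by blast
  from ft_pd[OF this] Cons show ?case by simp
qed simp

text \<open>The type argument fixes the dimension, which does not occur in the type of the
  value.\<close>

definition Wint :: "('n::finite) itself \<Rightarrow> real \<Rightarrow> real" where
  "Wint T h = (LINT x::real^'n|lborel. wt A h x)"

lemma Wint_nonneg [simp]: "Wint T h \<ge> 0" unfolding Wint_def by simp

lemma ft_le_dpart:
  fixes \<phi> :: "('n::finite) tf"
  assumes "h > 0" "\<phi> \<in> GSh M A h"
  shows "cmod (ft (dpart js \<phi>) \<xi>) \<le> GSnorm M A h \<phi> * (M (length js) / h ^ length js) * Wint TYPE('n) h"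
proof -
  let ?C = "GSnorm M A h \<phi> * (M (length js) / h ^ length js)"
  obtain h' where h': "h' > 0" "dpart js \<phi> \<in> GSh M A h'" using GSh_dpart[OF assms] by blast
  have "cmod (ft (dpart js \<phi>) \<xi>) \<le> (LINT x|lborel. cmod (chr (- \<xi>) x * dpart js \<phi> x))"
    unfolding ft_def by (rule integral_norm_bound)
  also have "\<dots> \<le> (LINT x::real^'n|lborel. ?C * wt A h x)"
  proof (rule integral_mono)
    show "integrable lborel (\<lambda>x. cmod (chr (- \<xi>) x * dpart js \<phi> x))"
      by (intro integrable_norm integrable_chr_mult GSh_integrable[OF h'])
    show "integrable lborel (\<lambda>x::real^'n. ?C * wt A h x)" by (intro integrable_mult_right wt_integrable[OF sA assms(1)])
  qed (use dbdD[OF dbd_GSnorm[OF assms], of js] in \<open>simp add: norm_mult\<close>)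
  also have "\<dots> = ?C * Wint TYPE('n) h" by (simp add: Wint_def)
  finally show ?thesis .
qed

text \<open>Some coordinate of \<xi> is at least |\<xi>| / N, which is where N enters the level.
  Differentiating p times in that direction bounds the p-th term of the supremum for e^M, uniformly
  in p.\<close>

lemma ft_decay:
  fixes \<phi> :: "('n::finite) tf"
  assumes h: "h > 0" and \<phi>: "\<phi> \<in> GSh M A h"
  shows "cmod (ft \<phi> \<xi>) \<le> GSnorm M A h \<phi> * Wint TYPE('n) h * wt M (2 * pi * h / CARD('n)) \<xi>"
proof -
  let ?G = "GSnorm M A h \<phi> * Wint TYPE('n) h" and ?N = "real CARD('n)"
  have N: "?N > 0" by simp
  have G: "?G \<ge> 0" using GSnorm_nonneg[OF assms] by simp
  have "\<exists>i. norm \<xi> \<le> ?N * \<bar>\<xi> $ i\<bar>"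
  proof (rule ccontr)
    assume "\<not> ?thesis"
    then have "\<And>i. \<bar>\<xi> $ i\<bar> < norm \<xi> / ?N" using N by (simp add: not_le field_simps)
    then have "(\<Sum>i\<in>UNIV. \<bar>\<xi> $ i\<bar>) < (\<Sum>i\<in>(UNIV::'n set). norm \<xi> / ?N)" by (intro sum_strict_mono) auto
    then show False using norm_le_l1_cart[of \<xi>] by simp
  qed
  then obtain i where i: "norm \<xi> \<le> ?N * \<bar>\<xi> $ i\<bar>" by blast
  have *: "(2 * pi * h / ?N * norm \<xi>) ^ p / M p * cmod (ft \<phi> \<xi>) \<le> ?G" for p
  proof -
    have l: "cmod (chsym \<xi> (replicate p i)) = (2 * pi * \<bar>\<xi> $ i\<bar>) ^ p"
      by (induction p) (auto simp: norm_mult abs_mult)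
    have "(2 * pi / ?N * norm \<xi>) ^ p \<le> (2 * pi * \<bar>\<xi> $ i\<bar>) ^ p"
      using i N by (intro power_mono) (auto simp: field_simps)
    then have "(2 * pi / ?N * norm \<xi>) ^ p * cmod (ft \<phi> \<xi>) \<le> cmod (ft (dpart (replicate p i) \<phi>) \<xi>)"
      unfolding ft_dpart[OF assms] norm_mult l by (intro mult_right_mono) auto
    also have "\<dots> \<le> ?G * (M p / h ^ p)" using ft_le_dpart[OF assms, of "replicate p i" \<xi>] by (simp add: mult_ac)
    finally have "(2 * pi / ?N * norm \<xi>) ^ p * cmod (ft \<phi> \<xi>) * (h ^ p / M p) \<le> ?G * (M p / h ^ p) * (h ^ p / M p)"
      using h by (intro mult_right_mono) auto
    also have "\<dots> = ?G" using h by simp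
    also have "(2 * pi / ?N * norm \<xi>) ^ p * cmod (ft \<phi> \<xi>) * (h ^ p / M p) = (2 * pi * h / ?N * norm \<xi>) ^ p / M p * cmod (ft \<phi> \<xi>)"
      by (simp add: power_mult_distrib power_divide)
    finally show ?thesis .
  qed
  show ?thesis
  proof (cases "cmod (ft \<phi> \<xi>) = 0")
    case True then show ?thesis using G by simp
  next
    case False
    then have p: "cmod (ft \<phi> \<xi>) > 0" by simp
    have "ea M (2 * pi * h / ?N * norm \<xi>) \<le> ?G / cmod (ft \<phi> \<xi>)"
      using * h N p by (intro ea_le sM) (auto simp: pos_le_divide_eq)
    then show ?thesis using p by (simp add: wt_def pos_le_divide_eq mult.commute)
  qed
qed

text \<open>Inversion is applied to the derivative itself and the symbol is then moved to the
  character, which avoids differentiating under the integral sign.\<close>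

lemma GSh_inversion:
  fixes \<phi> :: "('n::finite) tf"
  assumes h: "h > 0" and \<phi>: "\<phi> \<in> GSh M A h"
  shows "dpart js \<phi> y = (LINT \<xi>|lborel. ft \<phi> \<xi> * dpart js (chr \<xi>) y)"
proof -
  obtain h' where h': "h' > 0" "dpart js \<phi> \<in> GSh M A h'" using GSh_dpart[OF assms] by blast
  let ?g = "dpart js \<phi>"
  have "?g y = (LINT \<xi>|lborel. ft ?g \<xi> * chr \<xi> y)"
  proof (rule fourier_inversion)
    show "continuous_on UNIV ?g" using GSh_continuous[OF h'(2)] .
    show "cmod (?g x) \<le> GSnorm M A h' ?g" for x
      using GSh_bound[OF h', of x] wt_le_1[OF sA, of h' x] GSnorm_nonneg[OF h'] 
      by (meson mult_left_le order_trans)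
    show "integrable lborel ?g" by (rule GSh_integrable[OF h'])
    show "integrable lborel (ft ?g)"
    proof (rule Bochner_Integration.integrable_bound)
      have "2 * pi * h' / real CARD('n) > 0" using h' by simp
      then show "integrable lborel (\<lambda>\<xi>::real^'n. GSnorm M A h' ?g * Wint TYPE('n) h' * wt M (2 * pi * h' / CARD('n)) \<xi>)"
        by (intro integrable_mult_right wt_integrable[OF sM])
      show "AE \<xi> in lborel. norm (ft ?g \<xi>) \<le> norm (GSnorm M A h' ?g * Wint TYPE('n) h' * wt M (2 * pi * h' / CARD('n)) \<xi>)"
        using ft_decay[OF h'] by (intro AE_I2) (metis abs_ge_self order_trans real_norm_def)
      show "ft ?g \<in> borel_measurable lborel" using ft_measurable[OF GSh_measurable[OF h'(2)]] by simp
    qed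
  qed
  also have "\<dots> = (LINT \<xi>|lborel. ft \<phi> \<xi> * dpart js (chr \<xi>) y)"
    by (simp add: ft_dpart[OF assms] dpart_chr mult_ac)
  finally show ?thesis .
qed

text \<open>Riemann sums of a locally Lipschitz family approximate its integral in the norm of the test
  space, simultaneously with the integrals of all locally Lipschitz functionals of the family.\<close>

lemma superposition:
  fixes \<Phi> :: "real^('n::finite) \<Rightarrow> 'n tf" and K :: "real^'n \<Rightarrow> real"
  assumes h: "h > 0" and K: "integrable lborel K" "\<And>x. K x \<ge> 0"
    and \<Phi>: "\<And>x. \<Phi> x \<in> GSh M A h" "\<And>x. GSnorm M A h (\<Phi> x) \<le> K x"
    and lip: "\<And>x x'. norm (x - x') \<le> 1 \<Longrightarrow> GSnorm M A h (\<lambda>y. \<Phi> x y - \<Phi> x' y) \<le> K x * norm (x - x')"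
    and \<Psi>: "smooth_fn \<Psi>" "\<And>js y. dpart js \<Psi> y = (LINT x|lborel. dpart js (\<Phi> x) y)"
    and e: "e > 0"
  obtains N :: nat and pt :: "nat \<Rightarrow> real^'n" and cw :: "nat \<Rightarrow> real" where "\<And>j. cw j \<ge> 0"
    "riemann_approx K e N pt cw"
    "(\<lambda>y. \<Psi> y + (- 1) * (\<Sum>j<N. complex_of_real (cw j) * \<Phi> (pt j) y)) \<in> GSh M A h"
    "GSnorm M A h (\<lambda>y. \<Psi> y + (- 1) * (\<Sum>j<N. complex_of_real (cw j) * \<Phi> (pt j) y)) \<le> e"
proof -
  obtain N :: nat and pt :: "nat \<Rightarrow> real^'n" and cw :: "nat \<Rightarrow> real" where q: "\<And>j. cw j \<ge> 0"
    "riemann_approx K e N pt cw"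
    by (rule quadrature[OF K e]) blast
  have sm: "smooth_fn (\<Phi> x)" for x using \<Phi>(1) GSh_smooth by blast
  have diff: "(\<lambda>y. \<Phi> x y - \<Phi> x' y) \<in> GSh M A h" "dpart js (\<lambda>y. \<Phi> x y - \<Phi> x' y) = (\<lambda>y. dpart js (\<Phi> x) y - dpart js (\<Phi> x') y)" for x x' js
  proof -
    have e: "(\<lambda>y. \<Phi> x y - \<Phi> x' y) = (\<lambda>y. \<Phi> x y + (- 1) * \<Phi> x' y)" by simp
    show "(\<lambda>y. \<Phi> x y - \<Phi> x' y) \<in> GSh M A h"
      unfolding e using GSh_add[OF h \<Phi>(1), of "\<lambda>y. (- 1) * \<Phi> x' y" x] GSh_scale[OF h \<Phi>(1), of "- 1" x'] by blast
    show "dpart js (\<lambda>y. \<Phi> x y - \<Phi> x' y) = (\<lambda>y. dpart js (\<Phi> x) y - dpart js (\<Phi> x') y)"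
      unfolding e dpart_add[OF sm smooth_scale[OF sm]] dpart_scale[OF sm] by simp
  qed
  define \<Sigma> where "\<Sigma> = (\<lambda>N y. \<Sum>j<N. complex_of_real (cw j) * \<Phi> (pt j) y)"
  have S: "smooth_fn (\<Sigma> N)" "dpart js (\<Sigma> N) = (\<lambda>y. \<Sum>j<N. complex_of_real (cw j) * dpart js (\<Phi> (pt j)) y)" for N js
  proof -
    have "smooth_fn (\<Sigma> N) \<and> (\<forall>js. dpart js (\<Sigma> N) = (\<lambda>y. \<Sum>j<N. complex_of_real (cw j) * dpart js (\<Phi> (pt j)) y))"
    proof (induction N)
      case 0
      have z: "smooth_fn (\<lambda>y. 0 * \<Phi> 0 y)" "dpart js (\<lambda>y. 0 * \<Phi> 0 y) = (\<lambda>y. 0 * dpart js (\<Phi> 0) y)" for js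
        by (rule smooth_scale[OF sm], rule dpart_scale[OF sm])
      then show ?case by (simp add: \<Sigma>_def)
    next
      case (Suc N)
      have e: "\<Sigma> (Suc N) = (\<lambda>y. \<Sigma> N y + complex_of_real (cw N) * \<Phi> (pt N) y)" by (simp add: \<Sigma>_def)
      show ?case unfolding e 
        using Suc smooth_add[OF conjunct1[OF Suc] smooth_scale[OF sm]] dpart_add[OF conjunct1[OF Suc] smooth_scale[OF sm]]
        by (auto simp: dpart_scale[OF sm])
    qed
    then show "smooth_fn (\<Sigma> N)" "dpart js (\<Sigma> N) = (\<lambda>y. \<Sum>j<N. complex_of_real (cw j) * dpart js (\<Phi> (pt j)) y)" by auto
  qed
  have bd: "cmod (dpart js (\<Sigma> N) y - dpart js \<Psi> y) \<le> e * (M (length js) / h ^ length js) * wt A h y" for js y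
  proof -
    \<comment> \<open>What depends on js and y is put into L. The quadrature depends on K and e
      alone, so its error is at most e times this factor, which is exactly a bound in the norm of
      level h.\<close>
    let ?L = "(M (length js) / h ^ length js) * wt A h y"
    have L: "?L \<ge> 0" using h by simp
    have "integrable lborel (\<lambda>x. dpart js (\<Phi> x) y) \<and> cmod ((\<Sum>j<N. complex_of_real (cw j) * dpart js (\<Phi> (pt j)) y) - (LINT x|lborel. dpart js (\<Phi> x) y)) \<le> ?L * e"
    proof (rule riemann_approxD[OF q(2) L])
      fix x
      have "cmod (dpart js (\<Phi> x) y) \<le> GSnorm M A h (\<Phi> x) * (M (length js) / h ^ length js) * wt A h y"
        by (rule dbdD[OF dbd_GSnorm[OF h \<Phi>(1)]])
      also have "\<dots> \<le> K x * (M (length js) / h ^ length js) * wt A h y"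
        using \<Phi>(2) h by (intro mult_right_mono) auto
      finally show "cmod (dpart js (\<Phi> x) y) \<le> ?L * K x" by (simp add: mult_ac)
    next
      fix x x' :: "real^'n" assume xx: "norm (x - x') \<le> 1"
      have "cmod (dpart js (\<lambda>y. \<Phi> x y - \<Phi> x' y) y) \<le> GSnorm M A h (\<lambda>y. \<Phi> x y - \<Phi> x' y) * (M (length js) / h ^ length js) * wt A h y"
        by (rule dbdD[OF dbd_GSnorm[OF h diff(1)]])
      also have "\<dots> \<le> (K x * norm (x - x')) * (M (length js) / h ^ length js) * wt A h y"
        using lip[OF xx] h by (intro mult_right_mono) auto
      finally show "cmod (dpart js (\<Phi> x) y - dpart js (\<Phi> x') y) \<le> ?L * K x * norm (x - x')"
        unfolding diff(2) by (simp add: mult_ac)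
    qed
    then show ?thesis unfolding S(2) \<Psi>(2) by (simp add: mult_ac)
  qed
  have "dbd M (\<lambda>y. \<Psi> y + (- 1) * \<Sigma> N y) e h (wt A h)"
    unfolding dbd_def dpart_add[OF \<Psi>(1) smooth_scale[OF S(1)]] dpart_scale[OF S(1)]
  proof (intro conjI allI)
    show "smooth_fn (\<lambda>y. \<Psi> y + (- 1) * \<Sigma> N y)" by (intro smooth_add smooth_scale \<Psi> S)
    show "cmod (dpart js \<Psi> y + (- 1) * dpart js (\<Sigma> N) y) \<le> e * (M (length js) / h ^ length js) * wt A h y" for js y
      using bd[of js y] by (simp add: norm_minus_commute)
  qed
  then have "(\<lambda>y. \<Psi> y + (- 1) * \<Sigma> N y) \<in> GSh M A h" "GSnorm M A h (\<lambda>y. \<Psi> y + (- 1) * \<Sigma> N y) \<le> e"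
    using GSh_I[OF h] by blast+
  then show ?thesis using q that unfolding \<Sigma>_def by blast
qed

text \<open>Exactly one split assigns no derivative to the second factor.\<close>

lemma sum_list_splits_fst:
  fixes F :: "'b list \<Rightarrow> 'c::comm_monoid_add"
  shows "(\<Sum>p\<leftarrow>splits js. if snd p = [] then F (fst p) else 0) = F js"
proof (induction js arbitrary: F)
  case (Cons i js)
  have "(\<Sum>p\<leftarrow>splits (i # js). if snd p = [] then F (fst p) else 0) =
     (\<Sum>p\<leftarrow>splits js. if snd p = [] then (\<lambda>l. F (i # l)) (fst p) else 0) + (\<Sum>p\<leftarrow>splits js. 0)"
    by (simp add: comp_def cong: if_cong)
  also have "\<dots> = F (i # js)" using Cons.IH[of "\<lambda>l. F (i # l)"] by simp
  finally show ?case .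
qed simp

lemma integral_reflect:
  fixes f :: "real^('n::finite) \<Rightarrow> complex"
  assumes "f \<in> borel_measurable borel"
  shows "(LINT x|lborel. f (y - x)) = (LINT x|lborel. f x)"
  using lborel_integral_affine[OF assms, of "- 1" y] by simp

lemma integrable_reflect:
  fixes f :: "real^('n::finite) \<Rightarrow> complex"
  assumes "integrable lborel f"
  shows "integrable lborel (\<lambda>x. f (y - x))"
proof -
  have [measurable]: "f \<in> borel_measurable borel" using assms by auto
  have "lborel = density (distr lborel borel (\<lambda>x::real^'n. y + (- 1) *\<^sub>R x)) (\<lambda>_. \<bar>- 1 :: real\<bar>^DIM(real^'n))"
    by (rule lborel_affine) simp
  then have "lborel = distr lborel borel (\<lambda>x::real^'n. y - x)" by (simp add: density_1)
  then have "integrable (distr lborel borel (\<lambda>x::real^'n. y - x)) f" using assms by simp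
  then show ?thesis by (subst (asm) integrable_distr_eq) auto
qed

text \<open>Supplies the hypotheses of \<open>superposition\<close> for the family of products of
  \<phi> with translates of \<psi>. One factor 2 H of the level pays for the product, a second one
  for the Lipschitz bound, because a difference in x is a product with a translated difference of
  \<psi>.\<close>

lemma trans_family:
  fixes \<phi> \<psi> :: "('n::finite) tf"
  assumes h: "h > 0" and \<phi>: "\<phi> \<in> GSh M A ((2 * H)\<^sup>2 * h)" and \<psi>: "\<psi> \<in> GSh M A ((2 * H)\<^sup>2 * h)"
  obtains C where "C \<ge> 0" "\<And>x. (\<lambda>y. \<phi> y * \<psi> (y - x)) \<in> GSh M A h"
    "\<And>x. GSnorm M A h (\<lambda>y. \<phi> y * \<psi> (y - x)) \<le> C * wt A h x"
    "\<And>x x'. norm (x - x') \<le> 1 \<Longrightarrow> GSnorm M A h (\<lambda>y. \<phi> y * \<psi> (y - x) - \<phi> y * \<psi> (y - x')) \<le> C * wt A h x * norm (x - x')"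
    "\<And>js y. dpart js (\<lambda>y. (LINT x|lborel. \<psi> x) * \<phi> y) y = (LINT x|lborel. dpart js (\<lambda>y. \<phi> y * \<psi> (y - x)) y)"
proof -
  let ?k = "2 * H * h"
  have k: "?k > 0" "h \<le> ?k" using h H1 by auto
  have k2: "2 * H * ?k = (2 * H)\<^sup>2 * h" by (simp add: power2_eq_square)
  have k3: "?k \<le> (2 * H)\<^sup>2 * h" "(2 * H)\<^sup>2 * h > 0" using h H1 unfolding k2[symmetric] by auto
  define g where "g = GSnorm M A ?k \<phi>"
  define D where "D = real CARD('n) * (c / (2 * ?k)) * ea A (2 * ?k)"
  define g2 where "g2 = GSnorm M A ((2 * H)\<^sup>2 * h) \<psi>"
  have m: "\<phi> \<in> GSh M A ?k" "\<psi> \<in> GSh M A ?k" "GSnorm M A ?k \<psi> \<le> g2"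
    using GSh_mono[OF k(1) k3(1)] \<phi> \<psi> by (auto simp: g2_def)
  have nn: "g \<ge> 0" "g2 \<ge> 0" "D \<ge> 0"
    using GSnorm_nonneg[OF k(1) m(1)] GSnorm_nonneg[OF k3(2) \<psi>] c1 h H1 by (simp_all add: g_def g2_def D_def)
  define C where "C = c * g * g2 * (1 + D)"
  have C: "C \<ge> 0" using nn c1 by (simp add: C_def)
  have P: "(\<lambda>y. \<phi> y * \<psi>' (y - x)) \<in> GSh M A h" "GSnorm M A h (\<lambda>y. \<phi> y * \<psi>' (y - x)) \<le> c * g * GSnorm M A ?k \<psi>' * wt A h x"
    if "\<psi>' \<in> GSh M A ?k" for \<psi>' x
    using GSh_mult_trans[OF h m(1) that] by (auto simp: g_def)
  have b1: "GSnorm M A h (\<lambda>y. \<phi> y * \<psi> (y - x)) \<le> C * wt A h x" for x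
  proof -
    have "c * g * GSnorm M A ?k \<psi> * wt A h x \<le> c * g * (g2 * (1 + D)) * wt A h x"
      using nn c1 m(3) by (intro mult_right_mono mult_left_mono) (auto simp: algebra_simps intro: order_trans)
    then show ?thesis using P(2)[OF m(2), of x] by (simp add: C_def mult_ac)
  qed
  have b2: "GSnorm M A h (\<lambda>y. \<phi> y * \<psi> (y - x) - \<phi> y * \<psi> (y - x')) \<le> C * wt A h x * norm (x - x')"
    if "norm (x - x') \<le> 1" for x x'
  proof -
    have s: "norm (x' - x) \<le> 1" using that by (simp add: norm_minus_commute)
    have T: "(\<lambda>y. \<psi> y - \<psi> (y - (x' - x))) \<in> GSh M A ?k" "GSnorm M A ?k (\<lambda>y. \<psi> y - \<psi> (y - (x' - x))) \<le> D * g2 * norm (x' - x)"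
      using GSh_trans_diff[OF k(1) s, of \<psi>] \<psi> unfolding k2 D_def g2_def by auto
    have e: "(\<lambda>y. \<phi> y * \<psi> (y - x) - \<phi> y * \<psi> (y - x')) = (\<lambda>y. \<phi> y * (\<lambda>y. \<psi> y - \<psi> (y - (x' - x))) (y - x))"
      by (simp add: algebra_simps)
    have "GSnorm M A h (\<lambda>y. \<phi> y * \<psi> (y - x) - \<phi> y * \<psi> (y - x')) \<le> c * g * (D * g2 * norm (x' - x)) * wt A h x"
      unfolding e by (rule order_trans[OF P(2)[OF T(1)]]) (use nn c1 T(2) in \<open>auto intro!: mult_right_mono mult_left_mono\<close>)
    also have "\<dots> = (c * g * g2) * D * (wt A h x * norm (x - x'))" by (simp add: norm_minus_commute)
    also have "\<dots> \<le> (c * g * g2) * (1 + D) * (wt A h x * norm (x - x'))"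
      using nn c1 by (intro mult_right_mono mult_left_mono) auto
    finally show ?thesis by (simp add: C_def mult_ac)
  qed
  have sm: "smooth_fn \<phi>" "smooth_fn \<psi>" using \<phi> \<psi> GSh_smooth by auto
  have d: "dpart js (\<lambda>y. (LINT x|lborel. \<psi> x) * \<phi> y) y = (LINT x|lborel. dpart js (\<lambda>y. \<phi> y * \<psi> (y - x)) y)" for js y
  proof -
    have dm: "dpart js (\<lambda>y. \<phi> y * \<psi> (y - x)) y = (\<Sum>p\<leftarrow>splits js. dpart (fst p) \<phi> y * dpart (snd p) \<psi> (y - x))" for x
      using dpart_mult[OF sm(1) smooth_trans[OF sm(2), of "- x"], of js] dpart_trans[OF sm(2), of _ "- x"] by simp
    have di: "integrable lborel (dpart l \<psi>)" for l
      using GSh_dpart[OF k3(2) \<psi>, of l] GSh_integrable by blast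
    \<comment> \<open>After integration over x, every Leibniz term with a derivative on \<psi>
      vanishes; the one term left has all derivatives on \<phi>.\<close>
    have dz: "(LINT x|lborel. dpart l \<psi> x) = (if l = [] then (LINT x|lborel. \<psi> x) else 0)" for l
    proof (cases l)
      case (Cons i l')
      obtain h' where "h' > 0" "dpart l' \<psi> \<in> GSh M A h'" using GSh_dpart[OF k3(2) \<psi>, of l'] by blast
      from integral_pd_zero[OF this] show ?thesis using Cons by simp
    qed simp
    have "(LINT x|lborel. (\<Sum>p\<leftarrow>ps. dpart (fst p) \<phi> y * dpart (snd p) \<psi> (y - x))) = (\<Sum>p\<leftarrow>ps. dpart (fst p) \<phi> y * (LINT x|lborel. dpart (snd p) \<psi> x)) \<and>
       integrable lborel (\<lambda>x. \<Sum>p\<leftarrow>ps. dpart (fst p) \<phi> y * dpart (snd p) \<psi> (y - x))" for ps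
    proof (induction ps)
      case (Cons p ps)
      have "integrable lborel (\<lambda>x. dpart (fst p) \<phi> y * dpart (snd p) \<psi> (y - x))"
        using integrable_reflect[OF di, of "snd p" y] by simp
      moreover have "(LINT x|lborel. dpart (snd p) \<psi> (y - x)) = (LINT x|lborel. dpart (snd p) \<psi> x)"
        using di[of "snd p"] by (intro integral_reflect) auto
      ultimately show ?case using Cons by simp
    qed simp
    then have "(LINT x|lborel. dpart js (\<lambda>y. \<phi> y * \<psi> (y - x)) y) = (\<Sum>p\<leftarrow>splits js. dpart (fst p) \<phi> y * (LINT x|lborel. dpart (snd p) \<psi> x))"
      unfolding dm by blast
    also have "\<dots> = (\<Sum>p\<leftarrow>splits js. if snd p = [] then (\<lambda>l. dpart l \<phi> y * (LINT x|lborel. \<psi> x)) (fst p) else 0)"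
      unfolding dz by (rule arg_cong[of _ _ sum_list], rule map_cong[OF refl]) auto
    also have "\<dots> = dpart js \<phi> y * (LINT x|lborel. \<psi> x)" by (rule sum_list_splits_fst)
    finally show ?thesis unfolding dpart_scale[OF sm(1)] by (simp add: mult.commute)
  qed
  show ?thesis using that[OF C P(1)[OF m(2)] b1 b2 d] by blast
qed

text \<open>Fourier inversion writes multiplication by \<kappa> as a superposition of modulations
  with coefficients \<open>ft \<kappa> \<xi>\<close>. Modulation costs e^{M(h'|\<xi>|)}; the
  coefficients decay at level H h', so by \<open>wt_sq\<close> the integrable kernel at level h'
  remains.\<close>

lemma mod_family:
  fixes \<phi> \<kappa> :: "('n::finite) tf"
  assumes h: "h > 0" and \<phi>: "\<phi> \<in> GSh M A (8 * H^3 * CARD('n) * h)" and \<kappa>: "\<kappa> \<in> GSh M A (8 * H^3 * CARD('n) * h)"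
  obtains C h' where "C \<ge> 0" "h' > 0" "\<And>\<xi>. (\<lambda>y. ft \<kappa> \<xi> * (chr \<xi> y * \<phi> y)) \<in> GSh M A h"
    "\<And>\<xi>. GSnorm M A h (\<lambda>y. ft \<kappa> \<xi> * (chr \<xi> y * \<phi> y)) \<le> C * wt M h' \<xi>"
    "\<And>\<xi> \<zeta>. norm (\<xi> - \<zeta>) \<le> 1 \<Longrightarrow> GSnorm M A h (\<lambda>y. ft \<kappa> \<xi> * (chr \<xi> y * \<phi> y) - ft \<kappa> \<zeta> * (chr \<zeta> y * \<phi> y)) \<le> C * wt M h' \<xi> * norm (\<xi> - \<zeta>)"
    "\<And>js y. dpart js (\<lambda>y. \<kappa> y * \<phi> y) y = (LINT \<xi>|lborel. dpart js (\<lambda>y. ft \<kappa> \<xi> * (chr \<xi> y * \<phi> y)) y)"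
proof -
  let ?N = "real CARD('n)"
  \<comment> \<open>\<open>ft_decay\<close> from level h0 gives decay at level 2 pi h0 / N = H h',
    where h' = 8 pi H h is the growth of modulations measured at level 2 H h. The larger h1 = 2 H h0
    leaves room for the Lipschitz bound on the transform.\<close>
  define h0 where "h0 = 4 * H\<^sup>2 * ?N * h"
  define h1 where "h1 = 8 * H^3 * ?N * h"
  define h' where "h' = 8 * pi * H * h"
  have N: "?N \<ge> 1" by simp
  have h0: "h0 > 0" "2 * H * h0 = h1" "h0 \<le> h1" "h1 > 0" using h H1 N by (auto simp: h0_def h1_def power2_eq_square power3_eq_cube)
  have hh: "4 * H * h \<le> h1"
  proof -
    have "1 * 1 \<le> (2 * H\<^sup>2) * ?N" using H1 N by (intro mult_mono) (auto simp: one_le_power intro: order_trans[of _ "H\<^sup>2"])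
    then have "(4 * H * h) * 1 \<le> (4 * H * h) * ((2 * H\<^sup>2) * ?N)" using h H1 by (intro mult_left_mono) auto
    then show ?thesis by (simp add: h1_def power2_eq_square power3_eq_cube mult_ac)
  qed
  have h': "h' > 0" "2 * pi * h0 / ?N = H * h'" using h H1 by (auto simp: h'_def h0_def power2_eq_square)
  have \<phi>': "\<phi> \<in> GSh M A (4 * H * h)" using GSh_mono[OF _ hh] \<phi> h H1 by (auto simp: h1_def)
  define g where "g = GSnorm M A (4 * H * h) \<phi>"
  have hpos: "4 * H * h > 0" "2 * H * h > 0" "2 * h > 0" using h H1 by auto
  have g: "g \<ge> 0" unfolding g_def by (rule GSnorm_nonneg[OF hpos(1) \<phi>'])
  have \<kappa>1: "\<kappa> \<in> GSh M A h1" using \<kappa> by (simp add: h1_def)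
  have \<kappa>0: "\<kappa> \<in> GSh M A h0" using GSh_mono[OF h0(1,3)] \<kappa>1 by auto
  define W where "W = Wint TYPE('n) h0"
  have W: "W \<ge> 0" unfolding W_def by (rule Wint_nonneg)
  define E where "E = 2 * pi * ea M (4 * pi * h0) * (1 + c / h0)"
  have E: "E \<ge> 0" using c1 h0 by (simp add: E_def)
  define F where "F = GSnorm M A h1 \<kappa> * W * (1 + E)"
  have g1: "GSnorm M A h1 \<kappa> \<ge> 0" "GSnorm M A h0 \<kappa> \<le> GSnorm M A h1 \<kappa>"
    using GSnorm_nonneg[OF h0(4) \<kappa>1] GSh_mono[OF h0(1,3) \<kappa>1] by auto
  have F: "F \<ge> 0" using g1 W E by (simp add: F_def)
  have f1: "cmod (ft \<kappa> \<xi>) \<le> F * wt M (H * h') \<xi>" for \<xi>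
  proof -
    have "cmod (ft \<kappa> \<xi>) \<le> GSnorm M A h0 \<kappa> * W * wt M (H * h') \<xi>"
      using ft_decay[OF h0(1) \<kappa>0, of \<xi>] unfolding W_def h'(2) .
    also have "\<dots> \<le> F * wt M (H * h') \<xi>"
    proof (rule mult_right_mono)
      have "GSnorm M A h0 \<kappa> * W * 1 \<le> GSnorm M A h1 \<kappa> * W * (1 + E)"
        using g1 W E by (intro mult_mono) auto
      then show "GSnorm M A h0 \<kappa> * W \<le> F" by (simp add: F_def)
    qed simp
    finally show ?thesis .
  qed
  have f2: "cmod (ft \<kappa> \<xi> - ft \<kappa> \<zeta>) \<le> F * wt M (H * h') \<xi> * norm (\<xi> - \<zeta>)" if n: "norm (\<xi> - \<zeta>) \<le> 1" for \<xi> \<zeta>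
  proof -
    let ?s = "\<xi> - \<zeta>"
    have T: "(\<lambda>x. (chr ?s x - 1) * \<kappa> x) \<in> GSh M A h0" "GSnorm M A h0 (\<lambda>x. (chr ?s x - 1) * \<kappa> x) \<le> E * GSnorm M A h1 \<kappa> * norm ?s"
      using GSh_chr_diff[OF h0(1) n, of \<kappa>] \<kappa>1 unfolding h0(2) E_def by auto
    have i: "integrable lborel \<kappa>" by (rule GSh_integrable[OF h0(4) \<kappa>1])
    \<comment> \<open>Multiplication by \<open>chr ?s\<close> moves the argument of the transform
      from \<xi> to \<zeta>, so the difference of two values is again a transform, to which
      \<open>ft_decay\<close> applies at \<xi>.\<close>
    have "ft (\<lambda>x. (chr ?s x - 1) * \<kappa> x) \<xi> = (LINT x|lborel. chr (- \<zeta>) x * \<kappa> x - chr (- \<xi>) x * \<kappa> x)"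
      unfolding ft_def
      by (rule Bochner_Integration.integral_cong[OF refl]) (use chr_add[of "- \<xi>" ?s] in \<open>auto simp: algebra_simps\<close>)
    also have "\<dots> = ft \<kappa> \<zeta> - ft \<kappa> \<xi>" unfolding ft_def
      by (intro Bochner_Integration.integral_diff integrable_chr_mult i)
    finally have "cmod (ft \<kappa> \<xi> - ft \<kappa> \<zeta>) = cmod (ft (\<lambda>x. (chr ?s x - 1) * \<kappa> x) \<xi>)" by (simp add: norm_minus_commute)
    also have "\<dots> \<le> GSnorm M A h0 (\<lambda>x. (chr ?s x - 1) * \<kappa> x) * W * wt M (H * h') \<xi>"
      using ft_decay[OF h0(1) T(1), of \<xi>] unfolding W_def h'(2) .
    also have "\<dots> \<le> (E * GSnorm M A h1 \<kappa> * norm ?s) * W * wt M (H * h') \<xi>"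
      using T(2) W by (intro mult_right_mono) auto
    also have "\<dots> = (GSnorm M A h1 \<kappa> * W * E) * (wt M (H * h') \<xi> * norm ?s)" by simp
    also have "\<dots> \<le> F * (wt M (H * h') \<xi> * norm ?s)"
      unfolding F_def using g1 W E by (intro mult_right_mono mult_left_mono) auto
    finally show ?thesis by simp
  qed
  have ww: "wt M (H * h') \<xi> * ea M (h' * norm \<xi>) \<le> c * wt M h' \<xi>" for \<xi> :: "real^'n"
  proof -
    have "wt M (H * h') \<xi> * ea M (h' * norm \<xi>) \<le> (c * (wt M h' \<xi>)\<^sup>2) * ea M (h' * norm \<xi>)"
      using wt_sq[OF sM M2M H1 c1, of h' \<xi>] h' by (intro mult_right_mono) auto
    also have "\<dots> = c * wt M h' \<xi>" by (simp add: wt_def power2_eq_square)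
    finally show ?thesis .
  qed
  have G1: "(\<lambda>y. chr \<xi> y * \<phi> y) \<in> GSh M A (2 * H * h)" "GSnorm M A (2 * H * h) (\<lambda>y. chr \<xi> y * \<phi> y) \<le> ea M (h' * norm \<xi>) * g" for \<xi>
    using GSh_chr[OF hpos(2), of \<phi> \<xi>] \<phi>' by (auto simp: g_def h'_def mult_ac)
  have hle: "h \<le> 2 * H * h" using h H1 by simp
  have G2: "(\<lambda>y. chr \<xi> y * \<phi> y) \<in> GSh M A h" "GSnorm M A h (\<lambda>y. chr \<xi> y * \<phi> y) \<le> ea M (h' * norm \<xi>) * g" for \<xi>
    using GSh_mono[OF h hle G1(1)[of \<xi>]] G1(2)[of \<xi>] by (auto intro: order_trans)
  define E2 where "E2 = 2 * pi * ea M (4 * pi * h) * (1 + c / h)"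
  have E2: "E2 \<ge> 0" using c1 h by (simp add: E2_def)
  have G3: "(\<lambda>y. (chr s y - 1) * (chr \<xi> y * \<phi> y)) \<in> GSh M A h" 
    "GSnorm M A h (\<lambda>y. (chr s y - 1) * (chr \<xi> y * \<phi> y)) \<le> E2 * (ea M (h' * norm \<xi>) * g) * norm s" if "norm s \<le> 1" for s \<xi>
    using GSh_chr_diff[OF h that G1(1)[of \<xi>]] G1(2)[of \<xi>] E2 
    by (auto simp: E2_def intro: order_trans[OF _ mult_right_mono[OF mult_left_mono]])
  define C where "C = c * F * g * (1 + 2 * E2)"
  have C: "C \<ge> 0" using c1 F g E2 by (simp add: C_def)
  have P: "(\<lambda>y. ft \<kappa> \<xi> * (chr \<xi> y * \<phi> y)) \<in> GSh M A h" for \<xi> using GSh_scale[OF h G2(1)] by blast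
  have b1: "GSnorm M A h (\<lambda>y. ft \<kappa> \<xi> * (chr \<xi> y * \<phi> y)) \<le> C * wt M h' \<xi>" for \<xi>
  proof -
    have "GSnorm M A h (\<lambda>y. ft \<kappa> \<xi> * (chr \<xi> y * \<phi> y)) \<le> cmod (ft \<kappa> \<xi>) * GSnorm M A h (\<lambda>y. chr \<xi> y * \<phi> y)"
      using GSh_scale[OF h G2(1)] by blast
    also have "\<dots> \<le> (F * wt M (H * h') \<xi>) * (ea M (h' * norm \<xi>) * g)"
      using F by (intro mult_mono f1 G2(2) GSnorm_nonneg[OF h G2(1)]) auto
    also have "\<dots> = F * g * (wt M (H * h') \<xi> * ea M (h' * norm \<xi>))" by simp
    also have "\<dots> \<le> F * g * (c * wt M h' \<xi>)" using F g ww[of \<xi>] by (intro mult_left_mono) auto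
    also have "\<dots> = (c * F * g * wt M h' \<xi>) * 1" by simp
    also have "\<dots> \<le> (c * F * g * wt M h' \<xi>) * (1 + 2 * E2)" using E2 F g c1 by (intro mult_left_mono) auto
    finally show ?thesis by (simp add: C_def mult_ac)
  qed
  have b2: "GSnorm M A h (\<lambda>y. ft \<kappa> \<xi> * (chr \<xi> y * \<phi> y) - ft \<kappa> \<zeta> * (chr \<zeta> y * \<phi> y)) \<le> C * wt M h' \<xi> * norm (\<xi> - \<zeta>)"
    if n: "norm (\<xi> - \<zeta>) \<le> 1" for \<xi> \<zeta>
  proof -
    let ?s = "\<zeta> - \<xi>"
    let ?X = "wt M (H * h') \<xi>" and ?Y = "ea M (h' * norm \<xi>)"
    have s: "norm ?s \<le> 1" using n by (simp add: norm_minus_commute)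
    \<comment> \<open>The variation of the coefficient is separated from that of the character, both
      relative to the modulation at \<xi>.\<close>
    have e: "(\<lambda>y. ft \<kappa> \<xi> * (chr \<xi> y * \<phi> y) - ft \<kappa> \<zeta> * (chr \<zeta> y * \<phi> y)) = 
      (\<lambda>y. (ft \<kappa> \<xi> - ft \<kappa> \<zeta>) * (chr \<xi> y * \<phi> y) + (- ft \<kappa> \<zeta>) * ((chr ?s y - 1) * (chr \<xi> y * \<phi> y)))"
    proof
      fix y
      have "chr \<zeta> y = chr ?s y * chr \<xi> y" using chr_add[of ?s \<xi> y] by simp
      then show "ft \<kappa> \<xi> * (chr \<xi> y * \<phi> y) - ft \<kappa> \<zeta> * (chr \<zeta> y * \<phi> y) = (ft \<kappa> \<xi> - ft \<kappa> \<zeta>) * (chr \<xi> y * \<phi> y) + (- ft \<kappa> \<zeta>) * ((chr ?s y - 1) * (chr \<xi> y * \<phi> y))"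
        by (simp add: algebra_simps)
    qed
    \<comment> \<open>The Lipschitz bound must be expressed at \<xi> alone, so the coefficient at
      \<zeta> is estimated there too, at the price of the factor 2.\<close>
    have z: "cmod (ft \<kappa> \<zeta>) \<le> 2 * F * ?X"
    proof -
      have "cmod (ft \<kappa> \<zeta>) \<le> cmod (ft \<kappa> \<xi>) + cmod (ft \<kappa> \<xi> - ft \<kappa> \<zeta>)"
        using norm_triangle_ineq4[of "ft \<kappa> \<xi>" "ft \<kappa> \<xi> - ft \<kappa> \<zeta>"] by simp
      also have "\<dots> \<le> F * ?X + F * ?X * norm (\<xi> - \<zeta>)" by (intro add_mono f1 f2 n)
      also have "\<dots> \<le> F * ?X + F * ?X * 1" using n F by (intro add_left_mono mult_left_mono) auto
      finally show ?thesis by simp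
    qed
    note S1 = GSh_scale[OF h G2(1), of "ft \<kappa> \<xi> - ft \<kappa> \<zeta>" \<xi>]
    note S2 = GSh_scale[OF h G3(1)[OF s], of "- ft \<kappa> \<zeta>" \<xi>]
    have "GSnorm M A h (\<lambda>y. ft \<kappa> \<xi> * (chr \<xi> y * \<phi> y) - ft \<kappa> \<zeta> * (chr \<zeta> y * \<phi> y)) \<le>
       cmod (ft \<kappa> \<xi> - ft \<kappa> \<zeta>) * GSnorm M A h (\<lambda>y. chr \<xi> y * \<phi> y) + cmod (- ft \<kappa> \<zeta>) * GSnorm M A h (\<lambda>y. (chr ?s y - 1) * (chr \<xi> y * \<phi> y))"
      unfolding e using GSh_add[OF h conjunct1[OF S1] conjunct1[OF S2]] S1 S2 by linarith
    also have "\<dots> \<le> (F * ?X * norm (\<xi> - \<zeta>)) * (?Y * g) + (2 * F * ?X) * (E2 * (?Y * g) * norm ?s)"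
      using F z by (intro add_mono mult_mono f2[OF n] G2(2) G3(2)[OF s] GSnorm_nonneg[OF h G2(1)] GSnorm_nonneg[OF h G3(1)[OF s]]) auto
    also have "\<dots> = F * g * (1 + 2 * E2) * norm (\<xi> - \<zeta>) * (?X * ?Y)"
      by (simp add: norm_minus_commute algebra_simps)
    also have "\<dots> \<le> F * g * (1 + 2 * E2) * norm (\<xi> - \<zeta>) * (c * wt M h' \<xi>)"
      using F g E2 ww[of \<xi>] by (intro mult_left_mono) auto
    finally show ?thesis by (simp add: C_def mult_ac)
  qed
  have sm: "smooth_fn \<phi>" "smooth_fn \<kappa>" using \<phi> \<kappa> GSh_smooth by auto
  have fi: "integrable lborel (\<lambda>\<xi>. ft \<kappa> \<xi> * dpart l (chr \<xi>) y)" for l y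
  proof -
    obtain h2 where h2: "h2 > 0" "dpart l \<kappa> \<in> GSh M A h2" using GSh_dpart[OF h0(4) \<kappa>1] by blast
    show ?thesis
    proof (rule Bochner_Integration.integrable_bound)
    have "2 * pi * h2 / ?N > 0" using h2 by simp
    then show "integrable lborel (\<lambda>\<xi>::real^'n. GSnorm M A h2 (dpart l \<kappa>) * Wint TYPE('n) h2 * wt M (2 * pi * h2 / ?N) \<xi>)"
      by (intro integrable_mult_right wt_integrable[OF sM])
    show "AE \<xi> in lborel. norm (ft \<kappa> \<xi> * dpart l (chr \<xi>) y) \<le> norm (GSnorm M A h2 (dpart l \<kappa>) * Wint TYPE('n) h2 * wt M (2 * pi * h2 / ?N) \<xi>)"
    proof (rule AE_I2)
      fix \<xi>
      have "norm (ft \<kappa> \<xi> * dpart l (chr \<xi>) y) = norm (ft (dpart l \<kappa>) \<xi>)"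
        by (simp add: ft_dpart[OF h0(4) \<kappa>1] dpart_chr norm_mult mult_ac)
      also have "\<dots> \<le> GSnorm M A h2 (dpart l \<kappa>) * Wint TYPE('n) h2 * wt M (2 * pi * h2 / ?N) \<xi>" by (rule ft_decay[OF h2])
      finally show "norm (ft \<kappa> \<xi> * dpart l (chr \<xi>) y) \<le> norm (GSnorm M A h2 (dpart l \<kappa>) * Wint TYPE('n) h2 * wt M (2 * pi * h2 / ?N) \<xi>)"
        by (metis abs_ge_self order_trans real_norm_def)
    qed
    have [measurable]: "ft \<kappa> \<in> borel_measurable borel" by (rule ft_measurable[OF GSh_measurable[OF \<kappa>1]])
    have "(\<lambda>\<xi>. chsym \<xi> l) \<in> borel_measurable borel" unfolding chsym_def 
      by (intro borel_measurable_continuous_onI, induction l) (auto intro!: continuous_intros)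
    then show "(\<lambda>\<xi>. ft \<kappa> \<xi> * dpart l (chr \<xi>) y) \<in> borel_measurable lborel"
      unfolding dpart_chr chr_commute[of _ y] by measurable
    qed
  qed
  have d: "dpart js (\<lambda>y. \<kappa> y * \<phi> y) y = (LINT \<xi>|lborel. dpart js (\<lambda>y. ft \<kappa> \<xi> * (chr \<xi> y * \<phi> y)) y)" for js y
  proof -
    have dm: "dpart js (\<lambda>y. ft \<kappa> \<xi> * (chr \<xi> y * \<phi> y)) y = (\<Sum>p\<leftarrow>splits js. (ft \<kappa> \<xi> * dpart (fst p) (chr \<xi>) y) * dpart (snd p) \<phi> y)" for \<xi>
      unfolding dpart_scale[OF smooth_mult[OF smooth_chr sm(1)]] dpart_mult[OF smooth_chr sm(1)] sum_list_const_mult[symmetric]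
      by (simp add: mult.assoc)
    have "(LINT \<xi>|lborel. (\<Sum>p\<leftarrow>ps. (ft \<kappa> \<xi> * dpart (fst p) (chr \<xi>) y) * dpart (snd p) \<phi> y)) = (\<Sum>p\<leftarrow>ps. dpart (fst p) \<kappa> y * dpart (snd p) \<phi> y) \<and>
       integrable lborel (\<lambda>\<xi>. \<Sum>p\<leftarrow>ps. (ft \<kappa> \<xi> * dpart (fst p) (chr \<xi>) y) * dpart (snd p) \<phi> y)" for ps
    proof (induction ps)
      case (Cons p ps)
      then show ?case using fi[of "fst p" y] GSh_inversion[OF h0(4) \<kappa>1, of "fst p" y] by simp
    qed simp
    then show ?thesis unfolding dm dpart_mult[OF sm(2,1)] by metis
  qed
  show ?thesis using that[OF C h'(1) P b1 b2 d] by blast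
qed

end

section \<open>Seminorms and functionals on the test space\<close>

locale gsk = gs M A c H for M A :: "nat \<Rightarrow> real" and c H :: real +
  fixes k :: GSkind
begin

abbreviation S :: "('n::finite) tf set" where "S \<equiv> GS k M A"

lemma S_dcl: "\<phi> \<in> S \<Longrightarrow> a > 0 \<Longrightarrow> dcl k (\<lambda>h. \<phi> \<in> GSh M A (a * h))"
  unfolding GS_iff by (rule dcl_scale)

lemma S_dcl2:
  assumes "\<phi> \<in> S" "\<psi> \<in> S" "a > 0"
  shows "dcl k (\<lambda>h. \<phi> \<in> GSh M A (a * h) \<and> \<psi> \<in> GSh M A (a * h))"
proof (rule dcl_conj[OF S_dcl[OF assms(1,3)] S_dcl[OF assms(2,3)]])
  fix h h' :: real assume "0 < h" "h \<le> h'"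
  then have "0 < a * h" "a * h \<le> a * h'" using assms by auto
  then show "\<phi> \<in> GSh M A (a * h') \<Longrightarrow> \<phi> \<in> GSh M A (a * h)" "\<psi> \<in> GSh M A (a * h') \<Longrightarrow> \<psi> \<in> GSh M A (a * h)"
    using GSh_mono(1) by blast+
qed

lemma S_add: assumes "\<phi> \<in> S" "\<psi> \<in> S" shows "(\<lambda>x. \<phi> x + \<psi> x) \<in> S"
  unfolding GS_iff using S_dcl2[OF assms, of 1] by (rule dcl_mono) (use GSh_add in auto)

lemma S_scale: assumes "\<phi> \<in> S" shows "(\<lambda>x. a * \<phi> x) \<in> S"
  unfolding GS_iff using S_dcl[OF assms, of 1] by (rule dcl_mono) (use GSh_scale in auto)

lemma S_diff: assumes "\<phi> \<in> S" "\<psi> \<in> S" shows "(\<lambda>x. \<phi> x - \<psi> x) \<in> S"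
  using S_add[OF assms(1) S_scale[OF assms(2), of "- 1"]] by simp

lemma S_cnj: assumes "\<phi> \<in> S" shows "(\<lambda>x. cnj (\<phi> x)) \<in> S"
  unfolding GS_iff using S_dcl[OF assms, of 1] by (rule dcl_mono) (use GSh_cnj in auto)

lemma S_trans: assumes "\<phi> \<in> S" shows "(\<lambda>x. \<phi> (x + a)) \<in> S"
  unfolding GS_iff using S_dcl[OF assms, of 2] by (rule dcl_mono) (use GSh_trans in auto)

lemma S_trans': assumes "\<phi> \<in> S" shows "(\<lambda>x. \<phi> (x - a)) \<in> S"
  using S_trans[OF assms, of "- a"] by simp

lemma S_chr: assumes "\<phi> \<in> S" shows "(\<lambda>x. chr \<xi> x * \<phi> x) \<in> S"
  unfolding GS_iff using S_dcl[OF assms, of 2] by (rule dcl_mono) (use GSh_chr in auto)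

lemma S_mult_trans: assumes "\<phi> \<in> S" "\<psi> \<in> S" shows "(\<lambda>y. \<phi> y * \<psi> (y - x)) \<in> S"
  unfolding GS_iff using S_dcl2[OF assms, of "2 * H"]
  by (rule dcl_mono) (use GSh_mult_trans H1 in auto)

lemma S_mult: assumes "\<phi> \<in> S" "\<psi> \<in> S" shows "(\<lambda>y. \<phi> y * \<psi> y) \<in> S"
  using S_mult_trans[OF assms, of 0] by simp

lemma S_zero: "(\<lambda>x. 0) \<in> (S :: ('n::finite) tf set)"
proof -
  have "(\<lambda>x::real^'n. 0) \<in> GSh M A h" if h: "h > 0" for h
  proof -
    have sm: "smooth_fn (\<lambda>x. 0 * chr (0::real^'n) x)" "\<And>js. dpart js (\<lambda>x. 0 * chr (0::real^'n) x) = (\<lambda>x. 0)"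
      by (intro smooth_scale smooth_chr) (simp only: dpart_scale[OF smooth_chr], simp)
    then have "dbd M (\<lambda>x::real^'n. 0) 0 h (wt A h)" unfolding dbd_def by simp
    then show ?thesis using GSh_I[OF h] by blast
  qed
  then show ?thesis unfolding GS_iff by (cases k) (auto simp: dcl_def intro: exI[of _ 1])
qed

lemma S_sum: "finite I \<Longrightarrow> (\<And>i. i \<in> I \<Longrightarrow> f i \<in> S) \<Longrightarrow> (\<lambda>x. \<Sum>i\<in>I. f i x) \<in> S"
  by (induction I rule: finite_induct) (auto simp: S_zero S_add)

lemma S_integrable: assumes "\<phi> \<in> S" shows "integrable lborel \<phi>"
  using GS_GSh[OF assms] GSh_integrable by blast

lemma S_continuous: assumes "\<phi> \<in> S" shows "continuous_on T \<phi>"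
  using GS_GSh[OF assms] GSh_continuous by blast

lemma S_integrable_mult: "\<phi> \<in> S \<Longrightarrow> \<psi> \<in> S \<Longrightarrow> integrable lborel (\<lambda>x. \<phi> x * \<psi> x)"
  by (intro S_integrable S_mult)

text \<open>A continuous seminorm on the test space. The modulus of an ultradistribution is one as
  well (\<open>UD_gsn\<close>), so integral estimates for norms and integral formulas for
  functionals are proved together.\<close>

definition gsn :: "(('n::finite) tf \<Rightarrow> real) \<Rightarrow> bool" where
  "gsn n \<longleftrightarrow> (\<forall>\<phi>\<in>S. n \<phi> \<ge> 0) \<and> (\<forall>\<phi>\<in>S. \<forall>\<psi>\<in>S. n (\<lambda>x. \<phi> x + \<psi> x) \<le> n \<phi> + n \<psi>)
     \<and> (\<forall>a. \<forall>\<phi>\<in>S. n (\<lambda>x. a * \<phi> x) = cmod a * n \<phi>) \<and> GS_cont k M A n"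

lemma gsn_nonneg: "gsn n \<Longrightarrow> \<phi> \<in> S \<Longrightarrow> n \<phi> \<ge> 0"
  and gsn_add: "gsn n \<Longrightarrow> \<phi> \<in> S \<Longrightarrow> \<psi> \<in> S \<Longrightarrow> n (\<lambda>x. \<phi> x + \<psi> x) \<le> n \<phi> + n \<psi>"
  and gsn_scale: "gsn n \<Longrightarrow> \<phi> \<in> S \<Longrightarrow> n (\<lambda>x. a * \<phi> x) = cmod a * n \<phi>"
  by (auto simp: gsn_def)

lemma gsn_zero: "gsn n \<Longrightarrow> n (\<lambda>x. 0) = 0"
  using gsn_scale[of n "\<lambda>x. 0" 0] S_zero by simp

lemma gsn_uminus: "gsn n \<Longrightarrow> \<phi> \<in> S \<Longrightarrow> n (\<lambda>x. - \<phi> x) = n \<phi>"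
  using gsn_scale[of n \<phi> "- 1"] by simp

lemma gsn_sum:
  assumes "gsn n" "finite I" "\<And>i. i \<in> I \<Longrightarrow> f i \<in> S"
  shows "n (\<lambda>x. \<Sum>i\<in>I. f i x) \<le> (\<Sum>i\<in>I. n (f i))"
  using assms(2,3)
proof (induction I rule: finite_induct)
  case (insert i I)
  have "n (\<lambda>x. f i x + (\<Sum>i\<in>I. f i x)) \<le> n (f i) + n (\<lambda>x. \<Sum>i\<in>I. f i x)"
    using insert by (intro gsn_add assms(1) S_sum) auto
  then show ?case using insert by (simp; fastforce)
qed (simp add: gsn_zero[OF assms(1)])

lemma gsn_diff: assumes "gsn n" "\<phi> \<in> S" "\<psi> \<in> S"
  shows "n (\<lambda>x. \<phi> x - \<psi> x) \<le> n \<phi> + n \<psi>" "\<bar>n \<phi> - n \<psi>\<bar> \<le> n (\<lambda>x. \<phi> x - \<psi> x)"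
    "n (\<lambda>x. \<phi> x - \<psi> x) = n (\<lambda>x. \<psi> x - \<phi> x)"
proof -
  show sy: "n (\<lambda>x. \<phi> x - \<psi> x) = n (\<lambda>x. \<psi> x - \<phi> x)"
    using gsn_uminus[OF assms(1) S_diff[OF assms(2,3)]] by simp
  show "n (\<lambda>x. \<phi> x - \<psi> x) \<le> n \<phi> + n \<psi>"
    using gsn_add[OF assms(1,2) S_scale[OF assms(3), of "- 1"]] gsn_uminus[OF assms(1,3)] by simp
  have "n \<phi> \<le> n (\<lambda>x. \<phi> x - \<psi> x) + n \<psi>" "n \<psi> \<le> n (\<lambda>x. \<psi> x - \<phi> x) + n \<phi>"
    using gsn_add[OF assms(1) S_diff[OF assms(2,3)] assms(3)] gsn_add[OF assms(1) S_diff[OF assms(3,2)] assms(2)] by simp_all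
  then show "\<bar>n \<phi> - n \<psi>\<bar> \<le> n (\<lambda>x. \<phi> x - \<psi> x)" using sy by linarith
qed

lemma cont_bound_up:
  assumes "0 < h" "h \<le> h'" "\<exists>C. \<forall>\<phi>\<in>S \<inter> GSh M A h. n \<phi> \<le> C * GSnorm M A h \<phi>"
  shows "\<exists>C\<ge>0. \<forall>\<phi>\<in>S \<inter> GSh M A h'. n \<phi> \<le> C * GSnorm M A h' \<phi>"
proof -
  obtain C where C: "\<forall>\<phi>\<in>S \<inter> GSh M A h. n \<phi> \<le> C * GSnorm M A h \<phi>" using assms by blast
  have "n \<phi> \<le> max C 0 * GSnorm M A h' \<phi>" if "\<phi> \<in> S \<inter> GSh M A h'" for \<phi>
  proof -
    note m = GSh_mono[OF assms(1,2), of \<phi>]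
    have "n \<phi> \<le> C * GSnorm M A h \<phi>" using C m that by blast
    also have "\<dots> \<le> max C 0 * GSnorm M A h' \<phi>" using m that GSnorm_nonneg[OF assms(1), of \<phi>] by (intro mult_mono) auto
    finally show ?thesis .
  qed
  then show ?thesis by (intro exI[of _ "max C 0"]) auto
qed

lemma gsn_cls: "gsn n \<Longrightarrow> cls k (\<lambda>h. \<exists>C\<ge>0. \<forall>\<phi>\<in>S \<inter> GSh M A h. n \<phi> \<le> C * GSnorm M A h \<phi>)"
  unfolding gsn_def GS_cont_iff by (auto elim!: cls_mono intro: cont_bound_up)

lemma
  assumes "u \<in> UD k M A"
  shows UD_add: "\<phi> \<in> S \<Longrightarrow> \<psi> \<in> S \<Longrightarrow> u (\<lambda>x. \<phi> x + \<psi> x) = u \<phi> + u \<psi>"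
    and UD_scale: "\<phi> \<in> S \<Longrightarrow> u (\<lambda>x. a * \<phi> x) = a * u \<phi>"
  using assms by (auto simp: UD_def)

lemma UD_gsn: assumes "u \<in> UD k M A" shows "gsn (\<lambda>\<phi>. cmod (u \<phi>))"
  unfolding gsn_def using assms by (auto simp: UD_def norm_mult norm_triangle_ineq)

lemma UD_zero: "u \<in> UD k M A \<Longrightarrow> u (\<lambda>x. 0) = 0"
  using UD_scale[of u "\<lambda>x. 0" 0] S_zero by simp

lemma UD_diff: "u \<in> UD k M A \<Longrightarrow> \<phi> \<in> S \<Longrightarrow> \<psi> \<in> S \<Longrightarrow> u (\<lambda>x. \<phi> x - \<psi> x) = u \<phi> - u \<psi>"
  using UD_add[of u \<phi> "\<lambda>x. (-1) * \<psi> x"] UD_scale[of u \<psi> "- 1"] S_scale[of \<psi> "- 1"] by simp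

lemma UD_sum:
  assumes "finite I" "u \<in> UD k M A" "\<And>i. i \<in> I \<Longrightarrow> f i \<in> S"
  shows "u (\<lambda>x. \<Sum>i\<in>I. f i x) = (\<Sum>i\<in>I. u (f i))"
  using assms(1,3)
proof (induction I rule: finite_induct)
  case (insert i I)
  have "u (\<lambda>x. f i x + (\<Sum>i\<in>I. f i x)) = u (f i) + u (\<lambda>x. \<Sum>i\<in>I. f i x)"
    using insert by (intro UD_add[OF assms(2)] S_sum) auto
  then show ?case using insert by simp
qed (simp add: UD_zero[OF assms(2)])

text \<open>Minkowski's integral inequality for a continuous seminorm: the triangle inequality for
  Riemann sums passes to the limit, because they converge in a norm that dominates n. When n is the
  modulus of u, linearity of u replaces the triangle inequality and gives an equation.\<close>

lemma superposition_gsn: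
  fixes \<Phi> :: "real^('n::finite) \<Rightarrow> 'n tf" and K :: "real^'n \<Rightarrow> real"
  assumes h: "h > 0" and K: "integrable lborel K" "\<And>x. K x \<ge> 0"
    and \<Phi>: "\<And>x. \<Phi> x \<in> GSh M A h" "\<And>x. GSnorm M A h (\<Phi> x) \<le> K x"
    and lip: "\<And>x x'. norm (x - x') \<le> 1 \<Longrightarrow> GSnorm M A h (\<lambda>y. \<Phi> x y - \<Phi> x' y) \<le> K x * norm (x - x')"
    and \<Psi>: "\<And>js y. dpart js \<Psi> y = (LINT x|lborel. dpart js (\<Phi> x) y)"
    and S: "\<And>x. \<Phi> x \<in> S" "\<Psi> \<in> S"
    and n: "gsn n" "C \<ge> 0" "\<And>\<phi>. \<phi> \<in> S \<inter> GSh M A h \<Longrightarrow> n \<phi> \<le> C * GSnorm M A h \<phi>"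
  shows "integrable lborel (\<lambda>x. n (\<Phi> x))" "n \<Psi> \<le> (LINT x|lborel. n (\<Phi> x))" "continuous_on UNIV (\<lambda>x. n (\<Phi> x))"
    "\<And>u. u \<in> UD k M A \<Longrightarrow> n = (\<lambda>\<phi>. cmod (u \<phi>)) \<Longrightarrow> u \<Psi> = (LINT x|lborel. u (\<Phi> x))"
    "\<And>u. u \<in> UD k M A \<Longrightarrow> n = (\<lambda>\<phi>. cmod (u \<phi>)) \<Longrightarrow> integrable lborel (\<lambda>x. u (\<Phi> x))"
    "\<And>u. u \<in> UD k M A \<Longrightarrow> n = (\<lambda>\<phi>. cmod (u \<phi>)) \<Longrightarrow> continuous_on UNIV (\<lambda>x. u (\<Phi> x))"
proof -
  have dS: "(\<lambda>y. \<Phi> x y - \<Phi> x' y) \<in> S \<inter> GSh M A h" for x x'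
    using S_diff[OF S(1) S(1)] GSh_add[OF h \<Phi>(1), of "\<lambda>y. (- 1) * \<Phi> x' y" x] GSh_scale[OF h \<Phi>(1), of "- 1" x'] by simp
  have b1: "n (\<Phi> x) \<le> C * K x" for x
    using n(3)[of "\<Phi> x"] \<Phi>(1,2)[of x] S(1)[of x] mult_left_mono[OF \<Phi>(2) n(2)] by (meson IntI order_trans)
  have b2: "n (\<lambda>y. \<Phi> x y - \<Phi> x' y) \<le> C * K x * norm (x - x')" if "norm (x - x') \<le> 1" for x x'
    using n(3)[OF dS, of x x'] mult_left_mono[OF lip[OF that] n(2)] by (simp add: mult.assoc)
  have b2': "\<bar>n (\<Phi> x) - n (\<Phi> x')\<bar> \<le> C * K x * norm (x - x')" if "norm (x - x') \<le> 1" for x x'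
    using gsn_diff(2)[OF n(1) S(1) S(1), of x x'] b2[OF that] by linarith
  show "continuous_on UNIV (\<lambda>x. n (\<Phi> x))"
    using b2' by (intro loclip_continuous[where K = "\<lambda>x. C * K x"]) auto
  have nn: "n (\<Phi> x) \<ge> 0" for x using gsn_nonneg[OF n(1) S(1)] .
  have sm: "smooth_fn \<Psi>" using S(2) GS_GSh GSh_smooth by blast
  have main: "integrable lborel (\<lambda>x. n (\<Phi> x)) \<and> n \<Psi> \<le> (LINT x|lborel. n (\<Phi> x)) + 2 * C * e" if e: "e > 0" for e
  proof -
    obtain N :: nat and pt :: "nat \<Rightarrow> real^'n" and cw :: "nat \<Rightarrow> real" where q: "\<And>j. cw j \<ge> 0"
      "riemann_approx K e N pt cw"
      "(\<lambda>y. \<Psi> y + (- 1) * (\<Sum>j<N. complex_of_real (cw j) * \<Phi> (pt j) y)) \<in> GSh M A h"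
      "GSnorm M A h (\<lambda>y. \<Psi> y + (- 1) * (\<Sum>j<N. complex_of_real (cw j) * \<Phi> (pt j) y)) \<le> e"
      by (rule superposition[OF h K \<Phi> lip sm \<Psi> e]) blast+
    have I: "integrable lborel (\<lambda>x. complex_of_real (n (\<Phi> x)))" and
      Q: "cmod ((\<Sum>j<N. complex_of_real (cw j) * complex_of_real (n (\<Phi> (pt j)))) - (LINT x|lborel. complex_of_real (n (\<Phi> x)))) \<le> C * e"
      using riemann_approxD[OF q(2), of C "\<lambda>x. complex_of_real (n (\<Phi> x))"] n(2) b1 b2' nn by (auto simp flip: of_real_diff)
    have I': "integrable lborel (\<lambda>x. n (\<Phi> x))" using I by (simp add: complex_of_real_integrable_eq)
    have "cmod (complex_of_real ((\<Sum>j<N. cw j * n (\<Phi> (pt j))) - (LINT x|lborel. n (\<Phi> x)))) \<le> C * e"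
      using Q by simp
    then have Q': "(\<Sum>j<N. cw j * n (\<Phi> (pt j))) \<le> (LINT x|lborel. n (\<Phi> x)) + C * e"
      unfolding norm_of_real by linarith
    let ?T = "\<lambda>y. \<Sum>j<N. complex_of_real (cw j) * \<Phi> (pt j) y"
    have T: "?T \<in> S" by (intro S_sum S_scale S) auto
    have R: "(\<lambda>y. \<Psi> y + (- 1) * ?T y) \<in> S" using S_add[OF S(2) S_scale[OF T]] .
    have "n (\<lambda>y. (\<Psi> y + (- 1) * ?T y) + ?T y) \<le> n (\<lambda>y. \<Psi> y + (- 1) * ?T y) + n ?T"
      by (rule gsn_add[OF n(1) R T])
    also have "n (\<lambda>y. \<Psi> y + (- 1) * ?T y) \<le> C * e"
      by (rule order_trans[OF n(3) mult_left_mono[OF q(4) n(2)]]) (rule IntI[OF R q(3)])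
    also have "n ?T \<le> (\<Sum>j<N. n (\<lambda>y. complex_of_real (cw j) * \<Phi> (pt j) y))"
      by (intro gsn_sum n S_scale S) auto
    also have "\<dots> = (\<Sum>j<N. cw j * n (\<Phi> (pt j)))" using q(1) by (simp add: gsn_scale[OF n(1) S(1)])
    also have "\<dots> \<le> (LINT x|lborel. n (\<Phi> x)) + C * e" by (rule Q')
    finally show ?thesis using I' by simp
  qed
  show "integrable lborel (\<lambda>x. n (\<Phi> x))" using main[of 1] by simp
  show "n \<Psi> \<le> (LINT x|lborel. n (\<Phi> x))"
  proof (rule field_le_epsilon)
    fix e :: real assume e: "e > 0"
    have "n \<Psi> \<le> (LINT x|lborel. n (\<Phi> x)) + 2 * C * (e / (2 * C + 1))" using main[of "e / (2 * C + 1)"] e n(2) by auto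
    also have "2 * C * (e / (2 * C + 1)) \<le> e" using e n(2) by (simp add: field_simps)
    finally show "n \<Psi> \<le> (LINT x|lborel. n (\<Phi> x)) + e" by simp
  qed
  fix u assume u: "u \<in> UD k M A" and nu: "n = (\<lambda>\<phi>. cmod (u \<phi>))"
  have ub1: "cmod (u (\<Phi> x)) \<le> C * K x" for x using b1 nu by simp
  have ub2: "cmod (u (\<Phi> x) - u (\<Phi> x')) \<le> C * K x * norm (x - x')" if "norm (x - x') \<le> 1" for x x'
    using b2[OF that] by (simp add: nu UD_diff[OF u S(1) S(1)])
  show "continuous_on UNIV (\<lambda>x. u (\<Phi> x))"
    using ub2 by (intro loclip_continuous[where K = "\<lambda>x. C * K x"]) auto
  have main: "integrable lborel (\<lambda>x. u (\<Phi> x)) \<and> cmod (u \<Psi> - (LINT x|lborel. u (\<Phi> x))) \<le> 2 * C * e" if e: "e > 0" for e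
  proof -
    obtain N :: nat and pt :: "nat \<Rightarrow> real^'n" and cw :: "nat \<Rightarrow> real" where q: "\<And>j. cw j \<ge> 0"
      "riemann_approx K e N pt cw"
      "(\<lambda>y. \<Psi> y + (- 1) * (\<Sum>j<N. complex_of_real (cw j) * \<Phi> (pt j) y)) \<in> GSh M A h"
      "GSnorm M A h (\<lambda>y. \<Psi> y + (- 1) * (\<Sum>j<N. complex_of_real (cw j) * \<Phi> (pt j) y)) \<le> e"
      by (rule superposition[OF h K \<Phi> lip sm \<Psi> e]) blast+
    have I: "integrable lborel (\<lambda>x. u (\<Phi> x))" and
      Q: "cmod ((\<Sum>j<N. complex_of_real (cw j) * u (\<Phi> (pt j))) - (LINT x|lborel. u (\<Phi> x))) \<le> C * e"
      using riemann_approxD[OF q(2), of C "\<lambda>x. u (\<Phi> x)"] n(2) ub1 ub2 by auto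
    let ?T = "\<lambda>y. \<Sum>j<N. complex_of_real (cw j) * \<Phi> (pt j) y"
    have T: "?T \<in> S" by (intro S_sum S_scale S) auto
    have R: "(\<lambda>y. \<Psi> y + (- 1) * ?T y) \<in> S" using S_add[OF S(2) S_scale[OF T]] .
    have uT: "u ?T = (\<Sum>j<N. complex_of_real (cw j) * u (\<Phi> (pt j)))"
      by (subst UD_sum[OF _ u]) (auto intro!: S_scale S simp: UD_scale[OF u S(1)])
    have "u (\<lambda>y. \<Psi> y + (- 1) * ?T y) = u \<Psi> - u ?T"
      unfolding UD_add[OF u S(2) S_scale[OF T]] UD_scale[OF u T] by simp
    moreover have "n (\<lambda>y. \<Psi> y + (- 1) * ?T y) \<le> C * e"
      by (rule order_trans[OF n(3) mult_left_mono[OF q(4) n(2)]]) (rule IntI[OF R q(3)])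
    ultimately have "cmod (u \<Psi> - u ?T) \<le> C * e" unfolding nu by simp
    then have "cmod ((u \<Psi> - u ?T) + (u ?T - (LINT x|lborel. u (\<Phi> x)))) \<le> C * e + C * e"
      using Q unfolding uT[symmetric] by (intro norm_triangle_mono)
    then show ?thesis using I by simp
  qed
  show "integrable lborel (\<lambda>x. u (\<Phi> x))" using main[of 1] by simp
  have "cmod (u \<Psi> - (LINT x|lborel. u (\<Phi> x))) \<le> 0"
  proof (rule field_le_epsilon)
    fix e :: real assume e: "e > 0"
    have "cmod (u \<Psi> - (LINT x|lborel. u (\<Phi> x))) \<le> 2 * C * (e / (2 * C + 1))" using main[of "e / (2 * C + 1)"] e n(2) by auto
    also have "2 * C * (e / (2 * C + 1)) \<le> e" using e n(2) by (simp add: field_simps)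
    finally show "cmod (u \<Psi> - (LINT x|lborel. u (\<Phi> x))) \<le> 0 + e" by simp
  qed
  then show "u \<Psi> = (LINT x|lborel. u (\<Phi> x))" by simp
qed

text \<open>Integrating all translates of \<psi> gives a constant, the integral of \<psi>. If it is
  nonzero, this recovers \<phi> from its windowed pieces; later \<psi> is a function times its
  conjugate.\<close>

lemma gsn_trans:
  fixes \<phi> \<psi> :: "('n::finite) tf"
  assumes n: "gsn n" and S: "\<phi> \<in> S" "\<psi> \<in> S"
  shows "integrable lborel (\<lambda>x. n (\<lambda>y. \<phi> y * \<psi> (y - x)))"
    and "cmod (LINT x|lborel. \<psi> x) * n \<phi> \<le> (LINT x|lborel. n (\<lambda>y. \<phi> y * \<psi> (y - x)))"
    and "continuous_on UNIV (\<lambda>x. n (\<lambda>y. \<phi> y * \<psi> (y - x)))"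
    and "\<And>u. u \<in> UD k M A \<Longrightarrow> n = (\<lambda>\<phi>. cmod (u \<phi>)) \<Longrightarrow> (LINT x|lborel. \<psi> x) * u \<phi> = (LINT x|lborel. u (\<lambda>y. \<phi> y * \<psi> (y - x)))"
    and "\<And>u. u \<in> UD k M A \<Longrightarrow> n = (\<lambda>\<phi>. cmod (u \<phi>)) \<Longrightarrow> integrable lborel (\<lambda>x. u (\<lambda>y. \<phi> y * \<psi> (y - x)))"
    and "\<And>u. u \<in> UD k M A \<Longrightarrow> n = (\<lambda>\<phi>. cmod (u \<phi>)) \<Longrightarrow> continuous_on UNIV (\<lambda>x. u (\<lambda>y. \<phi> y * \<psi> (y - x)))"
proof -
  have "(2 * H)\<^sup>2 > 0" using H1 by simp
  from cls_meet[OF gsn_cls[OF n] S_dcl2[OF S this]] obtain h C where h: "h > 0" "C \<ge> 0"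
    "\<And>\<phi>. \<phi> \<in> S \<inter> GSh M A h \<Longrightarrow> n \<phi> \<le> C * GSnorm M A h \<phi>" "\<phi> \<in> GSh M A ((2 * H)\<^sup>2 * h)" "\<psi> \<in> GSh M A ((2 * H)\<^sup>2 * h)"
    by blast
  obtain D where D: "D \<ge> 0" "\<And>x. (\<lambda>y. \<phi> y * \<psi> (y - x)) \<in> GSh M A h"
    "\<And>x. GSnorm M A h (\<lambda>y. \<phi> y * \<psi> (y - x)) \<le> D * wt A h x"
    "\<And>x x'. norm (x - x') \<le> 1 \<Longrightarrow> GSnorm M A h (\<lambda>y. \<phi> y * \<psi> (y - x) - \<phi> y * \<psi> (y - x')) \<le> D * wt A h x * norm (x - x')"
    "\<And>js y. dpart js (\<lambda>y. (LINT x|lborel. \<psi> x) * \<phi> y) y = (LINT x|lborel. dpart js (\<lambda>y. \<phi> y * \<psi> (y - x)) y)"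
    by (rule trans_family[OF h(1,4,5)]) (rule that, assumption+)
  have Ki: "integrable lborel (\<lambda>x::real^'n. D * wt A h x)" by (intro integrable_mult_right wt_integrable[OF sA h(1)])
  have Kn: "D * wt A h x \<ge> 0" for x :: "real^'n" using D(1) by simp
  note sup = superposition_gsn[where \<Phi> = "\<lambda>x y. \<phi> y * \<psi> (y - x)", OF h(1) Ki Kn D(2) D(3) D(4) D(5) S_mult_trans[OF S] S_scale[OF S(1)] n h(2,3)]
  show "integrable lborel (\<lambda>x. n (\<lambda>y. \<phi> y * \<psi> (y - x)))" "continuous_on UNIV (\<lambda>x. n (\<lambda>y. \<phi> y * \<psi> (y - x)))"
    by (rule sup(1) sup(3); assumption)+
  have "n (\<lambda>y. (LINT x|lborel. \<psi> x) * \<phi> y) \<le> (LINT x|lborel. n (\<lambda>y. \<phi> y * \<psi> (y - x)))"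
    by (rule sup(2); assumption)
  then show "cmod (LINT x|lborel. \<psi> x) * n \<phi> \<le> (LINT x|lborel. n (\<lambda>y. \<phi> y * \<psi> (y - x)))"
    by (simp add: gsn_scale[OF n S(1)])
  fix u assume u: "u \<in> UD k M A" "n = (\<lambda>\<phi>. cmod (u \<phi>))"
  show "integrable lborel (\<lambda>x. u (\<lambda>y. \<phi> y * \<psi> (y - x)))" "continuous_on UNIV (\<lambda>x. u (\<lambda>y. \<phi> y * \<psi> (y - x)))"
    by (rule sup(5)[OF _ _ u] sup(6)[OF _ _ u]; assumption)+
  have "u (\<lambda>y. (LINT x|lborel. \<psi> x) * \<phi> y) = (LINT x|lborel. u (\<lambda>y. \<phi> y * \<psi> (y - x)))"
    by (rule sup(4)[OF _ _ u]; assumption)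
  then show "(LINT x|lborel. \<psi> x) * u \<phi> = (LINT x|lborel. u (\<lambda>y. \<phi> y * \<psi> (y - x)))"
    by (simp add: UD_scale[OF u(1) S(1)])
qed

lemmas UD_trans = gsn_trans(4-6)[OF UD_gsn _ _ _ refl]

text \<open>Minkowski's inequality for the Fourier inversion of the multiplier \<psi>.\<close>

lemma gsn_fourier:
  fixes \<phi> \<psi> :: "('n::finite) tf"
  assumes n: "gsn n" and S: "\<phi> \<in> S" "\<psi> \<in> S"
  shows "integrable lborel (\<lambda>\<xi>. cmod (ft \<psi> \<xi>) * n (\<lambda>y. chr \<xi> y * \<phi> y))"
    and "n (\<lambda>y. \<psi> y * \<phi> y) \<le> (LINT \<xi>|lborel. cmod (ft \<psi> \<xi>) * n (\<lambda>y. chr \<xi> y * \<phi> y))"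
proof -
  have "8 * H^3 * CARD('n) > 0" using H1 by simp
  from cls_meet[OF gsn_cls[OF n] S_dcl2[OF S this]] obtain h C where h: "h > 0" "C \<ge> 0"
    "\<And>\<phi>. \<phi> \<in> S \<inter> GSh M A h \<Longrightarrow> n \<phi> \<le> C * GSnorm M A h \<phi>" "\<phi> \<in> GSh M A (8 * H^3 * CARD('n) * h)" "\<psi> \<in> GSh M A (8 * H^3 * CARD('n) * h)"
    by blast
  obtain D h' where D: "D \<ge> 0" "h' > 0" "\<And>\<xi>. (\<lambda>y. ft \<psi> \<xi> * (chr \<xi> y * \<phi> y)) \<in> GSh M A h"
    "\<And>\<xi>. GSnorm M A h (\<lambda>y. ft \<psi> \<xi> * (chr \<xi> y * \<phi> y)) \<le> D * wt M h' \<xi>"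
    "\<And>\<xi> \<zeta>. norm (\<xi> - \<zeta>) \<le> 1 \<Longrightarrow> GSnorm M A h (\<lambda>y. ft \<psi> \<xi> * (chr \<xi> y * \<phi> y) - ft \<psi> \<zeta> * (chr \<zeta> y * \<phi> y)) \<le> D * wt M h' \<xi> * norm (\<xi> - \<zeta>)"
    "\<And>js y. dpart js (\<lambda>y. \<psi> y * \<phi> y) y = (LINT \<xi>|lborel. dpart js (\<lambda>y. ft \<psi> \<xi> * (chr \<xi> y * \<phi> y)) y)"
    by (rule mod_family[OF h(1,4,5)]) (rule that, assumption+)
  have Ki: "integrable lborel (\<lambda>x::real^'n. D * wt M h' x)" by (intro integrable_mult_right wt_integrable[OF sM D(2)])
  have Kn: "D * wt M h' x \<ge> 0" for x :: "real^'n" using D(1) by simp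
  note sup = superposition_gsn[where \<Phi> = "\<lambda>\<xi> y. ft \<psi> \<xi> * (chr \<xi> y * \<phi> y)", OF h(1) Ki Kn D(3) D(4) D(5) D(6) S_scale[OF S_chr[OF S(1)]] S_mult[OF S(2,1)] n h(2,3)]
  have e: "n (\<lambda>y. ft \<psi> \<xi> * (chr \<xi> y * \<phi> y)) = cmod (ft \<psi> \<xi>) * n (\<lambda>y. chr \<xi> y * \<phi> y)" for \<xi>
    by (rule gsn_scale[OF n S_chr[OF S(1)]])
  have "integrable lborel (\<lambda>\<xi>. n (\<lambda>y. ft \<psi> \<xi> * (chr \<xi> y * \<phi> y)))" by (rule sup(1); assumption)
  then show "integrable lborel (\<lambda>\<xi>. cmod (ft \<psi> \<xi>) * n (\<lambda>y. chr \<xi> y * \<phi> y))" unfolding e .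
  have "n (\<lambda>y. \<psi> y * \<phi> y) \<le> (LINT \<xi>|lborel. n (\<lambda>y. ft \<psi> \<xi> * (chr \<xi> y * \<phi> y)))" by (rule sup(2); assumption)
  then show "n (\<lambda>y. \<psi> y * \<phi> y) \<le> (LINT \<xi>|lborel. cmod (ft \<psi> \<xi>) * n (\<lambda>y. chr \<xi> y * \<phi> y))" unfolding e .
qed

lemma ft_trans: "cmod (ft (\<lambda>x. \<psi> (x - a)) \<xi>) = cmod (ft \<psi> \<xi>)"
proof -
  have "ft (\<lambda>x. \<psi> (x - a)) \<xi> = (LINT x|lborel. chr (- \<xi>) (a + x) * \<psi> (a + x - a))"
    unfolding ft_def using lborel_integrable_shift(2)[of "\<lambda>x. chr (- \<xi>) x * \<psi> (x - a)" a] by simp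
  also have "\<dots> = (LINT x|lborel. chr (- \<xi>) a * (chr (- \<xi>) x * \<psi> x))" by (simp add: chr_add_right mult.assoc)
  also have "\<dots> = chr (- \<xi>) a * ft \<psi> \<xi>" unfolding ft_def by simp
  finally show ?thesis by (simp add: norm_mult)
qed

definition mod_bound :: "(('n::finite) tf \<Rightarrow> real) \<Rightarrow> real \<Rightarrow> bool" where
  "mod_bound n \<tau> \<longleftrightarrow> (\<exists>C>0. \<forall>\<phi>\<in>S. \<forall>x. n (\<lambda>z. \<phi> (z - x)) \<le> C * ea A (\<tau> * norm x) * n \<phi>
     \<and> n (\<lambda>z. chr x z * \<phi> z) \<le> C * ea M (\<tau> * norm x) * n \<phi>)"

text \<open>A multiplier is a superposition of modulations, so the growth bound on modulations
  bounds it. Uniformity in the translation x holds because translating \<psi> changes its transform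
  only by a phase (\<open>ft_trans\<close>).\<close>

lemma gsn_multiplier:
  fixes n :: "('n::finite) tf \<Rightarrow> real"
  assumes n: "gsn n" and m: "cls k (mod_bound n)"
  shows "cls k (\<lambda>h. \<exists>C\<ge>0. \<forall>\<phi>\<in>S. \<forall>\<psi>\<in>S \<inter> GSh M A h. \<forall>x. n (\<lambda>y. \<phi> y * \<psi> (y - x)) \<le> C * GSnorm M A h \<psi> * n \<phi>)"
proof -
  let ?N = "real CARD('n)"
  \<comment> \<open>With t = 2 pi h / (N H), the transform of a function at level h decays at level
    H t; by (M.2) this compensates the cost e^{M(t|\<xi>|)} of modulations and leaves an integrable
    kernel.\<close>
  have "2 * pi / (?N * H) > 0" using H1 by simp
  from cls_scale[OF m this] show ?thesis
  proof (rule cls_mono)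
    fix h :: real assume h: "h > 0" and mb: "mod_bound n (2 * pi / (?N * H) * h)"
    let ?t = "2 * pi / (?N * H) * h"
    have t: "?t > 0" "2 * pi * h / ?N = H * ?t" using h H1 by auto
    from mb obtain C where C: "C > 0" "\<And>\<phi> x. \<phi> \<in> S \<Longrightarrow> n (\<lambda>z. chr x z * \<phi> z) \<le> C * ea M (?t * norm x) * n \<phi>"
      unfolding mod_bound_def by blast
    define W where "W = (LINT x::real^'n|lborel. wt M ?t x)"
    have W: "W \<ge> 0" by (simp add: W_def)
    let ?D = "C * Wint TYPE('n) h * c * W"
    have "n (\<lambda>y. \<phi> y * \<psi> (y - x)) \<le> ?D * GSnorm M A h \<psi> * n \<phi>" if \<phi>: "\<phi> \<in> S" and \<psi>: "\<psi> \<in> S \<inter> GSh M A h" for \<phi> \<psi> x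
    proof -
      let ?f = "\<lambda>y. \<psi> (y - x)" and ?G = "GSnorm M A h \<psi> * Wint TYPE('n) h"
      have f: "?f \<in> S" using \<psi> by (intro S_trans') auto
      have np: "n \<phi> \<ge> 0" using gsn_nonneg[OF n \<phi>] .
      have G: "?G \<ge> 0" using GSnorm_nonneg[OF h, of \<psi>] \<psi> by auto
      have b: "cmod (ft ?f \<xi>) * n (\<lambda>y. chr \<xi> y * \<phi> y) \<le> (?G * C * n \<phi> * c) * wt M ?t \<xi>" for \<xi>
      proof -
        have "cmod (ft ?f \<xi>) * n (\<lambda>y. chr \<xi> y * \<phi> y) \<le> (?G * wt M (H * ?t) \<xi>) * (C * ea M (?t * norm \<xi>) * n \<phi>)"
          using ft_decay[OF h, of \<psi> \<xi>] \<psi> G unfolding ft_trans t(2)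
          by (intro mult_mono C(2)[OF \<phi>] gsn_nonneg[OF n S_chr[OF \<phi>]]) auto
        also have "\<dots> \<le> (?G * (c * (wt M ?t \<xi>)\<^sup>2)) * (C * ea M (?t * norm \<xi>) * n \<phi>)"
          using wt_sq[OF sM M2M H1 c1, of ?t \<xi>] t G C(1) np by (intro mult_right_mono mult_left_mono) auto
        also have "\<dots> = (?G * C * n \<phi> * c) * wt M ?t \<xi> * (wt M ?t \<xi> * ea M (?t * norm \<xi>))" by (simp add: power2_eq_square)
        also have "wt M ?t \<xi> * ea M (?t * norm \<xi>) = 1" by (simp add: wt_def)
        finally show ?thesis by simp
      qed
      have "n (\<lambda>y. ?f y * \<phi> y) \<le> (LINT \<xi>|lborel. cmod (ft ?f \<xi>) * n (\<lambda>y. chr \<xi> y * \<phi> y))"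
        by (rule gsn_fourier(2)[OF n \<phi> f])
      also have "\<dots> \<le> (LINT \<xi>::real^'n|lborel. (?G * C * n \<phi> * c) * wt M ?t \<xi>)"
        by (intro integral_mono gsn_fourier(1)[OF n \<phi> f] integrable_mult_right wt_integrable[OF sM t(1)] b)
      also have "\<dots> = ?D * GSnorm M A h \<psi> * n \<phi>" by (simp add: W_def)
      finally show ?thesis by (simp add: mult.commute)
    qed
    moreover have "?D \<ge> 0" using C(1) W c1 by simp
    ultimately show "\<exists>C\<ge>0. \<forall>\<phi>\<in>S. \<forall>\<psi>\<in>S \<inter> GSh M A h. \<forall>x. n (\<lambda>y. \<phi> y * \<psi> (y - x)) \<le> C * GSnorm M A h \<psi> * n \<phi>"
      by blast
  qed
qed

end

section \<open>Spaces of class TMIB as completions of the test space\<close>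

lemma cls_Beurling: "cls k P \<Longrightarrow> k = Beurling \<Longrightarrow> \<exists>h>0. P h"
  and cls_Roumieu: "cls k P \<Longrightarrow> k = Roumieu \<Longrightarrow> h > 0 \<Longrightarrow> P h"
  by (simp_all add: cls_def)

context gsk begin

text \<open>Under \<open>cls\<close> this is the continuity of the inclusion into the
  ultradistributions, expressed on test functions alone.\<close>

definition pair_bound :: "(('n::finite) tf \<Rightarrow> real) \<Rightarrow> real \<Rightarrow> bool" where
  "pair_bound n h \<longleftrightarrow> (\<exists>C\<ge>0. \<forall>\<phi>\<in>S. \<forall>\<psi>\<in>S \<inter> GSh M A h. cmod (LINT x|lborel. \<phi> x * \<psi> x) \<le> C * GSnorm M A h \<psi> * n \<phi>)"

definition ncauchy :: "(('n::finite) tf \<Rightarrow> real) \<Rightarrow> (nat \<Rightarrow> 'n tf) \<Rightarrow> bool" where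
  "ncauchy n s \<longleftrightarrow> (\<forall>e>0. \<exists>N. \<forall>i\<ge>N. \<forall>j\<ge>N. n (\<lambda>x. s i x - s j x) < e)"

lemma ncauchyE:
  assumes "ncauchy n s" "e > 0"
  obtains N where "\<And>i j. i \<ge> N \<Longrightarrow> j \<ge> N \<Longrightarrow> n (\<lambda>x. s i x - s j x) < e"
proof -
  from assms obtain N where "\<forall>i\<ge>N. \<forall>j\<ge>N. n (\<lambda>x. s i x - s j x) < e" unfolding ncauchy_def by metis
  then show ?thesis using that[of N] by simp
qed

definition closable :: "(('n::finite) tf \<Rightarrow> real) \<Rightarrow> bool" where
  "closable n \<longleftrightarrow> (\<forall>s. (\<forall>j. s j \<in> S) \<longrightarrow> ncauchy n s \<longrightarrow>
     (\<forall>\<psi>\<in>S. (\<lambda>j. LINT x|lborel. s j x * \<psi> x) \<longlonglongrightarrow> 0) \<longrightarrow> (\<lambda>j. n (s j)) \<longlonglongrightarrow> 0)"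

text \<open>The norms on the test space that arise by restricting the norm of a TMIB space. Closability says
  that the completion still embeds into the ultradistributions.\<close>

definition tnorm :: "(('n::finite) tf \<Rightarrow> real) \<Rightarrow> bool" where
  "tnorm n \<longleftrightarrow> gsn n \<and> cls k (pair_bound n) \<and> closable n \<and> cls k (mod_bound n)"

lemma tnorm_gsn: "tnorm n \<Longrightarrow> gsn n" by (simp add: tnorm_def)

section \<open>Test functions as ultradistributions\<close>

abbreviation em :: "('n::finite) tf \<Rightarrow> 'n ud" where "em \<equiv> emb k M A"

lemma em_S: "\<psi> \<in> S \<Longrightarrow> em \<phi> \<psi> = (LINT x|lborel. \<phi> x * \<psi> x)"
  and em_out: "\<psi> \<notin> S \<Longrightarrow> em \<phi> \<psi> = 0"
  by (auto simp: emb_def)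

lemma em_add: assumes "\<phi> \<in> S" "\<psi> \<in> S" shows "em (\<lambda>x. \<phi> x + \<psi> x) = uadd (em \<phi>) (em \<psi>)"
proof
  fix \<rho> show "em (\<lambda>x. \<phi> x + \<psi> x) \<rho> = uadd (em \<phi>) (em \<psi>) \<rho>"
    using assms by (cases "\<rho> \<in> S") (auto simp: emb_def uadd_def distrib_right S_integrable_mult)
qed

lemma em_scale: "em (\<lambda>x. a * \<phi> x) = uscale a (em \<phi>)"
  by (auto simp: emb_def uscale_def fun_eq_iff mult.assoc)

lemma em_diff: assumes "\<phi> \<in> S" "\<psi> \<in> S" shows "em (\<lambda>x. \<phi> x - \<psi> x) = udiff (em \<phi>) (em \<psi>)"
proof
  fix \<rho> show "em (\<lambda>x. \<phi> x - \<psi> x) \<rho> = udiff (em \<phi>) (em \<psi>) \<rho>"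
    using assms by (cases "\<rho> \<in> S") (auto simp: emb_def udiff_def left_diff_distrib S_integrable_mult)
qed

lemma em_trans: "utrans k M A x (em \<phi>) = em (\<lambda>z. \<phi> (z - x))"
proof
  fix \<psi> show "utrans k M A x (em \<phi>) \<psi> = em (\<lambda>z. \<phi> (z - x)) \<psi>"
  proof (cases "\<psi> \<in> S")
    case True
    have "(LINT z|lborel. \<phi> (x + z - x) * \<psi> (x + z)) = (LINT z|lborel. \<phi> (z - x) * \<psi> z)"
      by (rule lborel_integrable_shift(2)[of "\<lambda>z. \<phi> (z - x) * \<psi> z" x])
    then show ?thesis using True S_trans[OF True, of x] by (simp add: utrans_def emb_def add.commute)
  qed (simp add: utrans_def emb_def)
qed

lemma em_mod: "umod k M A \<xi> (em \<phi>) = em (\<lambda>z. chr \<xi> z * \<phi> z)"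
proof
  fix \<psi> show "umod k M A \<xi> (em \<phi>) \<psi> = em (\<lambda>z. chr \<xi> z * \<phi> z) \<psi>"
    unfolding umod_def chr_def[symmetric] using S_chr[of \<psi> \<xi>] by (cases "\<psi> \<in> S") (simp_all add: emb_def mult_ac)
qed

lemma em_mult: "\<theta> \<in> S \<Longrightarrow> umult k M A (em \<phi>) \<theta> = em (\<lambda>z. \<phi> z * \<theta> z)"
proof
  fix \<psi> assume "\<theta> \<in> S" then show "umult k M A (em \<phi>) \<theta> \<psi> = em (\<lambda>z. \<phi> z * \<theta> z) \<psi>"
    using S_mult[of \<theta> \<psi>] by (cases "\<psi> \<in> S") (auto simp: umult_def emb_def mult_ac)
qed

lemma em_UD: assumes "\<phi> \<in> S" shows "em \<phi> \<in> UD k M A"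
proof -
  have c: "GS_cont k M A (\<lambda>\<psi>. cmod (em \<phi> \<psi>))"
    unfolding GS_cont_iff
  proof -
    have "cls k (\<lambda>h. True)" by (cases k) (auto simp: cls_def intro: exI[of _ 1])
    then show "cls k (\<lambda>h. \<exists>C. \<forall>\<psi>\<in>S \<inter> GSh M A h. cmod (em \<phi> \<psi>) \<le> C * GSnorm M A h \<psi>)"
    proof (rule cls_mono)
      fix h :: real assume h: "h > 0"
      have "cmod (em \<phi> \<psi>) \<le> (LINT x|lborel. cmod (\<phi> x)) * GSnorm M A h \<psi>" if "\<psi> \<in> S \<inter> GSh M A h" for \<psi>
      proof -
        have \<psi>: "\<psi> \<in> S" "\<psi> \<in> GSh M A h" using that by auto
        have b: "cmod (\<psi> x) \<le> GSnorm M A h \<psi>" for x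
          using GSh_bound[OF h \<psi>(2), of x] wt_le_1[OF sA, of h x] GSnorm_nonneg[OF h \<psi>(2)] by (meson mult_left_le order_trans)
        have "cmod (em \<phi> \<psi>) \<le> (LINT x|lborel. cmod (\<phi> x * \<psi> x))"
          unfolding em_S[OF \<psi>(1)] by (rule integral_norm_bound)
        also have "\<dots> \<le> (LINT x|lborel. cmod (\<phi> x) * GSnorm M A h \<psi>)"
          using S_integrable[OF assms] b
          by (intro integral_mono integrable_norm S_integrable_mult assms \<psi>) (auto simp: norm_mult mult_left_mono)
        finally show ?thesis by simp
      qed
      then show "\<exists>C. \<forall>\<psi>\<in>S \<inter> GSh M A h. cmod (em \<phi> \<psi>) \<le> C * GSnorm M A h \<psi>" by blast
    qed
  qed
  show ?thesis unfolding UD_def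
    using c S_add S_scale by (auto simp: emb_def distrib_left S_integrable_mult[OF assms] mult.left_commute)
qed

lemma pair_bound_up: assumes "gsn n" "0 < h" "h \<le> h'" "pair_bound n h" shows "pair_bound n h'"
proof -
  obtain C where C: "C \<ge> 0" "\<And>\<phi> \<psi>. \<phi> \<in> S \<Longrightarrow> \<psi> \<in> S \<inter> GSh M A h \<Longrightarrow> cmod (LINT x|lborel. \<phi> x * \<psi> x) \<le> C * GSnorm M A h \<psi> * n \<phi>"
    using assms(4) by (auto simp: pair_bound_def)
  have "cmod (LINT x|lborel. \<phi> x * \<psi> x) \<le> C * GSnorm M A h' \<psi> * n \<phi>" if "\<phi> \<in> S" "\<psi> \<in> S \<inter> GSh M A h'" for \<phi> \<psi>
  proof -
    note m = GSh_mono[OF assms(2,3), of \<psi>]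
    have "cmod (LINT x|lborel. \<phi> x * \<psi> x) \<le> C * GSnorm M A h \<psi> * n \<phi>" using that m by (intro C(2)) auto
    also have "\<dots> \<le> C * GSnorm M A h' \<psi> * n \<phi>"
      using m that C(1) gsn_nonneg[OF assms(1) that(1)] by (intro mult_right_mono mult_left_mono) auto
    finally show ?thesis .
  qed
  then show ?thesis using C(1) unfolding pair_bound_def by blast
qed

lemma GSnorm_0_imp: assumes "h > 0" "\<phi> \<in> GSh M A h" "GSnorm M A h \<phi> = 0" shows "\<phi> = (\<lambda>x. 0)"
proof
  fix x show "\<phi> x = 0" using GSh_bound[OF assms(1,2), of x] assms(3) by simp
qed

text \<open>A pairing that is bounded on bounded sets is continuous; in the Beurling case the negation of
  continuity produces a bounded sequence on which the pairing is unbounded.\<close>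

lemma pair_bound_of_bounded:
  fixes n :: "('n::finite) tf \<Rightarrow> real"
  assumes n: "\<And>\<phi>. \<phi> \<in> S \<Longrightarrow> n \<phi> \<ge> 0"
    and B: "\<And>B. GS_bounded k M A B \<Longrightarrow> \<exists>C. \<forall>\<phi>\<in>S. \<forall>\<psi>\<in>B. cmod (LINT x|lborel. \<phi> x * \<psi> x) \<le> C * n \<phi>"
  shows "cls k (pair_bound n)"
proof (cases k)
  case Roumieu
  have "pair_bound n h" if h: "h > 0" for h
  proof -
    let ?B = "{\<psi> \<in> S \<inter> GSh M A h. GSnorm M A h \<psi> \<le> 1}"
    have "GS_bounded k M A ?B"
      unfolding GS_bounded_def using Roumieu h by (auto intro!: exI[of _ h] bdd_aboveI[of _ 1])
    from B[OF this] obtain C where C: "\<And>\<phi> \<psi>. \<phi> \<in> S \<Longrightarrow> \<psi> \<in> ?B \<Longrightarrow> cmod (LINT x|lborel. \<phi> x * \<psi> x) \<le> C * n \<phi>"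
      by blast
    have "cmod (LINT x|lborel. \<phi> x * \<psi> x) \<le> max C 0 * GSnorm M A h \<psi> * n \<phi>" if \<phi>: "\<phi> \<in> S" and \<psi>: "\<psi> \<in> S \<inter> GSh M A h" for \<phi> \<psi>
    proof (cases "GSnorm M A h \<psi> = 0")
      case True
      have \<psi>0: "\<psi> = (\<lambda>x. 0)" using GSnorm_0_imp[OF h _ True] \<psi> by blast
      have "(LINT x|lborel. \<phi> x * \<psi> x) = 0" unfolding \<psi>0 by simp
      then show ?thesis using True by simp
    next
      case False
      let ?g = "GSnorm M A h \<psi>"
      have g: "?g > 0" using False GSnorm_nonneg[OF h, of \<psi>] \<psi> by auto
      let ?a = "complex_of_real (1 / ?g)"
      have "(\<lambda>x. ?a * \<psi> x) \<in> ?B"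
        using GSh_scale[OF h, of \<psi> ?a] S_scale[of \<psi> ?a] \<psi> g by (auto simp: norm_divide)
      from C[OF \<phi> this] have "cmod (?a * (LINT x|lborel. \<phi> x * \<psi> x)) \<le> C * n \<phi>"
        by (simp add: mult.left_commute[of _ ?a] del: of_real_divide)
      also have "\<dots> \<le> max C 0 * n \<phi>" using n[OF \<phi>] by (intro mult_right_mono) auto
      finally show ?thesis using g by (simp add: norm_mult norm_divide field_simps)
    qed
    then show ?thesis unfolding pair_bound_def by (intro exI[of _ "max C 0"]) auto
  qed
  then show ?thesis using Roumieu by (simp add: cls_def)
next
  case Beurling
  have SG: "\<phi> \<in> GSh M A h" if "\<phi> \<in> S" "h > 0" for \<phi> :: "'n tf" and h using that Beurling by (auto simp: GS_def)
  show ?thesis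
  proof (rule ccontr)
    assume neg: "\<not> ?thesis"
    have ex: "\<exists>\<phi> \<psi>. \<phi> \<in> S \<and> \<psi> \<in> S \<and> cmod (LINT x|lborel. \<phi> x * \<psi> x) > real (Suc m) * GSnorm M A (real (Suc m)) \<psi> * n \<phi>" for m
    proof -
      have "\<not> pair_bound n (real (Suc m))" using neg Beurling by (auto simp: cls_def)
      then have "\<not> (\<forall>\<phi>\<in>S. \<forall>\<psi>\<in>S \<inter> GSh M A (real (Suc m)). cmod (LINT x|lborel. \<phi> x * \<psi> x) \<le> real (Suc m) * GSnorm M A (real (Suc m)) \<psi> * n \<phi>)"
        unfolding pair_bound_def using of_nat_0_le_iff by blast
      then show ?thesis by (auto simp: not_le)
    qed
    then have "\<forall>m. \<exists>p. fst p \<in> S \<and> snd p \<in> S \<and> cmod (LINT x|lborel. fst p x * snd p x) > real (Suc m) * GSnorm M A (real (Suc m)) (snd p) * n (fst p)"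
      by simp
    from choice[OF this] obtain p where p: "\<forall>m. fst (p m) \<in> S \<and> snd (p m) \<in> S \<and>
      cmod (LINT x|lborel. fst (p m) x * snd (p m) x) > real (Suc m) * GSnorm M A (real (Suc m)) (snd (p m)) * n (fst (p m))" ..
    define \<phi> where "\<phi> = (\<lambda>m. fst (p m))"
    define \<psi> where "\<psi> = (\<lambda>m. snd (p m))"
    have fp: "\<And>m. \<phi> m \<in> S" "\<And>m. \<psi> m \<in> S"
      "\<And>m. cmod (LINT x|lborel. \<phi> m x * \<psi> m x) > real (Suc m) * GSnorm M A (real (Suc m)) (\<psi> m) * n (\<phi> m)"
      using p by (simp_all add: \<phi>_def \<psi>_def)
    define g where "g = (\<lambda>m. GSnorm M A (real (Suc m)) (\<psi> m))"
    have g: "g m > 0" for m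
    proof -
      have p: "\<psi> m \<in> GSh M A (real (Suc m))" by (rule SG[OF fp(2)]) simp
      have "g m \<noteq> 0"
      proof
        assume "g m = 0"
        then have z: "\<psi> m = (\<lambda>x. 0)" using GSnorm_0_imp[OF _ p] by (simp add: g_def)
        show False using fp(3)[of m] \<open>g m = 0\<close>[unfolded g_def] by (simp add: z)
      qed
      then show ?thesis using GSnorm_nonneg[OF _ p] by (simp add: g_def less_le)
    qed
    define \<rho> where "\<rho> = (\<lambda>m x. complex_of_real (1 / g m) * \<psi> m x)"
    have \<rho>: "\<rho> m \<in> S" for m unfolding \<rho>_def by (intro S_scale fp)
    have eg: "GSnorm M A (real (Suc m)) (\<psi> m) = g m" for m by (simp add: g_def)
    have \<rho>1: "GSnorm M A (real (Suc m)) (\<rho> m) \<le> 1" for m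
      using GSh_scale[OF _ SG[OF fp(2)], of "real (Suc m)" "complex_of_real (1 / g m)" m] g[of m]
      by (simp add: \<rho>_def norm_divide eg del: of_nat_Suc)
    \<comment> \<open>The norms increase with the level and the m-th function is normalised at level
      m + 1. At a fixed level h the bound 1 can therefore fail only for the finitely many m below
      h.\<close>
    have "GS_bounded k M A (range \<rho>)"
    proof -
      have "bdd_above (GSnorm M A h ` range \<rho>)" if h: "h > 0" for h
      proof -
        define m0 where "m0 = nat \<lceil>h\<rceil>"
        have "GSnorm M A h (\<rho> m) \<le> 1" if "m \<ge> m0" for m
        proof -
          have "h \<le> real (Suc m)" using that by (simp add: m0_def)
          then have "GSnorm M A h (\<rho> m) \<le> GSnorm M A (real (Suc m)) (\<rho> m)"
            by (intro GSh_mono(2)[OF h] SG[OF \<rho>]) auto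
          then show ?thesis using \<rho>1[of m] by linarith
        qed
        then have "GSnorm M A h (\<rho> m) \<in> (\<lambda>m. GSnorm M A h (\<rho> m)) ` {..<m0} \<union> {..1}" for m
          by (cases "m < m0") auto
        then have "GSnorm M A h ` range \<rho> \<subseteq> (\<lambda>m. GSnorm M A h (\<rho> m)) ` {..<m0} \<union> {..1}" by blast
        moreover have "bdd_above ((\<lambda>m. GSnorm M A h (\<rho> m)) ` {..<m0} \<union> {..1})" by simp
        ultimately show ?thesis by (rule bdd_above_mono[rotated])
      qed
      then show ?thesis using \<rho> Beurling unfolding GS_bounded_def by auto
    qed
    from B[OF this] obtain C where C: "\<And>\<phi> m. \<phi> \<in> S \<Longrightarrow> cmod (LINT x|lborel. \<phi> x * \<rho> m x) \<le> C * n \<phi>" by blast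
    obtain m where m: "C \<le> real (Suc m)" using real_arch_simple[of C] by (metis le_SucI of_nat_le_iff order_trans order_refl)
    have "real (Suc m) * n (\<phi> m) < cmod (LINT x|lborel. \<phi> m x * \<rho> m x)"
    proof -
      have "(LINT x|lborel. \<phi> m x * \<rho> m x) = complex_of_real (1 / g m) * (LINT x|lborel. \<phi> m x * \<psi> m x)"
        unfolding \<rho>_def by (simp add: mult.left_commute[of _ "complex_of_real (1 / g m)"] del: of_real_divide)
      then have e: "cmod (LINT x|lborel. \<phi> m x * \<rho> m x) = cmod (LINT x|lborel. \<phi> m x * \<psi> m x) / g m"
        using g[of m] by (simp add: norm_mult norm_divide)
      show ?thesis unfolding e using fp(3)[of m, unfolded eg] g[of m] by (simp add: pos_less_divide_eq mult_ac del: of_nat_Suc)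
    qed
    also have "\<dots> \<le> C * n (\<phi> m)" by (rule C[OF fp(1)])
    also have "\<dots> \<le> real (Suc m) * n (\<phi> m)" using m n[OF fp(1)] by (intro mult_right_mono) auto
    finally show False by simp
  qed
qed

lemma GS_bounded_single: assumes "\<psi> \<in> S" shows "GS_bounded k M A {\<psi>}"
  using assms GS_GSh[OF assms] by (cases k) (auto simp: GS_bounded_def)

lemma banach_sub_complete:
  assumes "banach_sub E nE" "\<forall>m. s m \<in> E" "\<forall>e>0. \<exists>N. \<forall>m\<ge>N. \<forall>n\<ge>N. nE (udiff (s m) (s n)) < e"
  shows "\<exists>u\<in>E. (\<lambda>m. nE (udiff (s m) u)) \<longlonglongrightarrow> 0"
proof -
  have "\<forall>s. (\<forall>m. s m \<in> E) \<longrightarrow> (\<forall>e>0. \<exists>N. \<forall>m\<ge>N. \<forall>n\<ge>N. nE (udiff (s m) (s n)) < e)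
            \<longrightarrow> (\<exists>u\<in>E. (\<lambda>m. nE (udiff (s m) u)) \<longlonglongrightarrow> 0)"
    using assms(1) unfolding banach_sub_def by (elim conjE)
  from mp[OF mp[OF spec[OF this] assms(2)] assms(3)] show ?thesis .
qed

text \<open>The point is closability. A Cauchy sequence has a limit u in E by completeness;
  convergence in E implies weak convergence, as singletons are bounded sets, so a weak limit 0
  forces u = 0 and the norms tend to 0.\<close>

theorem TMIB_tnorm:
  fixes E :: "('n::finite) ud set"
  assumes T: "TMIB k M A E nE"
  shows "tnorm (\<lambda>\<phi>. nE (em \<phi>))"
proof -
  let ?n = "\<lambda>\<phi>. nE (em \<phi>)"
  have b: "banach_sub E nE" and sub: "\<And>\<phi>. \<phi> \<in> S \<Longrightarrow> em \<phi> \<in> E" and EU: "E \<subseteq> UD k M A"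
    and gc: "GS_cont k M A ?n"
    and bd: "\<And>B. GS_bounded k M A B \<Longrightarrow> \<exists>C. \<forall>u\<in>E. \<forall>\<phi>\<in>B. cmod (u \<phi>) \<le> C * nE u"
    and cl: "cls k (\<lambda>\<tau>. \<exists>C>0. \<forall>u\<in>E. \<forall>x.
          nE (utrans k M A x u) \<le> C * exp (assoc A (\<tau> * norm x)) * nE u
        \<and> nE (umod k M A (- x) u) \<le> C * exp (assoc M (\<tau> * norm x)) * nE u)"
    using T by (auto simp: TMIB_def)
  have nn: "?n \<phi> \<ge> 0" if "\<phi> \<in> S" for \<phi> using b sub[OF that] by (auto simp: banach_sub_def)
  have g: "gsn ?n"
    unfolding gsn_def using b sub gc nn by (auto simp: banach_sub_def em_add em_scale)
  have p: "cls k (pair_bound ?n)"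
  proof (rule pair_bound_of_bounded[OF nn])
    fix B :: "'n tf set" assume B: "GS_bounded k M A B"
    from bd[OF this] obtain C where C: "\<And>u \<psi>. u \<in> E \<Longrightarrow> \<psi> \<in> B \<Longrightarrow> cmod (u \<psi>) \<le> C * nE u" by blast
    have "B \<subseteq> S" using B by (simp add: GS_bounded_def)
    then have "cmod (LINT x|lborel. \<phi> x * \<psi> x) \<le> C * ?n \<phi>" if "\<phi> \<in> S" "\<psi> \<in> B" for \<phi> \<psi>
      using C[OF sub[OF that(1)] that(2)] that by (auto simp: em_S)
    then show "\<exists>C. \<forall>\<phi>\<in>S. \<forall>\<psi>\<in>B. cmod (LINT x|lborel. \<phi> x * \<psi> x) \<le> C * ?n \<phi>" by blast
  qed
  have c: "closable ?n"
    unfolding closable_def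
  proof (intro allI impI)
    fix s assume s: "\<forall>j. s j \<in> S" and ca: "ncauchy ?n s" and w: "\<forall>\<psi>\<in>S. (\<lambda>j. LINT x|lborel. s j x * \<psi> x) \<longlonglongrightarrow> 0"
    have "\<forall>e>0. \<exists>N. \<forall>m\<ge>N. \<forall>n\<ge>N. nE (udiff (em (s m)) (em (s n))) < e"
      using ca s unfolding ncauchy_def by (simp add: em_diff)
    moreover have "\<forall>m. em (s m) \<in> E" using sub s by auto
    ultimately obtain u where u: "u \<in> E" "(\<lambda>m. nE (udiff (em (s m)) u)) \<longlonglongrightarrow> 0"
      using banach_sub_complete[OF b, of "\<lambda>m. em (s m)"] by auto
    have dE: "udiff (em (s m)) u \<in> E" for m
    proof -
      have "udiff (em (s m)) u = uadd (em (s m)) (uscale (- 1) u)" by (simp add: udiff_def uadd_def uscale_def)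
      then show ?thesis using b u sub s by (auto simp: banach_sub_def)
    qed
    have "u \<psi> = 0" for \<psi>
    proof (cases "\<psi> \<in> S")
      case True
      from bd[OF GS_bounded_single[OF True]] obtain C where C: "\<And>u. u \<in> E \<Longrightarrow> cmod (u \<psi>) \<le> C * nE u" by blast
      have "(\<lambda>m. udiff (em (s m)) u \<psi>) \<longlonglongrightarrow> 0"
        by (rule Lim_null_comparison[OF always_eventually[OF allI[OF C[OF dE]]] tendsto_mult_right_zero[OF u(2)]])
      moreover have "(\<lambda>m. udiff (em (s m)) u \<psi>) \<longlonglongrightarrow> 0 - u \<psi>"
        unfolding udiff_def em_S[OF True] using w True by (intro tendsto_intros) auto
      ultimately show ?thesis using LIMSEQ_unique by fastforce
    next
      case False then show ?thesis using EU u(1) by (auto simp: UD_def)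
    qed
    then have "udiff (em (s m)) u = em (s m)" for m by (simp add: udiff_def)
    then show "(\<lambda>j. ?n (s j)) \<longlonglongrightarrow> 0" using u(2) by simp
  qed
  have m: "cls k (mod_bound ?n)"
    using cl
  proof (rule cls_mono)
    fix \<tau> :: real assume "\<exists>C>0. \<forall>u\<in>E. \<forall>x.
          nE (utrans k M A x u) \<le> C * exp (assoc A (\<tau> * norm x)) * nE u
        \<and> nE (umod k M A (- x) u) \<le> C * exp (assoc M (\<tau> * norm x)) * nE u"
    then obtain C where C: "C > 0" "\<And>u x. u \<in> E \<Longrightarrow> nE (utrans k M A x u) \<le> C * ea A (\<tau> * norm x) * nE u
        \<and> nE (umod k M A (- x) u) \<le> C * ea M (\<tau> * norm x) * nE u" unfolding ea_def by blast
    have "?n (\<lambda>z. \<phi> (z - x)) \<le> C * ea A (\<tau> * norm x) * ?n \<phi> \<and> ?n (\<lambda>z. chr x z * \<phi> z) \<le> C * ea M (\<tau> * norm x) * ?n \<phi>" if "\<phi> \<in> S" for \<phi> x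
      using C(2)[OF sub[OF that], of x] C(2)[OF sub[OF that], of "- x"] by (simp add: em_trans em_mod)
    then show "mod_bound ?n \<tau>" using C(1) unfolding mod_bound_def by blast
  qed
  show ?thesis using g p c m by (simp add: tnorm_def)
qed

text \<open>Elements of the completion are realised directly as functionals, namely as weak limits
  of Cauchy sequences of test functions. Vanishing off the test space is the normalisation built
  into \<open>UD\<close>.\<close>

definition appr :: "(('n::finite) tf \<Rightarrow> real) \<Rightarrow> (nat \<Rightarrow> 'n tf) \<Rightarrow> 'n ud \<Rightarrow> bool" where
  "appr n s u \<longleftrightarrow> (\<forall>j. s j \<in> S) \<and> ncauchy n s \<and> (\<forall>\<psi>\<in>S. (\<lambda>j. LINT x|lborel. s j x * \<psi> x) \<longlonglongrightarrow> u \<psi>)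
     \<and> (\<forall>\<psi>. \<psi> \<notin> S \<longrightarrow> u \<psi> = 0)"

definition compl :: "(('n::finite) tf \<Rightarrow> real) \<Rightarrow> 'n ud set" where
  "compl n = {u. \<exists>s. appr n s u}"

definition cnorm :: "(('n::finite) tf \<Rightarrow> real) \<Rightarrow> 'n ud \<Rightarrow> real" where
  "cnorm n u = lim (\<lambda>j. n ((SOME s. appr n s u) j))"

lemma ncauchy_lin:
  assumes n: "gsn n" and s: "\<And>j. s j \<in> S" "\<And>j. t j \<in> S" "ncauchy n s" "ncauchy n t"
  shows "ncauchy n (\<lambda>j x. a * s j x + b * t j x)"
  unfolding ncauchy_def
proof (intro allI impI)
  fix e :: real assume e: "e > 0"
  define d where "d = e / (2 * (cmod a + cmod b + 1))"
  have p: "2 * (cmod a + cmod b + 1) > 0" by (intro mult_pos_pos add_nonneg_pos add_nonneg_nonneg) auto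
  have d: "d > 0" using e p by (simp add: d_def)
  obtain N1 N2 where N: "\<And>i j. i \<ge> N1 \<Longrightarrow> j \<ge> N1 \<Longrightarrow> n (\<lambda>x. s i x - s j x) < d" "\<And>i j. i \<ge> N2 \<Longrightarrow> j \<ge> N2 \<Longrightarrow> n (\<lambda>x. t i x - t j x) < d"
    using s(3,4) d unfolding ncauchy_def by metis
  have "n (\<lambda>x. (a * s i x + b * t i x) - (a * s j x + b * t j x)) < e" if "i \<ge> max N1 N2" "j \<ge> max N1 N2" for i j
  proof -
    have "(\<lambda>x. (a * s i x + b * t i x) - (a * s j x + b * t j x)) = (\<lambda>x. a * (s i x - s j x) + b * (t i x - t j x))"
      by (simp add: algebra_simps)
    then have "n (\<lambda>x. (a * s i x + b * t i x) - (a * s j x + b * t j x)) \<le> cmod a * n (\<lambda>x. s i x - s j x) + cmod b * n (\<lambda>x. t i x - t j x)"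
      using gsn_add[OF n S_scale[OF S_diff[OF s(1) s(1)]] S_scale[OF S_diff[OF s(2) s(2)]], of a i j b i j]
      by (simp add: gsn_scale[OF n S_diff[OF s(1) s(1)]] gsn_scale[OF n S_diff[OF s(2) s(2)]])
    also have "\<dots> \<le> cmod a * d + cmod b * d" using that by (intro add_mono mult_left_mono less_imp_le[OF N(1)] less_imp_le[OF N(2)]) auto
    also have "\<dots> < 2 * (cmod a + cmod b + 1) * d"
    proof -
      have "cmod a * d + cmod b * d \<ge> 0" using d by simp
      moreover have "2 * (cmod a + cmod b + 1) * d = 2 * (cmod a * d + cmod b * d) + 2 * d" by (simp add: algebra_simps)
      ultimately show ?thesis using d by (smt (verit))
    qed
    also have "\<dots> = e" using p by (simp add: d_def)
    finally show ?thesis .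
  qed
  then show "\<exists>N. \<forall>i\<ge>N. \<forall>j\<ge>N. n (\<lambda>x. (a * s i x + b * t i x) - (a * s j x + b * t j x)) < e" by blast
qed

lemma appr_lin:
  assumes n: "gsn n" and "appr n s u" "appr n t v"
  shows "appr n (\<lambda>j x. a * s j x + b * t j x) (\<lambda>\<psi>. a * u \<psi> + b * v \<psi>)"
proof -
  have s: "\<And>j. s j \<in> S" "ncauchy n s" "\<And>\<psi>. \<psi> \<in> S \<Longrightarrow> (\<lambda>j. LINT x|lborel. s j x * \<psi> x) \<longlonglongrightarrow> u \<psi>" "\<And>\<psi>. \<psi> \<notin> S \<Longrightarrow> u \<psi> = 0"
    and t: "\<And>j. t j \<in> S" "ncauchy n t" "\<And>\<psi>. \<psi> \<in> S \<Longrightarrow> (\<lambda>j. LINT x|lborel. t j x * \<psi> x) \<longlonglongrightarrow> v \<psi>" "\<And>\<psi>. \<psi> \<notin> S \<Longrightarrow> v \<psi> = 0"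
    using assms by (auto simp: appr_def)
  have "(\<lambda>j. LINT x|lborel. (a * s j x + b * t j x) * \<psi> x) \<longlonglongrightarrow> a * u \<psi> + b * v \<psi>" if \<psi>: "\<psi> \<in> S" for \<psi>
  proof -
    have "(LINT x|lborel. (a * s j x + b * t j x) * \<psi> x) = a * (LINT x|lborel. s j x * \<psi> x) + b * (LINT x|lborel. t j x * \<psi> x)" for j
      using S_integrable_mult[OF s(1) \<psi>, of j] S_integrable_mult[OF t(1) \<psi>, of j] by (simp add: distrib_right mult.assoc)
    then show ?thesis using s(3)[OF \<psi>] t(3)[OF \<psi>] by (auto intro!: tendsto_intros)
  qed
  then show ?thesis unfolding appr_def
    using ncauchy_lin[OF n s(1) t(1) s(2) t(2)] s t S_add[OF S_scale[OF s(1)] S_scale[OF t(1)]] by auto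
qed

lemma appr_const: assumes "gsn n" "\<phi> \<in> S" shows "appr n (\<lambda>_. \<phi>) (em \<phi>)"
  using assms by (auto simp: appr_def ncauchy_def gsn_zero em_S em_out)

text \<open>The choice in \<open>cnorm\<close> is harmless: two sequences approximating the same u
  differ by a Cauchy sequence with weak limit 0, whose norms tend to 0 by closability.\<close>

lemma appr_cnorm:
  assumes t: "tnorm n" and a: "appr n s u"
  shows "(\<lambda>j. n (s j)) \<longlonglongrightarrow> cnorm n u"
proof -
  have n: "gsn n" and cl: "closable n" using t by (auto simp: tnorm_def)
  have conv: "convergent (\<lambda>j. n (s j))" if "appr n s u" for s
    unfolding Cauchy_convergent_iff[symmetric] Cauchy_def
  proof (intro allI impI)
    have s: "\<And>j. s j \<in> S" "ncauchy n s" using that by (auto simp: appr_def)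
    fix e :: real assume "e > 0"
    then obtain N where N: "\<forall>i\<ge>N. \<forall>j\<ge>N. n (\<lambda>x. s i x - s j x) < e" using s(2) by (auto simp: ncauchy_def)
    have "\<bar>n (s i) - n (s j)\<bar> < e" if "i \<ge> N" "j \<ge> N" for i j
      using N that gsn_diff(2)[OF n s(1) s(1), of i j] by (meson le_less_trans)
    then show "\<exists>N. \<forall>i\<ge>N. \<forall>j\<ge>N. dist (n (s i)) (n (s j)) < e" by (auto simp: dist_real_def)
  qed
  define t where "t = (SOME s. appr n s u)"
  have at: "appr n t u" unfolding t_def by (rule someI[of "\<lambda>s. appr n s u", OF a])
  have s: "\<And>j. s j \<in> S" "\<And>j. t j \<in> S" using a at by (auto simp: appr_def)
  have "appr n (\<lambda>j x. 1 * s j x + (- 1) * t j x) (\<lambda>\<psi>. 1 * u \<psi> + (- 1) * u \<psi>)" by (rule appr_lin[OF n a at])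
  then have "(\<lambda>j. n (\<lambda>x. 1 * s j x + (- 1) * t j x)) \<longlonglongrightarrow> 0"
    using cl unfolding closable_def appr_def by auto
  then have d: "(\<lambda>j. n (\<lambda>x. s j x - t j x)) \<longlonglongrightarrow> 0" by simp
  have "(\<lambda>j. n (s j) - n (t j)) \<longlonglongrightarrow> 0"
    by (rule Lim_null_comparison[OF _ d]) (use gsn_diff(2)[OF n s(1) s(2)] in auto)
  moreover have "(\<lambda>j. n (t j)) \<longlonglongrightarrow> cnorm n u"
    unfolding cnorm_def t_def[symmetric] using conv[OF at] by (simp add: convergent_LIMSEQ_iff)
  ultimately have "(\<lambda>j. (n (s j) - n (t j)) + n (t j)) \<longlonglongrightarrow> 0 + cnorm n u" by (rule tendsto_add)
  then show ?thesis by simp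
qed

lemma cnorm_em: "tnorm n \<Longrightarrow> \<phi> \<in> S \<Longrightarrow> cnorm n (em \<phi>) = n \<phi>"
  using appr_cnorm[OF _ appr_const[OF tnorm_gsn]] LIMSEQ_unique tendsto_const by metis

lemma cnorm_le:
  assumes t: "tnorm n" and a: "appr n s u" "appr n s' v" and le: "\<And>j. n (s' j) \<le> K * n (s j)"
  shows "cnorm n v \<le> K * cnorm n u"
proof (rule LIMSEQ_le[OF appr_cnorm[OF t a(2)]])
  show "(\<lambda>j. K * n (s j)) \<longlonglongrightarrow> K * cnorm n u" by (intro tendsto_intros appr_cnorm t a)
qed (use le in auto)

lemma compl_bound:
  assumes t: "tnorm n" and u: "u \<in> compl n" and C: "\<And>\<phi>. \<phi> \<in> S \<Longrightarrow> cmod (LINT x|lborel. \<phi> x * \<psi> x) \<le> C * n \<phi>" and \<psi>: "\<psi> \<in> S"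
  shows "cmod (u \<psi>) \<le> C * cnorm n u"
proof -
  obtain s where s: "appr n s u" using u by (auto simp: compl_def)
  show ?thesis
  proof (rule LIMSEQ_le)
    show "(\<lambda>j. cmod (LINT x|lborel. s j x * \<psi> x)) \<longlonglongrightarrow> cmod (u \<psi>)" using s \<psi> by (intro tendsto_norm) (auto simp: appr_def)
    show "(\<lambda>j. C * n (s j)) \<longlonglongrightarrow> C * cnorm n u" by (intro tendsto_intros appr_cnorm t s)
  qed (use C s in \<open>auto simp: appr_def\<close>)
qed

lemma compl_bound_h:
  assumes t: "tnorm n" and h: "pair_bound n h"
  shows "\<exists>C\<ge>0. \<forall>u\<in>compl n. \<forall>\<psi>\<in>S \<inter> GSh M A h. cmod (u \<psi>) \<le> C * GSnorm M A h \<psi> * cnorm n u"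
proof -
  obtain C where C: "C \<ge> 0" "\<And>\<phi> \<psi>. \<phi> \<in> S \<Longrightarrow> \<psi> \<in> S \<inter> GSh M A h \<Longrightarrow> cmod (LINT x|lborel. \<phi> x * \<psi> x) \<le> C * GSnorm M A h \<psi> * n \<phi>"
    using h by (auto simp: pair_bound_def)
  have "cmod (u \<psi>) \<le> C * GSnorm M A h \<psi> * cnorm n u" if "u \<in> compl n" "\<psi> \<in> S \<inter> GSh M A h" for u \<psi>
    using that C(2) by (intro compl_bound[OF t]) auto
  then show ?thesis using C(1) by blast
qed

lemma compl_nonneg: "tnorm n \<Longrightarrow> u \<in> compl n \<Longrightarrow> cnorm n u \<ge> 0"
  unfolding compl_def by (auto intro!: LIMSEQ_le_const[OF appr_cnorm] simp: appr_def gsn_nonneg[OF tnorm_gsn])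

lemma pair_bound_point:
  assumes t: "tnorm n" and \<psi>: "\<psi> \<in> S"
  shows "\<exists>C\<ge>0. \<forall>\<phi>\<in>S. cmod (LINT x|lborel. \<phi> x * \<psi> x) \<le> C * n \<phi>"
proof -
  have "cls k (pair_bound n)" "dcl k (\<lambda>h. \<psi> \<in> GSh M A h)" using t \<psi> GS_iff by (auto simp: tnorm_def)
  from cls_meet[OF this] obtain h where h: "h > 0" "pair_bound n h" "\<psi> \<in> GSh M A h" by blast
  then obtain C where C: "C \<ge> 0" "\<forall>\<phi>\<in>S. cmod (LINT x|lborel. \<phi> x * \<psi> x) \<le> C * GSnorm M A h \<psi> * n \<phi>"
    using \<psi> unfolding pair_bound_def by blast
  then show ?thesis using GSnorm_nonneg[OF h(1,3)] by (intro exI[of _ "C * GSnorm M A h \<psi>"]) auto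
qed

lemma compl_UD: assumes t: "tnorm n" shows "compl n \<subseteq> UD k M A"
proof
  fix u assume u: "u \<in> compl n"
  then obtain s where s: "\<And>j. s j \<in> S" "\<And>\<psi>. \<psi> \<in> S \<Longrightarrow> (\<lambda>j. LINT x|lborel. s j x * \<psi> x) \<longlonglongrightarrow> u \<psi>" "\<And>\<psi>. \<psi> \<notin> S \<Longrightarrow> u \<psi> = 0"
    by (auto simp: compl_def appr_def)
  have add: "u (\<lambda>x. \<phi> x + \<psi> x) = u \<phi> + u \<psi>" if "\<phi> \<in> S" "\<psi> \<in> S" for \<phi> \<psi>
  proof (rule LIMSEQ_unique[OF s(2)[OF S_add[OF that]]])
    have "(\<lambda>j. (LINT x|lborel. s j x * \<phi> x) + (LINT x|lborel. s j x * \<psi> x)) \<longlonglongrightarrow> u \<phi> + u \<psi>" by (intro tendsto_intros s that)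
    then show "(\<lambda>j. LINT x|lborel. s j x * (\<phi> x + \<psi> x)) \<longlonglongrightarrow> u \<phi> + u \<psi>"
      using S_integrable_mult[OF s(1)] that by (simp add: distrib_left)
  qed
  have sc: "u (\<lambda>x. a * \<phi> x) = a * u \<phi>" if "\<phi> \<in> S" for a \<phi>
  proof (rule LIMSEQ_unique[OF s(2)[OF S_scale[OF that]]])
    have "(\<lambda>j. a * (LINT x|lborel. s j x * \<phi> x)) \<longlonglongrightarrow> a * u \<phi>" by (intro tendsto_intros s that)
    then show "(\<lambda>j. LINT x|lborel. s j x * (a * \<phi> x)) \<longlonglongrightarrow> a * u \<phi>" by (simp add: mult.left_commute)
  qed
  have "GS_cont k M A (\<lambda>\<psi>. cmod (u \<psi>))" unfolding GS_cont_iff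
  proof (rule cls_mono)
    show "cls k (pair_bound n)" using t by (simp add: tnorm_def)
    fix h :: real assume "pair_bound n h"
    from compl_bound_h[OF t this] u obtain C where "\<forall>\<psi>\<in>S \<inter> GSh M A h. cmod (u \<psi>) \<le> C * GSnorm M A h \<psi> * cnorm n u" by blast
    then show "\<exists>C. \<forall>\<psi>\<in>S \<inter> GSh M A h. cmod (u \<psi>) \<le> C * GSnorm M A h \<psi>"
      by (intro exI[of _ "C * cnorm n u"]) (simp add: mult_ac)
  qed
  then show "u \<in> UD k M A" using add sc s(3) by (auto simp: UD_def)
qed

lemma compl_lin:
  assumes t: "tnorm n" and "u \<in> compl n" "v \<in> compl n"
  shows "(\<lambda>\<psi>. a * u \<psi> + b * v \<psi>) \<in> compl n" 
    and "cnorm n (\<lambda>\<psi>. a * u \<psi> + b * v \<psi>) \<le> cmod a * cnorm n u + cmod b * cnorm n v"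
proof -
  obtain s s' where s: "appr n s u" "appr n s' v" using assms by (auto simp: compl_def)
  note n = tnorm_gsn[OF t]
  note l = appr_lin[OF n s, of a b]
  show "(\<lambda>\<psi>. a * u \<psi> + b * v \<psi>) \<in> compl n" using l by (auto simp: compl_def)
  have S: "\<And>j. s j \<in> S" "\<And>j. s' j \<in> S" using s by (auto simp: appr_def)
  show "cnorm n (\<lambda>\<psi>. a * u \<psi> + b * v \<psi>) \<le> cmod a * cnorm n u + cmod b * cnorm n v"
  proof (rule LIMSEQ_le[OF appr_cnorm[OF t l]])
    show "(\<lambda>j. cmod a * n (s j) + cmod b * n (s' j)) \<longlonglongrightarrow> cmod a * cnorm n u + cmod b * cnorm n v"
      by (intro tendsto_intros appr_cnorm t s)
    show "\<exists>N. \<forall>j\<ge>N. n (\<lambda>x. a * s j x + b * s' j x) \<le> cmod a * n (s j) + cmod b * n (s' j)"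
      using gsn_add[OF n S_scale[OF S(1)] S_scale[OF S(2)], of a _ b] by (auto simp: gsn_scale[OF n S(1)] gsn_scale[OF n S(2)])
  qed
qed

lemma udiff_lin: "udiff u v = (\<lambda>\<psi>. 1 * u \<psi> + (- 1) * v \<psi>)"
  and uadd_lin: "uadd u v = (\<lambda>\<psi>. 1 * u \<psi> + 1 * v \<psi>)"
  and uscale_lin: "uscale a u = (\<lambda>\<psi>. a * u \<psi> + 0 * u \<psi>)"
  by (simp_all add: udiff_def uadd_def uscale_def)

lemma em_compl: "tnorm n \<Longrightarrow> \<phi> \<in> S \<Longrightarrow> em \<phi> \<in> compl n"
  using appr_const[OF tnorm_gsn] by (auto simp: compl_def)

lemma udiff_compl: "tnorm n \<Longrightarrow> u \<in> compl n \<Longrightarrow> v \<in> compl n \<Longrightarrow> udiff u v \<in> compl n"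
  unfolding udiff_lin by (rule compl_lin(1))

lemma cnorm_udiff_sym: assumes "tnorm n" "u \<in> compl n" "v \<in> compl n" shows "cnorm n (udiff u v) = cnorm n (udiff v u)"
proof -
  have *: "cnorm n (udiff v u) \<le> cnorm n (udiff u v)" if "u \<in> compl n" "v \<in> compl n" for u v
  proof -
    have "udiff v u = (\<lambda>\<psi>. (- 1) * udiff u v \<psi> + 0 * udiff u v \<psi>)" by (simp add: udiff_def fun_eq_iff)
    then show ?thesis using compl_lin(2)[OF assms(1) udiff_compl[OF assms(1) that] udiff_compl[OF assms(1) that], of "- 1" 0] by simp
  qed
  show ?thesis using *[OF assms(2,3)] *[OF assms(3,2)] by simp
qed

lemma cnorm_tri:
  assumes t: "tnorm n" and "u \<in> compl n" "v \<in> compl n" "w \<in> compl n"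
  shows "cnorm n (udiff u w) \<le> cnorm n (udiff u v) + cnorm n (udiff v w)"
proof -
  have "udiff u w = (\<lambda>\<psi>. 1 * udiff u v \<psi> + 1 * udiff v w \<psi>)" by (simp add: udiff_def fun_eq_iff)
  then show ?thesis using compl_lin(2)[OF t udiff_compl[OF t assms(2,3)] udiff_compl[OF t assms(3,4)], of 1 1] by simp
qed

lemma appr_diff_small:
  assumes t: "tnorm n" and a: "appr n s u" and e: "e > 0"
  shows "\<exists>N. \<forall>m\<ge>N. cnorm n (udiff u (em (s m))) \<le> e"
proof -
  note n = tnorm_gsn[OF t]
  have S: "\<And>j. s j \<in> S" "ncauchy n s" using a by (auto simp: appr_def)
  obtain N where N: "\<And>i j. i \<ge> N \<Longrightarrow> j \<ge> N \<Longrightarrow> n (\<lambda>x. s i x - s j x) < e" by (rule ncauchyE[OF S(2) e]) blast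
  have "cnorm n (udiff u (em (s m))) \<le> e" if "m \<ge> N" for m
  proof -
    have "appr n (\<lambda>j x. 1 * s j x + (- 1) * s m x) (udiff u (em (s m)))"
      unfolding udiff_lin by (rule appr_lin[OF n a appr_const[OF n S(1)]])
    from appr_cnorm[OF t this] show ?thesis
      by (rule LIMSEQ_le_const2) (use N that in \<open>auto intro!: exI[of _ N] less_imp_le\<close>)
  qed
  then show ?thesis by blast
qed

text \<open>Each member of the sequence is replaced by a test function within 1 / (m + 1). The
  resulting sequence of test functions is Cauchy, and \<open>pair_bound_point\<close> makes its
  pairings converge; their limit is the required functional.\<close>

lemma compl_complete:
  assumes t: "tnorm n" and s: "\<And>m. s m \<in> compl n" 
    and ca: "\<And>e. e > 0 \<Longrightarrow> \<exists>N. \<forall>m\<ge>N. \<forall>j\<ge>N. cnorm n (udiff (s m) (s j)) < e"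
  shows "\<exists>u\<in>compl n. (\<lambda>m. cnorm n (udiff (s m) u)) \<longlonglongrightarrow> 0"
proof -
  note n = tnorm_gsn[OF t]
  have "\<exists>\<phi>. \<phi> \<in> S \<and> cnorm n (udiff (s m) (em \<phi>)) \<le> 1 / real (Suc m)" for m
  proof -
    obtain q where q: "appr n q (s m)" using s by (auto simp: compl_def)
    from appr_diff_small[OF t q, of "1 / real (Suc m)"] obtain N where "cnorm n (udiff (s m) (em (q N))) \<le> 1 / real (Suc m)" by auto
    then show ?thesis using q by (auto simp: appr_def)
  qed
  then obtain \<phi> where \<phi>: "\<And>m. \<phi> m \<in> S" "\<And>m. cnorm n (udiff (s m) (em (\<phi> m))) \<le> 1 / real (Suc m)" by metis
  note c = em_compl[OF t \<phi>(1)]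
  have small: "\<exists>N. \<forall>m\<ge>N. 1 / real (Suc m) < e" if "e > 0" for e
    using order_tendstoD(2)[OF LIMSEQ_Suc[OF lim_1_over_n] that] by (simp add: eventually_sequentially)
  have nc: "ncauchy n \<phi>" unfolding ncauchy_def
  proof (intro allI impI)
    fix e :: real assume e: "e > 0"
    obtain N1 where N1: "\<And>m. m \<ge> N1 \<Longrightarrow> 1 / real (Suc m) < e / 3" using small[of "e / 3"] e by auto
    obtain N2 where N2: "\<And>m j. m \<ge> N2 \<Longrightarrow> j \<ge> N2 \<Longrightarrow> cnorm n (udiff (s m) (s j)) < e / 3" using ca[of "e / 3"] e by auto
    have "n (\<lambda>x. \<phi> i x - \<phi> j x) < e" if "i \<ge> max N1 N2" "j \<ge> max N1 N2" for i j
    proof -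
      have "n (\<lambda>x. \<phi> i x - \<phi> j x) = cnorm n (udiff (em (\<phi> i)) (em (\<phi> j)))"
        using cnorm_em[OF t S_diff[OF \<phi>(1) \<phi>(1)], of i j] by (simp add: em_diff[OF \<phi>(1) \<phi>(1)])
      also have "\<dots> \<le> cnorm n (udiff (em (\<phi> i)) (s i)) + (cnorm n (udiff (s i) (s j)) + cnorm n (udiff (s j) (em (\<phi> j))))"
      proof -
        have "cnorm n (udiff (em (\<phi> i)) (em (\<phi> j))) \<le> cnorm n (udiff (em (\<phi> i)) (s i)) + cnorm n (udiff (s i) (em (\<phi> j)))"
          by (rule cnorm_tri[OF t c s c])
        moreover have "cnorm n (udiff (s i) (em (\<phi> j))) \<le> cnorm n (udiff (s i) (s j)) + cnorm n (udiff (s j) (em (\<phi> j)))"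
          by (rule cnorm_tri[OF t s s c])
        ultimately show ?thesis by linarith
      qed
      also have "cnorm n (udiff (em (\<phi> i)) (s i)) = cnorm n (udiff (s i) (em (\<phi> i)))" by (rule cnorm_udiff_sym[OF t c s])
      finally show ?thesis using \<phi>(2)[of i] \<phi>(2)[of j] N1[of i] N1[of j] N2[of i j] that by simp
    qed
    then show "\<exists>N. \<forall>i\<ge>N. \<forall>j\<ge>N. n (\<lambda>x. \<phi> i x - \<phi> j x) < e" by blast
  qed
  have conv: "convergent (\<lambda>j. LINT x|lborel. \<phi> j x * \<psi> x)" if \<psi>: "\<psi> \<in> S" for \<psi>
    unfolding Cauchy_convergent_iff[symmetric] Cauchy_def
  proof (intro allI impI)
    fix e :: real assume e: "e > 0"
    obtain C where C: "C \<ge> 0" "\<And>\<phi>. \<phi> \<in> S \<Longrightarrow> cmod (LINT x|lborel. \<phi> x * \<psi> x) \<le> C * n \<phi>" using pair_bound_point[OF t \<psi>] by blast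
    have eC: "e / (C + 1) > 0" using e C by simp
    obtain N where N: "\<And>i j. i \<ge> N \<Longrightarrow> j \<ge> N \<Longrightarrow> n (\<lambda>x. \<phi> i x - \<phi> j x) < e / (C + 1)" by (rule ncauchyE[OF nc eC]) blast
    have "dist (LINT x|lborel. \<phi> i x * \<psi> x) (LINT x|lborel. \<phi> j x * \<psi> x) < e" if "i \<ge> N" "j \<ge> N" for i j
    proof -
      have "dist (LINT x|lborel. \<phi> i x * \<psi> x) (LINT x|lborel. \<phi> j x * \<psi> x) = cmod (LINT x|lborel. (\<phi> i x - \<phi> j x) * \<psi> x)"
        using S_integrable_mult[OF \<phi>(1) \<psi>] by (simp add: dist_norm left_diff_distrib)
      also have "\<dots> \<le> C * n (\<lambda>x. \<phi> i x - \<phi> j x)" by (rule C(2)[OF S_diff[OF \<phi>(1) \<phi>(1)]])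
      also have "\<dots> \<le> C * (e / (C + 1))" using N[OF that] C(1) by (intro mult_left_mono) auto
      also have "\<dots> < e" using e C(1) by (simp add: field_simps)
      finally show ?thesis .
    qed
    then show "\<exists>N. \<forall>i\<ge>N. \<forall>j\<ge>N. dist (LINT x|lborel. \<phi> i x * \<psi> x) (LINT x|lborel. \<phi> j x * \<psi> x) < e" by blast
  qed
  define u where "u = (\<lambda>\<psi>. if \<psi> \<in> S then lim (\<lambda>j. LINT x|lborel. \<phi> j x * \<psi> x) else 0)"
  have a: "appr n \<phi> u" unfolding appr_def u_def using \<phi>(1) nc conv by (auto simp: convergent_LIMSEQ_iff)
  have uc: "u \<in> compl n" using a by (auto simp: compl_def)
  have "(\<lambda>m. cnorm n (udiff (s m) u)) \<longlonglongrightarrow> 0"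
  proof (rule LIMSEQ_I)
    fix e :: real assume e: "e > 0"
    obtain N1 where N1: "\<And>m. m \<ge> N1 \<Longrightarrow> 1 / real (Suc m) < e / 3" using small[of "e / 3"] e by auto
    obtain N2 where N2: "\<And>m. m \<ge> N2 \<Longrightarrow> cnorm n (udiff u (em (\<phi> m))) \<le> e / 3" using appr_diff_small[OF t a, of "e / 3"] e by auto
    have "norm (cnorm n (udiff (s m) u) - 0) < e" if "m \<ge> max N1 N2" for m
    proof -
      have "cnorm n (udiff (s m) u) \<le> cnorm n (udiff (s m) (em (\<phi> m))) + cnorm n (udiff (em (\<phi> m)) u)"
        by (rule cnorm_tri[OF t s c uc])
      also have "cnorm n (udiff (em (\<phi> m)) u) = cnorm n (udiff u (em (\<phi> m)))" by (rule cnorm_udiff_sym[OF t c uc])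
      finally have "cnorm n (udiff (s m) u) < e" using N1[of m] N2[of m] \<phi>(2)[of m] that e by simp
      then show ?thesis using compl_nonneg[OF t udiff_compl[OF t s uc], of m] by simp
    qed
    then show "\<exists>N. \<forall>m\<ge>N. norm (cnorm n (udiff (s m) u) - 0) < e" by blast
  qed
  with uc show ?thesis by blast
qed

lemma compl_trans:
  assumes t: "tnorm n" and a: "appr n s u"
  shows "appr n (\<lambda>j z. s j (z - x)) (utrans k M A x u)" "appr n (\<lambda>j z. chr \<xi> z * s j z) (umod k M A \<xi> u)"
proof -
  note n = tnorm_gsn[OF t]
  have S: "\<And>j. s j \<in> S" "ncauchy n s" "\<And>\<psi>. \<psi> \<in> S \<Longrightarrow> (\<lambda>j. LINT x|lborel. s j x * \<psi> x) \<longlonglongrightarrow> u \<psi>" using a by (auto simp: appr_def)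
  have "cls k (mod_bound n)" using t by (simp add: tnorm_def)
  then obtain \<tau> where "mod_bound n \<tau>" by (cases k) (auto simp: cls_def intro: zero_less_one)
  then obtain C where C: "C > 0" "\<And>\<phi> x. \<phi> \<in> S \<Longrightarrow> n (\<lambda>z. \<phi> (z - x)) \<le> C * ea A (\<tau> * norm x) * n \<phi>"
    "\<And>\<phi> x. \<phi> \<in> S \<Longrightarrow> n (\<lambda>z. chr x z * \<phi> z) \<le> C * ea M (\<tau> * norm x) * n \<phi>" unfolding mod_bound_def by blast
  have nc: "ncauchy n s'" if "K > 0" "\<And>i j. n (\<lambda>z. s' i z - s' j z) \<le> K * n (\<lambda>z. s i z - s j z)" for s' K
    unfolding ncauchy_def
  proof (intro allI impI)
    fix e :: real assume e: "e > 0"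
    have eK: "e / K > 0" using e that(1) by simp
    obtain N where N: "\<And>i j. i \<ge> N \<Longrightarrow> j \<ge> N \<Longrightarrow> n (\<lambda>x. s i x - s j x) < e / K" by (rule ncauchyE[OF S(2) eK]) blast
    have "n (\<lambda>z. s' i z - s' j z) < e" if "i \<ge> N" "j \<ge> N" for i j
      using N[OF that] \<open>K > 0\<close> \<open>\<And>i j. n (\<lambda>z. s' i z - s' j z) \<le> K * n (\<lambda>z. s i z - s j z)\<close>[of i j]
      by (simp add: pos_less_divide_eq mult.commute)
    then show "\<exists>N. \<forall>i\<ge>N. \<forall>j\<ge>N. n (\<lambda>z. s' i z - s' j z) < e" by blast
  qed
  have n1: "ncauchy n (\<lambda>j z. s j (z - x))"
    by (rule nc[of "C * ea A (\<tau> * norm x)"]) (use C(1) C(2)[OF S_diff[OF S(1) S(1)]] in auto)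
  have n2: "ncauchy n (\<lambda>j z. chr \<xi> z * s j z)"
    by (rule nc[of "C * ea M (\<tau> * norm \<xi>)"])
      (use C(1) C(3)[OF S_diff[OF S(1) S(1)]] in \<open>auto simp: right_diff_distrib\<close>)
  have w1: "(\<lambda>j. LINT z|lborel. s j (z - x) * \<psi> z) \<longlonglongrightarrow> utrans k M A x u \<psi>" if \<psi>: "\<psi> \<in> S" for \<psi>
  proof -
    have "(LINT z|lborel. s j (z - x) * \<psi> z) = (LINT z|lborel. s j z * \<psi> (z + x))" for j
      using fun_cong[OF em_trans[of x "s j"], of \<psi>] \<psi> S_trans[OF \<psi>, of x] by (simp add: utrans_def emb_def)
    then show ?thesis using S(3)[OF S_trans[OF \<psi>, of x]] \<psi> by (simp add: utrans_def)
  qed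
  have w2: "(\<lambda>j. LINT z|lborel. (chr \<xi> z * s j z) * \<psi> z) \<longlonglongrightarrow> umod k M A \<xi> u \<psi>" if \<psi>: "\<psi> \<in> S" for \<psi>
  proof -
    have "(LINT z|lborel. (chr \<xi> z * s j z) * \<psi> z) = (LINT z|lborel. s j z * (chr \<xi> z * \<psi> z))" for j by (simp add: mult_ac)
    then show ?thesis unfolding umod_def chr_def[symmetric] using S(3)[OF S_chr[OF \<psi>, of \<xi>]] \<psi> by simp
  qed
  show "appr n (\<lambda>j z. s j (z - x)) (utrans k M A x u)"
    unfolding appr_def using S_trans'[OF S(1)] n1 w1 by (auto simp: utrans_def)
  show "appr n (\<lambda>j z. chr \<xi> z * s j z) (umod k M A \<xi> u)"
    unfolding appr_def using S_chr[OF S(1)] n2 w2 by (auto simp: umod_def)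
qed

text \<open>Supplies the predual demanded by \<open>DTMIB\<close>: the completion carries the given
  norm on test functions, and the dual is determined by that norm.\<close>

theorem tnorm_TMIB:
  fixes n :: "('n::finite) tf \<Rightarrow> real"
  assumes t: "tnorm n"
  shows "TMIB k M A (compl n) (cnorm n)"
proof -
  note n = tnorm_gsn[OF t]
  have UZ: "(uzero :: 'n ud) = em (\<lambda>x. 0)" by (simp add: uzero_def emb_def fun_eq_iff)
  have z: "(uzero :: 'n ud) \<in> compl n" "cnorm n uzero = 0"
    unfolding UZ using em_compl[OF t S_zero] cnorm_em[OF t S_zero] gsn_zero[OF n] by auto
  have sc: "cnorm n (uscale a u) = cmod a * cnorm n u" if u: "u \<in> compl n" for a u
  proof -
    obtain s where s: "appr n s u" using u by (auto simp: compl_def)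
    have "appr n (\<lambda>j x. a * s j x + 0 * s j x) (uscale a u)" unfolding uscale_lin by (rule appr_lin[OF n s s])
    from appr_cnorm[OF t this] have "(\<lambda>j. cmod a * n (s j)) \<longlonglongrightarrow> cnorm n (uscale a u)"
      using s by (simp add: appr_def gsn_scale[OF n])
    moreover have "(\<lambda>j. cmod a * n (s j)) \<longlonglongrightarrow> cmod a * cnorm n u" by (intro tendsto_intros appr_cnorm[OF t s])
    ultimately show ?thesis using LIMSEQ_unique by blast
  qed
  have zero: "u = uzero" if u: "u \<in> compl n" "cnorm n u = 0" for u
  proof
    fix \<psi> show "u \<psi> = uzero \<psi>"
    proof (cases "\<psi> \<in> S")
      case True
      obtain C where "\<forall>\<phi>\<in>S. cmod (LINT x|lborel. \<phi> x * \<psi> x) \<le> C * n \<phi>" using pair_bound_point[OF t True] by blast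
      then show ?thesis using compl_bound[OF t u(1) _ True, of C] u(2) by (simp add: uzero_def)
    next
      case False then show ?thesis using u(1) by (auto simp: compl_def appr_def uzero_def)
    qed
  qed
  have ban: "banach_sub (compl n) (cnorm n)"
    unfolding banach_sub_def
  proof (intro conjI ballI allI impI)
    fix s :: "nat \<Rightarrow> 'n ud" assume "\<forall>m. s m \<in> compl n" "\<forall>e>0. \<exists>N. \<forall>m\<ge>N. \<forall>na\<ge>N. cnorm n (udiff (s m) (s na)) < e"
    then show "\<exists>u\<in>compl n. (\<lambda>m. cnorm n (udiff (s m) u)) \<longlonglongrightarrow> 0" by (intro compl_complete[OF t]) auto
  next
    fix u v assume "u \<in> compl n" "v \<in> compl n"
    then show "uadd u v \<in> compl n" "cnorm n (uadd u v) \<le> cnorm n u + cnorm n v"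
      unfolding uadd_lin using compl_lin[OF t, of u v 1 1] by auto
  next
    fix a u assume "u \<in> compl n"
    then show "uscale a u \<in> compl n" unfolding uscale_lin using compl_lin(1)[OF t] by blast
  qed (use z zero sc compl_nonneg[OF t] in auto)
  have cont: "GS_cont k M A (\<lambda>\<phi>. cnorm n (em \<phi>))"
    using n unfolding gsn_def GS_cont_iff by (auto elim!: cls_mono simp: cnorm_em[OF t])
  have dense: "\<forall>u\<in>compl n. \<forall>e>0. \<exists>\<phi>\<in>S. cnorm n (udiff u (em \<phi>)) < e"
  proof (intro ballI allI impI)
    fix u and e :: real assume u: "u \<in> compl n" and e: "e > 0"
    then obtain s where s: "appr n s u" by (auto simp: compl_def)
    from appr_diff_small[OF t s, of "e / 2"] e obtain N where "cnorm n (udiff u (em (s N))) \<le> e / 2" by auto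
    then show "\<exists>\<phi>\<in>S. cnorm n (udiff u (em \<phi>)) < e" using s e by (intro bexI[of _ "s N"]) (auto simp: appr_def)
  qed
  have bdd: "\<exists>C. \<forall>u\<in>compl n. \<forall>\<phi>\<in>B. cmod (u \<phi>) \<le> C * cnorm n u" if B: "GS_bounded k M A B" for B
  proof -
    have ct: "cls k (pair_bound n)" using t by (simp add: tnorm_def)
    \<comment> \<open>In the Beurling case the level comes from the pairing bound, a bounded set
      being bounded at every level; in the Roumieu case it comes from the bounded set.\<close>
    have "\<exists>h>0. pair_bound n h \<and> B \<subseteq> GSh M A h \<and> bdd_above (GSnorm M A h ` B)"
    proof (cases k)
      case Beurling
      from cls_Beurling[OF ct this] obtain h where h: "h > 0" "pair_bound n h" by blast
      have "B \<subseteq> GSh M A h" using B h(1) Beurling by (auto simp: GS_bounded_def GS_def)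
      then show ?thesis using B h Beurling by (auto simp: GS_bounded_def)
    next
      case Roumieu
      with B obtain h where h: "h > 0" "B \<subseteq> GSh M A h" "bdd_above (GSnorm M A h ` B)" by (auto simp: GS_bounded_def)
      then show ?thesis using cls_Roumieu[OF ct Roumieu h(1)] by blast
    qed
    then obtain h D where h: "h > 0" "pair_bound n h" "B \<subseteq> GSh M A h" "\<And>\<phi>. \<phi> \<in> B \<Longrightarrow> GSnorm M A h \<phi> \<le> D"
      by (auto simp: bdd_above_def)
    from compl_bound_h[OF t h(2)] obtain C where C: "C \<ge> 0" "\<And>u \<psi>. u \<in> compl n \<Longrightarrow> \<psi> \<in> S \<inter> GSh M A h \<Longrightarrow> cmod (u \<psi>) \<le> C * GSnorm M A h \<psi> * cnorm n u"
      by blast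
    have "cmod (u \<psi>) \<le> (C * D) * cnorm n u" if "u \<in> compl n" "\<psi> \<in> B" for u \<psi>
    proof -
      have "cmod (u \<psi>) \<le> C * GSnorm M A h \<psi> * cnorm n u" using that B h(3) by (intro C(2)) (auto simp: GS_bounded_def)
      also have "\<dots> \<le> C * D * cnorm n u" using h(4)[OF that(2)] C(1) compl_nonneg[OF t that(1)] by (intro mult_right_mono mult_left_mono)
      finally show ?thesis .
    qed
    then show ?thesis by blast
  qed
  have ops: "utrans k M A x u \<in> compl n" "umod k M A x u \<in> compl n" if "u \<in> compl n" for x u
    using that compl_trans[OF t] unfolding compl_def by blast+
  have opn: "cls k (\<lambda>\<tau>. \<exists>C>0. \<forall>u\<in>compl n. \<forall>x.
          cnorm n (utrans k M A x u) \<le> C * exp (assoc A (\<tau> * norm x)) * cnorm n u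
        \<and> cnorm n (umod k M A (- x) u) \<le> C * exp (assoc M (\<tau> * norm x)) * cnorm n u)"
  proof (rule cls_mono)
    show "cls k (mod_bound n)" using t by (simp add: tnorm_def)
    fix \<tau> assume "mod_bound n \<tau>"
    then obtain C where C: "C > 0" "\<And>\<phi> x. \<phi> \<in> S \<Longrightarrow> n (\<lambda>z. \<phi> (z - x)) \<le> C * ea A (\<tau> * norm x) * n \<phi>"
      "\<And>\<phi> x. \<phi> \<in> S \<Longrightarrow> n (\<lambda>z. chr x z * \<phi> z) \<le> C * ea M (\<tau> * norm x) * n \<phi>" unfolding mod_bound_def by blast
    have "cnorm n (utrans k M A x u) \<le> C * exp (assoc A (\<tau> * norm x)) * cnorm n u
        \<and> cnorm n (umod k M A (- x) u) \<le> C * exp (assoc M (\<tau> * norm x)) * cnorm n u" if u: "u \<in> compl n" for u x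
    proof -
      obtain s where s: "appr n s u" using u by (auto simp: compl_def)
      have S: "\<And>j. s j \<in> S" using s by (auto simp: appr_def)
      show ?thesis
        using cnorm_le[OF t s compl_trans(1)[OF t s, of x], of "C * ea A (\<tau> * norm x)"]
          cnorm_le[OF t s compl_trans(2)[OF t s, of "- x"], of "C * ea M (\<tau> * norm x)"] C(2)[OF S] C(3)[OF S, of "- x"]
        by (simp add: ea_def)
    qed
    then show "\<exists>C>0. \<forall>u\<in>compl n. \<forall>x.
          cnorm n (utrans k M A x u) \<le> C * exp (assoc A (\<tau> * norm x)) * cnorm n u
        \<and> cnorm n (umod k M A (- x) u) \<le> C * exp (assoc M (\<tau> * norm x)) * cnorm n u" using C(1) by blast
  qed
  show ?thesis
    unfolding TMIB_def using ban em_compl[OF t] compl_UD[OF t] cont dense bdd ops opn by (intro conjI) auto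
qed

end

section \<open>Lebesgue norms and their lattice duality\<close>

definition nnm :: "(real^('n::finite) \<Rightarrow> real) \<Rightarrow> bool" where
  "nnm G \<longleftrightarrow> G \<in> borel_measurable borel \<and> (\<forall>x. G x \<ge> 0)"

lemma nnm_measurable: "nnm G \<Longrightarrow> G \<in> borel_measurable borel" by (simp add: nnm_def)

definition lpint :: "real \<Rightarrow> (real^('n::finite) \<Rightarrow> real) \<Rightarrow> ennreal" where
  "lpint p G = (\<integral>\<^sup>+ x. ennreal (G x powr p) \<partial>lborel)"

definition lpfin :: "real \<Rightarrow> (real^('n::finite) \<Rightarrow> real) \<Rightarrow> bool" where
  "lpfin p G \<longleftrightarrow> lpint p G < \<infinity>"

definition lpn :: "real \<Rightarrow> (real^('n::finite) \<Rightarrow> real) \<Rightarrow> real" where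
  "lpn p G = enn2real (lpint p G) powr (1 / p)"

definition lifin :: "(real^('n::finite) \<Rightarrow> real) \<Rightarrow> bool" where
  "lifin G \<longleftrightarrow> esssup lborel (\<lambda>x. ereal (G x)) < \<infinity>"

definition lin :: "(real^('n::finite) \<Rightarrow> real) \<Rightarrow> real" where
  "lin G = real_of_ereal (esssup lborel (\<lambda>x. ereal (G x)))"

text \<open>\<open>enn2real\<close> sends infinity to 0, so a bound on \<open>lpn\<close> is
  meaningful only together with \<open>lpfin\<close>. The equivalence moves all estimates to
  extended nonnegative integrals.\<close>

lemma lp_iff:
  assumes "p \<ge> 1" "a \<ge> 0"
  shows "lpfin p G \<and> lpn p G \<le> a \<longleftrightarrow> lpint p G \<le> ennreal (a powr p)"
proof
  assume L: "lpfin p G \<and> lpn p G \<le> a"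
  then have e: "lpint p G = ennreal (enn2real (lpint p G))" by (simp add: lpfin_def)
  have "enn2real (lpint p G) = (enn2real (lpint p G) powr (1 / p)) powr p"
    using assms by (simp add: powr_powr)
  also have "\<dots> \<le> a powr p" using L assms unfolding lpn_def by (intro powr_mono2) auto
  finally show "lpint p G \<le> ennreal (a powr p)" by (subst e) (rule ennreal_leI)
next
  assume R: "lpint p G \<le> ennreal (a powr p)"
  then have fin: "lpint p G < \<infinity>" using le_less_trans by (metis ennreal_less_top infinity_ennreal_def)
  have "enn2real (lpint p G) \<le> a powr p" using R by (intro enn2real_leI) auto
  then have "enn2real (lpint p G) powr (1 / p) \<le> (a powr p) powr (1 / p)" using assms by (intro powr_mono2) auto
  also have "\<dots> = a" using assms by (simp add: powr_powr)
  finally show "lpfin p G \<and> lpn p G \<le> a" using fin by (simp add: lpfin_def lpn_def)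
qed

lemma lpn_nonneg [simp]: "lpn p G \<ge> 0" by (simp add: lpn_def)

lemma lpint_le: "p \<ge> 1 \<Longrightarrow> lpfin p G \<Longrightarrow> lpint p G \<le> ennreal (lpn p G powr p)"
  using lp_iff[of p "lpn p G" G] by simp

text \<open>Beyond \<open>powr_convex\<close> the case to settle is an endpoint at 0, where
  convexity reduces to s^p \<le> s for 0 < s < 1.\<close>

lemma powr_convex_nonneg:
  fixes p :: real
  assumes "p \<ge> 1" shows "convex_on {0..} (\<lambda>x. x powr p)"
proof (rule convex_onI)
  fix t x y :: real assume t: "0 < t" "t < 1" and xy: "x \<in> {0..}" "y \<in> {0..}"
  have le: "s powr p \<le> s" if "0 < s" "s < 1" for s :: real
    using powr_mono'[of 1 p s] that assms by simp
  show "((1 - t) *\<^sub>R x + t *\<^sub>R y) powr p \<le> (1 - t) * x powr p + t * y powr p"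
  proof (cases "x = 0 \<or> y = 0")
    case True
    then show ?thesis
    proof
      assume "x = 0"
      then show ?thesis using t xy assms le[of t] by (auto simp: powr_mult intro!: mult_right_mono)
    next
      assume "y = 0"
      then show ?thesis using t xy assms le[of "1 - t"] by (auto simp: powr_mult intro!: mult_right_mono)
    qed
  next
    case False
    then show ?thesis using convex_onD[OF powr_convex[OF assms], of t x y] t xy by (auto simp: less_eq_real_def)
  qed
qed auto

lemma lpint_nn_cong_mult:
  assumes "G \<in> borel_measurable borel" "a > 0" "\<And>x. G x \<ge> 0"
  shows "(\<integral>\<^sup>+ x. ennreal ((G x / a) powr p) \<partial>lborel) = lpint p G / ennreal (a powr p)"
proof -
  have "(\<integral>\<^sup>+ x. ennreal ((G x / a) powr p) \<partial>lborel) = (\<integral>\<^sup>+ x. ennreal (G x powr p) / ennreal (a powr p) \<partial>lborel)"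
    using assms by (intro nn_integral_cong) (simp add: powr_divide divide_ennreal)
  also have "\<dots> = lpint p G / ennreal (a powr p)"
    unfolding lpint_def using assms(1) by (intro nn_integral_divide) auto
  finally show ?thesis .
qed

text \<open>Division is by a number strictly above the norm, which stays legitimate when the norm is
  0. This explains the e > 0 in the inequalities that follow.\<close>

lemma lp_normalized:
  assumes "p \<ge> 1" "nnm G" "lpfin p G" "a > lpn p G"
  shows "(\<integral>\<^sup>+ x. ennreal ((G x / a) powr p) \<partial>lborel) \<le> 1"
proof -
  have a: "a > 0" using assms(4) lpn_nonneg[of p G] by linarith
  have "lpint p G \<le> ennreal (a powr p)" using lp_iff[OF assms(1), of a G] assms a by auto
  then have "lpint p G / ennreal (a powr p) \<le> ennreal (a powr p) / ennreal (a powr p)" by (rule divide_right_mono_ennreal)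
  also have "\<dots> = 1" using a by (simp add: divide_ennreal)
  finally show ?thesis using lpint_nn_cong_mult[of G a p] assms a by (auto simp: nnm_def)
qed

lemma lp_mono:
  assumes p: "p \<ge> 1" and G: "nnm G" "nnm G'" "lpfin p G'" "K \<ge> 0" "\<And>x. G x \<le> K * G' x"
  shows "lpfin p G \<and> lpn p G \<le> K * lpn p G'"
proof -
  have "lpint p G \<le> (\<integral>\<^sup>+ x. ennreal (K powr p) * ennreal (G' x powr p) \<partial>lborel)"
    unfolding lpint_def
  proof (rule nn_integral_mono)
    fix x
    have "G x powr p \<le> (K * G' x) powr p" using G p by (intro powr_mono2) (auto simp: nnm_def)
    also have "\<dots> = K powr p * G' x powr p" by (rule powr_mult)
    finally show "ennreal (G x powr p) \<le> ennreal (K powr p) * ennreal (G' x powr p)"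
      by (simp add: ennreal_leI flip: ennreal_mult)
  qed
  also have "\<dots> = ennreal (K powr p) * lpint p G'" unfolding lpint_def using G by (intro nn_integral_cmult) (auto simp: nnm_def)
  also have "\<dots> \<le> ennreal (K powr p) * ennreal (lpn p G' powr p)" by (intro mult_left_mono lpint_le p G) auto
  also have "\<dots> = ennreal ((K * lpn p G') powr p)" using G(4) by (simp add: powr_mult flip: ennreal_mult)
  finally show ?thesis using lp_iff[OF p, of "K * lpn p G'" G] G(4) by simp
qed

text \<open>Minkowski by convexity: (G + G') / (a + b) is a convex combination of G / a and G' / b,
  whose p-th powers have integral at most 1.\<close>

lemma lp_add:
  assumes p: "p \<ge> 1" and G: "nnm G" "nnm G'" "lpfin p G" "lpfin p G'"
  shows "lpfin p (\<lambda>x. G x + G' x) \<and> lpn p (\<lambda>x. G x + G' x) \<le> lpn p G + lpn p G'"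
proof -
  have *: "lpfin p (\<lambda>x. G x + G' x) \<and> lpn p (\<lambda>x. G x + G' x) \<le> lpn p G + lpn p G' + e" if e: "e > 0" for e
  proof -
    define a b where "a = lpn p G + e / 2" and "b = lpn p G' + e / 2"
    have ab: "a > lpn p G" "b > lpn p G'" "a > 0" "b > 0" using e lpn_nonneg[of p G] lpn_nonneg[of p G'] by (auto simp: a_def b_def add_nonneg_pos)
    have [measurable]: "G \<in> borel_measurable borel" "G' \<in> borel_measurable borel" using G by (auto simp: nnm_def)
    have conv: "((G x + G' x) / (a + b)) powr p \<le> a / (a + b) * (G x / a) powr p + b / (a + b) * (G' x / b) powr p" for x
    proof -
      have e1: "(G x + G' x) / (a + b) = (1 - b / (a + b)) *\<^sub>R (G x / a) + (b / (a + b)) *\<^sub>R (G' x / b)"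
        using ab by (simp add: divide_simps)
      have e2: "1 - b / (a + b) = a / (a + b)" using ab by (simp add: field_simps)
      show ?thesis unfolding e1 using convex_onD[OF powr_convex_nonneg[OF p], of "b / (a + b)" "G x / a" "G' x / b"] ab G
        unfolding e2 by (auto simp: nnm_def)
    qed
    have "(\<integral>\<^sup>+ x. ennreal (((G x + G' x) / (a + b)) powr p) \<partial>lborel) \<le> 
      (\<integral>\<^sup>+ x. ennreal (a / (a + b)) * ennreal ((G x / a) powr p) + ennreal (b / (a + b)) * ennreal ((G' x / b) powr p) \<partial>lborel)"
      using conv ab by (intro nn_integral_mono) (simp add: ennreal_leI flip: ennreal_mult ennreal_plus)
    also have "\<dots> = ennreal (a / (a + b)) * (\<integral>\<^sup>+ x. ennreal ((G x / a) powr p) \<partial>lborel) + ennreal (b / (a + b)) * (\<integral>\<^sup>+ x. ennreal ((G' x / b) powr p) \<partial>lborel)"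
      by (simp add: nn_integral_add nn_integral_cmult)
    also have "\<dots> \<le> ennreal (a / (a + b)) * 1 + ennreal (b / (a + b)) * 1"
      by (intro add_mono mult_left_mono lp_normalized p G ab) auto
    also have "\<dots> = 1" using ab by (simp add: add_divide_distrib[symmetric] flip: ennreal_plus)
    finally have le1: "(\<integral>\<^sup>+ x. ennreal (((G x + G' x) / (a + b)) powr p) \<partial>lborel) \<le> 1" .
    have "lpint p (\<lambda>x. G x + G' x) = (\<integral>\<^sup>+ x. ennreal ((a + b) powr p) * ennreal (((G x + G' x) / (a + b)) powr p) \<partial>lborel)"
      unfolding lpint_def
    proof (rule nn_integral_cong)
      fix x
      have "(G x + G' x) powr p = ((a + b) * ((G x + G' x) / (a + b))) powr p" using ab by simp
      also have "\<dots> = (a + b) powr p * ((G x + G' x) / (a + b)) powr p" by (rule powr_mult)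
      finally show "ennreal ((G x + G' x) powr p) = ennreal ((a + b) powr p) * ennreal (((G x + G' x) / (a + b)) powr p)"
        by (simp add: ennreal_mult)
    qed
    also have "\<dots> = ennreal ((a + b) powr p) * (\<integral>\<^sup>+ x. ennreal (((G x + G' x) / (a + b)) powr p) \<partial>lborel)"
      by (simp add: nn_integral_cmult)
    also have "\<dots> \<le> ennreal ((a + b) powr p) * 1" using le1 by (rule mult_left_mono) simp
    finally have "lpint p (\<lambda>x. G x + G' x) \<le> ennreal ((a + b) powr p)" by simp
    then have "lpfin p (\<lambda>x. G x + G' x) \<and> lpn p (\<lambda>x. G x + G' x) \<le> a + b" using lp_iff[OF p, of "a + b" "\<lambda>x. G x + G' x"] ab by simp
    then show ?thesis by (simp add: a_def b_def)
  qed
  have "lpn p (\<lambda>x. G x + G' x) \<le> lpn p G + lpn p G'" by (rule field_le_epsilon) (use * in blast)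
  then show ?thesis using *[of 1] by simp
qed

lemma lp_fatou:
  assumes p: "p \<ge> 1" and G: "\<And>j. nnm (Gs j)" "nnm G" "\<And>x. (\<lambda>j. Gs j x) \<longlonglongrightarrow> G x" "\<And>j. lpfin p (Gs j)" "\<And>j. lpn p (Gs j) \<le> B"
  shows "lpn p G \<le> B"
proof -
  have B: "B \<ge> 0" using G(5)[of 0] lpn_nonneg[of p "Gs 0"] by linarith
  have "lpint p G = (\<integral>\<^sup>+ x. liminf (\<lambda>j. ennreal (Gs j x powr p)) \<partial>lborel)"
    unfolding lpint_def
  proof (rule nn_integral_cong)
    fix x
    have "(\<lambda>j. Gs j x powr p) \<longlonglongrightarrow> G x powr p"
      using G(1,3) p by (intro tendsto_powr') (auto simp: nnm_def)
    then have "(\<lambda>j. ennreal (Gs j x powr p)) \<longlonglongrightarrow> ennreal (G x powr p)" by (rule tendsto_ennrealI)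
    then show "ennreal (G x powr p) = liminf (\<lambda>j. ennreal (Gs j x powr p))" 
      using lim_imp_Liminf[OF sequentially_bot] by metis
  qed
  also have "\<dots> \<le> liminf (\<lambda>j. lpint p (Gs j))" unfolding lpint_def
  proof (rule nn_integral_liminf)
    fix j
    have [measurable]: "Gs j \<in> borel_measurable borel" using G(1) by (rule nnm_measurable)
    show "(\<lambda>x. ennreal (Gs j x powr p)) \<in> borel_measurable lborel" by simp
  qed
  also have "\<dots> \<le> ennreal (B powr p)"
  proof -
    have "lpint p (Gs j) \<le> ennreal (B powr p)" for j using lp_iff[OF p B] G by blast
    then show ?thesis by (intro Liminf_le) auto
  qed
  finally show ?thesis using lp_iff[OF p B] by blast
qed

lemma nn_integral_shift:
  fixes f :: "real^('n::finite) \<Rightarrow> ennreal"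
  assumes "f \<in> borel_measurable borel"
  shows "(\<integral>\<^sup>+ x. f (t + x) \<partial>lborel) = (\<integral>\<^sup>+ x. f x \<partial>lborel)"
proof -
  have "(\<integral>\<^sup>+ x. f x \<partial>distr lborel borel ((+) t)) = (\<integral>\<^sup>+ x. f (t + x) \<partial>lborel)"
    using assms by (intro nn_integral_distr) auto
  then show ?thesis by (simp add: lborel_distr_plus)
qed

lemma lp_shift: assumes "nnm G" shows "lpint p (\<lambda>x. G (x - y)) = lpint p G"
proof -
  have [measurable]: "G \<in> borel_measurable borel" using assms by (rule nnm_measurable)
  show ?thesis unfolding lpint_def using nn_integral_shift[of "\<lambda>x. ennreal (G x powr p)" "- y"] by simp
qed

text \<open>Young's inequality for the normalised functions, followed by letting the excess e over
  the two norms tend to 0.\<close>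

lemma lp_holder:
  assumes p: "p > 1" and G: "nnm G" "lpfin p G" and F: "nnm F" "lpfin (p / (p - 1)) F"
  shows "(\<integral>\<^sup>+ x. ennreal (F x * G x) \<partial>lborel) \<le> ennreal (lpn (p / (p - 1)) F * lpn p G)"
proof -
  define q where "q = p / (p - 1)"
  have q: "q > 1" "1 / p + 1 / q = 1" "q \<ge> 1" "p \<ge> 1" using p by (auto simp: q_def field_simps)
  have F': "lpfin q F" using F q_def by simp
  have [measurable]: "G \<in> borel_measurable borel" "F \<in> borel_measurable borel" using G F by (auto simp: nnm_def)
  have *: "(\<integral>\<^sup>+ x. ennreal (F x * G x) \<partial>lborel) \<le> ennreal ((lpn q F + e) * (lpn p G + e))" if e: "e > 0" for e
  proof -
    define a b where "a = lpn q F + e" and "b = lpn p G + e"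
    have ab: "a > lpn q F" "b > lpn p G" "a > 0" "b > 0" using e by (auto simp: a_def b_def add_nonneg_pos)
    have y: "(F x / a) * (G x / b) \<le> (1 / q) * (F x / a) powr q + (1 / p) * (G x / b) powr p" for x
      using Youngs_inequality[of q p "F x / a" "G x / b"] q p G F ab by (auto simp: nnm_def)
    have "(\<integral>\<^sup>+ x. ennreal (F x * G x) \<partial>lborel) = (\<integral>\<^sup>+ x. ennreal (a * b) * ennreal ((F x / a) * (G x / b)) \<partial>lborel)"
      using ab G F by (intro nn_integral_cong) (auto simp: nnm_def simp flip: ennreal_mult)
    also have "\<dots> = ennreal (a * b) * (\<integral>\<^sup>+ x. ennreal ((F x / a) * (G x / b)) \<partial>lborel)" by (simp add: nn_integral_cmult)
    also have "(\<integral>\<^sup>+ x. ennreal ((F x / a) * (G x / b)) \<partial>lborel) \<le> (\<integral>\<^sup>+ x. ennreal (1 / q) * ennreal ((F x / a) powr q) + ennreal (1 / p) * ennreal ((G x / b) powr p) \<partial>lborel)"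
      using y q p by (intro nn_integral_mono) (simp add: ennreal_leI flip: ennreal_mult ennreal_plus)
    also have "\<dots> = ennreal (1 / q) * (\<integral>\<^sup>+ x. ennreal ((F x / a) powr q) \<partial>lborel) + ennreal (1 / p) * (\<integral>\<^sup>+ x. ennreal ((G x / b) powr p) \<partial>lborel)"
      by (simp add: nn_integral_add nn_integral_cmult)
    also have "\<dots> \<le> ennreal (1 / q) * 1 + ennreal (1 / p) * 1"
      by (intro add_mono mult_left_mono lp_normalized G F F' q ab) auto
    also have "\<dots> = 1" using q p by (simp add: add.commute flip: ennreal_plus)
    finally show ?thesis by (simp add: a_def b_def mult_left_mono)
  qed
  have "(\<lambda>m. ennreal ((lpn q F + 1 / real (Suc m)) * (lpn p G + 1 / real (Suc m)))) \<longlonglongrightarrow> ennreal ((lpn q F + 0) * (lpn p G + 0))"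
    by (intro tendsto_ennrealI tendsto_intros LIMSEQ_Suc[OF lim_1_over_n])
  then show ?thesis unfolding q_def[symmetric] by (intro LIMSEQ_le_const[where X = "\<lambda>m. ennreal ((lpn q F + 1 / real (Suc m)) * (lpn p G + 1 / real (Suc m)))"]) (use * in auto)
qed

text \<open>\<open>real_of_ereal\<close> sends both infinities to 0. Nonnegativity of G excludes the
  value minus infinity and \<open>lifin\<close> the other one.\<close>

lemma li_iff:
  assumes "nnm G" "a \<ge> 0"
  shows "lifin G \<and> lin G \<le> a \<longleftrightarrow> (AE x in lborel. G x \<le> a)"
proof -
  have [measurable]: "G \<in> borel_measurable borel" using assms(1) by (rule nnm_measurable)
  have m: "(\<lambda>x. ereal (G x)) \<in> borel_measurable lborel" by simp
  have nn: "esssup lborel (\<lambda>x. ereal (G x)) \<ge> 0"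
  proof -
    have "esssup lborel (\<lambda>x::real^'a. 0::ereal) \<le> esssup lborel (\<lambda>x. ereal (G x))"
      using assms by (intro esssup_mono) (auto simp: nnm_def)
    moreover have "esssup (lborel :: (real^'a) measure) (\<lambda>x. 0::ereal) = 0"
      by (rule esssup_const) simp
    ultimately show ?thesis by simp
  qed
  show ?thesis
  proof
    assume "lifin G \<and> lin G \<le> a"
    then have "esssup lborel (\<lambda>x. ereal (G x)) \<le> ereal a"
      using nn by (cases "esssup lborel (\<lambda>x. ereal (G x))") (auto simp: lifin_def lin_def)
    moreover have "AE x in lborel. ereal (G x) \<le> esssup lborel (\<lambda>x. ereal (G x))" by (rule esssup_AE)
    ultimately show "AE x in lborel. G x \<le> a" by (auto elim!: eventually_mono intro: order_trans simp flip: ereal_less_eq(3))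
  next
    assume "AE x in lborel. G x \<le> a"
    then have "esssup lborel (\<lambda>x. ereal (G x)) \<le> ereal a" using m by (intro esssup_I) auto
    then show "lifin G \<and> lin G \<le> a"
      using nn assms(2) by (cases "esssup lborel (\<lambda>x. ereal (G x))") (auto simp: lifin_def lin_def)
  qed
qed

lemma lin_nonneg: assumes "nnm G" shows "lin G \<ge> 0"
proof -
  have "esssup lborel (\<lambda>x::real^'a. 0::ereal) \<le> esssup lborel (\<lambda>x. ereal (G x))"
    using assms by (intro esssup_mono) (auto simp: nnm_def)
  moreover have "esssup (lborel :: (real^'a) measure) (\<lambda>x. 0::ereal) = 0"
    by (rule esssup_const) simp
  ultimately show ?thesis by (simp add: lin_def real_of_ereal_pos)
qed

lemma lin_AE: "nnm G \<Longrightarrow> lifin G \<Longrightarrow> AE x in lborel. G x \<le> lin G"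
  using li_iff[of G "lin G"] lin_nonneg by blast

lemma li_mono:
  assumes G: "nnm G" "nnm G'" "lifin G'" "K \<ge> 0" "\<And>x. G x \<le> K * G' x"
  shows "lifin G \<and> lin G \<le> K * lin G'"
proof -
  have "AE x in lborel. G x \<le> K * lin G'"
    using lin_AE[OF G(2,3)] by eventually_elim (meson G(4,5) mult_left_mono order_trans)
  then show ?thesis using li_iff[OF G(1), of "K * lin G'"] G(4) lin_nonneg[OF G(2)] by simp
qed

lemma nnm_add: "nnm G \<Longrightarrow> nnm G' \<Longrightarrow> nnm (\<lambda>x. G x + G' x)" by (auto simp: nnm_def)

lemma nnm_mult: "nnm G \<Longrightarrow> nnm G' \<Longrightarrow> nnm (\<lambda>x. G x * G' x)" by (auto simp: nnm_def)

lemma nnm_shift: "nnm G \<Longrightarrow> nnm (\<lambda>x. G (x - y))"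
  unfolding nnm_def using borel_measurable_continuous_onI[of "\<lambda>x. x - y"] measurable_compose[of "\<lambda>x. x - y" borel borel G borel]
  by (auto intro!: continuous_intros)

lemma nnm_sum: "finite I \<Longrightarrow> (\<And>i. i \<in> I \<Longrightarrow> nnm (f i)) \<Longrightarrow> nnm (\<lambda>x. \<Sum>i\<in>I. f i x)"
  unfolding nnm_def by (auto intro!: sum_nonneg borel_measurable_sum)

lemma li_add:
  assumes G: "nnm G" "nnm G'" "lifin G" "lifin G'"
  shows "lifin (\<lambda>x. G x + G' x) \<and> lin (\<lambda>x. G x + G' x) \<le> lin G + lin G'"
proof -
  have "AE x in lborel. G x + G' x \<le> lin G + lin G'"
    using lin_AE[OF G(1,3)] lin_AE[OF G(2,4)] by eventually_elim simp
  then show ?thesis using li_iff[OF nnm_add[OF G(1,2)], of "lin G + lin G'"] lin_nonneg[OF G(1)] lin_nonneg[OF G(2)] by simp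
qed

lemma li_fatou:
  assumes G: "\<And>j. nnm (Gs j)" "nnm G" "\<And>x. (\<lambda>j. Gs j x) \<longlonglongrightarrow> G x" "\<And>j. lifin (Gs j)" "\<And>j. lin (Gs j) \<le> B"
  shows "lin G \<le> B"
proof -
  have B: "B \<ge> 0" using G(5)[of 0] lin_nonneg[OF G(1), of 0] by linarith
  have "AE x in lborel. \<forall>j. Gs j x \<le> B"
    unfolding AE_all_countable using li_iff[OF G(1) B] G(4,5) by blast
  then have "AE x in lborel. G x \<le> B"
    by eventually_elim (rule LIMSEQ_le_const2[OF G(3)], blast)
  then show ?thesis using li_iff[OF G(2) B] by blast
qed

lemma li_shift: assumes "nnm G" "lifin G" shows "lifin (\<lambda>x. G (x - y)) \<and> lin (\<lambda>x. G (x - y)) \<le> lin G"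
proof -
  have 1: "AE x in distr lborel borel ((+) (- y)). G x \<le> lin G"
    using lin_AE[OF assms] by (simp only: lborel_distr_plus)
  have [measurable]: "G \<in> borel_measurable borel" using assms(1) by (rule nnm_measurable)
  have m: "{x. G x \<le> lin G} \<in> sets borel" by measurable
  have "AE x in lborel. G (- y + x) \<le> lin G"
    using 1 by (subst (asm) AE_distr_iff) (use m in auto)
  then show ?thesis using li_iff[OF nnm_shift[OF assms(1)], of "lin G" y] lin_nonneg[OF assms(1)] by simp
qed

lemma l1_li_holder:
  assumes "nnm F" "nnm G" "lifin F" "lpfin 1 G"
  shows "(\<integral>\<^sup>+ x. ennreal (F x * G x) \<partial>lborel) \<le> ennreal (lin F * lpn 1 G)"
proof -
  have [measurable]: "G \<in> borel_measurable borel" using assms by (auto simp: nnm_def)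
  have "(\<integral>\<^sup>+ x. ennreal (F x * G x) \<partial>lborel) \<le> (\<integral>\<^sup>+ x. ennreal (lin F) * ennreal (G x powr 1) \<partial>lborel)"
  proof (rule nn_integral_mono_AE)
    show "AE x in lborel. ennreal (F x * G x) \<le> ennreal (lin F) * ennreal (G x powr 1)"
      using lin_AE[OF assms(1,3)]
    proof eventually_elim
      case (elim x)
      have "F x * G x \<le> lin F * G x" using elim assms by (intro mult_right_mono) (auto simp: nnm_def)
      then show ?case using assms lin_nonneg[OF assms(1)] by (simp add: nnm_def ennreal_leI flip: ennreal_mult)
    qed
  qed
  also have "\<dots> = ennreal (lin F) * lpint 1 G" unfolding lpint_def by (simp add: nn_integral_cmult)
  also have "\<dots> \<le> ennreal (lin F) * ennreal (lpn 1 G powr 1)" by (intro mult_left_mono lpint_le assms) auto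
  also have "\<dots> = ennreal (lin F * lpn 1 G)" using lin_nonneg[OF assms(1)] by (simp flip: ennreal_mult)
  finally show ?thesis .
qed

section \<open>Tilings by unit cells, lattice sums and duality on lattices\<close>

lemma cell_unit_measure: "emeasure lborel {x::real^('n::finite). cellof 1 x = 0} \<le> 1"
proof -
  have "{x::real^'n. cellof 1 x = 0} \<subseteq> cbox 0 1"
  proof
    fix x :: "real^'n" assume x: "x \<in> {x. cellof 1 x = 0}"
    have "0 \<le> x $ i \<and> x $ i \<le> 1" for i
    proof -
      have "\<lfloor>x $ i\<rfloor> = 0" using x by (auto simp: cellof_def vec_eq_iff)
      then show ?thesis by linarith
    qed
    then show "x \<in> cbox 0 1" by (simp add: mem_box_cart)
  qed
  then have "emeasure lborel {x::real^'n. cellof 1 x = 0} \<le> emeasure lborel (cbox 0 (1::real^'n))"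
    by (rule emeasure_mono) simp
  also have "\<dots> = ennreal (\<Prod>b\<in>Basis. ((1::real^'n) - 0) \<bullet> b)"
    by (rule emeasure_lborel_cbox) (auto simp: Basis_vec_def inner_axis)
  also have "\<dots> = 1"
  proof -
    have "(\<Prod>b\<in>Basis. ((1::real^'n) - 0) \<bullet> b) = 1" by (rule prod.neutral) (auto simp: Basis_vec_def inner_axis)
    then show ?thesis by simp
  qed
  finally show ?thesis .
qed

lemma cellof_shift: "cellof 1 (cellpt 1 v + x) = v \<longleftrightarrow> cellof 1 (x::real^('n::finite)) = 0"
  by (auto simp: cellof_def cellpt_def vec_eq_iff)

text \<open>The integral over the whole space is the integral, over one unit cell, of the sum over
  the lattice translated by s. Finite partial sums are bounded by B and the cell has measure at most
  1; monotone convergence along an enumeration of the cells concludes.\<close>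

lemma tiling:
  fixes G :: "real^('n::finite) \<Rightarrow> ennreal"
  assumes [measurable]: "G \<in> borel_measurable borel"
    and B: "\<And>s I. finite I \<Longrightarrow> (\<Sum>v\<in>I. G (cellpt 1 v + s)) \<le> B"
  shows "(\<integral>\<^sup>+ x. G x \<partial>lborel) \<le> B"
proof -
  define C where "C = (\<lambda>v::int^'n. {x::real^'n. cellof 1 x = v})"
  have Cm[measurable]: "C v \<in> sets borel" for v unfolding C_def by measurable
  define V where "V = (\<lambda>N::nat. {v::int^'n. to_nat v < N})"
  have V: "finite (V N)" for N
    unfolding V_def by (rule finite_imageD[of to_nat]) (auto intro: finite_subset[of _ "{..<N}"] inj_on_subset[OF inj_to_nat])
  define T where "T = (\<lambda>N x. \<Sum>v\<in>V N. G x * indicator (C v) x)"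
  have Tx: "T N x = (if to_nat (cellof 1 x) < N then G x else 0)" for N x
  proof -
    have "T N x = (\<Sum>v\<in>V N. if v = cellof 1 x then G x else 0)" unfolding T_def
      by (rule sum.cong) (auto simp: C_def indicator_def)
    then show ?thesis using V by (simp add: V_def)
  qed
  have step: "(\<integral>\<^sup>+ x. T N x \<partial>lborel) \<le> B" for N
  proof -
    have "(\<integral>\<^sup>+ x. T N x \<partial>lborel) = (\<Sum>v\<in>V N. \<integral>\<^sup>+ x. G x * indicator (C v) x \<partial>lborel)"
      unfolding T_def by (rule nn_integral_sum) simp
    also have "\<dots> = (\<Sum>v\<in>V N. \<integral>\<^sup>+ x. G (cellpt 1 v + x) * indicator (C 0) x \<partial>lborel)"
    proof (rule sum.cong[OF refl])
      fix v
      have "(\<integral>\<^sup>+ x. G x * indicator (C v) x \<partial>lborel) = (\<integral>\<^sup>+ x. G (cellpt 1 v + x) * indicator (C v) (cellpt 1 v + x) \<partial>lborel)"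
        by (rule nn_integral_shift[symmetric]) simp
      also have "\<dots> = (\<integral>\<^sup>+ x. G (cellpt 1 v + x) * indicator (C 0) x \<partial>lborel)"
        by (intro nn_integral_cong) (auto simp: C_def indicator_def cellof_shift)
      finally show "(\<integral>\<^sup>+ x. G x * indicator (C v) x \<partial>lborel) = (\<integral>\<^sup>+ x. G (cellpt 1 v + x) * indicator (C 0) x \<partial>lborel)" .
    qed
    also have "\<dots> = (\<integral>\<^sup>+ x. (\<Sum>v\<in>V N. G (cellpt 1 v + x) * indicator (C 0) x) \<partial>lborel)"
      by (rule nn_integral_sum[symmetric]) simp
    also have "\<dots> \<le> (\<integral>\<^sup>+ x. B * indicator (C 0) x \<partial>lborel)"
      using B[OF V] by (intro nn_integral_mono) (auto simp: indicator_def)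
    also have "\<dots> = B * emeasure lborel (C 0)" by (rule nn_integral_cmult_indicator) simp
    also have "\<dots> \<le> B * 1" unfolding C_def by (intro mult_left_mono cell_unit_measure) simp
    finally show ?thesis by simp
  qed
  have "(\<integral>\<^sup>+ x. G x \<partial>lborel) = (\<integral>\<^sup>+ x. (SUP N. T N x) \<partial>lborel)"
  proof (rule nn_integral_cong)
    fix x
    have "(SUP N. T N x) \<le> G x" by (rule SUP_least) (simp add: Tx)
    moreover have "G x \<le> (SUP N. T N x)" by (rule SUP_upper2[of "Suc (to_nat (cellof 1 x))"]) (auto simp: Tx)
    ultimately show "G x = (SUP N. T N x)" by (rule antisym[rotated])
  qed
  also have "\<dots> = (SUP N. \<integral>\<^sup>+ x. T N x \<partial>lborel)"
  proof (rule nn_integral_monotone_convergence_SUP)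
    show "incseq T" by (auto simp: incseq_def le_fun_def Tx)
  qed (simp add: T_def)
  also have "\<dots> \<le> B" by (rule SUP_least) (rule step)
  finally show ?thesis .
qed

context gs begin

lemma nnm_wt: "nnm (wt A h)" using wt_measurable[OF sA] by (simp add: nnm_def)

lemma nnm_wt_shift: "nnm (\<lambda>x. wt A h (x - y))" by (rule nnm_shift[OF nnm_wt])

lemma nn_integral_wt:
  fixes y :: "real^('n::finite)"
  assumes "h > 0"
  shows "(\<integral>\<^sup>+ (x::real^'n). ennreal (wt A h x) \<partial>lborel) = ennreal (Wint TYPE('n) h)"
  and "(\<integral>\<^sup>+ x. ennreal (wt A h (x - y)) \<partial>lborel) = ennreal (Wint TYPE('n) h)"
proof -
  have *: "(\<integral>\<^sup>+ (x::real^'n). ennreal (wt A h x) \<partial>lborel) = ennreal (Wint TYPE('n) h)"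
    unfolding Wint_def by (rule nn_integral_eq_integral[OF wt_integrable[OF sA assms]]) simp
  then show "(\<integral>\<^sup>+ (x::real^'n). ennreal (wt A h x) \<partial>lborel) = ennreal (Wint TYPE('n) h)" .
  have "(\<lambda>x::real^'n. ennreal (wt A h x)) \<in> borel_measurable borel" using wt_measurable[OF sA] by simp
  from nn_integral_shift[OF this, of "- y"] show "(\<integral>\<^sup>+ x. ennreal (wt A h (x - y)) \<partial>lborel) = ennreal (Wint TYPE('n) h)"
    using * by simp
qed

lemma wt_powr_le: "p \<ge> 1 \<Longrightarrow> wt A h x powr p \<le> wt A h x"
  using powr_mono'[of 1 p "wt A h x"] wt_le_1[OF sA, of h x] by simp

lemma lp_wt: assumes "p \<ge> 1" "h > 0" shows "lpfin p (wt A h :: real^('n::finite) \<Rightarrow> real)"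
proof -
  have "lpint p (wt A h :: real^'n \<Rightarrow> real) \<le> (\<integral>\<^sup>+ (x::real^'n). ennreal (wt A h x) \<partial>lborel)"
    unfolding lpint_def using wt_powr_le[OF assms(1)] by (intro nn_integral_mono ennreal_leI)
  also have "\<dots> < \<infinity>" by (simp add: nn_integral_wt(1)[OF assms(2)])
  finally show ?thesis by (simp add: lpfin_def)
qed

lemma li_wt: "lifin (wt A h :: real^('n::finite) \<Rightarrow> real)"
proof -
  have "AE x::real^'n in lborel. wt A h x \<le> 1" by (simp add: wt_le_1[OF sA])
  then show ?thesis using li_iff[of "wt A h :: real^'n \<Rightarrow> real" 1, OF nnm_wt] by simp
qed

text \<open>A substitute for the inequality of Hoelder that treats all p \<ge> 1 alike: for g \<ge>
  0 and 0 \<le> w \<le> 1 one has g w \<le> g^p + w, according to whether g is below or above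
  1.\<close>

lemma lp_int_wt:
  fixes G :: "real^('n::finite) \<Rightarrow> real"
  assumes p: "p \<ge> 1" and h: "h > 0" and G: "nnm G" "lpfin p G"
  shows "(\<integral>\<^sup>+ x. ennreal (G x * wt A h x) \<partial>lborel) \<le> ennreal ((1 + Wint TYPE('n) h) * lpn p G)"
proof -
  have [measurable]: "G \<in> borel_measurable borel" "wt A h \<in> borel_measurable borel" using G wt_measurable[OF sA] by (auto simp: nnm_def)
  let ?W = "Wint TYPE('n) h"
  have *: "(\<integral>\<^sup>+ x. ennreal (G x * wt A h x) \<partial>lborel) \<le> ennreal ((1 + ?W) * (lpn p G + e))" if e: "e > 0" for e
  proof -
    define a where "a = lpn p G + e"
    have a: "a > lpn p G" "a > 0" using e by (auto simp: a_def add_nonneg_pos)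
    have y: "(G x / a) * wt A h x \<le> (G x / a) powr p + wt A h x" for x
    proof (cases "G x / a \<le> 1")
      case True
      have "(G x / a) * wt A h x \<le> 1 * wt A h x" using True by (intro mult_right_mono) auto
      then show ?thesis using powr_ge_zero[of "G x / a" p] by linarith
    next
      case False
      have "(G x / a) * wt A h x \<le> (G x / a) * 1" using False wt_le_1[OF sA] by (intro mult_left_mono) auto
      also have "\<dots> \<le> (G x / a) powr p" using powr_mono[of 1 p "G x / a"] powr_one[of "G x / a"] False p by linarith
      finally show ?thesis using wt_nonneg[of A h x] by linarith
    qed
    have "(\<integral>\<^sup>+ x. ennreal (G x * wt A h x) \<partial>lborel) = (\<integral>\<^sup>+ x. ennreal a * ennreal ((G x / a) * wt A h x) \<partial>lborel)"
      using a G by (intro nn_integral_cong) (auto simp: nnm_def simp flip: ennreal_mult)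
    also have "\<dots> = ennreal a * (\<integral>\<^sup>+ x. ennreal ((G x / a) * wt A h x) \<partial>lborel)" by (simp add: nn_integral_cmult)
    also have "(\<integral>\<^sup>+ x. ennreal ((G x / a) * wt A h x) \<partial>lborel) \<le> (\<integral>\<^sup>+ x. ennreal ((G x / a) powr p) + ennreal (wt A h x) \<partial>lborel)"
      using y by (intro nn_integral_mono) (simp add: ennreal_leI flip: ennreal_plus)
    also have "\<dots> = (\<integral>\<^sup>+ x. ennreal ((G x / a) powr p) \<partial>lborel) + (\<integral>\<^sup>+ (x::real^'n). ennreal (wt A h x) \<partial>lborel)"
      by (simp add: nn_integral_add)
    also have "\<dots> \<le> 1 + ennreal ?W" unfolding nn_integral_wt(1)[OF h] by (intro add_mono lp_normalized p G a) simp
    also have "\<dots> = ennreal (1 + ?W)" by (simp flip: ennreal_plus ennreal_1)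
    finally have "(\<integral>\<^sup>+ x. ennreal (G x * wt A h x) \<partial>lborel) \<le> ennreal a * ennreal (1 + ?W)" by (simp add: mult_left_mono)
    also have "ennreal a * ennreal (1 + ?W) = ennreal (a * (1 + ?W))" by (rule ennreal_mult[symmetric]) (use a in auto)
    finally show ?thesis unfolding a_def[symmetric] by (simp only: mult.commute)
  qed
  have "(\<lambda>m. ennreal ((1 + ?W) * (lpn p G + 1 / real (Suc m)))) \<longlonglongrightarrow> ennreal ((1 + ?W) * (lpn p G + 0))"
    by (intro tendsto_ennrealI tendsto_intros LIMSEQ_Suc[OF lim_1_over_n])
  then show ?thesis by (intro LIMSEQ_le_const[where X = "\<lambda>m. ennreal ((1 + ?W) * (lpn p G + 1 / real (Suc m)))"]) (use * in auto)
qed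

lemma li_int_wt:
  fixes G :: "real^('n::finite) \<Rightarrow> real"
  assumes h: "h > 0" and G: "nnm G" "lifin G"
  shows "(\<integral>\<^sup>+ x. ennreal (G x * wt A h x) \<partial>lborel) \<le> ennreal ((1 + Wint TYPE('n) h) * lin G)"
proof -
  let ?W = "Wint TYPE('n) h"
  have "(\<integral>\<^sup>+ x. ennreal (G x * wt A h x) \<partial>lborel) \<le> ennreal (lin G * lpn 1 (wt A h :: real^'n \<Rightarrow> real))"
    by (rule l1_li_holder[OF G(1) nnm_wt G(2) lp_wt[OF _ h]]) simp
  also have "lpn 1 (wt A h :: real^'n \<Rightarrow> real) = ?W"
    using nn_integral_wt(1)[OF h, where 'n = 'n] by (simp add: lpn_def lpint_def)
  also have "ennreal (lin G * ?W) \<le> ennreal ((1 + ?W) * lin G)"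
    using lin_nonneg[OF G(1)] by (intro ennreal_leI) (simp add: algebra_simps)
  finally show ?thesis .
qed

definition lattW :: "('n::finite) itself \<Rightarrow> real \<Rightarrow> real" where
  "lattW T h = 1 + ea A (h * real CARD('n)) * Wint T (h / 2)"

lemma lattW_pos: "lattW T h > 0" "lattW T h \<ge> 0"
proof -
  have "ea A (h * real CARD('a)) * Wint T (h / 2) \<ge> 0" by simp
  then show "lattW T h > 0" "lattW T h \<ge> 0" unfolding lattW_def by linarith+
qed

lemma cell_unit_measure_eq: "emeasure lborel {x::real^('n::finite). cellof 1 x = v} = 1"
proof -
  have "emeasure lborel {x::real^'n. cellof 1 x = v} = (\<integral>\<^sup>+ x. indicator {x. cellof 1 x = v} x \<partial>lborel)" by simp
  also have "\<dots> = (\<integral>\<^sup>+ x. indicator {x. cellof 1 x = v} (cellpt 1 v + x) \<partial>lborel)"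
    by (rule nn_integral_shift[symmetric]) simp
  also have "\<dots> = (\<integral>\<^sup>+ x. indicator {x. cellof 1 x = (0::int^'n)} x \<partial>lborel)"
    by (intro nn_integral_cong) (auto simp: indicator_def cellof_shift)
  also have "\<dots> = emeasure lborel {x::real^'n. cellof 1 x = 0}" by simp
  finally have e: "emeasure lborel {x::real^'n. cellof 1 x = v} = emeasure lborel {x::real^'n. cellof 1 x = 0}" .
  have "box 0 1 \<subseteq> {x::real^'n. cellof 1 x = 0}"
    by (auto simp: mem_box_cart cellof_def vec_eq_iff floor_eq_iff less_imp_le)
  then have "emeasure lborel (box 0 (1::real^'n)) \<le> emeasure lborel {x::real^'n. cellof 1 x = 0}"
    by (rule emeasure_mono) simp
  moreover have "emeasure lborel (box 0 (1::real^'n)) = ennreal (\<Prod>b\<in>Basis. ((1::real^'n) - 0) \<bullet> b)"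
    by (rule emeasure_lborel_box) (auto simp: Basis_vec_def inner_axis)
  moreover have "(\<Prod>b\<in>Basis. ((1::real^'n) - 0) \<bullet> b) = 1" by (rule prod.neutral) (auto simp: Basis_vec_def inner_axis)
  ultimately have "1 \<le> emeasure lborel {x::real^'n. cellof 1 x = 0}" by simp
  then show ?thesis unfolding e using cell_unit_measure by (intro antisym)
qed

text \<open>Each value is averaged over the unit cell at its lattice point. Within a cell, of extent
  at most N, the kernel at level h is at most e^{A(h N)} times the kernel at level h / 2, and the
  cells are disjoint. This is the origin of \<open>lattW\<close>, whose summand 1 makes it
  positive.\<close>

lemma lattice_sum:
  fixes x :: "real^('n::finite)"
  assumes h: "h > 0" and I: "finite I"
  shows "(\<Sum>v\<in>I. wt A h (x - (cellpt 1 v + s))) \<le> lattW TYPE('n) h"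
proof -
  let ?N = "real CARD('n)"
  let ?E = "ea A (h * ?N)"
  define C where "C = (\<lambda>v::int^'n. {z::real^'n. cellof 1 z = v})"
  have Cm[measurable]: "C v \<in> sets borel" for v unfolding C_def by measurable
  have wm[measurable]: "(\<lambda>z. wt A (h / 2) (x - s - z)) \<in> borel_measurable borel"
  proof -
    have [measurable]: "wt A (h / 2) \<in> borel_measurable (borel :: (real^'n) measure)" by (rule wt_measurable[OF sA])
    show ?thesis by measurable
  qed
  have p: "wt A h (x - (cellpt 1 v + s)) \<le> ?E * wt A (h / 2) (x - s - z)" if "z \<in> C v" for z v
  proof -
    have nz: "norm (z - cellpt 1 v) \<le> ?N" using cellof_dist[of 1 z] that by (simp add: C_def)
    have "wt A (2 * (h / 2)) ((x - s - z) + (z - cellpt 1 v)) \<le> ea A (2 * (h / 2) * norm (z - cellpt 1 v)) * wt A (h / 2) (x - s - z)"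
      using h by (intro wt_shift sA) auto
    also have "\<dots> \<le> ?E * wt A (h / 2) (x - s - z)" using nz h by (intro mult_right_mono ea_mono sA) auto
    finally show ?thesis by (simp add: algebra_simps)
  qed
  have "ennreal (\<Sum>v\<in>I. wt A h (x - (cellpt 1 v + s))) = (\<Sum>v\<in>I. ennreal (wt A h (x - (cellpt 1 v + s))))" by simp
  also have "\<dots> \<le> (\<Sum>v\<in>I. \<integral>\<^sup>+ z. ennreal (?E * wt A (h / 2) (x - s - z)) * indicator (C v) z \<partial>lborel)"
  proof (rule sum_mono)
    fix v
    have "ennreal (wt A h (x - (cellpt 1 v + s))) = (\<integral>\<^sup>+ z. ennreal (wt A h (x - (cellpt 1 v + s))) * indicator (C v) z \<partial>lborel)"
      using cell_unit_measure_eq[of v] by (subst nn_integral_cmult_indicator) (auto simp: C_def)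
    also have "\<dots> \<le> (\<integral>\<^sup>+ z. ennreal (?E * wt A (h / 2) (x - s - z)) * indicator (C v) z \<partial>lborel)"
      using p[of _ v] by (intro nn_integral_mono) (auto simp: indicator_def intro!: ennreal_leI)
    finally show "ennreal (wt A h (x - (cellpt 1 v + s))) \<le> (\<integral>\<^sup>+ z. ennreal (?E * wt A (h / 2) (x - s - z)) * indicator (C v) z \<partial>lborel)" .
  qed
  also have "\<dots> = (\<integral>\<^sup>+ z. (\<Sum>v\<in>I. ennreal (?E * wt A (h / 2) (x - s - z)) * indicator (C v) z) \<partial>lborel)"
    by (rule nn_integral_sum[symmetric]) simp
  also have "\<dots> \<le> (\<integral>\<^sup>+ z. ennreal (?E * wt A (h / 2) (x - s - z)) \<partial>lborel)"
  proof (rule nn_integral_mono)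
    fix z
    have "(\<Sum>v\<in>I. ennreal (?E * wt A (h / 2) (x - s - z)) * indicator (C v) z) = (\<Sum>v\<in>I. if v = cellof 1 z then ennreal (?E * wt A (h / 2) (x - s - z)) else 0)"
      by (rule sum.cong) (auto simp: C_def indicator_def)
    then show "(\<Sum>v\<in>I. ennreal (?E * wt A (h / 2) (x - s - z)) * indicator (C v) z) \<le> ennreal (?E * wt A (h / 2) (x - s - z))"
      using I by simp
  qed
  also have "\<dots> = (\<integral>\<^sup>+ z. ennreal ?E * ennreal (wt A (h / 2) (z - (x - s))) \<partial>lborel)"
    by (intro nn_integral_cong) (simp add: ennreal_mult wt_minus_commute[of A "h / 2" "x - s"])
  also have "\<dots> = ennreal ?E * (\<integral>\<^sup>+ z. ennreal (wt A (h / 2) (z - (x - s))) \<partial>lborel)"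
    using nnm_wt_shift[of "h / 2" "x - s"] by (intro nn_integral_cmult) (auto simp: nnm_def)
  also have "\<dots> = ennreal (?E * Wint TYPE('n) (h / 2))"
    using h by (simp add: nn_integral_wt(2) ennreal_mult)
  finally have "(\<Sum>v\<in>I. wt A h (x - (cellpt 1 v + s))) \<le> ?E * Wint TYPE('n) (h / 2)"
    by (simp add: ennreal_le_iff)
  then show ?thesis by (simp add: lattW_def)
qed

text \<open>A Young inequality for a discrete measure against the kernel wt: the weights
  of the lattice points have total mass at most lattW, so Jensen applies.\<close>

lemma lp_lattice:
  fixes b :: "int^('n::finite) \<Rightarrow> real"
  assumes p: "p \<ge> 1" and h: "h > 0" and I: "finite I" and b: "\<And>v. b v \<ge> 0"
  shows "lpn p (\<lambda>x. \<Sum>v\<in>I. b v * wt A h (x - (cellpt 1 v + s))) \<le> 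
     (lattW TYPE('n) h powr (p - 1) * Wint TYPE('n) h) powr (1 / p) * (\<Sum>v\<in>I. b v powr p) powr (1 / p)"
proof -
  let ?w = "\<lambda>v x. wt A h (x - (cellpt 1 v + s))"
  let ?L = "lattW TYPE('n) h" and ?W = "Wint TYPE('n) h"
  have L: "?L > 0" by (rule lattW_pos)
  have wm[measurable]: "?w v \<in> borel_measurable borel" for v using nnm_wt_shift by (auto simp: nnm_def)
  have pw: "(\<Sum>v\<in>I. b v * ?w v x) powr p \<le> ?L powr (p - 1) * (\<Sum>v\<in>I. b v powr p * ?w v x)" for x
  proof (cases "I = {}")
    case False
    define t where "t = (\<Sum>v\<in>I. ?w v x)"
    have t: "t > 0" unfolding t_def using False I by (intro sum_pos) auto
    have tL: "t \<le> ?L" unfolding t_def by (rule lattice_sum[OF h I])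
    have s1: "(\<Sum>v\<in>I. ?w v x / t) = 1" using t by (simp add: t_def sum_divide_distrib[symmetric])
    have "(\<Sum>v\<in>I. (?w v x / t) *\<^sub>R b v) powr p \<le> (\<Sum>v\<in>I. (?w v x / t) * (b v powr p))"
      by (rule convex_on_sum[OF I False powr_convex_nonneg[OF p] s1]) (use t b in auto)
    also have "(\<Sum>v\<in>I. (?w v x / t) *\<^sub>R b v) = (\<Sum>v\<in>I. b v * ?w v x) / t"
      by (simp add: sum_divide_distrib mult.commute)
    also have "(\<Sum>v\<in>I. (?w v x / t) * (b v powr p)) = (\<Sum>v\<in>I. b v powr p * ?w v x) / t"
      by (simp add: sum_divide_distrib mult.commute)
    finally have c: "((\<Sum>v\<in>I. b v * ?w v x) / t) powr p \<le> (\<Sum>v\<in>I. b v powr p * ?w v x) / t" .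
    have nn: "(\<Sum>v\<in>I. b v * ?w v x) \<ge> 0" "(\<Sum>v\<in>I. b v powr p * ?w v x) \<ge> 0" using b by (auto intro!: sum_nonneg)
    have "(\<Sum>v\<in>I. b v * ?w v x) powr p = (t * ((\<Sum>v\<in>I. b v * ?w v x) / t)) powr p" using t by simp
    also have "\<dots> = t powr p * ((\<Sum>v\<in>I. b v * ?w v x) / t) powr p" by (rule powr_mult)
    also have "\<dots> \<le> t powr p * ((\<Sum>v\<in>I. b v powr p * ?w v x) / t)" using c by (intro mult_left_mono) auto
    also have "\<dots> = t powr (p - 1) * (\<Sum>v\<in>I. b v powr p * ?w v x)" using t by (simp add: powr_diff)
    also have "\<dots> \<le> ?L powr (p - 1) * (\<Sum>v\<in>I. b v powr p * ?w v x)" using tL t p nn by (intro mult_right_mono powr_mono2) auto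
    finally show ?thesis .
  qed simp
  have "lpint p (\<lambda>x. \<Sum>v\<in>I. b v * ?w v x) \<le> (\<integral>\<^sup>+ x. ennreal (?L powr (p - 1) * (\<Sum>v\<in>I. b v powr p * ?w v x)) \<partial>lborel)"
    unfolding lpint_def by (intro nn_integral_mono ennreal_leI pw)
  also have "\<dots> = (\<integral>\<^sup>+ x. (\<Sum>v\<in>I. ennreal (?L powr (p - 1) * b v powr p) * ennreal (?w v x)) \<partial>lborel)"
    by (intro nn_integral_cong) (simp add: sum_distrib_left ennreal_mult[symmetric] mult.assoc sum_nonneg flip: sum_ennreal)
  also have "\<dots> = (\<Sum>v\<in>I. ennreal (?L powr (p - 1) * b v powr p) * (\<integral>\<^sup>+ x. ennreal (?w v x) \<partial>lborel))"
    by (simp add: nn_integral_sum nn_integral_cmult)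
  also have "\<dots> = (\<Sum>v\<in>I. ennreal (?L powr (p - 1) * b v powr p * ?W))"
    using h by (simp add: nn_integral_wt(2) ennreal_mult)
  also have "\<dots> = ennreal ((?L powr (p - 1) * ?W) * (\<Sum>v\<in>I. b v powr p))"
    by (simp add: sum_distrib_left sum_distrib_right mult_ac)
  also have "\<dots> = ennreal (((?L powr (p - 1) * ?W) powr (1 / p) * (\<Sum>v\<in>I. b v powr p) powr (1 / p)) powr p)"
    using p by (simp add: powr_mult powr_powr sum_nonneg)
  finally show ?thesis using lp_iff[OF p, of "(?L powr (p - 1) * ?W) powr (1 / p) * (\<Sum>v\<in>I. b v powr p) powr (1 / p)" "\<lambda>x. \<Sum>v\<in>I. b v * ?w v x"] by simp
qed

text \<open>The coefficients F^(q - 1) are extremal in the inequality of Hoelder. With T the sum of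
  F^q over a translated lattice, the hypothesis and \<open>lp_lattice\<close> give T \<le> D K
  T^(1/p), hence T^(1/q) \<le> D K. This is uniform in the translation, so \<open>tiling\<close>
  bounds the integral.\<close>

lemma lp_dual_lattice:
  fixes F :: "real^('n::finite) \<Rightarrow> real"
  assumes p: "p > 1" and h: "h > 0" and F: "nnm F" and D: "D \<ge> 0"
    and hyp: "\<And>(I :: (int^'n) set) pt b. finite I \<Longrightarrow> (\<And>v. b v \<ge> 0) \<Longrightarrow> (\<Sum>v\<in>I. b v * F (pt v)) \<le> D * lpn p (\<lambda>x. \<Sum>v\<in>I. b v * wt A h (x - pt v))"
  shows "lpfin (p / (p - 1)) F \<and> lpn (p / (p - 1)) F \<le> D * (lattW TYPE('n) h powr (p - 1) * Wint TYPE('n) h) powr (1 / p)"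
proof -
  define q where "q = p / (p - 1)"
  have q: "q > 1" "q \<ge> 1" "p \<ge> 1" "(q - 1) * p = q" "1 - 1 / p = 1 / q" using p by (auto simp: q_def field_simps)
  let ?K = "(lattW TYPE('n) h powr (p - 1) * Wint TYPE('n) h) powr (1 / p)"
  have Fn: "F x \<ge> 0" for x using F by (simp add: nnm_def)
  have "(\<integral>\<^sup>+ x. ennreal (F x powr q) \<partial>lborel) \<le> ennreal ((D * ?K) powr q)"
  proof (rule tiling)
    show "(\<lambda>x. ennreal (F x powr q)) \<in> borel_measurable borel" using F by (auto simp: nnm_def)
    fix s and I :: "(int^'n) set" assume I: "finite I"
    define T where "T = (\<Sum>v\<in>I. F (cellpt 1 v + s) powr q)"
    have T0: "T \<ge> 0" unfolding T_def by (intro sum_nonneg) auto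
    have "T = (\<Sum>v\<in>I. F (cellpt 1 v + s) powr (q - 1) * F (cellpt 1 v + s))"
      unfolding T_def
    proof (rule sum.cong[OF refl])
      fix v show "F (cellpt 1 v + s) powr q = F (cellpt 1 v + s) powr (q - 1) * F (cellpt 1 v + s)"
        using Fn[of "cellpt 1 v + s"] q(1) by (cases "F (cellpt 1 v + s) = 0") (auto simp: powr_diff)
    qed
    also have "\<dots> \<le> D * lpn p (\<lambda>x. \<Sum>v\<in>I. F (cellpt 1 v + s) powr (q - 1) * wt A h (x - (cellpt 1 v + s)))"
      by (rule hyp[OF I]) simp
    also have "\<dots> \<le> D * (?K * (\<Sum>v\<in>I. (F (cellpt 1 v + s) powr (q - 1)) powr p) powr (1 / p))"
      by (intro mult_left_mono lp_lattice q h I D) simp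
    also have "(\<Sum>v\<in>I. (F (cellpt 1 v + s) powr (q - 1)) powr p) = T" by (simp add: T_def powr_powr q)
    finally have le: "T \<le> D * ?K * T powr (1 / p)" by (simp add: mult.assoc)
    have "T \<le> (D * ?K) powr q"
    \<comment> \<open>T is finite as a sum over finitely many points, so dividing by T^(1/p) is
      legitimate once T is nonzero.\<close>
    proof (cases "T = 0")
      case False
      then have T: "T > 0" using T0 by simp
      have "T powr (1 / q) = T / T powr (1 / p)" unfolding q(5)[symmetric] using T by (simp add: powr_diff)
      also have "\<dots> \<le> D * ?K" using le T by (simp add: pos_divide_le_eq)
      finally have "(T powr (1 / q)) powr q \<le> (D * ?K) powr q" using q by (intro powr_mono2) auto
      then show ?thesis using T q by (simp add: powr_powr)
    qed simp
    then show "(\<Sum>v\<in>I. ennreal (F (cellpt 1 v + s) powr q)) \<le> ennreal ((D * ?K) powr q)"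
      by (simp add: T_def ennreal_leI)
  qed
  then have "lpint q F \<le> ennreal ((D * ?K) powr q)" by (simp add: lpint_def)
  then show ?thesis unfolding q_def[symmetric] using lp_iff[OF q(2), of "D * ?K" F] D by simp
qed

text \<open>All coefficients are taken to be 1: the sum of the kernels over a translated lattice is
  bounded by \<open>lattice_sum\<close>, and \<open>tiling\<close> turns sums of F over such
  lattices into its integral.\<close>

lemma li_dual_lattice:
  fixes F :: "real^('n::finite) \<Rightarrow> real"
  assumes h: "h > 0" and F: "nnm F" and D: "D \<ge> 0"
    and hyp: "\<And>(I :: (int^'n) set) pt b. finite I \<Longrightarrow> (\<And>v. b v \<ge> 0) \<Longrightarrow> (\<Sum>v\<in>I. b v * F (pt v)) \<le> D * lin (\<lambda>x. \<Sum>v\<in>I. b v * wt A h (x - pt v))"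
  shows "lpfin 1 F \<and> lpn 1 F \<le> D * lattW TYPE('n) h"
proof -
  have Fn: "F x \<ge> 0" for x using F by (simp add: nnm_def)
  have "(\<integral>\<^sup>+ x. ennreal (F x) \<partial>lborel) \<le> ennreal (D * lattW TYPE('n) h)"
  proof (rule tiling)
    show "(\<lambda>x. ennreal (F x)) \<in> borel_measurable borel" using F by (auto simp: nnm_def)
    fix s and I :: "(int^'n) set" assume I: "finite I"
    have "(\<Sum>v\<in>I. 1 * F (cellpt 1 v + s)) \<le> D * lin (\<lambda>x. \<Sum>v\<in>I. 1 * wt A h (x - (cellpt 1 v + s)))"
      by (rule hyp[OF I]) simp
    also have "lin (\<lambda>x. \<Sum>v\<in>I. 1 * wt A h (x - (cellpt 1 v + s))) \<le> lattW TYPE('n) h"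
    proof -
      have "nnm (\<lambda>x. \<Sum>v\<in>I. 1 * wt A h (x - (cellpt 1 v + s)))" by (intro nnm_sum I) (simp add: nnm_wt_shift)
      then have "lifin (\<lambda>x. \<Sum>v\<in>I. 1 * wt A h (x - (cellpt 1 v + s))) \<and> lin (\<lambda>x. \<Sum>v\<in>I. 1 * wt A h (x - (cellpt 1 v + s))) \<le> lattW TYPE('n) h"
        using lattice_sum[OF h I] by (subst li_iff) (auto simp: lattW_pos)
      then show ?thesis ..
    qed
    finally show "(\<Sum>v\<in>I. ennreal (F (cellpt 1 v + s))) \<le> ennreal (D * lattW TYPE('n) h)"
      using D Fn by (simp add: ennreal_leI mult_left_mono)
  qed
  then have "lpint 1 F \<le> ennreal ((D * lattW TYPE('n) h) powr 1)" using Fn D lattW_pos(2)[of "TYPE('n)" h] by (simp add: lpint_def)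
  then show ?thesis using lp_iff[of 1 "D * lattW TYPE('n) h" F] D lattW_pos(2)[of "TYPE('n)" h] by simp
qed

text \<open>A single point with coefficient 1 suffices and bounds F everywhere, since all translates
  of the kernel have the same integral.\<close>

lemma l1_dual_lattice:
  fixes F :: "real^('n::finite) \<Rightarrow> real"
  assumes h: "h > 0" and F: "nnm F" and D: "D \<ge> 0"
    and hyp: "\<And>(I :: (int^'n) set) pt b. finite I \<Longrightarrow> (\<And>v. b v \<ge> 0) \<Longrightarrow> (\<Sum>v\<in>I. b v * F (pt v)) \<le> D * lpn 1 (\<lambda>x. \<Sum>v\<in>I. b v * wt A h (x - pt v))"
  shows "lifin F \<and> lin F \<le> D * Wint TYPE('n) h"
proof -
  have "F s \<le> D * Wint TYPE('n) h" for s
    using hyp[of "{0}" "\<lambda>_. 1" "\<lambda>_. s"] nn_integral_wt(2)[OF h, of s] by (simp add: lpn_def lpint_def)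
  then show ?thesis using li_iff[OF F, of "D * Wint TYPE('n) h"] D by simp
qed

end

section \<open>Amalgam norms on test functions\<close>

lemma continuous_AE_zero:
  fixes f :: "real^('n::finite) \<Rightarrow> complex"
  assumes "continuous_on UNIV f" "AE x in lborel. f x = 0"
  shows "f x = 0"
proof (rule ccontr)
  assume nz: "f x \<noteq> 0"
  let ?U = "{x. f x \<noteq> 0}"
  have o: "open ?U" using open_Collect_neq[OF assms(1) continuous_on_const] .
  have "AE x in lborel. x \<notin> ?U" using assms(2) by simp
  then have "?U \<in> null_sets lborel" using o by (subst (asm) AE_iff_null_sets[symmetric]) auto
  then have "negligible ?U" by (simp add: negligible_iff_null_sets null_sets_completionI)
  then show False using open_not_negligible[OF o] nz by blast
qed

context gsk begin

lemma closableD: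
  assumes "closable n" "\<And>j. s j \<in> S" "ncauchy n s" "\<And>\<psi>. \<psi> \<in> S \<Longrightarrow> (\<lambda>j. LINT x|lborel. s j x * \<psi> x) \<longlonglongrightarrow> 0"
  shows "(\<lambda>j. n (s j)) \<longlonglongrightarrow> 0"
  using assms(1)[unfolded closable_def, rule_format, OF assms(2,3,4)] .

text \<open>Makes it possible to divide by the constant of the averaging formula, called c0 in the
  later proofs.\<close>

lemma S_integral_cnj_nonzero:
  fixes \<theta> :: "('n::finite) tf"
  assumes \<theta>: "\<theta> \<in> S" and nz: "\<theta> \<noteq> (\<lambda>x. 0)"
  shows "(LINT x|lborel. \<theta> x * cnj (\<theta> x)) \<noteq> 0"
proof
  assume z: "(LINT x|lborel. \<theta> x * cnj (\<theta> x)) = 0"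
  have e: "\<theta> x * cnj (\<theta> x) = complex_of_real ((cmod (\<theta> x))\<^sup>2)" for x by (rule complex_norm_square[symmetric])
  have i: "integrable lborel (\<lambda>x. complex_of_real ((cmod (\<theta> x))\<^sup>2))"
    using S_integrable_mult[OF \<theta> S_cnj[OF \<theta>]] unfolding e .
  have i': "integrable lborel (\<lambda>x. (cmod (\<theta> x))\<^sup>2)" using i unfolding complex_of_real_integrable_eq .
  have "complex_of_real (LINT x|lborel. (cmod (\<theta> x))\<^sup>2) = 0" using z unfolding e integral_complex_of_real .
  then have "(LINT x|lborel. (cmod (\<theta> x))\<^sup>2) = 0" by (simp only: of_real_eq_0_iff)
  then have "AE x in lborel. (cmod (\<theta> x))\<^sup>2 = 0"
    using integral_nonneg_eq_0_iff_AE[OF i'] by simp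
  then have "AE x in lborel. \<theta> x = 0" by simp
  then have "\<theta> x = 0" for x using continuous_AE_zero[OF S_continuous[OF \<theta>]] by blast
  then show False using nz by auto
qed

text \<open>This and the next two predicates isolate a bound at one parameter, so that
  \<open>cls\<close> statements can be rescaled and combined.\<close>

definition ncont :: "(('n::finite) tf \<Rightarrow> real) \<Rightarrow> real \<Rightarrow> bool" where
  "ncont n h \<longleftrightarrow> (\<exists>C\<ge>0. \<forall>\<phi>\<in>S \<inter> GSh M A h. n \<phi> \<le> C * GSnorm M A h \<phi>)"

definition mult_ok :: "(('n::finite) tf \<Rightarrow> real) \<Rightarrow> real \<Rightarrow> bool" where
  "mult_ok n h \<longleftrightarrow> (\<exists>C\<ge>0. \<forall>\<phi>\<in>S. \<forall>\<psi>\<in>S \<inter> GSh M A h. \<forall>x. n (\<lambda>y. \<phi> y * \<psi> (y - x)) \<le> C * GSnorm M A h \<psi> * n \<phi>)"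

definition eta_ok :: "(real^('n::finite) \<Rightarrow> real) \<Rightarrow> real \<Rightarrow> bool" where
  "eta_ok \<eta> \<tau> \<longleftrightarrow> (\<exists>C>0. \<forall>x y. \<eta> (x + y) \<le> C * \<eta> x * ea A (\<tau> * norm y))"

lemma ncont_up: "0 < h \<Longrightarrow> h \<le> h' \<Longrightarrow> ncont n h \<Longrightarrow> ncont n h'"
  unfolding ncont_def by (rule cont_bound_up) auto

lemma ncont_cls: "gsn n \<Longrightarrow> cls k (ncont n)"
  unfolding ncont_def by (rule gsn_cls)

lemma mult_ok_up:
  assumes n: "gsn n" and h: "0 < h" "h \<le> h'" and m: "mult_ok n h"
  shows "mult_ok n h'"
proof -
  obtain C where C: "C \<ge> 0" "\<And>\<phi> \<psi> x. \<phi> \<in> S \<Longrightarrow> \<psi> \<in> S \<inter> GSh M A h \<Longrightarrow> n (\<lambda>y. \<phi> y * \<psi> (y - x)) \<le> C * GSnorm M A h \<psi> * n \<phi>"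
    using m unfolding mult_ok_def by blast
  have "n (\<lambda>y. \<phi> y * \<psi> (y - x)) \<le> C * GSnorm M A h' \<psi> * n \<phi>" if "\<phi> \<in> S" "\<psi> \<in> S \<inter> GSh M A h'" for \<phi> \<psi> x
  proof -
    note mo = GSh_mono[OF h, of \<psi>]
    have "n (\<lambda>y. \<phi> y * \<psi> (y - x)) \<le> C * GSnorm M A h \<psi> * n \<phi>" using that mo by (intro C(2)) auto
    also have "\<dots> \<le> C * GSnorm M A h' \<psi> * n \<phi>"
      using mo that C(1) gsn_nonneg[OF n that(1)] by (intro mult_right_mono mult_left_mono) auto
    finally show ?thesis .
  qed
  then show ?thesis using C(1) unfolding mult_ok_def by blast
qed

lemma mod_bound_up:
  assumes n: "gsn n" and h: "0 < h" "h \<le> h'" and m: "mod_bound n h"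
  shows "mod_bound n h'"
proof -
  obtain C where C: "C > 0" "\<And>\<phi> x. \<phi> \<in> S \<Longrightarrow> n (\<lambda>z. \<phi> (z - x)) \<le> C * ea A (h * norm x) * n \<phi>"
    "\<And>\<phi> x. \<phi> \<in> S \<Longrightarrow> n (\<lambda>z. chr x z * \<phi> z) \<le> C * ea M (h * norm x) * n \<phi>" using m unfolding mod_bound_def by blast
  have e: "ea A (h * norm x) \<le> ea A (h' * norm x)" "ea M (h * norm x) \<le> ea M (h' * norm x)" for x :: "real^'a"
    using h by (auto intro!: ea_mono sA sM mult_right_mono)
  have "n (\<lambda>z. \<phi> (z - x)) \<le> C * ea A (h' * norm x) * n \<phi> \<and> n (\<lambda>z. chr x z * \<phi> z) \<le> C * ea M (h' * norm x) * n \<phi>"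
    if "\<phi> \<in> S" for \<phi> x
  proof
    have "C * ea A (h * norm x) * n \<phi> \<le> C * ea A (h' * norm x) * n \<phi>" "C * ea M (h * norm x) * n \<phi> \<le> C * ea M (h' * norm x) * n \<phi>"
      using C(1) e gsn_nonneg[OF n that] by (auto intro!: mult_right_mono mult_left_mono)
    then show "n (\<lambda>z. \<phi> (z - x)) \<le> C * ea A (h' * norm x) * n \<phi>" "n (\<lambda>z. chr x z * \<phi> z) \<le> C * ea M (h' * norm x) * n \<phi>"
      using C(2,3)[OF that, of x] by linarith+
  qed
  then show ?thesis using C(1) unfolding mod_bound_def by blast
qed

lemma eta_ok_up:
  assumes "\<And>x. \<eta> x > 0" and h: "0 < h" "h \<le> h'" and m: "eta_ok \<eta> h"
  shows "eta_ok \<eta> h'"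
proof -
  obtain C where C: "C > 0" "\<And>x y. \<eta> (x + y) \<le> C * \<eta> x * ea A (h * norm y)" using m unfolding eta_ok_def by blast
  have "\<eta> (x + y) \<le> C * \<eta> x * ea A (h' * norm y)" for x y
    using C(1) assms(1)[of x] h by (intro order_trans[OF C(2)] mult_left_mono ea_mono sA mult_right_mono) auto
  then show ?thesis using C(1) unfolding eta_ok_def by blast
qed

text \<open>Of the two kernel factors hidden in level H \<tau>, one absorbs the growth of the weight
  between x and y and the other remains. The weight can thus be moved from x to y, both for \<eta>
  and for its reciprocal.\<close>

lemma eta_wt:
  fixes \<eta> :: "real^('n::finite) \<Rightarrow> real"
  assumes pos: "\<And>x. \<eta> x > 0" and \<tau>: "\<tau> > 0" and m: "eta_ok \<eta> \<tau>"
  shows "\<exists>C>0. \<forall>x y. \<eta> x * wt A (H * \<tau>) (x - y) \<le> C * \<eta> y * wt A \<tau> (x - y)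
     \<and> wt A (H * \<tau>) (x - y) / \<eta> x \<le> C * wt A \<tau> (x - y) / \<eta> y"
proof -
  obtain C where C: "C > 0" "\<And>x y. \<eta> (x + y) \<le> C * \<eta> x * ea A (\<tau> * norm y)" using m unfolding eta_ok_def by blast
  have w: "wt A (H * \<tau>) z * ea A (\<tau> * norm z) \<le> c * wt A \<tau> z" for z :: "real^'n"
  proof -
    have "wt A (H * \<tau>) z * ea A (\<tau> * norm z) \<le> c * (wt A \<tau> z)\<^sup>2 * ea A (\<tau> * norm z)"
      using wt_sq[OF sA M2A H1 c1, of \<tau> z] \<tau> by (intro mult_right_mono) auto
    also have "\<dots> = c * wt A \<tau> z" by (simp add: wt_def power2_eq_square)
    finally show ?thesis .
  qed
  have "\<eta> x * wt A (H * \<tau>) (x - y) \<le> (C * c) * \<eta> y * wt A \<tau> (x - y) \<and> wt A (H * \<tau>) (x - y) / \<eta> x \<le> (C * c) * wt A \<tau> (x - y) / \<eta> y" for x y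
  proof
    have 1: "\<eta> x \<le> C * \<eta> y * ea A (\<tau> * norm (x - y))" using C(2)[of y "x - y"] by simp
    have 2: "\<eta> y \<le> C * \<eta> x * ea A (\<tau> * norm (x - y))" using C(2)[of x "y - x"] by (simp add: norm_minus_commute)
    have "\<eta> x * wt A (H * \<tau>) (x - y) \<le> (C * \<eta> y * ea A (\<tau> * norm (x - y))) * wt A (H * \<tau>) (x - y)"
      using 1 by (intro mult_right_mono) auto
    also have "\<dots> = C * \<eta> y * (wt A (H * \<tau>) (x - y) * ea A (\<tau> * norm (x - y)))" by simp
    also have "\<dots> \<le> C * \<eta> y * (c * wt A \<tau> (x - y))" using C(1) pos[of y] w by (intro mult_left_mono) auto
    finally show "\<eta> x * wt A (H * \<tau>) (x - y) \<le> (C * c) * \<eta> y * wt A \<tau> (x - y)" by (simp add: mult_ac)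
    have "wt A (H * \<tau>) (x - y) * \<eta> y \<le> wt A (H * \<tau>) (x - y) * (C * \<eta> x * ea A (\<tau> * norm (x - y)))"
      using 2 by (intro mult_left_mono) auto
    also have "\<dots> = C * \<eta> x * (wt A (H * \<tau>) (x - y) * ea A (\<tau> * norm (x - y)))" by simp
    also have "\<dots> \<le> C * \<eta> x * (c * wt A \<tau> (x - y))" using C(1) pos[of x] w by (intro mult_left_mono) auto
    finally have "wt A (H * \<tau>) (x - y) * \<eta> y \<le> (C * c * wt A \<tau> (x - y)) * \<eta> x" by (simp add: mult_ac)
    then show "wt A (H * \<tau>) (x - y) / \<eta> x \<le> (C * c) * wt A \<tau> (x - y) / \<eta> y"
      using pos[of x] pos[of y] by (simp add: divide_simps mult_ac)
  qed
  then show ?thesis using C(1) c1 by (intro exI[of _ "C * c"]) auto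
qed

end

text \<open>\<open>Y\<close> plays the role of a Lebesgue norm of nonnegative measurable functions, \<open>fin\<close> that of its
  finiteness, because the real-valued norm alone is junk on functions of infinite norm.\<close>

locale fnsp = gsk M A c H k for M A :: "nat \<Rightarrow> real" and c H :: real and k :: GSkind +
  fixes fin :: "(real^('n::finite) \<Rightarrow> real) \<Rightarrow> bool" and Y :: "(real^'n \<Rightarrow> real) \<Rightarrow> real"
  assumes fmono: "\<And>G G' K. nnm G \<Longrightarrow> nnm G' \<Longrightarrow> fin G' \<Longrightarrow> K \<ge> 0 \<Longrightarrow> (\<And>x. G x \<le> K * G' x) \<Longrightarrow> fin G \<and> Y G \<le> K * Y G'"
    and fadd: "\<And>G G'. nnm G \<Longrightarrow> nnm G' \<Longrightarrow> fin G \<Longrightarrow> fin G' \<Longrightarrow> fin (\<lambda>x. G x + G' x) \<and> Y (\<lambda>x. G x + G' x) \<le> Y G + Y G'"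
    and fnonneg: "\<And>G. nnm G \<Longrightarrow> fin G \<Longrightarrow> Y G \<ge> 0"
    and fwt: "\<And>h. h > 0 \<Longrightarrow> fin (wt A h)"
    and fint: "\<And>h. h > 0 \<Longrightarrow> \<exists>C\<ge>0. \<forall>G. nnm G \<longrightarrow> fin G \<longrightarrow> (\<integral>\<^sup>+ x. ennreal (G x * wt A h x) \<partial>lborel) \<le> ennreal (C * Y G)"
    and ffatou: "\<And>Gs G B. (\<And>j::nat. nnm (Gs j)) \<Longrightarrow> nnm G \<Longrightarrow> (\<And>x. (\<lambda>j. Gs j x) \<longlonglongrightarrow> G x) \<Longrightarrow> (\<And>j. fin (Gs j)) \<Longrightarrow> (\<And>j. Y (Gs j) \<le> B) \<Longrightarrow> Y G \<le> B"
    and fshift: "\<And>G y. nnm G \<Longrightarrow> fin G \<Longrightarrow> fin (\<lambda>x. G (x - y)) \<and> Y (\<lambda>x. G (x - y)) \<le> Y G"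

locale winsp = fnsp M A c H k fin Y for M A :: "nat \<Rightarrow> real" and c H :: real and k :: GSkind
    and fin :: "(real^('n::finite) \<Rightarrow> real) \<Rightarrow> bool" and Y :: "(real^'n \<Rightarrow> real) \<Rightarrow> real" +
  fixes n :: "'n tf \<Rightarrow> real" and \<eta> :: "real^'n \<Rightarrow> real" and \<theta> :: "'n tf"
  assumes tn: "tnorm n" and wei: "weight k A \<eta>" and \<theta>: "\<theta> \<in> S" and \<theta>nz: "\<theta> \<noteq> (\<lambda>x. 0)"
begin

lemma gn: "gsn n" using tn by (rule tnorm_gsn)

lemma \<eta>pos: "\<eta> x > 0" using wei by (simp add: weight_def)

lemma \<eta>_nonneg [simp]: "\<eta> x \<ge> 0" "\<eta> x \<noteq> 0" using \<eta>pos[of x] by auto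

lemma \<eta>_measurable [measurable]: "\<eta> \<in> borel_measurable borel" using wei by (simp add: weight_def)

lemma eta_cls: "cls k (eta_ok \<eta>)"
  using wei unfolding weight_def eta_ok_def ea_def by blast

lemma mult_cls: "cls k (mult_ok n)"
  unfolding mult_ok_def using gsn_multiplier[OF gn] tn by (simp add: tnorm_def)

definition wf :: "'n tf \<Rightarrow> real^'n \<Rightarrow> real" where
  "wf \<phi> x = n (\<lambda>y. \<phi> y * \<theta> (y - x))"

definition Gf :: "'n tf \<Rightarrow> real^'n \<Rightarrow> real" where
  "Gf \<phi> x = wf \<phi> x * \<eta> x"

text \<open>For Y the Lebesgue norm of exponent p, or the essential supremum, this is the norm of
  the amalgam space over E on embedded test functions when n is the norm of E there.\<close>

definition NY :: "'n tf \<Rightarrow> real" where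
  "NY \<phi> = Y (Gf \<phi>)"

lemma wf_nonneg: "\<phi> \<in> S \<Longrightarrow> wf \<phi> x \<ge> 0"
  unfolding wf_def by (intro gsn_nonneg gn S_mult_trans \<theta>)

lemma nnm_Gf: assumes "\<phi> \<in> S" shows "nnm (Gf \<phi>)"
proof -
  have [measurable]: "wf \<phi> \<in> borel_measurable borel"
    unfolding wf_def using gsn_trans(3)[OF gn assms \<theta>] by (intro borel_measurable_continuous_onI)
  have "Gf \<phi> \<in> borel_measurable borel" unfolding Gf_def by measurable
  then show ?thesis using wf_nonneg[OF assms] by (simp add: nnm_def Gf_def)
qed

text \<open>The product of two translates is small everywhere, as no point is close to two distant points.\<close>

lemma pair_decay:
  assumes \<psi>: "\<psi> \<in> S" and \<kappa>: "\<kappa> \<in> S"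
  shows "\<exists>\<tau>>0. \<exists>C\<ge>0. eta_ok \<eta> \<tau> \<and> (\<forall>\<phi>\<in>S. \<forall>x y. n (\<lambda>z. \<phi> z * (\<psi> (z - x) * \<kappa> (z - y))) \<le> C * wt A (H * \<tau>) (x - y) * n \<phi>)"
proof -
  have H0: "H > 0" "2 * H * H > 0" using H1 by auto
  have "cls k (\<lambda>\<tau>. eta_ok \<eta> \<tau> \<and> mult_ok n (H * \<tau>))"
  proof (rule cls_conj[OF eta_cls cls_scale[OF mult_cls H0(1)]])
    fix h h' :: real assume h: "0 < h" "h \<le> h'"
    show "eta_ok \<eta> h \<Longrightarrow> eta_ok \<eta> h'" by (rule eta_ok_up[OF \<eta>pos h])
    show "mult_ok n (H * h) \<Longrightarrow> mult_ok n (H * h')" by (rule mult_ok_up[OF gn]) (use h H1 in auto)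
  qed
  from cls_meet[OF this S_dcl2[OF \<psi> \<kappa> H0(2)]] obtain \<tau> where \<tau>: "\<tau> > 0" "eta_ok \<eta> \<tau>" "mult_ok n (H * \<tau>)"
    "\<psi> \<in> GSh M A (2 * H * (H * \<tau>))" "\<kappa> \<in> GSh M A (2 * H * (H * \<tau>))" by (auto simp: mult.assoc)
  from \<tau>(3) obtain C where C: "C \<ge> 0" "\<And>\<phi> \<psi> x. \<phi> \<in> S \<Longrightarrow> \<psi> \<in> S \<inter> GSh M A (H * \<tau>) \<Longrightarrow> n (\<lambda>y. \<phi> y * \<psi> (y - x)) \<le> C * GSnorm M A (H * \<tau>) \<psi> * n \<phi>"
    unfolding mult_ok_def by blast
  have h: "H * \<tau> > 0" "2 * H * (H * \<tau>) > 0" using \<tau>(1) H1 by auto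
  let ?g = "c * GSnorm M A (2 * H * (H * \<tau>)) \<psi> * GSnorm M A (2 * H * (H * \<tau>)) \<kappa>"
  have g: "?g \<ge> 0" using GSnorm_nonneg[OF h(2) \<tau>(4)] GSnorm_nonneg[OF h(2) \<tau>(5)] c1 by simp
  have "n (\<lambda>z. \<phi> z * (\<psi> (z - x) * \<kappa> (z - y))) \<le> (C * ?g) * wt A (H * \<tau>) (x - y) * n \<phi>" if \<phi>: "\<phi> \<in> S" for \<phi> x y
  proof -
    \<comment> \<open>The product of the two translates is the translate by x of a function that
      depends on y - x alone. Its norm carries the decay, and the multiplier bound is uniform in the
      translate.\<close>
    let ?p = "\<lambda>z. \<psi> z * \<kappa> (z - (y - x))"
    have p: "?p \<in> GSh M A (H * \<tau>)" "GSnorm M A (H * \<tau>) ?p \<le> ?g * wt A (H * \<tau>) (y - x)"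
      using GSh_mult_trans[OF h(1) \<tau>(4,5), of "y - x"] by auto
    have "n (\<lambda>z. \<phi> z * ?p (z - x)) \<le> C * GSnorm M A (H * \<tau>) ?p * n \<phi>"
      by (rule C(2)[OF \<phi>]) (use p(1) S_mult_trans[OF \<psi> \<kappa>, of "y - x"] in auto)
    also have "\<dots> \<le> C * (?g * wt A (H * \<tau>) (y - x)) * n \<phi>"
      using C(1) p(2) gsn_nonneg[OF gn \<phi>] by (intro mult_right_mono mult_left_mono) auto
    finally show ?thesis by (simp add: wt_minus_commute[of A "H * \<tau>" y x] mult_ac)
  qed
  then show ?thesis using \<tau>(1,2) C(1) g by (intro exI[of _ \<tau>] conjI exI[of _ "C * ?g"]) auto
qed

text \<open>The windowed pieces are of size \<open>wt A (H * \<tau>) x\<close> by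
  \<open>GSh_mult_trans\<close>. \<open>eta_wt\<close> with y = 0 trades \<eta> x for \<eta> 0 and
  leaves \<open>wt A \<tau>\<close>, on which Y is finite.\<close>

lemma NY_bound:
  assumes \<tau>: "\<tau> > 0" "ncont n (H * \<tau>)" "eta_ok \<eta> \<tau>" "\<theta> \<in> GSh M A (2 * H * (H * \<tau>))"
  shows "\<exists>C\<ge>0. \<forall>\<phi>\<in>S \<inter> GSh M A (2 * H * (H * \<tau>)). fin (Gf \<phi>) \<and> NY \<phi> \<le> C * GSnorm M A (2 * H * (H * \<tau>)) \<phi>"
proof -
  let ?k = "2 * H * (H * \<tau>)"
  have h: "H * \<tau> > 0" "?k > 0" using \<tau>(1) H1 by auto
  obtain C where C: "C \<ge> 0" "\<And>\<phi>. \<phi> \<in> S \<inter> GSh M A (H * \<tau>) \<Longrightarrow> n \<phi> \<le> C * GSnorm M A (H * \<tau>) \<phi>"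
    using \<tau>(2) unfolding ncont_def by blast
  obtain D where D: "D > 0" "\<And>x y. \<eta> x * wt A (H * \<tau>) (x - y) \<le> D * \<eta> y * wt A \<tau> (x - y)"
    using eta_wt[OF \<eta>pos \<tau>(1,3)] by blast
  let ?g = "c * GSnorm M A ?k \<theta>"
  let ?K = "C * ?g * (D * \<eta> 0)"
  have g: "?g \<ge> 0" using GSnorm_nonneg[OF h(2) \<tau>(4)] c1 by simp
  have "fin (Gf \<phi>) \<and> NY \<phi> \<le> (?K * Y (wt A \<tau>)) * GSnorm M A ?k \<phi>" if \<phi>: "\<phi> \<in> S \<inter> GSh M A ?k" for \<phi>
  proof -
    have gp: "GSnorm M A ?k \<phi> \<ge> 0" using GSnorm_nonneg[OF h(2)] \<phi> by blast
    have b: "Gf \<phi> x \<le> (?K * GSnorm M A ?k \<phi>) * wt A \<tau> x" for x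
    proof -
      have p: "(\<lambda>y. \<phi> y * \<theta> (y - x)) \<in> GSh M A (H * \<tau>)" "GSnorm M A (H * \<tau>) (\<lambda>y. \<phi> y * \<theta> (y - x)) \<le> c * GSnorm M A ?k \<phi> * GSnorm M A ?k \<theta> * wt A (H * \<tau>) x"
        using GSh_mult_trans[OF h(1) _ \<tau>(4)] \<phi> by auto
      have "wf \<phi> x \<le> C * GSnorm M A (H * \<tau>) (\<lambda>y. \<phi> y * \<theta> (y - x))"
        unfolding wf_def using p(1) S_mult_trans[of \<phi> \<theta> x] \<phi> \<theta> by (intro C(2)) auto
      also have "\<dots> \<le> C * (c * GSnorm M A ?k \<phi> * GSnorm M A ?k \<theta> * wt A (H * \<tau>) x)" using p(2) C(1) by (intro mult_left_mono)
      finally have "Gf \<phi> x \<le> C * (c * GSnorm M A ?k \<phi> * GSnorm M A ?k \<theta> * wt A (H * \<tau>) x) * \<eta> x"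
        unfolding Gf_def by (intro mult_right_mono) auto
      also have "\<dots> = C * ?g * GSnorm M A ?k \<phi> * (\<eta> x * wt A (H * \<tau>) (x - 0))" by (simp add: mult_ac)
      also have "\<dots> \<le> C * ?g * GSnorm M A ?k \<phi> * (D * \<eta> 0 * wt A \<tau> (x - 0))"
        by (intro mult_left_mono[OF D(2)] mult_nonneg_nonneg C g gp)
      finally show ?thesis by (simp add: mult_ac)
    qed
    have "fin (Gf \<phi>) \<and> Y (Gf \<phi>) \<le> (?K * GSnorm M A ?k \<phi>) * Y (wt A \<tau>)"
      by (rule fmono[OF nnm_Gf nnm_wt fwt[OF \<tau>(1)] _ b]) (use \<phi> C(1) g D(1) gp in auto)
    then show ?thesis unfolding NY_def by (simp add: mult_ac)
  qed
  moreover have "?K * Y (wt A \<tau>) \<ge> 0"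
    by (rule mult_nonneg_nonneg[OF mult_nonneg_nonneg[OF mult_nonneg_nonneg[OF C(1) g]] fnonneg[OF nnm_wt fwt[OF \<tau>(1)]]]) (use D(1) in simp)
  ultimately show ?thesis by blast
qed

lemma NY_cls: "cls k (\<lambda>\<tau>. ncont n (H * \<tau>) \<and> eta_ok \<eta> \<tau>)"
proof -
  have H0: "H > 0" using H1 by auto
  show ?thesis
  proof (rule cls_conj[OF cls_scale[OF ncont_cls[OF gn] H0] eta_cls])
    fix h h' :: real assume h: "0 < h" "h \<le> h'"
    show "eta_ok \<eta> h \<Longrightarrow> eta_ok \<eta> h'" by (rule eta_ok_up[OF \<eta>pos h])
    show "ncont n (H * h) \<Longrightarrow> ncont n (H * h')" by (rule ncont_up[of "H * h" "H * h'"]) (use h H1 in auto)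
  qed
qed

lemma fin_Gf: assumes \<phi>: "\<phi> \<in> S" shows "fin (Gf \<phi>)"
proof -
  have H0: "2 * H * H > 0" using H1 by auto
  from cls_meet[OF NY_cls S_dcl2[OF \<phi> \<theta> H0]] obtain \<tau> where "\<tau> > 0" "ncont n (H * \<tau>)" "eta_ok \<eta> \<tau>"
    "\<phi> \<in> GSh M A (2 * H * (H * \<tau>))" "\<theta> \<in> GSh M A (2 * H * (H * \<tau>))" by (auto simp: mult.assoc)
  then show ?thesis using NY_bound[of \<tau>] \<phi> by blast
qed

lemma NY_nonneg: "\<phi> \<in> S \<Longrightarrow> NY \<phi> \<ge> 0"
  unfolding NY_def by (intro fnonneg nnm_Gf fin_Gf)

lemma NY_le:
  assumes "\<phi> \<in> S" "\<psi> \<in> S" "K \<ge> 0" "\<And>x. wf \<phi> x \<le> K * wf \<psi> x" shows "NY \<phi> \<le> K * NY \<psi>"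
proof -
  have "Gf \<phi> x \<le> K * Gf \<psi> x" for x unfolding Gf_def using mult_right_mono[OF assms(4)[of x], of "\<eta> x"] by simp
  then show ?thesis unfolding NY_def using fmono[OF nnm_Gf[OF assms(1)] nnm_Gf[OF assms(2)] fin_Gf[OF assms(2)] assms(3)] by blast
qed

lemma NY_gsn: "gsn NY"
proof -
  have add: "NY (\<lambda>x. \<phi> x + \<psi> x) \<le> NY \<phi> + NY \<psi>" if \<phi>: "\<phi> \<in> S" and \<psi>: "\<psi> \<in> S" for \<phi> \<psi>
  proof -
    have "Gf (\<lambda>x. \<phi> x + \<psi> x) x \<le> 1 * (Gf \<phi> x + Gf \<psi> x)" for x
    proof -
      have "wf (\<lambda>x. \<phi> x + \<psi> x) x \<le> wf \<phi> x + wf \<psi> x"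
        unfolding wf_def using gsn_add[OF gn S_mult_trans[OF \<phi> \<theta>] S_mult_trans[OF \<psi> \<theta>]] by (simp add: distrib_right)
      then show ?thesis unfolding Gf_def using mult_right_mono[of "wf (\<lambda>x. \<phi> x + \<psi> x) x" "wf \<phi> x + wf \<psi> x" "\<eta> x"]
        by (simp add: distrib_right)
    qed
    note f = fadd[OF nnm_Gf[OF \<phi>] nnm_Gf[OF \<psi>] fin_Gf[OF \<phi>] fin_Gf[OF \<psi>]]
    have "Y (Gf (\<lambda>x. \<phi> x + \<psi> x)) \<le> 1 * Y (\<lambda>x. Gf \<phi> x + Gf \<psi> x)"
      using fmono[OF nnm_Gf[OF S_add[OF \<phi> \<psi>]] nnm_add[OF nnm_Gf[OF \<phi>] nnm_Gf[OF \<psi>]] conjunct1[OF f], of 1] \<open>\<And>x. Gf (\<lambda>x. \<phi> x + \<psi> x) x \<le> 1 * (Gf \<phi> x + Gf \<psi> x)\<close> by simp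
    then show ?thesis using f unfolding NY_def by simp
  qed
  have wsc: "wf (\<lambda>x. a * \<phi> x) x = cmod a * wf \<phi> x" if "\<phi> \<in> S" for a \<phi> x
    unfolding wf_def using gsn_scale[OF gn S_mult_trans[OF that \<theta>], of a x] by (simp add: mult.assoc)
  have sc: "NY (\<lambda>x. a * \<phi> x) = cmod a * NY \<phi>" if \<phi>: "\<phi> \<in> S" for a \<phi>
  proof (rule antisym)
    show le: "NY (\<lambda>x. a * \<phi> x) \<le> cmod a * NY \<phi>" by (rule NY_le) (use \<phi> S_scale wsc in auto)
    show "cmod a * NY \<phi> \<le> NY (\<lambda>x. a * \<phi> x)"
    proof (cases "a = 0")
      case True then show ?thesis using NY_nonneg[OF S_scale[OF \<phi>, of a]] by simp
    next
      case False
      have "NY \<phi> \<le> (1 / cmod a) * NY (\<lambda>x. a * \<phi> x)" by (rule NY_le) (use \<phi> S_scale wsc False in auto)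
      then show ?thesis using False by (simp add: field_simps)
    qed
  qed
  have H0: "2 * H * H > 0" using H1 by auto
  have "cls k (ncont NY)"
  proof (rule cls_trans[OF NY_cls S_dcl[OF \<theta> H0] H0])
    fix h :: real assume h: "h > 0" "ncont n (H * h) \<and> eta_ok \<eta> h" "\<theta> \<in> GSh M A (2 * H * H * h)"
    have e: "2 * H * H * h = 2 * H * (H * h)" by simp
    show "ncont NY (2 * H * H * h)"
      using NY_bound[OF h(1) conjunct1[OF h(2)] conjunct2[OF h(2)] h(3)[unfolded e]] unfolding e ncont_def by blast
  next
    fix h h' :: real assume h: "0 < h" "h \<le> h'"
    then show "\<theta> \<in> GSh M A (2 * H * H * h') \<Longrightarrow> \<theta> \<in> GSh M A (2 * H * H * h)" using H0 by (intro GSh_mono(1)[of "2 * H * H * h" "2 * H * H * h'"] mult_left_mono) auto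
    show "ncont NY h \<Longrightarrow> ncont NY h'" using h by (rule ncont_up)
  qed
  then have "GS_cont k M A NY" unfolding GS_cont_iff ncont_def by (rule cls_mono) blast
  then show ?thesis unfolding gsn_def using add sc NY_nonneg by blast
qed

lemma Gf_int_bound: "h > 0 \<Longrightarrow> \<exists>C\<ge>0. \<forall>\<phi>\<in>S. \<forall>y. (\<integral>\<^sup>+ x. ennreal (Gf \<phi> x * wt A h (x - y)) \<partial>lborel) \<le> ennreal (C * NY \<phi>)"
proof -
  assume h: "h > 0"
  from fint[OF h] obtain C where C: "C \<ge> 0" "\<And>G. nnm G \<Longrightarrow> fin G \<Longrightarrow> (\<integral>\<^sup>+ x. ennreal (G x * wt A h x) \<partial>lborel) \<le> ennreal (C * Y G)" by blast
  have "(\<integral>\<^sup>+ x. ennreal (Gf \<phi> x * wt A h (x - y)) \<partial>lborel) \<le> ennreal (C * NY \<phi>)" if \<phi>: "\<phi> \<in> S" for \<phi> y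
  proof -
    note s = fshift[OF nnm_Gf[OF \<phi>] fin_Gf[OF \<phi>], of "- y"]
    have [measurable]: "Gf \<phi> \<in> borel_measurable borel" "wt A h \<in> borel_measurable (borel :: (real^'n) measure)"
      using nnm_Gf[OF \<phi>] nnm_wt by (auto simp: nnm_def)
    have "(\<integral>\<^sup>+ x. ennreal (Gf \<phi> x * wt A h (x - y)) \<partial>lborel) = (\<integral>\<^sup>+ x. ennreal (Gf \<phi> (y + x) * wt A h (y + x - y)) \<partial>lborel)"
      by (rule nn_integral_shift[symmetric]) measurable
    also have "\<dots> = (\<integral>\<^sup>+ x. ennreal (Gf \<phi> (x - (- y)) * wt A h x) \<partial>lborel)" by (simp add: add.commute)
    also have "\<dots> \<le> ennreal (C * Y (\<lambda>x. Gf \<phi> (x - (- y))))"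
      by (rule C(2)[OF nnm_shift[OF nnm_Gf[OF \<phi>]] conjunct1[OF s]])
    also have "\<dots> \<le> ennreal (C * NY \<phi>)" unfolding NY_def using s C(1) by (intro ennreal_leI mult_left_mono) auto
    finally show ?thesis .
  qed
  then show ?thesis using C(1) by blast
qed

lemma nn_integral_bound_real:
  assumes "integrable lborel f" "\<And>x. norm (f x) \<le> K * g x" "K \<ge> 0" "(\<integral>\<^sup>+ x. ennreal (g x) \<partial>lborel) \<le> ennreal B" "B \<ge> 0" "g \<in> borel_measurable borel"
    and g: "\<And>x. g x \<ge> 0"
  shows "norm (LINT x|lborel. f (x :: real^'n)) \<le> K * B"
proof -
  have "ennreal (norm (LINT x|lborel. f x)) \<le> (\<integral>\<^sup>+ x. ennreal (norm (f x)) \<partial>lborel)"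
    by (rule integral_norm_bound_ennreal[OF assms(1)])
  also have "\<dots> \<le> (\<integral>\<^sup>+ x. ennreal K * ennreal (g x) \<partial>lborel)"
    using assms(2,3) g by (intro nn_integral_mono) (simp add: ennreal_leI flip: ennreal_mult)
  also have "\<dots> = ennreal K * (\<integral>\<^sup>+ x. ennreal (g x) \<partial>lborel)" using assms(6) by (intro nn_integral_cmult) auto
  also have "\<dots> \<le> ennreal K * ennreal B" by (intro mult_left_mono assms) simp
  also have "\<dots> = ennreal (K * B)" using assms by (simp add: ennreal_mult)
  finally show ?thesis using assms by (subst (asm) ennreal_le_iff) auto
qed

lemma measurable_Gf_wt: "\<phi> \<in> S \<Longrightarrow> (\<lambda>x. Gf \<phi> x * wt A h (x - y)) \<in> borel_measurable borel"
  using nnm_mult[OF nnm_Gf nnm_wt_shift] by (simp add: nnm_def)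

text \<open>The pairing of \<phi> with \<psi> is averaged over windows: \<theta> goes to \<phi> and
  produces \<open>wf \<phi> x\<close>, the conjugate goes to \<psi> and produces decay in x. That
  decay pays for 1 / \<eta>, and what remains is an integral of \<open>Gf \<phi>\<close> against a
  kernel.\<close>

lemma NY_pair: "cls k (pair_bound NY)"
proof -
  have H0: "2 * H * H > 0" "H > 0" using H1 by auto
  let ?\<kappa> = "\<lambda>x. cnj (\<theta> x)"
  have \<kappa>: "?\<kappa> \<in> S" by (rule S_cnj[OF \<theta>])
  define c0 where "c0 = (LINT x|lborel. \<theta> x * cnj (\<theta> x))"
  have c0: "cmod c0 > 0" using S_integral_cnj_nonzero[OF \<theta> \<theta>nz] by (simp add: c0_def)
  have \<theta>\<kappa>: "(\<lambda>x. \<theta> x * cnj (\<theta> x)) \<in> S" by (rule S_mult[OF \<theta> \<kappa>])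
  have cl: "cls k (\<lambda>\<tau>. pair_bound n (H * \<tau>) \<and> eta_ok \<eta> \<tau>)"
  proof (rule cls_conj[OF cls_scale[OF _ H0(2)] eta_cls])
    show "cls k (pair_bound n)" using tn by (simp add: tnorm_def)
    fix h h' :: real assume h: "0 < h" "h \<le> h'"
    show "eta_ok \<eta> h \<Longrightarrow> eta_ok \<eta> h'" by (rule eta_ok_up[OF \<eta>pos h])
    show "pair_bound n (H * h) \<Longrightarrow> pair_bound n (H * h')" by (rule pair_bound_up[OF gn]) (use h H1 in auto)
  qed
  show ?thesis
  proof (rule cls_trans[OF cl S_dcl[OF \<kappa> H0(1)] H0(1)])
    fix \<tau> :: real assume \<tau>: "\<tau> > 0" and PP: "pair_bound n (H * \<tau>) \<and> eta_ok \<eta> \<tau>" and \<kappa>h: "?\<kappa> \<in> GSh M A (2 * H * H * \<tau>)"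
    have e: "2 * H * H * \<tau> = 2 * H * (H * \<tau>)" by simp
    let ?k = "2 * H * (H * \<tau>)"
    have h: "H * \<tau> > 0" "?k > 0" using \<tau> H1 by auto
    obtain C where C: "C \<ge> 0" "\<And>\<phi> \<psi>. \<phi> \<in> S \<Longrightarrow> \<psi> \<in> S \<inter> GSh M A (H * \<tau>) \<Longrightarrow> cmod (LINT x|lborel. \<phi> x * \<psi> x) \<le> C * GSnorm M A (H * \<tau>) \<psi> * n \<phi>"
      using PP unfolding pair_bound_def by blast
    obtain D where D: "D > 0" "\<And>x y. wt A (H * \<tau>) (x - y) / \<eta> x \<le> D * wt A \<tau> (x - y) / \<eta> y"
      using eta_wt[OF \<eta>pos \<tau> conjunct2[OF PP]] by blast
    obtain B where B: "B \<ge> 0" "\<And>\<phi> y. \<phi> \<in> S \<Longrightarrow> (\<integral>\<^sup>+ x. ennreal (Gf \<phi> x * wt A \<tau> (x - y)) \<partial>lborel) \<le> ennreal (B * NY \<phi>)"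
      using Gf_int_bound[OF \<tau>] by blast
    let ?g = "c * GSnorm M A ?k ?\<kappa>"
    have g: "?g \<ge> 0" using GSnorm_nonneg[OF h(2) \<kappa>h[unfolded e]] c1 by simp
    have "cmod (LINT x|lborel. \<phi> x * \<psi> x) \<le> (C * ?g * (D / \<eta> 0) * B / cmod c0) * GSnorm M A ?k \<psi> * NY \<phi>"
      if \<phi>: "\<phi> \<in> S" and \<psi>: "\<psi> \<in> S \<inter> GSh M A ?k" for \<phi> \<psi>
    proof -
      have \<psi>S: "\<psi> \<in> S" using \<psi> by blast
      have gp: "GSnorm M A ?k \<psi> \<ge> 0" using GSnorm_nonneg[OF h(2)] \<psi> by blast
      note UT = UD_trans[OF em_UD[OF \<psi>S] \<phi> \<theta>\<kappa> em_UD[OF \<psi>S]]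
      let ?f = "\<lambda>x. em \<psi> (\<lambda>y. \<phi> y * (\<theta> (y - x) * cnj (\<theta> (y - x))))"
      let ?K = "C * ?g * (D / \<eta> 0) * GSnorm M A ?k \<psi>"
      have K: "?K \<ge> 0" by (intro mult_nonneg_nonneg C g gp) (use D(1) in auto)
      have b: "cmod (?f x) \<le> ?K * (Gf \<phi> x * wt A \<tau> (x - 0))" for x
      proof -
        have p: "(\<lambda>y. \<psi> y * cnj (\<theta> (y - x))) \<in> S \<inter> GSh M A (H * \<tau>)" "GSnorm M A (H * \<tau>) (\<lambda>y. \<psi> y * cnj (\<theta> (y - x))) \<le> c * GSnorm M A ?k \<psi> * GSnorm M A ?k ?\<kappa> * wt A (H * \<tau>) x"
          using GSh_mult_trans[OF h(1) _ \<kappa>h[unfolded e], of \<psi> x] \<psi> S_mult_trans[OF \<psi>S \<kappa>, of x] by auto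
        have "?f x = (LINT y|lborel. (\<phi> y * \<theta> (y - x)) * (\<psi> y * cnj (\<theta> (y - x))))"
          using S_mult_trans[OF \<phi> \<theta>\<kappa>, of x] by (simp add: em_S mult_ac)
        then have "cmod (?f x) \<le> C * GSnorm M A (H * \<tau>) (\<lambda>y. \<psi> y * cnj (\<theta> (y - x))) * wf \<phi> x"
          unfolding wf_def using C(2)[OF S_mult_trans[OF \<phi> \<theta>] p(1)] by simp
        also have "\<dots> \<le> C * (c * GSnorm M A ?k \<psi> * GSnorm M A ?k ?\<kappa> * wt A (H * \<tau>) x) * wf \<phi> x"
          using C(1) p(2) wf_nonneg[OF \<phi>] by (intro mult_right_mono mult_left_mono) auto
        also have "\<dots> = (C * ?g * GSnorm M A ?k \<psi> * Gf \<phi> x) * (wt A (H * \<tau>) (x - 0) / \<eta> x)"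
          by (simp add: Gf_def)
        also have "\<dots> \<le> (C * ?g * GSnorm M A ?k \<psi> * Gf \<phi> x) * (D * wt A \<tau> (x - 0) / \<eta> 0)"
          using nnm_Gf[OF \<phi>] by (intro mult_left_mono[OF D(2)] mult_nonneg_nonneg C g gp) (auto simp: nnm_def)
        finally show ?thesis by (simp add: mult_ac)
      qed
      have nb: "norm (LINT x|lborel. ?f x) \<le> ?K * (B * NY \<phi>)"
      proof (rule nn_integral_bound_real[OF UT(2) b K B(2)[OF \<phi>]])
        show "B * NY \<phi> \<ge> 0" using B(1) NY_nonneg[OF \<phi>] by simp
        show "Gf \<phi> x * wt A \<tau> (x - 0) \<ge> 0" for x using nnm_Gf[OF \<phi>] by (simp add: nnm_def)
      qed (rule measurable_Gf_wt[OF \<phi>])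
      have "c0 * em \<psi> \<phi> = (LINT x|lborel. ?f x)" using UT(1) by (simp only: c0_def)
      then have "cmod (c0 * em \<psi> \<phi>) \<le> ?K * (B * NY \<phi>)" using nb by (simp only:)
      then have "cmod c0 * cmod (em \<psi> \<phi>) \<le> ?K * (B * NY \<phi>)" by (simp only: norm_mult)
      moreover have "em \<psi> \<phi> = (LINT x|lborel. \<phi> x * \<psi> x)" using em_S[OF \<phi>] by (simp add: mult.commute)
      ultimately have "cmod (LINT x|lborel. \<phi> x * \<psi> x) \<le> ?K * (B * NY \<phi>) / cmod c0"
        by (simp only: pos_le_divide_eq[OF c0] mult.commute[of _ "cmod c0"])
      then show ?thesis by (simp add: mult_ac)
    qed
    moreover have "C * ?g * (D / \<eta> 0) * B / cmod c0 \<ge> 0" by (intro divide_nonneg_nonneg mult_nonneg_nonneg C g B) (use D(1) in auto)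
    ultimately show "pair_bound NY (2 * H * H * \<tau>)" unfolding pair_bound_def e by blast
  next
    fix h h' :: real assume h: "0 < h" "h \<le> h'"
    then show "?\<kappa> \<in> GSh M A (2 * H * H * h') \<Longrightarrow> ?\<kappa> \<in> GSh M A (2 * H * H * h)" using H0 by (intro GSh_mono(1)[of "2 * H * H * h" "2 * H * H * h'"] mult_left_mono) auto
    show "pair_bound NY h \<Longrightarrow> pair_bound NY h'" by (rule pair_bound_up[OF NY_gsn h])
  qed
qed

text \<open>Although Y may be an integral norm, it controls each windowed piece separately, with a
  constant depending on y. This is what transfers closability from n to \<open>NY\<close>.\<close>

lemma wf_le_NY: "\<exists>C\<ge>0. \<forall>\<phi>\<in>S. wf \<phi> y \<le> C * NY \<phi>"
proof -
  let ?\<kappa> = "\<lambda>x. cnj (\<theta> x)"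
  have \<kappa>: "?\<kappa> \<in> S" by (rule S_cnj[OF \<theta>])
  define c0 where "c0 = (LINT x|lborel. \<theta> x * cnj (\<theta> x))"
  have c0: "cmod c0 > 0" using S_integral_cnj_nonzero[OF \<theta> \<theta>nz] by (simp add: c0_def)
  have \<theta>\<kappa>: "(\<lambda>x. \<theta> x * cnj (\<theta> x)) \<in> S" by (rule S_mult[OF \<theta> \<kappa>])
  from pair_decay[OF \<theta> \<kappa>] obtain \<tau> C where \<tau>: "\<tau> > 0" "eta_ok \<eta> \<tau>" and C: "C \<ge> 0"
    "\<And>\<phi> x y. \<phi> \<in> S \<Longrightarrow> n (\<lambda>z. \<phi> z * (\<theta> (z - x) * ?\<kappa> (z - y))) \<le> C * wt A (H * \<tau>) (x - y) * n \<phi>" by blast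
  obtain D where D: "D > 0" "\<And>x y. wt A (H * \<tau>) (x - y) / \<eta> x \<le> D * wt A \<tau> (x - y) / \<eta> y"
    using eta_wt[OF \<eta>pos \<tau>] by blast
  obtain B where B: "B \<ge> 0" "\<And>\<phi> y. \<phi> \<in> S \<Longrightarrow> (\<integral>\<^sup>+ x. ennreal (Gf \<phi> x * wt A \<tau> (x - y)) \<partial>lborel) \<le> ennreal (B * NY \<phi>)"
    using Gf_int_bound[OF \<tau>(1)] by blast
  have "wf \<phi> y \<le> (C * (D / \<eta> y) * B / cmod c0) * NY \<phi>" if \<phi>: "\<phi> \<in> S" for \<phi>
  proof -
    let ?p = "\<lambda>z. \<phi> z * \<theta> (z - y)"
    have p: "?p \<in> S" by (rule S_mult_trans[OF \<phi> \<theta>])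
    let ?f = "\<lambda>x. n (\<lambda>z. ?p z * (\<theta> (z - x) * cnj (\<theta> (z - x))))"
    note G = gsn_trans(1,2)[OF gn p \<theta>\<kappa>]
    let ?K = "C * (D / \<eta> y)"
    have K: "?K \<ge> 0" using C(1) D(1) by simp
    have b: "norm (?f x) \<le> ?K * (Gf \<phi> x * wt A \<tau> (x - y))" for x
    proof -
      \<comment> \<open>Regrouping: the window at x is attached to \<phi>, while the window at y and
        the conjugate at x form a multiplier that decays in x - y.\<close>
      have e: "(\<lambda>z. ?p z * (\<theta> (z - x) * cnj (\<theta> (z - x)))) = (\<lambda>z. (\<phi> z * \<theta> (z - x)) * (\<theta> (z - y) * cnj (\<theta> (z - x))))"
        by (simp add: mult_ac)
      have "norm (?f x) = ?f x" using gsn_nonneg[OF gn S_mult_trans[OF p \<theta>\<kappa>], of x] by simp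
      also have "\<dots> \<le> C * wt A (H * \<tau>) (y - x) * wf \<phi> x"
        unfolding e wf_def by (rule C(2)[OF S_mult_trans[OF \<phi> \<theta>]])
      also have "\<dots> = (C * Gf \<phi> x) * (wt A (H * \<tau>) (x - y) / \<eta> x)"
        by (simp add: Gf_def wt_minus_commute[of A "H * \<tau>" y x])
      also have "\<dots> \<le> (C * Gf \<phi> x) * (D * wt A \<tau> (x - y) / \<eta> y)"
        using nnm_Gf[OF \<phi>] C(1) by (intro mult_left_mono[OF D(2)] mult_nonneg_nonneg) (auto simp: nnm_def)
      finally show ?thesis by (simp add: mult_ac)
    qed
    have "norm (LINT x|lborel. ?f x) \<le> ?K * (B * NY \<phi>)"
    proof (rule nn_integral_bound_real[OF G(1) b K B(2)[OF \<phi>]])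
      show "B * NY \<phi> \<ge> 0" using B(1) NY_nonneg[OF \<phi>] by simp
      show "Gf \<phi> x * wt A \<tau> (x - y) \<ge> 0" for x using nnm_Gf[OF \<phi>] by (simp add: nnm_def)
    qed (rule measurable_Gf_wt[OF \<phi>])
    then have "cmod c0 * n ?p \<le> ?K * (B * NY \<phi>)" using G(2) unfolding c0_def real_norm_def by linarith
    then have "wf \<phi> y \<le> ?K * (B * NY \<phi>) / cmod c0" unfolding wf_def by (simp only: pos_le_divide_eq[OF c0] mult.commute[of _ "cmod c0"])
    then show ?thesis by (simp add: mult_ac)
  qed
  moreover have "C * (D / \<eta> y) * B / cmod c0 \<ge> 0" using C(1) D(1) B(1) by simp
  ultimately show ?thesis by blast
qed

text \<open>For each y the windowed sequence is Cauchy for n with weak limit 0, so closability of n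
  gives convergence to 0 pointwise in y. The differences s_i - s_j then converge pointwise, as j
  grows, to the data of s_i, and Fatou bounds \<open>NY (s i)\<close> by the Cauchy
  estimate.\<close>

lemma NY_closable: "closable NY"
  unfolding closable_def
proof (intro allI impI)
  fix s :: "nat \<Rightarrow> 'n tf" assume s: "\<forall>j. s j \<in> S" and ca: "ncauchy NY s" and w: "\<forall>\<psi>\<in>S. (\<lambda>j. LINT x|lborel. s j x * \<psi> x) \<longlonglongrightarrow> 0"
  have sS: "s j \<in> S" for j using s by blast
  have cl: "closable n" using tn by (simp add: tnorm_def)
  have pt: "(\<lambda>j. wf (s j) y) \<longlonglongrightarrow> 0" for y
  proof -
    let ?t = "\<lambda>j z. s j z * \<theta> (z - y)"
    obtain C where C: "C \<ge> 0" "\<And>\<phi>. \<phi> \<in> S \<Longrightarrow> wf \<phi> y \<le> C * NY \<phi>" using wf_le_NY by blast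
    have 1: "ncauchy n ?t" unfolding ncauchy_def
    proof (intro allI impI)
      fix e :: real assume e: "e > 0"
      have eC: "e / (C + 1) > 0" using e C(1) by simp
      obtain N where N: "\<And>i j. i \<ge> N \<Longrightarrow> j \<ge> N \<Longrightarrow> NY (\<lambda>x. s i x - s j x) < e / (C + 1)" by (rule ncauchyE[OF ca eC]) blast
      have "n (\<lambda>z. ?t i z - ?t j z) < e" if "i \<ge> N" "j \<ge> N" for i j
      proof -
        have "n (\<lambda>z. ?t i z - ?t j z) = wf (\<lambda>x. s i x - s j x) y" by (simp add: wf_def left_diff_distrib)
        also have "\<dots> \<le> C * NY (\<lambda>x. s i x - s j x)" by (rule C(2)[OF S_diff[OF sS sS]])
        also have "\<dots> \<le> C * (e / (C + 1))" using N[OF that] C(1) by (intro mult_left_mono) auto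
        also have "\<dots> < e" using e C(1) by (simp add: field_simps)
        finally show ?thesis .
      qed
      then show "\<exists>N. \<forall>i\<ge>N. \<forall>j\<ge>N. n (\<lambda>z. ?t i z - ?t j z) < e" by blast
    qed
    have 2: "(\<lambda>j. LINT x|lborel. ?t j x * \<psi> x) \<longlonglongrightarrow> 0" if "\<psi> \<in> S" for \<psi>
    proof -
      have "(\<lambda>j. LINT x|lborel. s j x * (\<psi> x * \<theta> (x - y))) \<longlonglongrightarrow> 0" using bspec[OF w S_mult_trans[OF that \<theta>, of y]] by simp
      then show ?thesis by (simp add: mult_ac)
    qed
    have "(\<lambda>j. n (?t j)) \<longlonglongrightarrow> 0" by (rule closableD[OF cl S_mult_trans[OF sS \<theta>] 1 2])
    then show ?thesis by (simp add: wf_def)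
  qed
  show "(\<lambda>j. NY (s j)) \<longlonglongrightarrow> 0"
  proof (rule LIMSEQ_I)
    fix e :: real assume e: "e > 0"
    have e2: "e / 2 > 0" using e by simp
    obtain N where N: "\<And>i j. i \<ge> N \<Longrightarrow> j \<ge> N \<Longrightarrow> NY (\<lambda>x. s i x - s j x) < e / 2" by (rule ncauchyE[OF ca e2]) blast
    have "norm (NY (s i) - 0) < e" if i: "i \<ge> N" for i
    proof -
      \<comment> \<open>The offset N keeps both indices in the Cauchy range for every j, so that
        Fatou applies to the whole sequence.\<close>
      let ?d = "\<lambda>j x. s i x - s (j + N) x"
      have "Y (Gf (s i)) \<le> e / 2"
      proof (rule ffatou[where Gs = "\<lambda>j. Gf (?d j)"])
        fix y
        have "(\<lambda>j. wf (s (j + N)) y) \<longlonglongrightarrow> 0" using pt[of y] by (rule LIMSEQ_ignore_initial_segment)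
        then have "(\<lambda>j. wf (?d j) y - wf (s i) y) \<longlonglongrightarrow> 0"
        proof (rule Lim_null_comparison[rotated], intro always_eventually allI)
          fix j
          have "\<bar>wf (?d j) y - wf (s i) y\<bar> \<le> n (\<lambda>z. ?d j z * \<theta> (z - y) - s i z * \<theta> (z - y))"
            unfolding wf_def by (intro gsn_diff(2) gn S_mult_trans \<theta> S_diff sS)
          also have "(\<lambda>z. ?d j z * \<theta> (z - y) - s i z * \<theta> (z - y)) = (\<lambda>z. - (s (j + N) z * \<theta> (z - y)))" by (simp add: algebra_simps)
          also have "n \<dots> = wf (s (j + N)) y" unfolding wf_def by (rule gsn_uminus[OF gn S_mult_trans[OF sS \<theta>]])
          finally show "norm (wf (?d j) y - wf (s i) y) \<le> wf (s (j + N)) y" by simp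
        qed
        then have "(\<lambda>j. wf (?d j) y) \<longlonglongrightarrow> wf (s i) y" by (rule LIM_zero_cancel)
        then show "(\<lambda>j. Gf (?d j) y) \<longlonglongrightarrow> Gf (s i) y" unfolding Gf_def by (intro tendsto_intros)
      next
        show "Y (Gf (?d j)) \<le> e / 2" for j using N[OF i, of "j + N"] unfolding NY_def by simp
      qed (auto intro!: nnm_Gf fin_Gf S_diff sS)
      then show ?thesis using NY_nonneg[OF sS, of i] e unfolding NY_def by simp
    qed
    then show "\<exists>N. \<forall>i\<ge>N. norm (NY (s i) - 0) < e" by blast
  qed
qed

text \<open>A translation by y costs e^{A(\<tau>|y|)} twice, once through n and once through \<eta>;
  \<open>ea_sq\<close> merges the square into level H \<tau>. Modulations commute with windowing and
  keep their bound for n.\<close>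

lemma NY_mod: "cls k (mod_bound NY)"
proof -
  have H0: "H > 0" using H1 by auto
  have cl: "cls k (\<lambda>\<tau>. mod_bound n \<tau> \<and> eta_ok \<eta> \<tau>)"
  proof (rule cls_conj[OF _ eta_cls])
    show "cls k (mod_bound n)" using tn by (simp add: tnorm_def)
    fix h h' :: real assume h: "0 < h" "h \<le> h'"
    show "eta_ok \<eta> h \<Longrightarrow> eta_ok \<eta> h'" by (rule eta_ok_up[OF \<eta>pos h])
    show "mod_bound n h \<Longrightarrow> mod_bound n h'" by (rule mod_bound_up[OF gn h])
  qed
  have dt: "dcl k (\<lambda>_. True)" by (cases k) (auto simp: dcl_def intro: exI[of _ 1])
  show ?thesis
  proof (rule cls_trans[OF cl dt H0])
    fix \<tau> :: real assume \<tau>: "\<tau> > 0" and PP: "mod_bound n \<tau> \<and> eta_ok \<eta> \<tau>"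
    obtain C where C: "C > 0" "\<And>\<phi> x. \<phi> \<in> S \<Longrightarrow> n (\<lambda>z. \<phi> (z - x)) \<le> C * ea A (\<tau> * norm x) * n \<phi>"
      "\<And>\<phi> x. \<phi> \<in> S \<Longrightarrow> n (\<lambda>z. chr x z * \<phi> z) \<le> C * ea M (\<tau> * norm x) * n \<phi>" using PP unfolding mod_bound_def by blast
    obtain D where D: "D > 0" "\<And>x y. \<eta> (x + y) \<le> D * \<eta> x * ea A (\<tau> * norm y)" using PP unfolding eta_ok_def by blast
    let ?K = "C * D * c + C"
    have "NY (\<lambda>z. \<phi> (z - y)) \<le> ?K * ea A (H * \<tau> * norm y) * NY \<phi> \<and> NY (\<lambda>z. chr y z * \<phi> z) \<le> ?K * ea M (H * \<tau> * norm y) * NY \<phi>"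
      if \<phi>: "\<phi> \<in> S" for \<phi> y
    proof
      let ?E = "ea A (\<tau> * norm y)"
      have E2: "?E\<^sup>2 \<le> c * ea A (H * \<tau> * norm y)"
        using ea_sq[OF sA M2A H1 c1, of "\<tau> * norm y"] \<tau> by (simp add: mult.assoc)
      have b: "Gf (\<lambda>z. \<phi> (z - y)) x \<le> (C * D * ?E\<^sup>2) * Gf \<phi> (x - y)" for x
      proof -
        have "wf (\<lambda>z. \<phi> (z - y)) x = n (\<lambda>z. (\<lambda>w. \<phi> w * \<theta> (w - (x - y))) (z - y))" by (simp add: wf_def)
        also have "\<dots> \<le> C * ?E * wf \<phi> (x - y)" unfolding wf_def by (rule C(2)[OF S_mult_trans[OF \<phi> \<theta>]])
        finally have 1: "wf (\<lambda>z. \<phi> (z - y)) x \<le> C * ?E * wf \<phi> (x - y)" .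
        have 2: "\<eta> x \<le> D * \<eta> (x - y) * ?E" using D(2)[of "x - y" y] by simp
        have "Gf (\<lambda>z. \<phi> (z - y)) x \<le> (C * ?E * wf \<phi> (x - y)) * (D * \<eta> (x - y) * ?E)"
          unfolding Gf_def by (rule mult_mono[OF 1 2]) (use C(1) wf_nonneg[OF \<phi>] in auto)
        then show ?thesis by (simp add: Gf_def power2_eq_square mult_ac)
      qed
      note s = fshift[OF nnm_Gf[OF \<phi>] fin_Gf[OF \<phi>], of y]
      have "NY (\<lambda>z. \<phi> (z - y)) \<le> (C * D * ?E\<^sup>2) * Y (\<lambda>x. Gf \<phi> (x - y))"
        unfolding NY_def using fmono[OF nnm_Gf[OF S_trans'[OF \<phi>]] nnm_shift[OF nnm_Gf[OF \<phi>]] conjunct1[OF s] _ b] C(1) D(1) by simp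
      also have "\<dots> \<le> (C * D * ?E\<^sup>2) * NY \<phi>" unfolding NY_def using s C(1) D(1) by (intro mult_left_mono) auto
      also have "\<dots> \<le> (C * D * (c * ea A (H * \<tau> * norm y))) * NY \<phi>"
        using E2 C(1) D(1) NY_nonneg[OF \<phi>] by (intro mult_right_mono mult_left_mono) auto
      also have "\<dots> = (C * D * c) * ea A (H * \<tau> * norm y) * NY \<phi>" by simp
      also have "\<dots> \<le> ?K * ea A (H * \<tau> * norm y) * NY \<phi>"
        using C(1) NY_nonneg[OF \<phi>] by (intro mult_right_mono) auto
      finally show "NY (\<lambda>z. \<phi> (z - y)) \<le> ?K * ea A (H * \<tau> * norm y) * NY \<phi>" .
      have "NY (\<lambda>z. chr y z * \<phi> z) \<le> (C * ea M (\<tau> * norm y)) * NY \<phi>"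
      proof (rule NY_le[OF S_chr[OF \<phi>] \<phi>])
        fix x
        show "wf (\<lambda>z. chr y z * \<phi> z) x \<le> C * ea M (\<tau> * norm y) * wf \<phi> x"
          unfolding wf_def mult.assoc by (rule order_trans[OF C(3)[OF S_mult_trans[OF \<phi> \<theta>]]]) (simp add: mult.assoc)
      qed (use C(1) in simp)
      also have "\<dots> \<le> ?K * ea M (H * \<tau> * norm y) * NY \<phi>"
      proof (intro mult_right_mono mult_mono)
        have "\<tau> * norm y \<le> H * \<tau> * norm y" using H1 \<tau> by (simp add: mult_right_mono)
        then show "ea M (\<tau> * norm y) \<le> ea M (H * \<tau> * norm y)" by (rule ea_mono[OF sM])
      qed (use C(1) D(1) c1 NY_nonneg[OF \<phi>] in auto)
      finally show "NY (\<lambda>z. chr y z * \<phi> z) \<le> ?K * ea M (H * \<tau> * norm y) * NY \<phi>" .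
    qed
    moreover have "?K > 0" using C(1) D(1) c1 by (simp add: add_pos_pos)
    ultimately show "mod_bound NY (H * \<tau>)" unfolding mod_bound_def by blast
  qed (use mod_bound_up[OF NY_gsn] in auto)
qed

theorem NY_tnorm: "tnorm NY"
  unfolding tnorm_def using NY_gsn NY_pair NY_closable NY_mod by blast

end

section \<open>Duality of amalgam spaces\<close>

context gsk begin

definition DS :: "(('n::finite) tf \<Rightarrow> real) \<Rightarrow> 'n ud set" where
  "DS N = {f \<in> UD k M A. \<exists>C. \<forall>\<phi>\<in>S. cmod (f \<phi>) \<le> C * N \<phi>}"

definition DN :: "(('n::finite) tf \<Rightarrow> real) \<Rightarrow> 'n ud \<Rightarrow> real" where
  "DN N f = (SUP \<phi>\<in>{\<phi>\<in>S. N \<phi> \<le> 1}. cmod (f \<phi>))"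

lemma DS_bound:
  assumes N: "gsn N" and f: "f \<in> DS N"
  shows "\<exists>C\<ge>0. \<forall>\<phi>\<in>S. cmod (f \<phi>) \<le> C * N \<phi>"
proof -
  obtain C where C: "\<forall>\<phi>\<in>S. cmod (f \<phi>) \<le> C * N \<phi>" using f by (auto simp: DS_def)
  have "cmod (f \<phi>) \<le> max C 0 * N \<phi>" if "\<phi> \<in> S" for \<phi>
    using C that gsn_nonneg[OF N that] mult_right_mono[of C "max C 0" "N \<phi>"] by fastforce
  then show ?thesis by (intro exI[of _ "max C 0"]) auto
qed

lemma DN_bdd:
  assumes N: "gsn N" and f: "f \<in> DS N"
  shows "bdd_above ((\<lambda>\<phi>. cmod (f \<phi>)) ` {\<phi>\<in>S. N \<phi> \<le> 1})"
proof -
  obtain C where C: "C \<ge> 0" "\<forall>\<phi>\<in>S. cmod (f \<phi>) \<le> C * N \<phi>" using DS_bound[OF assms] by blast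
  have "cmod (f \<phi>) \<le> C" if "\<phi> \<in> S" "N \<phi> \<le> 1" for \<phi>
    using C that mult_left_mono[of "N \<phi>" 1 C] by fastforce
  then show ?thesis by (intro bdd_aboveI[of _ C]) auto
qed

lemma DN_ne: "gsn N \<Longrightarrow> {\<phi>\<in>S. N \<phi> \<le> 1} \<noteq> {}"
  using S_zero gsn_zero by fastforce

lemma DN_upper: "gsn N \<Longrightarrow> f \<in> DS N \<Longrightarrow> \<phi> \<in> S \<Longrightarrow> N \<phi> \<le> 1 \<Longrightarrow> cmod (f \<phi>) \<le> DN N f"
  unfolding DN_def by (intro cSUP_upper DN_bdd) auto

lemma DN_nonneg: "gsn N \<Longrightarrow> f \<in> DS N \<Longrightarrow> DN N f \<ge> 0"
  by (rule order_trans[OF norm_ge_zero DN_upper[OF _ _ S_zero]]) (auto simp: gsn_zero)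

lemma DN_bound:
  assumes N: "gsn N" and f: "f \<in> DS N" and \<phi>: "\<phi> \<in> S"
  shows "cmod (f \<phi>) \<le> DN N f * N \<phi>"
proof (cases "N \<phi> = 0")
  \<comment> \<open>N is only a seminorm here, so \<phi> cannot be normalised; but any bound by a
    multiple of N forces f \<phi> = 0.\<close>
  case True
  obtain C where C: "C \<ge> 0" "\<forall>\<phi>\<in>S. cmod (f \<phi>) \<le> C * N \<phi>" using DS_bound[OF N f] by blast
  then show ?thesis using \<phi> True by fastforce
next
  case False
  then have p: "N \<phi> > 0" using gsn_nonneg[OF N \<phi>] by simp
  have fU: "f \<in> UD k M A" using f by (simp add: DS_def)
  let ?a = "complex_of_real (1 / N \<phi>)"
  have a: "cmod ?a = 1 / N \<phi>" using p by (simp only: norm_of_real) simp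
  have "N (\<lambda>x. ?a * \<phi> x) = 1" unfolding gsn_scale[OF N \<phi>] a using p by simp
  then have "cmod (f (\<lambda>x. ?a * \<phi> x)) \<le> DN N f" by (intro DN_upper N f S_scale \<phi>) simp
  then have "cmod (f \<phi>) / N \<phi> \<le> DN N f" unfolding UD_scale[OF fU \<phi>] norm_mult a by simp
  then show ?thesis using p by (simp add: pos_divide_le_eq)
qed

lemma DN_le:
  assumes N: "gsn N" and C: "C \<ge> 0" "\<And>\<phi>. \<phi> \<in> S \<Longrightarrow> cmod (f \<phi>) \<le> C * N \<phi>"
  shows "DN N f \<le> C"
  unfolding DN_def
proof (rule cSUP_least[OF DN_ne[OF N]])
  fix \<phi> assume "\<phi> \<in> {\<phi> \<in> S. N \<phi> \<le> 1}"
  then show "cmod (f \<phi>) \<le> C" using C(2)[of \<phi>] mult_left_mono[of "N \<phi>" 1 C] C(1) by simp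
qed

lemma umult_DS:
  assumes N: "gsn N" and f: "f \<in> UD k M A" and \<rho>: "\<rho> \<in> S" and b: "\<And>\<phi>. \<phi> \<in> S \<Longrightarrow> cmod (f (\<lambda>x. \<rho> x * \<phi> x)) \<le> C * N \<phi>"
  shows "umult k M A f \<rho> \<in> DS N"
proof -
  let ?u = "umult k M A f \<rho>"
  have u: "?u \<phi> = f (\<lambda>x. \<rho> x * \<phi> x)" if "\<phi> \<in> S" for \<phi> using that by (simp add: umult_def)
  have add: "?u (\<lambda>x. \<phi> x + \<psi> x) = ?u \<phi> + ?u \<psi>" if "\<phi> \<in> S" "\<psi> \<in> S" for \<phi> \<psi>
    using UD_add[OF f S_mult[OF \<rho> that(1)] S_mult[OF \<rho> that(2)]] that by (simp add: u S_add distrib_left)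
  have sc: "?u (\<lambda>x. a * \<phi> x) = a * ?u \<phi>" if "\<phi> \<in> S" for a \<phi>
    using UD_scale[OF f S_mult[OF \<rho> that], of a] that by (simp add: u S_scale mult.left_commute)
  have "GS_cont k M A (\<lambda>\<phi>. cmod (?u \<phi>))" unfolding GS_cont_iff
  proof (rule cls_mono[OF gsn_cls[OF N]])
    fix h :: real assume h: "h > 0" "\<exists>C\<ge>0. \<forall>\<phi>\<in>S \<inter> GSh M A h. N \<phi> \<le> C * GSnorm M A h \<phi>"
    then obtain D where D: "D \<ge> 0" "\<And>\<phi>. \<phi> \<in> S \<inter> GSh M A h \<Longrightarrow> N \<phi> \<le> D * GSnorm M A h \<phi>" by blast
    have "cmod (?u \<phi>) \<le> (max C 0 * D) * GSnorm M A h \<phi>" if "\<phi> \<in> S \<inter> GSh M A h" for \<phi>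
    proof -
      have "cmod (?u \<phi>) \<le> C * N \<phi>" using b[of \<phi>] u[of \<phi>] that by auto
      also have "\<dots> \<le> max C 0 * N \<phi>" using gsn_nonneg[OF N, of \<phi>] that by (intro mult_right_mono) auto
      also have "\<dots> \<le> max C 0 * (D * GSnorm M A h \<phi>)" using D(2)[OF that] by (intro mult_left_mono) auto
      finally show ?thesis by (simp add: mult.assoc)
    qed
    then show "\<exists>C. \<forall>\<phi>\<in>S \<inter> GSh M A h. cmod (?u \<phi>) \<le> C * GSnorm M A h \<phi>" by blast
  qed
  then have "?u \<in> UD k M A" unfolding UD_def using add sc by (auto simp: umult_def)
  then show ?thesis unfolding DS_def using b u by auto
qed

end

text \<open>The last assumption tests \<open>F\<close> only at finitely many points against sums of translates of a kernel.
  This is what gluing translated test functions can detect; it replaces the duality of Lebesgue spaces.\<close>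

locale dualsp = winsp M A c H k fin Y n \<eta> \<theta> for M A :: "nat \<Rightarrow> real" and c H :: real and k :: GSkind
    and fin :: "(real^('n::finite) \<Rightarrow> real) \<Rightarrow> bool" and Y :: "(real^'n \<Rightarrow> real) \<Rightarrow> real"
    and n :: "'n tf \<Rightarrow> real" and \<eta> :: "real^'n \<Rightarrow> real" and \<theta> :: "'n tf" +
  fixes fin' :: "(real^'n \<Rightarrow> real) \<Rightarrow> bool" and Y' :: "(real^'n \<Rightarrow> real) \<Rightarrow> real"
  assumes dnonneg: "\<And>F. nnm F \<Longrightarrow> fin' F \<Longrightarrow> Y' F \<ge> 0"
    and dhold: "\<And>F G. nnm F \<Longrightarrow> fin' F \<Longrightarrow> nnm G \<Longrightarrow> fin G \<Longrightarrow> (\<integral>\<^sup>+ x. ennreal (F x * G x) \<partial>lborel) \<le> ennreal (Y' F * Y G)"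
    and dlatt: "\<And>h. h > 0 \<Longrightarrow> \<exists>K\<ge>0. \<forall>F D. nnm F \<longrightarrow> D \<ge> 0 \<longrightarrow>
       (\<forall>(I :: (int^'n) set) pt b. finite I \<longrightarrow> (\<forall>v. b v \<ge> 0) \<longrightarrow> (\<Sum>v\<in>I. b v * F (pt v)) \<le> D * Y (\<lambda>x. \<Sum>v\<in>I. b v * wt A h (x - pt v))) \<longrightarrow>
       fin' F \<and> Y' F \<le> D * K"
begin

definition Ff :: "'n ud \<Rightarrow> real^'n \<Rightarrow> real" where
  "Ff f x = DN n (umult k M A f (\<lambda>y. \<theta> (y - x)))"

lemma NYg: "gsn NY" by (rule NY_gsn)

lemma dual_easy:
  "\<exists>K\<ge>0. \<forall>f\<in>UD k M A. (\<forall>x. umult k M A f (\<lambda>y. \<theta> (y - x)) \<in> DS n) \<longrightarrow> nnm (\<lambda>x. Ff f x * (1 / \<eta> x)) \<longrightarrow> fin' (\<lambda>x. Ff f x * (1 / \<eta> x)) \<longrightarrow>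
     (\<forall>\<phi>\<in>S. cmod (f \<phi>) \<le> K * Y' (\<lambda>x. Ff f x * (1 / \<eta> x)) * NY \<phi>)"
proof -
  let ?q = "\<lambda>x. \<theta> x * \<theta> x"
  let ?\<kappa> = "\<lambda>x. cnj (?q x)"
  have q: "?q \<in> S" by (rule S_mult[OF \<theta> \<theta>])
  have \<kappa>: "?\<kappa> \<in> S" by (rule S_cnj[OF q])
  have qk: "(\<lambda>x. ?q x * ?\<kappa> x) \<in> S" by (rule S_mult[OF q \<kappa>])
  have qnz: "?q \<noteq> (\<lambda>x. 0)" using \<theta>nz by (auto simp: fun_eq_iff)
  define c0 where "c0 = (LINT x|lborel. ?q x * ?\<kappa> x)"
  have c0: "cmod c0 > 0" using S_integral_cnj_nonzero[OF q qnz] by (simp add: c0_def)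
  have "dcl k (\<lambda>h. ?\<kappa> \<in> GSh M A h)" using \<kappa> unfolding GS_iff .
  from cls_meet[OF mult_cls this] obtain h where h: "h > 0" "mult_ok n h" "?\<kappa> \<in> GSh M A h" by blast
  from h(2) obtain C where C: "C \<ge> 0" "\<And>\<phi> \<psi> x. \<phi> \<in> S \<Longrightarrow> \<psi> \<in> S \<inter> GSh M A h \<Longrightarrow> n (\<lambda>y. \<phi> y * \<psi> (y - x)) \<le> C * GSnorm M A h \<psi> * n \<phi>"
    unfolding mult_ok_def by blast
  let ?K = "C * GSnorm M A h ?\<kappa>"
  have K: "?K \<ge> 0" using C(1) GSnorm_nonneg[OF h(1,3)] by simp
  have "cmod (f \<phi>) \<le> (?K / cmod c0) * Y' (\<lambda>x. Ff f x * (1 / \<eta> x)) * NY \<phi>"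
    if f: "f \<in> UD k M A" and loc: "\<And>x. umult k M A f (\<lambda>y. \<theta> (y - x)) \<in> DS n" and nF: "nnm (\<lambda>x. Ff f x * (1 / \<eta> x))"
      and fF: "fin' (\<lambda>x. Ff f x * (1 / \<eta> x))" and \<phi>: "\<phi> \<in> S" for f \<phi>
  proof -
    note UT = UD_trans[OF f \<phi> qk f]
    let ?F = "\<lambda>x. Ff f x * (1 / \<eta> x)"
    let ?f = "\<lambda>x. f (\<lambda>y. \<phi> y * (?q (y - x) * ?\<kappa> (y - x)))"
    have b: "cmod (?f x) \<le> ?K * (?F x * Gf \<phi> x)" for x
    proof -
      \<comment> \<open>One of the two factors \<theta> in \<open>?q\<close> stays with \<phi>, the
        other is carried by \<open>umult\<close>; the conjugate is removed by the multiplier bound,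
        uniformly in x.\<close>
      let ?r = "\<lambda>y. (\<phi> y * \<theta> (y - x)) * ?\<kappa> (y - x)"
      have r: "?r \<in> S" by (rule S_mult_trans[OF S_mult_trans[OF \<phi> \<theta>] \<kappa>])
      have "?f x = umult k M A f (\<lambda>y. \<theta> (y - x)) ?r" using r by (simp add: umult_def mult_ac)
      then have "cmod (?f x) \<le> Ff f x * n ?r" unfolding Ff_def using DN_bound[OF gn loc r] by simp
      also have "\<dots> \<le> Ff f x * (?K * wf \<phi> x)"
        unfolding wf_def using DN_nonneg[OF gn loc, of x] \<kappa> h(3)
        by (intro mult_left_mono C(2)[OF S_mult_trans[OF \<phi> \<theta>]]) (auto simp: Ff_def)
      also have "\<dots> = ?K * (?F x * Gf \<phi> x)" by (simp add: Gf_def)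
      finally show ?thesis .
    qed
    have nG: "nnm (Gf \<phi>)" by (rule nnm_Gf[OF \<phi>])
    have "norm (LINT x|lborel. ?f x) \<le> ?K * (Y' ?F * NY \<phi>)"
    proof (rule nn_integral_bound_real[OF UT(2) b K])
      show "(\<integral>\<^sup>+ x. ennreal (?F x * Gf \<phi> x) \<partial>lborel) \<le> ennreal (Y' ?F * NY \<phi>)"
        unfolding NY_def by (rule dhold[OF nF fF nG fin_Gf[OF \<phi>]])
      show "Y' ?F * NY \<phi> \<ge> 0" using dnonneg[OF nF fF] NY_nonneg[OF \<phi>] by simp
      show "(\<lambda>x. ?F x * Gf \<phi> x) \<in> borel_measurable borel" "?F x * Gf \<phi> x \<ge> 0" for x
        using nnm_mult[OF nF nG] by (auto simp: nnm_def)
    qed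
    moreover have "c0 * f \<phi> = (LINT x|lborel. ?f x)" using UT(1) by (simp only: c0_def)
    ultimately have "cmod (c0 * f \<phi>) \<le> ?K * (Y' ?F * NY \<phi>)" by (simp only:)
    then have "cmod (f \<phi>) \<le> ?K * (Y' ?F * NY \<phi>) / cmod c0"
      by (simp only: norm_mult pos_le_divide_eq[OF c0] mult.commute[of _ "cmod c0"])
    then show ?thesis by (simp add: mult_ac)
  qed
  moreover have "?K / cmod c0 \<ge> 0" using K by (intro divide_nonneg_nonneg) auto
  ultimately show ?thesis by blast
qed

text \<open>A fixed factor \<rho> localises at the origin: by \<open>pair_decay\<close> the windowed
  pieces of \<rho> \<phi> decay in x, so the amalgam norm of \<rho> \<phi> is at most a multiple of
  n \<phi>, and a bound by \<open>NY\<close> becomes one by n.\<close>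

lemma dual_loc:
  assumes f: "f \<in> DS NY" and \<rho>: "\<rho> \<in> S"
  shows "umult k M A f \<rho> \<in> DS n"
proof -
  from DS_bound[OF NYg f] obtain C0 where C0: "C0 \<ge> 0" "\<And>\<phi>. \<phi> \<in> S \<Longrightarrow> cmod (f \<phi>) \<le> C0 * NY \<phi>" by blast
  have fU: "f \<in> UD k M A" using f by (simp add: DS_def)
  from pair_decay[OF \<rho> \<theta>] obtain \<tau> C where \<tau>: "\<tau> > 0" "eta_ok \<eta> \<tau>" and C: "C \<ge> 0"
    "\<And>\<phi> x y. \<phi> \<in> S \<Longrightarrow> n (\<lambda>z. \<phi> z * (\<rho> (z - x) * \<theta> (z - y))) \<le> C * wt A (H * \<tau>) (x - y) * n \<phi>" by blast
  obtain D where D: "D > 0" "\<And>x y. \<eta> x * wt A (H * \<tau>) (x - y) \<le> D * \<eta> y * wt A \<tau> (x - y)"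
    using eta_wt[OF \<eta>pos \<tau>] by blast
  let ?K = "C * (D * \<eta> 0)"
  have K: "?K \<ge> 0" using C(1) D(1) by simp
  have "cmod (f (\<lambda>x. \<rho> x * \<phi> x)) \<le> (C0 * (?K * Y (wt A \<tau>))) * n \<phi>" if \<phi>: "\<phi> \<in> S" for \<phi>
  proof -
    have np: "n \<phi> \<ge> 0" by (rule gsn_nonneg[OF gn \<phi>])
    have r: "(\<lambda>x. \<rho> x * \<phi> x) \<in> S" by (rule S_mult[OF \<rho> \<phi>])
    have "Gf (\<lambda>x. \<rho> x * \<phi> x) x \<le> (?K * n \<phi>) * wt A \<tau> x" for x
    proof -
      have "wf (\<lambda>x. \<rho> x * \<phi> x) x = n (\<lambda>z. \<phi> z * (\<rho> (z - 0) * \<theta> (z - x)))" by (simp add: wf_def mult_ac)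
      also have "\<dots> \<le> C * wt A (H * \<tau>) (0 - x) * n \<phi>" by (rule C(2)[OF \<phi>])
      finally have "Gf (\<lambda>x. \<rho> x * \<phi> x) x \<le> (C * wt A (H * \<tau>) x * n \<phi>) * \<eta> x"
        unfolding Gf_def by (intro mult_right_mono) auto
      also have "\<dots> = (C * n \<phi>) * (\<eta> x * wt A (H * \<tau>) (x - 0))" by simp
      also have "\<dots> \<le> (C * n \<phi>) * (D * \<eta> 0 * wt A \<tau> (x - 0))" by (intro mult_left_mono[OF D(2)] mult_nonneg_nonneg C np)
      finally show ?thesis by (simp add: mult_ac)
    qed
    then have "NY (\<lambda>x. \<rho> x * \<phi> x) \<le> (?K * n \<phi>) * Y (wt A \<tau>)"
      unfolding NY_def using fmono[OF nnm_Gf[OF r] nnm_wt fwt[OF \<tau>(1)], of "?K * n \<phi>"] mult_nonneg_nonneg[OF K np] by blast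
    then have "C0 * NY (\<lambda>x. \<rho> x * \<phi> x) \<le> C0 * ((?K * n \<phi>) * Y (wt A \<tau>))" using C0(1) by (rule mult_left_mono)
    then show ?thesis using C0(2)[OF r] by (simp add: mult_ac)
  qed
  then show ?thesis by (rule umult_DS[OF gn fU \<rho>])
qed

lemma Ff_SUP: "Ff f x = (SUP \<phi>\<in>{\<phi>\<in>S. n \<phi> \<le> 1}. cmod (f (\<lambda>y. \<phi> y * \<theta> (y - x))))"
  unfolding Ff_def DN_def by (rule SUP_cong) (auto simp: umult_def mult.commute)

text \<open>The supremum runs over a possibly uncountable set of test functions, but each of its
  members is continuous in x. Strict superlevel sets are therefore unions of open sets.\<close>

lemma Ff_measurable:
  assumes f: "f \<in> UD k M A" and loc: "\<And>x. umult k M A f (\<lambda>y. \<theta> (y - x)) \<in> DS n"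
  shows "Ff f \<in> borel_measurable borel"
  unfolding borel_measurable_iff_greater
proof
  fix a
  let ?B = "{\<phi>\<in>S. n \<phi> \<le> 1}"
  have e: "{x. a < Ff f x} = (\<Union>\<phi>\<in>?B. {x. a < cmod (f (\<lambda>y. \<phi> y * \<theta> (y - x)))})"
  proof -
    have "a < Ff f x \<longleftrightarrow> (\<exists>\<phi>\<in>?B. a < cmod (f (\<lambda>y. \<phi> y * \<theta> (y - x))))" for x
    proof -
      have "bdd_above ((\<lambda>\<phi>. cmod (umult k M A f (\<lambda>y. \<theta> (y - x)) \<phi>)) ` ?B)" by (rule DN_bdd[OF gn loc])
      moreover have "(\<lambda>\<phi>. cmod (umult k M A f (\<lambda>y. \<theta> (y - x)) \<phi>)) ` ?B = (\<lambda>\<phi>. cmod (f (\<lambda>y. \<phi> y * \<theta> (y - x)))) ` ?B"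
        by (rule image_cong) (auto simp: umult_def mult.commute)
      ultimately show ?thesis unfolding Ff_SUP using less_cSUP_iff[OF DN_ne[OF gn]] by (metis (no_types, lifting))
    qed
    then show ?thesis by auto
  qed
  have "open {x. a < Ff f x}" unfolding e
  proof (rule open_UN, rule ballI)
    fix \<phi> assume "\<phi> \<in> ?B"
    then have \<phi>: "\<phi> \<in> S" by simp
    have "continuous_on UNIV (\<lambda>x. cmod (f (\<lambda>y. \<phi> y * \<theta> (y - x))))"
      by (intro continuous_on_norm UD_trans(3)[OF f \<phi> \<theta> f])
    then show "open {x. a < cmod (f (\<lambda>y. \<phi> y * \<theta> (y - x)))}" by (intro open_Collect_less continuous_on_const)
  qed
  then show "{w \<in> space borel. a < Ff f w} \<in> sets borel" by simp
qed

lemma Ff_nonneg: "umult k M A f (\<lambda>y. \<theta> (y - x)) \<in> DS n \<Longrightarrow> Ff f x \<ge> 0"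
  unfolding Ff_def by (rule DN_nonneg[OF gn])

lemma nnm_Ff:
  assumes "f \<in> UD k M A" "\<And>x. umult k M A f (\<lambda>y. \<theta> (y - x)) \<in> DS n"
  shows "nnm (\<lambda>x. Ff f x * (1 / \<eta> x))"
proof -
  have [measurable]: "Ff f \<in> borel_measurable borel" by (rule Ff_measurable[OF assms])
  have "(\<lambda>x. Ff f x * (1 / \<eta> x)) \<in> borel_measurable borel" by measurable
  then show ?thesis using Ff_nonneg[OF assms(2)] by (simp add: nnm_def)
qed

lemma fin_sum_wt:
  fixes b :: "int^'n \<Rightarrow> real"
  assumes h: "h > 0" and I: "finite I" and b: "\<And>v. b v \<ge> 0"
  shows "nnm (\<lambda>x. \<Sum>v\<in>I. b v * wt A h (x - pt v)) \<and> fin (\<lambda>x. \<Sum>v\<in>I. b v * wt A h (x - pt v))"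
  using I
proof (induction I rule: finite_induct)
  case empty
  have "nnm (\<lambda>x::real^'n. 0 :: real)" by (simp add: nnm_def)
  then have "fin (\<lambda>x. 0)" using fmono[OF _ nnm_wt fwt[OF h], of "\<lambda>x. 0" 0] by simp
  then show ?case using \<open>nnm (\<lambda>x::real^'n. 0 :: real)\<close> by simp
next
  case (insert v I)
  have n1: "nnm (\<lambda>x. b v * wt A h (x - pt v))" using nnm_wt_shift[of h "pt v"] b[of v] by (auto simp: nnm_def)
  have f1: "fin (\<lambda>x. wt A h (x - pt v))" using fshift[OF nnm_wt fwt[OF h]] by blast
  have f2: "fin (\<lambda>x. b v * wt A h (x - pt v))" using fmono[OF n1 nnm_wt_shift f1 b[of v]] by blast
  have "nnm (\<lambda>x. b v * wt A h (x - pt v) + (\<Sum>v\<in>I. b v * wt A h (x - pt v)))" "fin (\<lambda>x. b v * wt A h (x - pt v) + (\<Sum>v\<in>I. b v * wt A h (x - pt v)))"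
    using nnm_add[OF n1] fadd[OF n1 _ f2] insert by auto
  then show ?case using insert by simp
qed

text \<open>Near-extremal test functions at finitely many points are glued by means of translates of the
  window; the decay of products of translates keeps the norm of the sum under control.\<close>

lemma dual_hard:
  "\<exists>K\<ge>0. \<forall>f\<in>DS NY. fin' (\<lambda>x. Ff f x * (1 / \<eta> x)) \<and> Y' (\<lambda>x. Ff f x * (1 / \<eta> x)) \<le> K * DN NY f"
proof -
  from pair_decay[OF \<theta> \<theta>] obtain \<tau> C where \<tau>: "\<tau> > 0" "eta_ok \<eta> \<tau>" and C: "C \<ge> 0"
    "\<And>\<phi> x y. \<phi> \<in> S \<Longrightarrow> n (\<lambda>z. \<phi> z * (\<theta> (z - x) * \<theta> (z - y))) \<le> C * wt A (H * \<tau>) (x - y) * n \<phi>" by blast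
  obtain D where D: "D > 0" "\<And>x y. \<eta> x * wt A (H * \<tau>) (x - y) \<le> D * \<eta> y * wt A \<tau> (x - y)"
    using eta_wt[OF \<eta>pos \<tau>] by blast
  obtain L where L0: "L \<ge> 0 \<and> (\<forall>F D. nnm F \<longrightarrow> D \<ge> 0 \<longrightarrow>
       (\<forall>(I :: (int^'n) set) pt b. finite I \<longrightarrow> (\<forall>v. b v \<ge> 0) \<longrightarrow> (\<Sum>v\<in>I. b v * F (pt v)) \<le> D * Y (\<lambda>x. \<Sum>v\<in>I. b v * wt A \<tau> (x - pt v))) \<longrightarrow>
       fin' F \<and> Y' F \<le> D * L)"
    using dlatt[OF \<tau>(1)] ..
  note L = conjunct1[OF L0] conjunct2[OF L0, rule_format]
  have "fin' (\<lambda>x. Ff f x * (1 / \<eta> x)) \<and> Y' (\<lambda>x. Ff f x * (1 / \<eta> x)) \<le> (2 * DN NY f * (C * D)) * L" if f: "f \<in> DS NY" for f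
  proof (rule L(2))
    have fU: "f \<in> UD k M A" using f by (simp add: DS_def)
    have loc: "umult k M A f (\<lambda>y. \<theta> (y - x)) \<in> DS n" for x by (rule dual_loc[OF f S_trans'[OF \<theta>]])
    show "nnm (\<lambda>x. Ff f x * (1 / \<eta> x))" by (rule nnm_Ff[OF fU loc])
    have d0: "DN NY f \<ge> 0" by (rule DN_nonneg[OF NYg f])
    show "2 * DN NY f * (C * D) \<ge> 0" using d0 C(1) D(1) by simp
    fix I :: "(int^'n) set" and pt :: "int^'n \<Rightarrow> real^'n" and b :: "int^'n \<Rightarrow> real" assume I: "finite I" and b: "\<And>v. b v \<ge> (0::real)"
    \<comment> \<open>The supremum in \<open>Ff\<close> need not be attained, so half of it is
      accepted; the value of f is moreover made real, so that the contributions of different points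
      do not cancel.\<close>
    have "\<exists>\<phi> r. \<phi> \<in> S \<and> n \<phi> \<le> 1 \<and> f (\<lambda>y. \<phi> y * \<theta> (y - x)) = complex_of_real r \<and> Ff f x \<le> 2 * r" for x
    proof (cases "Ff f x > 0")
      case True
      then have "Ff f x / 2 < Ff f x" by simp
      then obtain \<phi> where \<phi>: "\<phi> \<in> S" "n \<phi> \<le> 1" "Ff f x / 2 < cmod (umult k M A f (\<lambda>y. \<theta> (y - x)) \<phi>)"
        unfolding Ff_def DN_def using less_cSUP_iff[OF DN_ne[OF gn] DN_bdd[OF gn loc]] by auto
      let ?z = "f (\<lambda>y. \<phi> y * \<theta> (y - x))"
      have z: "Ff f x / 2 < cmod ?z" using \<phi>(1,3) by (simp add: umult_def mult.commute)
      then have z0: "?z \<noteq> 0" using True by auto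
      \<comment> \<open>The phase that rotates the value of f to its modulus; it leaves n
        unchanged.\<close>
      let ?u = "cnj ?z / complex_of_real (cmod ?z)"
      have u: "cmod ?u = 1" using z0 by (simp add: norm_divide)
      have "f (\<lambda>y. (?u * \<phi> y) * \<theta> (y - x)) = ?u * ?z"
        using UD_scale[OF fU S_mult_trans[OF \<phi>(1) \<theta>], of ?u x] by (simp add: mult.assoc)
      also have "\<dots> = complex_of_real (cmod ?z)"
      proof -
        have "?u * ?z = (?z * cnj ?z) / complex_of_real (cmod ?z)" by simp
        also have "?z * cnj ?z = complex_of_real (cmod ?z) * complex_of_real (cmod ?z)"
          using complex_norm_square[of ?z, symmetric] by (simp only: power2_eq_square of_real_mult)
        finally show ?thesis using z0 by (simp only: nonzero_mult_div_cancel_left norm_eq_zero of_real_eq_0_iff not_False_eq_True)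
      qed
      finally have fz: "f (\<lambda>y. (?u * \<phi> y) * \<theta> (y - x)) = complex_of_real (cmod ?z)" .
      have nu: "n (\<lambda>y. ?u * \<phi> y) \<le> 1" unfolding gsn_scale[OF gn \<phi>(1)] u using \<phi>(2) by simp
      have "Ff f x \<le> 2 * cmod ?z" using z by linarith
      then show ?thesis
        by (intro exI[of _ "\<lambda>y. ?u * \<phi> y"] exI[of _ "cmod ?z"] conjI S_scale[OF \<phi>(1)] nu fz)
    next
      case False
      then show ?thesis using S_zero gsn_zero[OF gn] UD_zero[OF fU] by (intro exI[of _ "\<lambda>y. 0"] exI[of _ 0]) auto
    qed
    then have "\<forall>v. \<exists>p. fst p \<in> S \<and> n (fst p) \<le> 1 \<and> f (\<lambda>y. fst p y * \<theta> (y - pt v)) = complex_of_real (snd p) \<and> Ff f (pt v) \<le> 2 * snd p"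
      by simp
    from choice[OF this] obtain p where p: "\<forall>v. fst (p v) \<in> S \<and> n (fst (p v)) \<le> 1 \<and> f (\<lambda>y. fst (p v) y * \<theta> (y - pt v)) = complex_of_real (snd (p v)) \<and> Ff f (pt v) \<le> 2 * snd (p v)" ..
    define \<phi> where "\<phi> = (\<lambda>v. fst (p v))"
    define r where "r = (\<lambda>v. snd (p v))"
    have \<phi>: "\<phi> v \<in> S" "n (\<phi> v) \<le> 1" "f (\<lambda>y. \<phi> v y * \<theta> (y - pt v)) = complex_of_real (r v)" "Ff f (pt v) \<le> 2 * r v" for v
      using p by (auto simp: \<phi>_def r_def)
    \<comment> \<open>Dividing by \<eta> at the point anticipates the weight in the amalgam norm:
      \<open>eta_wt\<close> moves \<eta> x to \<eta> (pt v), which cancels and leaves the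
      coefficient b v.\<close>
    define a where "a = (\<lambda>v. b v / \<eta> (pt v))"
    have a: "a v \<ge> 0" for v using b[of v] by (simp add: a_def)
    let ?t = "\<lambda>v y. complex_of_real (a v) * (\<phi> v y * \<theta> (y - pt v))"
    have t: "?t v \<in> S" for v by (intro S_scale S_mult_trans \<phi> \<theta>)
    let ?T = "\<lambda>y. \<Sum>v\<in>I. ?t v y"
    have T: "?T \<in> S" by (intro S_sum I t)
    have fT: "f ?T = complex_of_real (\<Sum>v\<in>I. a v * r v)"
      by (subst UD_sum[OF I fU t]) (simp add: UD_scale[OF fU S_mult_trans[OF \<phi>(1) \<theta>]] \<phi>(3))
    let ?W = "\<lambda>x. \<Sum>v\<in>I. b v * wt A \<tau> (x - pt v)"
    have W: "nnm ?W" "fin ?W" using fin_sum_wt[where b = b and pt = pt, OF \<tau>(1) I b] by auto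
    have GT: "Gf ?T x \<le> (C * D) * ?W x" for x
    proof -
      have e: "(\<lambda>y. ?T y * \<theta> (y - x)) = (\<lambda>y. \<Sum>v\<in>I. ?t v y * \<theta> (y - x))" by (simp add: sum_distrib_right)
      have "wf ?T x \<le> (\<Sum>v\<in>I. n (\<lambda>y. ?t v y * \<theta> (y - x)))"
        unfolding wf_def e by (rule gsn_sum[OF gn I S_mult_trans[OF t \<theta>]])
      also have "\<dots> \<le> (\<Sum>v\<in>I. a v * (C * wt A (H * \<tau>) (pt v - x)))"
      proof (rule sum_mono)
        fix v
        have e2: "(\<lambda>y. ?t v y * \<theta> (y - x)) = (\<lambda>y. complex_of_real (a v) * ((\<phi> v y * \<theta> (y - pt v)) * \<theta> (y - x)))" by (simp add: mult.assoc)
        have "n (\<lambda>y. ?t v y * \<theta> (y - x)) = a v * n (\<lambda>y. \<phi> v y * (\<theta> (y - pt v) * \<theta> (y - x)))"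
          unfolding e2 using gsn_scale[OF gn S_mult_trans[OF S_mult_trans[OF \<phi>(1) \<theta>] \<theta>], of "complex_of_real (a v)" v "pt v" x] a[of v]
          by (simp add: mult.assoc)
        also have "\<dots> \<le> a v * (C * wt A (H * \<tau>) (pt v - x) * n (\<phi> v))" by (intro mult_left_mono C(2)[OF \<phi>(1)] a)
        also have "\<dots> \<le> a v * (C * wt A (H * \<tau>) (pt v - x) * 1)"
          using C(1) by (intro mult_left_mono \<phi>(2) a) auto
        finally show "n (\<lambda>y. ?t v y * \<theta> (y - x)) \<le> a v * (C * wt A (H * \<tau>) (pt v - x))" by simp
      qed
      finally have "Gf ?T x \<le> (\<Sum>v\<in>I. a v * (C * wt A (H * \<tau>) (pt v - x))) * \<eta> x"
        unfolding Gf_def by (intro mult_right_mono) auto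
      also have "\<dots> = (\<Sum>v\<in>I. (a v * C) * (\<eta> x * wt A (H * \<tau>) (x - pt v)))"
        unfolding sum_distrib_right wt_minus_commute[of A "H * \<tau>" _ x] by (rule sum.cong) (simp_all add: mult_ac)
      also have "\<dots> \<le> (\<Sum>v\<in>I. (a v * C) * (D * \<eta> (pt v) * wt A \<tau> (x - pt v)))"
        by (intro sum_mono mult_left_mono[OF D(2)] mult_nonneg_nonneg a C)
      also have "\<dots> = (C * D) * ?W x"
        unfolding sum_distrib_left by (rule sum.cong) (auto simp: a_def)
      finally show ?thesis .
    qed
    have "(\<Sum>v\<in>I. b v * (Ff f (pt v) * (1 / \<eta> (pt v)))) \<le> (\<Sum>v\<in>I. 2 * (a v * r v))"
    proof (rule sum_mono)
      fix v
      have "b v * (Ff f (pt v) * (1 / \<eta> (pt v))) = a v * Ff f (pt v)" by (simp add: a_def)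
      also have "\<dots> \<le> a v * (2 * r v)" by (intro mult_left_mono \<phi>(4) a)
      finally show "b v * (Ff f (pt v) * (1 / \<eta> (pt v))) \<le> 2 * (a v * r v)" by simp
    qed
    also have "\<dots> = 2 * (\<Sum>v\<in>I. a v * r v)" by (simp add: sum_distrib_left)
    also have "\<dots> \<le> 2 * cmod (f ?T)" unfolding fT by (simp only: norm_of_real)
    also have "\<dots> \<le> 2 * (DN NY f * NY ?T)" using DN_bound[OF NYg f T] by simp
    also have "\<dots> \<le> 2 * (DN NY f * ((C * D) * Y ?W))"
    proof (intro mult_left_mono d0)
      have "C * D \<ge> 0" using C(1) D(1) by simp
      from fmono[OF nnm_Gf[OF T] W this GT] show "NY ?T \<le> (C * D) * Y ?W" unfolding NY_def by blast
    qed simp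
    finally show "(\<Sum>v\<in>I. b v * (Ff f (pt v) * (1 / \<eta> (pt v)))) \<le> 2 * DN NY f * (C * D) * Y ?W" by (simp add: mult_ac)
  qed
  then have "\<forall>f\<in>DS NY. fin' (\<lambda>x. Ff f x * (1 / \<eta> x)) \<and> Y' (\<lambda>x. Ff f x * (1 / \<eta> x)) \<le> (2 * (C * D) * L) * DN NY f"
    by (simp add: mult_ac)
  moreover have "2 * (C * D) * L \<ge> 0" using C(1) D(1) L(1) by simp
  ultimately show ?thesis by blast
qed

text \<open>The right side is the amalgam space of the dual, in the form in which
  \<open>W_Lp\<close> and \<open>W_Linf\<close> unfold to it.\<close>

theorem dual_space:
  "DS NY = {f \<in> UD k M A. (\<forall>\<rho>\<in>S. umult k M A f \<rho> \<in> DS n) \<and> Ff f \<in> borel_measurable borel \<and> fin' (\<lambda>x. Ff f x * (1 / \<eta> x))}"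
  (is "_ = ?R")
proof
  show "DS NY \<subseteq> ?R"
  proof
    fix f assume f: "f \<in> DS NY"
    have fU: "f \<in> UD k M A" using f by (simp add: DS_def)
    show "f \<in> ?R" using fU dual_loc[OF f] Ff_measurable[OF fU dual_loc[OF f S_trans'[OF \<theta>]]] dual_hard f by blast
  qed
  show "?R \<subseteq> DS NY"
  proof
    fix f assume f: "f \<in> ?R"
    then have loc: "umult k M A f (\<lambda>y. \<theta> (y - x)) \<in> DS n" for x using S_trans'[OF \<theta>, of x] by blast
    have fU: "f \<in> UD k M A" using f by blast
    obtain K where "\<forall>\<phi>\<in>S. cmod (f \<phi>) \<le> K * Y' (\<lambda>x. Ff f x * (1 / \<eta> x)) * NY \<phi>"
      using dual_easy nnm_Ff[OF fU loc] loc f by blast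
    then show "f \<in> DS NY" unfolding DS_def using fU by blast
  qed
qed

theorem dual_norm_equivalent:
  "\<exists>K>0. \<forall>f\<in>DS NY. DN NY f \<le> K * Y' (\<lambda>x. Ff f x * (1 / \<eta> x)) \<and> Y' (\<lambda>x. Ff f x * (1 / \<eta> x)) \<le> K * DN NY f"
proof -
  obtain K1 where K1: "K1 \<ge> 0" "\<And>f. f \<in> DS NY \<Longrightarrow> fin' (\<lambda>x. Ff f x * (1 / \<eta> x)) \<and> Y' (\<lambda>x. Ff f x * (1 / \<eta> x)) \<le> K1 * DN NY f"
    using dual_hard by blast
  obtain K2 where K2: "K2 \<ge> 0" "\<And>f. f \<in> UD k M A \<Longrightarrow> (\<And>x. umult k M A f (\<lambda>y. \<theta> (y - x)) \<in> DS n) \<Longrightarrow> nnm (\<lambda>x. Ff f x * (1 / \<eta> x)) \<Longrightarrow> fin' (\<lambda>x. Ff f x * (1 / \<eta> x)) \<Longrightarrow>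
     (\<forall>\<phi>\<in>S. cmod (f \<phi>) \<le> K2 * Y' (\<lambda>x. Ff f x * (1 / \<eta> x)) * NY \<phi>)" using dual_easy by blast
  let ?K = "K1 + K2 + 1"
  have "DN NY f \<le> ?K * Y' (\<lambda>x. Ff f x * (1 / \<eta> x)) \<and> Y' (\<lambda>x. Ff f x * (1 / \<eta> x)) \<le> ?K * DN NY f" if f: "f \<in> DS NY" for f
  proof
    let ?y = "Y' (\<lambda>x. Ff f x * (1 / \<eta> x))"
    have fU: "f \<in> UD k M A" using f by (simp add: DS_def)
    have loc: "umult k M A f (\<lambda>y. \<theta> (y - x)) \<in> DS n" for x by (rule dual_loc[OF f S_trans'[OF \<theta>]])
    note nF = nnm_Ff[OF fU loc]
    have fF: "fin' (\<lambda>x. Ff f x * (1 / \<eta> x))" using K1(2)[OF f] by blast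
    have y: "?y \<ge> 0" by (rule dnonneg[OF nF fF])
    have d: "DN NY f \<ge> 0" by (rule DN_nonneg[OF NYg f])
    have "DN NY f \<le> K2 * ?y" by (rule DN_le[OF NYg]) (use K2(1) y K2(2)[OF fU loc nF fF] in auto)
    also have "\<dots> \<le> ?K * ?y" using K1(1) y by (intro mult_right_mono) auto
    finally show "DN NY f \<le> ?K * ?y" .
    have "?y \<le> K1 * DN NY f" using K1(2)[OF f] by blast
    also have "\<dots> \<le> ?K * DN NY f" using K2(1) d by (intro mult_right_mono) auto
    finally show "?y \<le> ?K * DN NY f" .
  qed
  then show ?thesis using K1(1) K2(1) by (intro exI[of _ ?K]) auto
qed

end

context gsk begin

section \<open>Instances for exponents above 1, exponent 1 and the supremum norm\<close>

lemma fnsp_lp: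
  assumes p: "p \<ge> 1"
  shows "fnsp M A c H (lpfin p :: (real^('n::finite) \<Rightarrow> real) \<Rightarrow> bool) (lpn p)"
proof (unfold_locales, goal_cases)
  case (1 G G' K) then show ?case using lp_mono[OF p, of G G' K] by blast
next
  case (2 G G') then show ?case using lp_add[OF p] by blast
next
  case (3 G) show ?case by simp
next
  case (4 h) then show ?case by (rule lp_wt[OF p])
next
  case (5 h)
  have "0 \<le> 1 + Wint TYPE('n) h" by (simp add: Wint_def)
  then show ?case using lp_int_wt[OF p 5, where 'n = 'n] by blast
next
  case (6 Gs G B) then show ?case by (intro lp_fatou[OF p, of Gs G B])
next
  case 7 then show ?case by (simp add: lpfin_def lpn_def lp_shift[OF 7(1)])
qed

lemma fnsp_li: "fnsp M A c H (lifin :: (real^('n::finite) \<Rightarrow> real) \<Rightarrow> bool) lin"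
proof (unfold_locales, goal_cases)
  case (1 G G' K) then show ?case using li_mono[of G G' K] by blast
next
  case (2 G G') then show ?case using li_add by blast
next
  case (3 G) show ?case by (rule lin_nonneg[OF 3(1)])
next
  case (4 h) show ?case by (rule li_wt)
next
  case (5 h)
  have "0 \<le> 1 + Wint TYPE('n) h" by (simp add: Wint_def)
  then show ?case using li_int_wt[OF 5, where 'n = 'n] by blast
next
  case (6 Gs G B) then show ?case by (intro li_fatou[of Gs G B])
next
  case (7 G y) then show ?case by (rule li_shift)
qed

lemma dualsp_lp:
  fixes n :: "('n::finite) tf \<Rightarrow> real"
  assumes p: "p > 1" and w: "tnorm n" "weight k A \<eta>" "\<theta> \<in> S" "\<theta> \<noteq> (\<lambda>x. 0)"
  shows "dualsp M A c H k (lpfin p) (lpn p) n \<eta> \<theta> (lpfin (p / (p - 1))) (lpn (p / (p - 1)))"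
proof -
  interpret fnsp M A c H k "lpfin p :: (real^'n \<Rightarrow> real) \<Rightarrow> bool" "lpn p" by (rule fnsp_lp) (use p in simp)
  show ?thesis
  proof (unfold_locales, goal_cases)
    case (7 h)
    let ?K = "(lattW TYPE('n) h powr (p - 1) * Wint TYPE('n) h) powr (1 / p)"
    have "?K \<ge> 0" by simp
    then show ?case using lp_dual_lattice[OF p 7, where 'n = 'n] by (intro exI[of _ ?K]) simp
  qed (use w p lp_holder[OF p] in auto)
qed

lemma dualsp_l1:
  fixes n :: "('n::finite) tf \<Rightarrow> real"
  assumes w: "tnorm n" "weight k A \<eta>" "\<theta> \<in> S" "\<theta> \<noteq> (\<lambda>x. 0)"
  shows "dualsp M A c H k (lpfin 1) (lpn 1) n \<eta> \<theta> lifin lin"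
proof -
  interpret fnsp M A c H k "lpfin 1 :: (real^'n \<Rightarrow> real) \<Rightarrow> bool" "lpn 1" by (rule fnsp_lp) simp
  show ?thesis
  proof (unfold_locales, goal_cases)
    case (7 h)
    let ?K = "Wint TYPE('n) h"
    have "?K \<ge> 0" by (simp add: Wint_def)
    then show ?case using l1_dual_lattice[OF 7, where 'n = 'n] by (intro exI[of _ ?K]) simp
  qed (use w l1_li_holder lin_nonneg in auto)
qed

lemma dualsp_li:
  fixes n :: "('n::finite) tf \<Rightarrow> real"
  assumes w: "tnorm n" "weight k A \<eta>" "\<theta> \<in> S" "\<theta> \<noteq> (\<lambda>x. 0)"
  shows "dualsp M A c H k lifin lin n \<eta> \<theta> (lpfin 1) (lpn 1)"
proof -
  interpret fnsp M A c H k "lifin :: (real^'n \<Rightarrow> real) \<Rightarrow> bool" lin by (rule fnsp_li)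
  show ?thesis
  proof (unfold_locales, goal_cases)
    case (6 F G)
    then show ?case using l1_li_holder[of G F] by (simp add: mult.commute)
  next
    case (7 h)
    let ?K = "lattW TYPE('n) h"
    have "?K \<ge> 0" by (simp add: lattW_def ea_def)
    then show ?case using li_dual_lattice[OF 7, where 'n = 'n] by (intro exI[of _ ?K]) simp
  qed (use w in auto)
qed

text \<open>The dual reads its predual only through the norm of embedded test functions. All three
  kinds of amalgam space are thereby reduced to \<open>NY\<close>.\<close>

lemma dual_DS:
  assumes "\<And>\<phi>. \<phi> \<in> S \<Longrightarrow> nF (em \<phi>) = N \<phi>"
  shows "dual_sp k M A F nF = DS N" "dual_norm k M A nF = DN N"
proof -
  show "dual_sp k M A F nF = DS N" using assms by (simp add: dual_sp_def DS_def)
  have "{\<phi> \<in> S. nF (em \<phi>) \<le> 1} = {\<phi> \<in> S. N \<phi> \<le> 1}" using assms by auto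
  then show "dual_norm k M A nF = DN N" by (intro ext) (simp add: dual_norm_def DN_def)
qed

lemma amp_em: "\<theta> \<in> S \<Longrightarrow> amp k M A nE \<theta> (em \<phi>) x = nE (em (\<lambda>y. \<phi> y * \<theta> (y - x)))"
  by (simp add: amp_def em_mult S_trans')

end

context dualsp begin

lemma amp_DN: "amp k M A (DN n) \<theta> f = Ff f"
  by (rule ext) (simp add: amp_def Ff_def)

lemma NY_eq: "NY \<phi> = Y (\<lambda>x. n (\<lambda>y. \<phi> y * \<theta> (y - x)) * \<eta> x)"
  by (simp add: NY_def Gf_def[abs_def] wf_def)

lemma W_Lp_norm_em: "n = (\<lambda>\<phi>. nE (em \<phi>)) \<Longrightarrow> Y = lpn p \<Longrightarrow> W_Lp_norm k M A nE \<theta> \<eta> p (em \<phi>) = NY \<phi>"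
  unfolding NY_eq by (simp add: W_Lp_norm_def amp_em[OF \<theta>] lpn_def lpint_def)

lemma W_inf_norm_em: "n = (\<lambda>\<phi>. nE (em \<phi>)) \<Longrightarrow> Y = lin \<Longrightarrow> W_inf_norm k M A nE \<theta> \<eta> (em \<phi>) = NY \<phi>"
  unfolding NY_eq by (simp add: W_inf_norm_def amp_em[OF \<theta>] lin_def)

lemma W_Lp_dual: "fin' = lpfin q \<Longrightarrow> W_Lp k M A (DS n) (DN n) \<theta> (\<lambda>x. 1 / \<eta> x) q = DS NY"
  unfolding dual_space by (auto simp: W_Lp_def Eloc_def amp_DN lpfin_def lpint_def)

lemma W_Linf_dual: "fin' = lifin \<Longrightarrow> W_Linf k M A (DS n) (DN n) \<theta> (\<lambda>x. 1 / \<eta> x) = DS NY"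
  unfolding dual_space by (auto simp: W_Linf_def Eloc_def amp_DN lifin_def)

lemma W_Lp_norm_dual: "Y' = lpn q \<Longrightarrow> W_Lp_norm k M A (DN n) \<theta> (\<lambda>x. 1 / \<eta> x) q f = Y' (\<lambda>x. Ff f x * (1 / \<eta> x))"
  by (simp add: W_Lp_norm_def amp_DN lpn_def lpint_def)

lemma W_inf_norm_dual: "Y' = lin \<Longrightarrow> W_inf_norm k M A (DN n) \<theta> (\<lambda>x. 1 / \<eta> x) f = Y' (\<lambda>x. Ff f x * (1 / \<eta> x))"
  by (simp add: W_inf_norm_def amp_DN lin_def)

lemma norm_equiv_dual:
  assumes "\<And>f. nW f = Y' (\<lambda>x. Ff f x * (1 / \<eta> x))"
  shows "norm_equiv (DS NY) (DN NY) nW"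
  unfolding norm_equiv_def assms by (rule dual_norm_equivalent)

text \<open>The TMIB space witnessing the claim is the completion of the test space in the norm
  \<open>NY\<close>.\<close>

lemma DTMIB_dual:
  assumes "\<And>f. nW f = Y' (\<lambda>x. Ff f x * (1 / \<eta> x))"
  shows "DTMIB k M A (DS NY) nW"
proof -
  note e = dual_DS[of "cnorm NY" NY, OF cnorm_em[OF NY_tnorm]]
  have "norm_equiv (DS NY) nW (DN NY)" using norm_equiv_dual[OF assms] unfolding norm_equiv_def by blast
  then show ?thesis unfolding DTMIB_def
    using tnorm_TMIB[OF NY_tnorm] e(1)[of "compl NY"] e(2) by metis
qed

end

theorem theorem4p2:
  fixes k :: GSkind and M A :: "nat \<Rightarrow> real"
    and E :: "('n::finite) ud set" and nE :: "'n ud \<Rightarrow> real"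
    and \<eta> :: "real^'n \<Rightarrow> real" and \<theta> :: "'n tf"
  assumes "std_seq M" and "std_seq A" and "M2star A"
    and "weight k A \<eta>"
    and "TMIB k M A E nE"
    and "\<theta> \<in> GS k M A" and "\<theta> \<noteq> (\<lambda>x. 0)"
  shows
   "(\<forall>p::real. p > 1 \<longrightarrow>
       dual_sp k M A (W_Lp k M A E nE \<theta> \<eta> p) (W_Lp_norm k M A nE \<theta> \<eta> p)
         = W_Lp k M A (dual_sp k M A E nE) (dual_norm k M A nE) \<theta> (\<lambda>x. 1 / \<eta> x) (p / (p - 1))
     \<and> norm_equiv (W_Lp k M A (dual_sp k M A E nE) (dual_norm k M A nE) \<theta> (\<lambda>x. 1 / \<eta> x) (p / (p - 1)))
         (dual_norm k M A (W_Lp_norm k M A nE \<theta> \<eta> p))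
         (W_Lp_norm k M A (dual_norm k M A nE) \<theta> (\<lambda>x. 1 / \<eta> x) (p / (p - 1))))
  \<and> (dual_sp k M A (W_Lp k M A E nE \<theta> \<eta> 1) (W_Lp_norm k M A nE \<theta> \<eta> 1)
         = W_Linf k M A (dual_sp k M A E nE) (dual_norm k M A nE) \<theta> (\<lambda>x. 1 / \<eta> x)
     \<and> norm_equiv (W_Linf k M A (dual_sp k M A E nE) (dual_norm k M A nE) \<theta> (\<lambda>x. 1 / \<eta> x))
         (dual_norm k M A (W_Lp_norm k M A nE \<theta> \<eta> 1))
         (W_inf_norm k M A (dual_norm k M A nE) \<theta> (\<lambda>x. 1 / \<eta> x)))
  \<and> (dual_sp k M A (W_C0 k M A E nE \<theta> \<eta>) (W_inf_norm k M A nE \<theta> \<eta>)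
         = W_Lp k M A (dual_sp k M A E nE) (dual_norm k M A nE) \<theta> (\<lambda>x. 1 / \<eta> x) 1
     \<and> norm_equiv (W_Lp k M A (dual_sp k M A E nE) (dual_norm k M A nE) \<theta> (\<lambda>x. 1 / \<eta> x) 1)
         (dual_norm k M A (W_inf_norm k M A nE \<theta> \<eta>))
         (W_Lp_norm k M A (dual_norm k M A nE) \<theta> (\<lambda>x. 1 / \<eta> x) 1))
  \<and> (\<forall>p::real. p \<ge> 1 \<longrightarrow>
       DTMIB k M A (W_Lp k M A (dual_sp k M A E nE) (dual_norm k M A nE) \<theta> (\<lambda>x. 1 / \<eta> x) p)
                   (W_Lp_norm k M A (dual_norm k M A nE) \<theta> (\<lambda>x. 1 / \<eta> x) p))
  \<and> DTMIB k M A (W_Linf k M A (dual_sp k M A E nE) (dual_norm k M A nE) \<theta> (\<lambda>x. 1 / \<eta> x))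
              (W_inf_norm k M A (dual_norm k M A nE) \<theta> (\<lambda>x. 1 / \<eta> x))"
proof -
  obtain c1 H1 where M2: "c1 \<ge> 1" "H1 \<ge> 1" "\<And>p q. M (p + q) \<le> c1 * H1 ^ (p + q) * M p * M q"
    using assms(1) unfolding std_seq_def by blast
  obtain c2 H2 where A2: "c2 \<ge> 1" "H2 \<ge> 1" "\<And>p q. A (p + q) \<le> c2 * H2 ^ (p + q) * A p * A q"
    using assms(2) unfolding std_seq_def by blast
  define c H where "c = max c1 c2" and "H = max H1 H2"
  have cH: "c \<ge> 1" "H \<ge> 1" "c1 \<le> c" "c2 \<le> c" "H1 \<le> H" "H2 \<le> H" using M2 A2 by (auto simp: c_def H_def)
  have "c1 * H1 ^ (p + q) * M p * M q \<le> c * H ^ (p + q) * M p * M q" for p q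
    using M2 cH std_seq_pos[OF assms(1)] by (intro mult_mono power_mono) (auto simp: less_imp_le)
  then have bM: "M2_bound M c H" unfolding M2_bound_def using M2(3) order_trans by blast
  have "c2 * H2 ^ (p + q) * A p * A q \<le> c * H ^ (p + q) * A p * A q" for p q
    using A2 cH std_seq_pos[OF assms(2)] by (intro mult_mono power_mono) (auto simp: less_imp_le)
  then have bA: "M2_bound A c H" unfolding M2_bound_def using A2(3) order_trans by blast
  interpret gsk M A c H k using assms(1,2) bM bA cH(1,2) by unfold_locales
  let ?n = "\<lambda>\<phi>. nE (em \<phi>)"
  have t: "tnorm ?n" by (rule TMIB_tnorm[OF assms(5)])
  note w = t assms(4,6,7)
  have e: "dual_sp k M A E nE = DS ?n" "dual_norm k M A nE = DN ?n" by (rule dual_DS, simp)+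
  have lp: "dual_sp k M A (W_Lp k M A E nE \<theta> \<eta> p) (W_Lp_norm k M A nE \<theta> \<eta> p)
         = W_Lp k M A (DS ?n) (DN ?n) \<theta> (\<lambda>x. 1 / \<eta> x) (p / (p - 1))
     \<and> norm_equiv (W_Lp k M A (DS ?n) (DN ?n) \<theta> (\<lambda>x. 1 / \<eta> x) (p / (p - 1)))
         (dual_norm k M A (W_Lp_norm k M A nE \<theta> \<eta> p))
         (W_Lp_norm k M A (DN ?n) \<theta> (\<lambda>x. 1 / \<eta> x) (p / (p - 1)))
     \<and> DTMIB k M A (W_Lp k M A (DS ?n) (DN ?n) \<theta> (\<lambda>x. 1 / \<eta> x) (p / (p - 1)))
         (W_Lp_norm k M A (DN ?n) \<theta> (\<lambda>x. 1 / \<eta> x) (p / (p - 1)))" if p: "p > 1" for p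
  proof -
    interpret D: dualsp M A c H k "lpfin p" "lpn p" ?n \<eta> \<theta> "lpfin (p / (p - 1))" "lpn (p / (p - 1))"
      by (rule dualsp_lp[OF p w])
    have d: "dual_sp k M A (W_Lp k M A E nE \<theta> \<eta> p) (W_Lp_norm k M A nE \<theta> \<eta> p) = DS D.NY"
      "dual_norm k M A (W_Lp_norm k M A nE \<theta> \<eta> p) = DN D.NY"
      by (rule dual_DS, rule D.W_Lp_norm_em[OF refl refl])+
    show ?thesis unfolding d D.W_Lp_dual[OF refl]
      using D.norm_equiv_dual[OF D.W_Lp_norm_dual[OF refl]] D.DTMIB_dual[OF D.W_Lp_norm_dual[OF refl]] by blast
  qed
  have l1: "dual_sp k M A (W_Lp k M A E nE \<theta> \<eta> 1) (W_Lp_norm k M A nE \<theta> \<eta> 1)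
         = W_Linf k M A (DS ?n) (DN ?n) \<theta> (\<lambda>x. 1 / \<eta> x)
     \<and> norm_equiv (W_Linf k M A (DS ?n) (DN ?n) \<theta> (\<lambda>x. 1 / \<eta> x))
         (dual_norm k M A (W_Lp_norm k M A nE \<theta> \<eta> 1))
         (W_inf_norm k M A (DN ?n) \<theta> (\<lambda>x. 1 / \<eta> x))
     \<and> DTMIB k M A (W_Linf k M A (DS ?n) (DN ?n) \<theta> (\<lambda>x. 1 / \<eta> x))
         (W_inf_norm k M A (DN ?n) \<theta> (\<lambda>x. 1 / \<eta> x))"
  proof -
    interpret D: dualsp M A c H k "lpfin 1" "lpn 1" ?n \<eta> \<theta> lifin lin
      by (rule dualsp_l1[OF w])
    have d: "dual_sp k M A (W_Lp k M A E nE \<theta> \<eta> 1) (W_Lp_norm k M A nE \<theta> \<eta> 1) = DS D.NY"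
      "dual_norm k M A (W_Lp_norm k M A nE \<theta> \<eta> 1) = DN D.NY"
      by (rule dual_DS, rule D.W_Lp_norm_em[OF refl refl])+
    show ?thesis unfolding d D.W_Linf_dual[OF refl]
      using D.norm_equiv_dual[OF D.W_inf_norm_dual[OF refl]] D.DTMIB_dual[OF D.W_inf_norm_dual[OF refl]] by blast
  qed
  have li: "dual_sp k M A (W_C0 k M A E nE \<theta> \<eta>) (W_inf_norm k M A nE \<theta> \<eta>)
         = W_Lp k M A (DS ?n) (DN ?n) \<theta> (\<lambda>x. 1 / \<eta> x) 1
     \<and> norm_equiv (W_Lp k M A (DS ?n) (DN ?n) \<theta> (\<lambda>x. 1 / \<eta> x) 1)
         (dual_norm k M A (W_inf_norm k M A nE \<theta> \<eta>))
         (W_Lp_norm k M A (DN ?n) \<theta> (\<lambda>x. 1 / \<eta> x) 1)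
     \<and> DTMIB k M A (W_Lp k M A (DS ?n) (DN ?n) \<theta> (\<lambda>x. 1 / \<eta> x) 1)
         (W_Lp_norm k M A (DN ?n) \<theta> (\<lambda>x. 1 / \<eta> x) 1)"
  proof -
    interpret D: dualsp M A c H k lifin lin ?n \<eta> \<theta> "lpfin 1" "lpn 1"
      by (rule dualsp_li[OF w])
    have d: "dual_sp k M A (W_C0 k M A E nE \<theta> \<eta>) (W_inf_norm k M A nE \<theta> \<eta>) = DS D.NY"
      "dual_norm k M A (W_inf_norm k M A nE \<theta> \<eta>) = DN D.NY"
      by (rule dual_DS, rule D.W_inf_norm_em[OF refl refl])+
    show ?thesis unfolding d D.W_Lp_dual[OF refl]
      using D.norm_equiv_dual[OF D.W_Lp_norm_dual[OF refl]] D.DTMIB_dual[OF D.W_Lp_norm_dual[OF refl]] by blast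
  qed
  \<comment> \<open>An exponent p > 1 is the conjugate of p / (p - 1), so it is reached from the
    duality at that exponent. The case p = 1 comes from the space of continuous functions; p
    infinite was settled together with exponent 1.\<close>
  have dt: "DTMIB k M A (W_Lp k M A (DS ?n) (DN ?n) \<theta> (\<lambda>x. 1 / \<eta> x) p)
         (W_Lp_norm k M A (DN ?n) \<theta> (\<lambda>x. 1 / \<eta> x) p)" if p: "p \<ge> 1" for p
  proof (cases "p = 1")
    case True
    then show ?thesis using li by simp
  next
    case False
    have "p / (p - 1) > 1" "p / (p - 1) / (p / (p - 1) - 1) = p" using p False by (auto simp: field_simps)
    then show ?thesis using lp[of "p / (p - 1)"] by simp
  qed
  show ?thesis unfolding e using lp l1 li dt by blast
qed

end
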